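(* (First part.) Let $x^1,\dots,x^4$ be local coordinates on a coordinate domain $U$ in a four-manifold, and let $\alpha,\beta,\gamma,\delta$ be smooth functions on $U$, with $\alpha,\gamma:U\to(-\pi/2,\pi/2)$ and $\beta,\delta:U\to\mathbb{R}$. Let $g$ and $J$ be the metric and the $(1,1)$ tensor field on $U$ defined from $\alpha,\beta,\gamma,\delta$ by formulas (M) and (J) of the context. If $\alpha,\beta,\gamma,\delta$ satisfy the system of four first-order partial differential equations $$(-1)^p\beta_p=\alpha_q\,e^{(-1)^p\delta}\sec\gamma-\alpha_p\tan\gamma\quad\text{whenever }\{p,q\}=\{3,4\},$$ $$(-1)^\lambda\delta_\lambda=\gamma_\mu\,e^{(-1)^\lambda\beta}\sec\alpha-\gamma_\lambda\tan\alpha\quad\text{whenever }\{\lambda,\mu\}=\{1,2\},$$ where the subscripts denote partial derivatives with respect to the coordinates (and no summation is performed), then $g$ is a Kähler metric on $U$ with the complex-structure tensor $J$, and $TU=\mathcal{H}\oplus\mathcal{V}$ is a $g$-orthogonal direct sum of two integrable complex-line subbundles, where $\mathcal{H}$ is spanned by the coordinate vector fields $\partial_1,\partial_2$ and $\mathcal{V}$ by $\partial_3,\partial_4$. (Converse.) For any Kähler surface $(M,g)$, with complex structure $J$, and any decomposition $TM=\mathcal{H}\oplus\mathcal{V}$ of $TM$ into a $g$-orthogonal direct sum of two integrable complex-line subbundles, every point of $M$ has a neighborhood with suitable local coordinates $x^1,\dots,x^4$ and smooth functions $\alpha,\beta,\gamma,\delta$ on it, with $\alpha,\gamma$ valued in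 $(-\pi/2,\pi/2)$ and $\beta,\delta$ real-valued, such that on this neighborhood $g$ and $J$ are given in these coordinates by formulas (M) and (J) of the context, $\mathcal{H}$ is spanned by $\partial_1,\partial_2$ and $\mathcal{V}$ by $\partial_3,\partial_4$, and $\alpha,\beta,\gamma,\delta$ satisfy the system $$(-1)^p\beta_p=\alpha_q\,e^{(-1)^p\delta}\sec\gamma-\alpha_p\tan\gamma\quad\text{whenever }\{p,q\}=\{3,4\},$$ $$(-1)^\lambda\delta_\lambda=\gamma_\mu\,e^{(-1)^\lambda\beta}\sec\alpha-\gamma_\lambda\tan\alpha\quad\text{whenever }\{\lambda,\mu\}=\{1,2\}.$$
   Context: All manifolds, mappings and tensor fields are smooth, and all manifolds are connected. Conventions: $J\partial_j=\sum_k J^k_j\,\partial_k$. A Kähler metric with complex-structure tensor $J$ is a Riemannian metric $g$ with an almost-complex structure $J$ such that $\omega=g(J\cdot,\cdot)$ is skew-symmetric and $\nabla J=0$ for the Levi-Civita connection $\nabla$ of $g$; a Kähler surface is a manifold of real dimension four with such $g$ and $J$. A complex-line subbundle is a $J$-invariant subbundle of the tangent bundle, of real rank two. (M) The metric $g$ is given by $(g_{11},g_{12},g_{22})=(e^{-\beta}\sec\alpha,\ \tan\alpha,\ e^{\beta}\sec\alpha)$, $(g_{33},g_{34},g_{44})=(e^{-\delta}\sec\gamma,\ \tan\gamma,\ e^{\delta}\sec\gamma)$, $g_{13}=g_{14}=g_{23}=g_{24}=0$. (J) The tensor $J$ is given by $J^1_1=-g_{12},\ J^1_2=-g_{22},\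 J^2_1=g_{11},\ J^2_2=g_{12}$, $J^3_3=-g_{34},\ J^3_4=-g_{44},\ J^4_3=g_{33},\ J^4_4=g_{34}$, $J^p_\lambda=J^\lambda_p=0$ for $\lambda\in\{1,2\}$, $p\in\{3,4\}$. (It is an almost-complex structure, since $g_{11}g_{22}-g_{12}^2=g_{33}g_{44}-g_{34}^2=1$.) *)

theory Defs
  imports "HOL-Analysis.Analysis"
begin

section \<open>Smooth maps between Euclidean spaces\<close>

text \<open>\<open>S\<close> is meant to be open: the derivatives are taken without restriction to \<open>S\<close>.\<close>

primrec Ck_on :: "nat \<Rightarrow> ('e::euclidean_space \<Rightarrow> 'f::real_normed_vector) \<Rightarrow> 'e set \<Rightarrow> bool" where
  "Ck_on 0 = (\<lambda>f S. continuous_on S f)"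
| "Ck_on (Suc k) = (\<lambda>f S. (\<forall>x\<in>S. f differentiable (at x)) \<and>
     (\<forall>v. Ck_on k (\<lambda>x. frechet_derivative f (at x) v) S))"

definition smooth_on :: "'e::euclidean_space set \<Rightarrow> ('e \<Rightarrow> 'f::real_normed_vector) \<Rightarrow> bool" where
  "smooth_on S f \<longleftrightarrow> (\<forall>k. Ck_on k f S)"


section \<open>Smooth manifolds\<close>

text \<open>A chart is a pair of a domain \<open>U\<close> and a map that is a homeomorphism from \<open>U\<close> onto an open
  set of \<open>\<real>\<^sup>n\<close>; the values of the map outside \<open>U\<close> are irrelevant.\<close>

type_synonym ('a, 'n) chart = "'a set \<times> ('a \<Rightarrow> real ^ 'n)"

abbreviation cdom :: "('a, 'n::finite) chart \<Rightarrow> 'a set" where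
  "cdom c \<equiv> fst c"

abbreviation cmap :: "('a, 'n::finite) chart \<Rightarrow> 'a \<Rightarrow> real ^ 'n" where
  "cmap c \<equiv> snd c"

definition cinv :: "('a, 'n::finite) chart \<Rightarrow> real ^ 'n \<Rightarrow> 'a" where
  "cinv c = inv_into (cdom c) (cmap c)"

definition is_chart :: "'a topology \<Rightarrow> ('a, 'n::finite) chart \<Rightarrow> bool" where
  "is_chart T c \<longleftrightarrow> openin T (cdom c) \<and> open (cmap c ` cdom c) \<and>
     homeomorphic_map (subtopology T (cdom c)) (top_of_set (cmap c ` cdom c)) (cmap c)"

definition transition :: "('a, 'n::finite) chart \<Rightarrow> ('a, 'n) chart \<Rightarrow> real ^ 'n \<Rightarrow> real ^ 'n" where
  "transition c d = cmap d \<circ> cinv c"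

definition compatible :: "('a, 'n::finite) chart \<Rightarrow> ('a, 'n) chart \<Rightarrow> bool" where
  "compatible c d \<longleftrightarrow>
     smooth_on (cmap c ` (cdom c \<inter> cdom d)) (transition c d) \<and>
     smooth_on (cmap d ` (cdom c \<inter> cdom d)) (transition d c)"

text \<open>A connected smooth manifold, with its maximal atlas \<open>A\<close>. Thus the local coordinate systems
  of the manifold are exactly the elements of \<open>A\<close>.\<close>

definition smooth_manifold :: "'a topology \<Rightarrow> ('a, 'n::finite) chart set \<Rightarrow> bool" where
  "smooth_manifold T A \<longleftrightarrow>
     Hausdorff_space T \<and> second_countable T \<and> connected_space T \<and>
     (\<forall>c\<in>A. is_chart T c) \<and>
     (\<Union>c\<in>A. cdom c) = topspace T \<and>
     (\<forall>c\<in>A. \<forall>d\<in>A. compatible c d) \<and>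
     (\<forall>c. is_chart T c \<and> (\<forall>d\<in>A. compatible c d) \<longrightarrow> c \<in> A)"

definition charts_at :: "('a, 'n::finite) chart set \<Rightarrow> 'a \<Rightarrow> ('a, 'n) chart set" where
  "charts_at A p = {c \<in> A. p \<in> cdom c}"

definition smooth_fun_on :: "('a, 'n::finite) chart set \<Rightarrow> 'a set \<Rightarrow> ('a \<Rightarrow> real) \<Rightarrow> bool" where
  "smooth_fun_on A W f \<longleftrightarrow> (\<forall>c\<in>A. smooth_on (cmap c ` (cdom c \<inter> W)) (f \<circ> cinv c))"

text \<open>The partial derivative of \<open>f\<close> with respect to the \<open>i\<close>-th coordinate of the chart \<open>c\<close>.\<close>

definition coord_deriv :: "('a, 'n::finite) chart \<Rightarrow> 'n \<Rightarrow> ('a \<Rightarrow> real) \<Rightarrow> 'a \<Rightarrow> real" where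
  "coord_deriv c i f p = frechet_derivative (f \<circ> cinv c) (at (cmap c p)) (axis i 1)"


section \<open>Tangent vectors and vector fields\<close>

text \<open>A tangent vector at \<open>p\<close> is represented by the family of its component vectors in all charts
  around \<open>p\<close>, related to each other by the differentials of the transition maps (and extended
  by zero to all other pairs of type \<open>chart\<close>). The vector space operations are pointwise.\<close>

type_synonym ('a, 'n) tvec = "('a, 'n) chart \<Rightarrow> real ^ 'n"

definition tangent_space :: "('a, 'n::finite) chart set \<Rightarrow> 'a \<Rightarrow> ('a, 'n) tvec set" where
  "tangent_space A p = {v.
     (\<forall>c\<in>charts_at A p. \<forall>d\<in>charts_at A p.
        v d = frechet_derivative (transition c d) (at (cmap c p)) (v c)) \<and>
     (\<forall>c. c \<notin> charts_at A p \<longrightarrow> v c = 0)}"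

definition lincomb :: "real \<Rightarrow> ('a, 'n::finite) tvec \<Rightarrow> real \<Rightarrow> ('a, 'n) tvec \<Rightarrow> ('a, 'n) tvec" where
  "lincomb a u b v = (\<lambda>c. a *\<^sub>R u c + b *\<^sub>R v c)"

text \<open>The coordinate vector field \<open>\<partial>\<^sub>i\<close> of the chart \<open>c\<close>.\<close>

definition coord_field ::
    "('a, 'n::finite) chart set \<Rightarrow> ('a, 'n) chart \<Rightarrow> 'n \<Rightarrow> 'a \<Rightarrow> ('a, 'n) tvec" where
  "coord_field A c i p = (\<lambda>d. if d \<in> charts_at A p
     then frechet_derivative (transition c d) (at (cmap c p)) (axis i 1) else 0)"

definition smooth_vector_field_on ::
    "('a, 'n::finite) chart set \<Rightarrow> 'a set \<Rightarrow> ('a \<Rightarrow> ('a, 'n) tvec) \<Rightarrow> bool" where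
  "smooth_vector_field_on A W X \<longleftrightarrow>
     (\<forall>p\<in>W. X p \<in> tangent_space A p) \<and>
     (\<forall>c\<in>A. \<forall>i. smooth_fun_on A (cdom c \<inter> W) (\<lambda>p. X p c $ i))"

definition lie_bracket ::
    "('a, 'n::finite) chart set \<Rightarrow> ('a \<Rightarrow> ('a, 'n) tvec) \<Rightarrow> ('a \<Rightarrow> ('a, 'n) tvec)
      \<Rightarrow> 'a \<Rightarrow> ('a, 'n) tvec" where
  "lie_bracket A X Y p = (\<lambda>c. if c \<in> charts_at A p
     then (\<chi> i. \<Sum>j\<in>UNIV. X p c $ j * coord_deriv c j (\<lambda>q. Y q c $ i) p
                        - Y p c $ j * coord_deriv c j (\<lambda>q. X q c $ i) p)
     else 0)"


section \<open>Tensor fields and Kaehler metrics\<close>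

text \<open>All notions are relative to an open subset \<open>W\<close> of the manifold, viewed as a manifold
  itself. Values of tensors on arguments that are not tangent vectors are irrelevant.\<close>

type_synonym ('a, 'n) tensor02 = "'a \<Rightarrow> ('a, 'n) tvec \<Rightarrow> ('a, 'n) tvec \<Rightarrow> real"
type_synonym ('a, 'n) tensor11 = "'a \<Rightarrow> ('a, 'n) tvec \<Rightarrow> ('a, 'n) tvec"

definition tensor02_on ::
    "('a, 'n::finite) chart set \<Rightarrow> 'a set \<Rightarrow> ('a, 'n) tensor02 \<Rightarrow> bool" where
  "tensor02_on A W g \<longleftrightarrow>
     (\<forall>p\<in>W. \<forall>u\<in>tangent_space A p. \<forall>v\<in>tangent_space A p. \<forall>w\<in>tangent_space A p. \<forall>a b.
        g p (lincomb a u b v) w = a * g p u w + b * g p v w \<and>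
        g p w (lincomb a u b v) = a * g p w u + b * g p w v)"

definition tensor11_on ::
    "('a, 'n::finite) chart set \<Rightarrow> 'a set \<Rightarrow> ('a, 'n) tensor11 \<Rightarrow> bool" where
  "tensor11_on A W J \<longleftrightarrow>
     (\<forall>p\<in>W. \<forall>u\<in>tangent_space A p. \<forall>v\<in>tangent_space A p.
        J p u \<in> tangent_space A p \<and>
        (\<forall>a b. J p (lincomb a u b v) = lincomb a (J p u) b (J p v)))"

definition comp02 ::
    "('a, 'n::finite) chart set \<Rightarrow> ('a, 'n) chart \<Rightarrow> ('a, 'n) tensor02 \<Rightarrow> 'n \<Rightarrow> 'n \<Rightarrow> 'a \<Rightarrow> real" where
  "comp02 A c g i j p = g p (coord_field A c i p) (coord_field A c j p)"

text \<open>\<open>comp11 A c J k j\<close> is \<open>J\<^sup>k\<^sub>j\<close>, with the convention \<open>J \<partial>\<^sub>j = \<Sum>\<^sub>k J\<^sup>k\<^sub>j \<partial>\<^sub>k\<close>.\<close>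

definition comp11 ::
    "('a, 'n::finite) chart set \<Rightarrow> ('a, 'n) chart \<Rightarrow> ('a, 'n) tensor11 \<Rightarrow> 'n \<Rightarrow> 'n \<Rightarrow> 'a \<Rightarrow> real" where
  "comp11 A c J k j p = J p (coord_field A c j p) c $ k"

definition riemannian_metric_on ::
    "('a, 'n::finite) chart set \<Rightarrow> 'a set \<Rightarrow> ('a, 'n) tensor02 \<Rightarrow> bool" where
  "riemannian_metric_on A W g \<longleftrightarrow>
     tensor02_on A W g \<and>
     (\<forall>c\<in>A. \<forall>i j. smooth_fun_on A (cdom c \<inter> W) (comp02 A c g i j)) \<and>
     (\<forall>p\<in>W. \<forall>u\<in>tangent_space A p. \<forall>v\<in>tangent_space A p. g p u v = g p v u) \<and>
     (\<forall>p\<in>W. \<forall>u\<in>tangent_space A p. u \<noteq> (\<lambda>_. 0) \<longrightarrow> g p u u > 0)"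

definition almost_complex_structure_on ::
    "('a, 'n::finite) chart set \<Rightarrow> 'a set \<Rightarrow> ('a, 'n) tensor11 \<Rightarrow> bool" where
  "almost_complex_structure_on A W J \<longleftrightarrow>
     tensor11_on A W J \<and>
     (\<forall>c\<in>A. \<forall>k j. smooth_fun_on A (cdom c \<inter> W) (comp11 A c J k j)) \<and>
     (\<forall>p\<in>W. \<forall>u\<in>tangent_space A p. J p (J p u) = (\<lambda>d. - u d))"

definition inverse_metric ::
    "('a, 'n::finite) chart set \<Rightarrow> ('a, 'n) chart \<Rightarrow> ('a, 'n) tensor02 \<Rightarrow> 'n \<Rightarrow> 'n \<Rightarrow> 'a \<Rightarrow> real" where
  "inverse_metric A c g k l p = matrix_inv (\<chi> i j. comp02 A c g i j p) $ k $ l"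

text \<open>\<open>christoffel A c g k i j\<close> is \<open>\<Gamma>\<^sup>k\<^sub>i\<^sub>j\<close>, for the Levi-Civita connection of \<open>g\<close>.\<close>

definition christoffel ::
    "('a, 'n::finite) chart set \<Rightarrow> ('a, 'n) chart \<Rightarrow> ('a, 'n) tensor02
      \<Rightarrow> 'n \<Rightarrow> 'n \<Rightarrow> 'n \<Rightarrow> 'a \<Rightarrow> real" where
  "christoffel A c g k i j p = 1/2 * (\<Sum>l\<in>UNIV. inverse_metric A c g k l p *
     (coord_deriv c i (comp02 A c g j l) p + coord_deriv c j (comp02 A c g i l) p
      - coord_deriv c l (comp02 A c g i j) p))"

text \<open>\<open>nabla11 A c g J i k j\<close> is the component \<open>(\<nabla>\<^sub>i J)\<^sup>k\<^sub>j\<close> of the covariant derivative of \<open>J\<close>.\<close>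

definition nabla11 ::
    "('a, 'n::finite) chart set \<Rightarrow> ('a, 'n) chart \<Rightarrow> ('a, 'n) tensor02 \<Rightarrow> ('a, 'n) tensor11
      \<Rightarrow> 'n \<Rightarrow> 'n \<Rightarrow> 'n \<Rightarrow> 'a \<Rightarrow> real" where
  "nabla11 A c g J i k j p = coord_deriv c i (comp11 A c J k j) p
     + (\<Sum>l\<in>UNIV. christoffel A c g k i l p * comp11 A c J l j p)
     - (\<Sum>l\<in>UNIV. christoffel A c g l i j p * comp11 A c J k l p)"

definition parallel11_on ::
    "('a, 'n::finite) chart set \<Rightarrow> 'a set \<Rightarrow> ('a, 'n) tensor02 \<Rightarrow> ('a, 'n) tensor11 \<Rightarrow> bool" where
  "parallel11_on A W g J \<longleftrightarrow>
     (\<forall>c\<in>A. \<forall>p\<in>cdom c \<inter> W. \<forall>i k j. nabla11 A c g J i k j p = 0)"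

definition kaehler_on ::
    "('a, 'n::finite) chart set \<Rightarrow> 'a set \<Rightarrow> ('a, 'n) tensor02 \<Rightarrow> ('a, 'n) tensor11 \<Rightarrow> bool" where
  "kaehler_on A W g J \<longleftrightarrow>
     riemannian_metric_on A W g \<and>
     almost_complex_structure_on A W J \<and>
     (\<forall>p\<in>W. \<forall>u\<in>tangent_space A p. \<forall>v\<in>tangent_space A p. g p (J p u) v = - g p (J p v) u) \<and>
     parallel11_on A W g J"


section \<open>Subbundles of the tangent bundle\<close>

type_synonym ('a, 'n) distribution = "'a \<Rightarrow> ('a, 'n) tvec set"

text \<open>Smooth subbundles of rank \<open>k\<close>, described by local frames of smooth sections.\<close>

definition subbundle_on ::
    "'a topology \<Rightarrow> ('a, 'n::finite) chart set \<Rightarrow> 'a set \<Rightarrow> nat \<Rightarrow> ('a, 'n) distribution \<Rightarrow> bool" where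
  "subbundle_on T A W k D \<longleftrightarrow>
     (\<forall>p\<in>W. \<exists>V E. openin T V \<and> p \<in> V \<and> V \<subseteq> W \<and>
        (\<forall>i<k. smooth_vector_field_on A V (E i)) \<and>
        (\<forall>q\<in>V. D q = {(\<lambda>c. \<Sum>i<k. a i *\<^sub>R E i q c) | a :: nat \<Rightarrow> real. True} \<and>
               (\<forall>a :: nat \<Rightarrow> real. (\<lambda>c. \<Sum>i<k. a i *\<^sub>R E i q c) = (\<lambda>_. 0) \<longrightarrow> (\<forall>i<k. a i = 0))))"

text \<open>Integrability in the sense of Frobenius: the local smooth sections are closed under the
  Lie bracket.\<close>

definition integrable_distribution_on ::
    "'a topology \<Rightarrow> ('a, 'n::finite) chart set \<Rightarrow> 'a set \<Rightarrow> ('a, 'n) distribution \<Rightarrow> bool" where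
  "integrable_distribution_on T A W D \<longleftrightarrow>
     (\<forall>V X Y. openin T V \<and> V \<subseteq> W \<and>
        smooth_vector_field_on A V X \<and> smooth_vector_field_on A V Y \<and>
        (\<forall>p\<in>V. X p \<in> D p \<and> Y p \<in> D p) \<longrightarrow>
        (\<forall>p\<in>V. lie_bracket A X Y p \<in> D p))"

definition complex_line_subbundle_on ::
    "'a topology \<Rightarrow> ('a, 'n::finite) chart set \<Rightarrow> 'a set \<Rightarrow> ('a, 'n) tensor11
      \<Rightarrow> ('a, 'n) distribution \<Rightarrow> bool" where
  "complex_line_subbundle_on T A W J D \<longleftrightarrow>
     subbundle_on T A W 2 D \<and> (\<forall>p\<in>W. \<forall>u\<in>D p. J p u \<in> D p)"

definition orthogonal_direct_sum_on ::
    "('a, 'n::finite) chart set \<Rightarrow> 'a set \<Rightarrow> ('a, 'n) tensor02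
      \<Rightarrow> ('a, 'n) distribution \<Rightarrow> ('a, 'n) distribution \<Rightarrow> bool" where
  "orthogonal_direct_sum_on A W g H V \<longleftrightarrow>
     (\<forall>p\<in>W. (\<forall>h\<in>H p. \<forall>v\<in>V p. g p h v = 0) \<and>
        (\<forall>u\<in>tangent_space A p. \<exists>!z. z \<in> H p \<times> V p \<and> u = lincomb 1 (fst z) 1 (snd z)))"

definition integrable_complex_splitting_on ::
    "'a topology \<Rightarrow> ('a, 'n::finite) chart set \<Rightarrow> 'a set \<Rightarrow> ('a, 'n) tensor02 \<Rightarrow> ('a, 'n) tensor11
      \<Rightarrow> ('a, 'n) distribution \<Rightarrow> ('a, 'n) distribution \<Rightarrow> bool" where
  "integrable_complex_splitting_on T A W g J H V \<longleftrightarrow>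
     complex_line_subbundle_on T A W J H \<and> integrable_distribution_on T A W H \<and>
     complex_line_subbundle_on T A W J V \<and> integrable_distribution_on T A W V \<and>
     orthogonal_direct_sum_on A W g H V"

definition spanned_by_coord_fields ::
    "('a, 'n::finite) chart set \<Rightarrow> ('a, 'n) chart \<Rightarrow> 'n \<Rightarrow> 'n \<Rightarrow> ('a, 'n) distribution \<Rightarrow> bool" where
  "spanned_by_coord_fields A c i j D \<longleftrightarrow>
     (\<forall>p\<in>cdom c. D p = {lincomb a (coord_field A c i p) b (coord_field A c j p) | a b. True})"


section \<open>The coordinate expressions of the metric and the complex structure, and the equations\<close>

definition sec :: "real \<Rightarrow> real" where
  "sec x = 1 / cos x"

definition admissible_functions ::
    "('a, 4) chart set \<Rightarrow> ('a, 4) chart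
      \<Rightarrow> ('a \<Rightarrow> real) \<Rightarrow> ('a \<Rightarrow> real) \<Rightarrow> ('a \<Rightarrow> real) \<Rightarrow> ('a \<Rightarrow> real) \<Rightarrow> bool" where
  "admissible_functions A c \<alpha> \<beta> \<gamma> \<delta> \<longleftrightarrow>
     smooth_fun_on A (cdom c) \<alpha> \<and> smooth_fun_on A (cdom c) \<beta> \<and>
     smooth_fun_on A (cdom c) \<gamma> \<and> smooth_fun_on A (cdom c) \<delta> \<and>
     (\<forall>p\<in>cdom c. \<alpha> p \<in> {-pi/2<..<pi/2} \<and> \<gamma> p \<in> {-pi/2<..<pi/2})"

text \<open>Indices of type \<^typ>\<open>4\<close> are \<open>1, 2, 3, 4\<close> (where \<open>4 = 0\<close>).\<close>

definition metric_formula ::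
    "('a, 4) chart set \<Rightarrow> ('a, 4) chart \<Rightarrow> ('a, 4) tensor02
      \<Rightarrow> ('a \<Rightarrow> real) \<Rightarrow> ('a \<Rightarrow> real) \<Rightarrow> ('a \<Rightarrow> real) \<Rightarrow> ('a \<Rightarrow> real) \<Rightarrow> bool" where
  "metric_formula A c g \<alpha> \<beta> \<gamma> \<delta> \<longleftrightarrow>
     (\<forall>p\<in>cdom c. let G = (\<lambda>i j. comp02 A c g i j p) in
        (\<forall>i j. G i j = G j i) \<and>
        G 1 1 = exp (- \<beta> p) * sec (\<alpha> p) \<and> G 1 2 = tan (\<alpha> p) \<and> G 2 2 = exp (\<beta> p) * sec (\<alpha> p) \<and>
        G 3 3 = exp (- \<delta> p) * sec (\<gamma> p) \<and> G 3 4 = tan (\<gamma> p) \<and> G 4 4 = exp (\<delta> p) * sec (\<gamma> p) \<and>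
        G 1 3 = 0 \<and> G 1 4 = 0 \<and> G 2 3 = 0 \<and> G 2 4 = 0)"

definition complex_structure_formula ::
    "('a, 4) chart set \<Rightarrow> ('a, 4) chart \<Rightarrow> ('a, 4) tensor02 \<Rightarrow> ('a, 4) tensor11 \<Rightarrow> bool" where
  "complex_structure_formula A c g J \<longleftrightarrow>
     (\<forall>p\<in>cdom c. let G = (\<lambda>i j. comp02 A c g i j p); K = (\<lambda>k j. comp11 A c J k j p) in
        K 1 1 = - G 1 2 \<and> K 1 2 = - G 2 2 \<and> K 2 1 = G 1 1 \<and> K 2 2 = G 1 2 \<and>
        K 3 3 = - G 3 4 \<and> K 3 4 = - G 4 4 \<and> K 4 3 = G 3 3 \<and> K 4 4 = G 3 4 \<and>
        (\<forall>l\<in>{1,2}. \<forall>r\<in>{3,4}. K r l = 0 \<and> K l r = 0))"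

definition pde_system ::
    "('a, 4) chart
      \<Rightarrow> ('a \<Rightarrow> real) \<Rightarrow> ('a \<Rightarrow> real) \<Rightarrow> ('a \<Rightarrow> real) \<Rightarrow> ('a \<Rightarrow> real) \<Rightarrow> bool" where
  "pde_system c \<alpha> \<beta> \<gamma> \<delta> \<longleftrightarrow>
     (\<forall>x\<in>cdom c. let d = (\<lambda>(i::nat) f. coord_deriv c (of_nat i) f x) in
        (\<forall>p q. {p, q} = {3, 4} \<longrightarrow>
           (-1) ^ p * d p \<beta> = d q \<alpha> * exp ((-1) ^ p * \<delta> x) * sec (\<gamma> x) - d p \<alpha> * tan (\<gamma> x)) \<and>
        (\<forall>l m. {l, m} = {1, 2} \<longrightarrow>
           (-1) ^ l * d l \<delta> = d m \<gamma> * exp ((-1) ^ l * \<beta> x) * sec (\<alpha> x) - d l \<gamma> * tan (\<alpha> x)))"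

end

theory Submission
  imports Defs
begin

text \<open>In the normal form the Kaehler form is constant, and the remaining components of \<open>\<nabla>J = 0\<close> say that
  \<open>\<alpha> + i \<beta>\<close> is holomorphic along the leaves of \<open>V\<close> and \<open>\<gamma> + i \<delta>\<close> along those of \<open>H\<close>; these are the
  equations. Conversely, the Frobenius theorem for the two distributions
  provides coordinates in which \<open>H\<close> and \<open>V\<close> are spanned by \<open>\<partial>\<^sub>1, \<partial>\<^sub>2\<close> and \<open>\<partial>\<^sub>3, \<partial>\<^sub>4\<close>. As the Kaehler form
  is closed, \<open>x\<^sup>1\<close> and \<open>x\<^sup>3\<close> can be changed so as to make it \<open>dx\<^sup>1 \<and> dx\<^sup>2 + dx\<^sup>3 \<and> dx\<^sup>4\<close>. Then both blocks
  of the metric have determinant one, which is what the parametrization by \<open>\<alpha>, \<beta>, \<gamma>, \<delta>\<close> expresses.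
  The Frobenius theorem is derived from the smooth dependence of solutions of ordinary differential
  equations on parameters.\<close>

section \<open>Calculus of smooth maps\<close>

text \<open>Unit-area metrics on a plane with a fixed basis form a hyperbolic plane: the block with
  entries g_11, g_12, g_22 corresponds to the point \<tau> = (g_12 + i) / g_11 of the upper
  half-plane, and here \<tau> = i exp (-i (\<alpha> + i \<beta>)). So \<alpha> + i \<beta> is the
  coordinate of the strip model, which explains the range of \<alpha> and the shape of the metric,
  and the equations say that the conformal modulus of each block varies holomorphically along the
  leaves of the other distribution. Two features of the setting shape the proof. Parallelism of J is
  required in all charts of the maximal atlas, while the formulas live in one of them; hence the
  covariant derivative is lowered with g to a trilinear form \<open>par\<close>, which contains no
  inverse matrix and is shown to be tensorial. And straightening one distribution must not disturb
  the other: each distribution contributes to the new chart only the two functions that are constant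
  along its own leaves.\<close>

abbreviation fd :: "('e::real_normed_vector \<Rightarrow> 'f::real_normed_vector) \<Rightarrow> 'e \<Rightarrow> 'e \<Rightarrow> 'f" where
  "fd f x \<equiv> frechet_derivative f (at x)"

lemma fd_eqI: "(f has_derivative f') (at x) \<Longrightarrow> fd f x = f'"
  by (metis frechet_derivative_at)

lemma fd_works: "f differentiable (at x) \<Longrightarrow> (f has_derivative fd f x) (at x)"
  using frechet_derivative_works by blast

lemma has_derivative_cong_open:
  assumes "open S" "x \<in> S" "\<And>y. y \<in> S \<Longrightarrow> f y = g y"
  shows "(f has_derivative f') (at x) \<longleftrightarrow> (g has_derivative f') (at x)"
proof
  show "(f has_derivative f') (at x) \<Longrightarrow> (g has_derivative f') (at x)"
    by (erule has_derivative_transform_within_open[OF _ assms(1,2)]) (simp add: assms(3))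
  show "(g has_derivative f') (at x) \<Longrightarrow> (f has_derivative f') (at x)"
    by (erule has_derivative_transform_within_open[OF _ assms(1,2)]) (simp add: assms(3))
qed

lemma differentiable_cong_open:
  assumes "open S" "x \<in> S" "\<And>y. y \<in> S \<Longrightarrow> f y = g y"
  shows "f differentiable (at x) \<longleftrightarrow> g differentiable (at x)"
  unfolding differentiable_def using has_derivative_cong_open[OF assms] by simp

lemma fd_cong_open:
  assumes "open S" "x \<in> S" "\<And>y. y \<in> S \<Longrightarrow> f y = g y"
  shows "fd f x = fd g x"
  unfolding frechet_derivative_def using has_derivative_cong_open[OF assms] by simp

text \<open>\<open>Ck_on\<close> takes unrestricted derivatives, which see a full neighborhood of
  each point; agreement on \<open>S\<close> determines them because \<open>S\<close> is open. The
  same reason puts \<open>open S\<close> into most closure rules below.\<close>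

lemma Ck_on_cong:
  assumes "open S" "\<And>y. y \<in> S \<Longrightarrow> f y = g y"
  shows "Ck_on k f S \<longleftrightarrow> Ck_on k g S"
  using assms(2)
proof (induction k arbitrary: f g)
  case 0
  then show ?case by (auto intro: continuous_on_cong)
next
  case (Suc k)
  have 1: "f differentiable (at x) \<longleftrightarrow> g differentiable (at x)" if "x \<in> S" for x
    using differentiable_cong_open[OF assms(1) that] Suc.prems by blast
  have 2: "fd f x v = fd g x v" if "x \<in> S" for x v
    using fd_cong_open[OF assms(1) that, of f g] Suc.prems by simp
  have "Ck_on k (\<lambda>x. fd f x v) S \<longleftrightarrow> Ck_on k (\<lambda>x. fd g x v) S" for v
    by (rule Suc.IH) (use 2 in auto)
  then show ?case using 1 by simp
qed

text \<open>Lets the derivative be presented by an explicit formula instead of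
  \<open>frechet_derivative\<close>; most inductions on the order of differentiability go through
  this rule.\<close>

lemma Ck_on_SucI:
  assumes "open S" "\<And>x. x \<in> S \<Longrightarrow> (f has_derivative f' x) (at x)"
    and "\<And>v. Ck_on k (\<lambda>x. f' x v) S"
  shows "Ck_on (Suc k) f S"
proof -
  have "Ck_on k (\<lambda>x. fd f x v) S" for v
    using Ck_on_cong[OF assms(1), of "\<lambda>x. fd f x v" "\<lambda>x. f' x v"] assms(2,3) fd_eqI by metis
  then show ?thesis using assms(2) by (auto simp: differentiable_def)
qed

lemma Ck_on_Suc_imp_has_derivative:
  "Ck_on (Suc k) f S \<Longrightarrow> x \<in> S \<Longrightarrow> (f has_derivative fd f x) (at x)"
  by (simp add: fd_works)

lemma Ck_on_Suc_imp_fd: "Ck_on (Suc k) f S \<Longrightarrow> Ck_on k (\<lambda>x. fd f x v) S"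
  by simp

lemma Ck_on_Suc_imp: "Ck_on (Suc k) f S \<Longrightarrow> Ck_on k f S"
proof (induction k arbitrary: f)
  case 0
  then show ?case
    by (auto intro!: continuous_at_imp_continuous_on differentiable_imp_continuous_within)
next
  case (Suc k)
  then have "Ck_on k (\<lambda>x. fd f x v) S" for v
    using Suc.IH by (metis Ck_on.simps(2))
  with Suc.prems show ?case by simp
qed

lemma Ck_on_le: "Ck_on k f S \<Longrightarrow> j \<le> k \<Longrightarrow> Ck_on j f S"
proof (induction k)
  case (Suc k)
  then show ?case using Ck_on_Suc_imp le_Suc_eq by blast
qed simp

lemma Ck_on_imp_continuous_on: "Ck_on k f S \<Longrightarrow> continuous_on S f"
  using Ck_on_le[of k f S 0] by simp

lemma Ck_on_subset: "Ck_on k f S \<Longrightarrow> T \<subseteq> S \<Longrightarrow> Ck_on k f T"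
  by (induction k arbitrary: f) (auto intro: continuous_on_subset)

text \<open>Makes it possible to prove regularity of ODE solutions on each smaller time interval and
  to conclude it on the whole open interval.\<close>

lemma Ck_on_local:
  assumes "\<And>x. x \<in> S \<Longrightarrow> \<exists>T. open T \<and> x \<in> T \<and> Ck_on k f T"
  shows "Ck_on k f S"
  using assms
proof (induction k arbitrary: f)
  case 0
  have "isCont f x" if "x \<in> S" for x
    using 0[OF that] by (auto simp: continuous_on_eq_continuous_at)
  then show ?case by (simp add: continuous_at_imp_continuous_on)
next
  case (Suc k)
  have "f differentiable (at x)" if "x \<in> S" for x
    using Suc.prems[OF that] by auto
  moreover have "Ck_on k (\<lambda>x. fd f x v) S" for v
    by (rule Suc.IH) (use Suc.prems in fastforce)
  ultimately show ?case by simp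
qed

section \<open>Closure rules for maps of class C^k\<close>

lemma Ck_on_const [simp]: "Ck_on k (\<lambda>x. c) S"
  by (induction k arbitrary: c) auto

lemma Ck_on_bounded_linear: "bounded_linear f \<Longrightarrow> Ck_on k f S"
proof (induction k)
  case 0
  then show ?case by (simp add: linear_continuous_on)
next
  case (Suc k)
  then have "(f has_derivative f) (at x)" for x
    by (simp add: bounded_linear_imp_has_derivative)
  then have "fd f x = f" "f differentiable (at x)" for x
    by (auto intro: fd_eqI differentiableI)
  then show ?case by simp
qed

lemma Ck_on_add:
  assumes "open S" "Ck_on k f S" "Ck_on k g S"
  shows "Ck_on k (\<lambda>x. f x + g x) S"
  using assms(2,3)
proof (induction k arbitrary: f g)
  case 0
  then show ?case by (auto intro: continuous_on_add)
next
  case (Suc k)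
  show ?case
  proof (rule Ck_on_SucI[OF assms(1)])
    show "((\<lambda>x. f x + g x) has_derivative (\<lambda>v. fd f x v + fd g x v)) (at x)" if "x \<in> S" for x
      using Suc.prems that by (intro has_derivative_add Ck_on_Suc_imp_has_derivative)
    show "Ck_on k (\<lambda>x. fd f x v + fd g x v) S" for v
      using Suc.prems by (intro Suc.IH) auto
  qed
qed

text \<open>By the Leibniz rule the derivative is again a sum of two such products, with factors of
  class C^k, so induction on the order applies. Scalar multiplication, real multiplication and the
  inner product are instances.\<close>

lemma (in bounded_bilinear) Ck_on:
  assumes "open S" "Ck_on k f S" "Ck_on k g S"
  shows "Ck_on k (\<lambda>x. prod (f x) (g x)) S"
  using assms(2,3)
proof (induction k arbitrary: f g)
  case 0
  then show ?case by (auto intro: continuous_on)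
next
  case (Suc k)
  show ?case
  proof (rule Ck_on_SucI[OF assms(1)])
    show "((\<lambda>x. prod (f x) (g x)) has_derivative
        (\<lambda>v. prod (f x) (fd g x v) + prod (fd f x v) (g x))) (at x)" if "x \<in> S" for x
      using Suc.prems that by (intro FDERIV Ck_on_Suc_imp_has_derivative)
    show "Ck_on k (\<lambda>x. prod (f x) (fd g x v) + prod (fd f x v) (g x)) S" for v
      using Suc.prems Ck_on_Suc_imp[OF Suc.prems(1)] Ck_on_Suc_imp[OF Suc.prems(2)]
      by (intro Ck_on_add[OF assms(1)] Suc.IH) auto
  qed
qed

lemmas Ck_on_scaleR = bounded_bilinear.Ck_on[OF bounded_bilinear_scaleR]
lemmas Ck_on_mult = bounded_bilinear.Ck_on[OF bounded_bilinear_mult]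
lemmas Ck_on_inner = bounded_bilinear.Ck_on[OF bounded_bilinear_inner]

lemma Ck_on_sum:
  assumes "open S" "\<And>i. i \<in> I \<Longrightarrow> Ck_on k (f i) S"
  shows "Ck_on k (\<lambda>x. \<Sum>i\<in>I. f i x) S"
  using assms(2) by (induction I rule: infinite_finite_induct) (auto intro: Ck_on_add[OF assms(1)])

lemma Ck_on_prod:
  fixes f :: "'i \<Rightarrow> 'a::euclidean_space \<Rightarrow> real"
  assumes "open S" "\<And>i. i \<in> I \<Longrightarrow> Ck_on k (f i) S"
  shows "Ck_on k (\<lambda>x. \<Prod>i\<in>I. f i x) S"
  using assms(2) by (induction I rule: infinite_finite_induct) (auto intro: Ck_on_mult[OF assms(1)])

lemma Ck_on_linear_compose:
  assumes "open S" "bounded_linear L" "Ck_on k f S"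
  shows "Ck_on k (\<lambda>x. L (f x)) S"
  using assms(3)
proof (induction k arbitrary: f)
  case 0
  then show ?case
    using assms(2) by (simp add: bounded_linear.continuous_on)
next
  case (Suc k)
  show ?case
  proof (rule Ck_on_SucI[OF assms(1)])
    show "((\<lambda>x. L (f x)) has_derivative (\<lambda>v. L (fd f x v))) (at x)" if "x \<in> S" for x
      using Suc.prems that
      by (intro bounded_linear.has_derivative[OF assms(2)] Ck_on_Suc_imp_has_derivative)
    show "Ck_on k (\<lambda>x. L (fd f x v)) S" for v
      using Suc by auto
  qed
qed

lemma linear_fd: "f differentiable (at x) \<Longrightarrow> linear (fd f x)"
  using linear_frechet_derivative by blast

lemma linear_basis_expand:
  fixes L :: "'a::euclidean_space \<Rightarrow> 'b::real_vector"
  assumes "linear L"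
  shows "L v = (\<Sum>b\<in>Basis. (v \<bullet> b) *\<^sub>R L b)"
proof -
  have "L v = L (\<Sum>b\<in>Basis. (v \<bullet> b) *\<^sub>R b)" by (simp add: euclidean_representation)
  also have "\<dots> = (\<Sum>b\<in>Basis. (v \<bullet> b) *\<^sub>R L b)"
    using assms by (simp add: linear_sum linear_cmul)
  finally show ?thesis .
qed

text \<open>In the chain rule the outer derivative is applied to a direction that varies with the
  point, whereas \<open>Ck_on\<close> speaks of fixed directions. Expansion over the basis leaves
  products of scalar functions with composites of the maps \<open>fd g _ b\<close>, to which the
  induction hypothesis applies.\<close>

lemma Ck_on_compose:
  fixes f :: "'a::euclidean_space \<Rightarrow> 'b::euclidean_space" and g :: "'b \<Rightarrow> 'c::real_normed_vector"
  assumes "open S" "open T" "f ` S \<subseteq> T" "Ck_on k g T" "Ck_on k f S"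
  shows "Ck_on k (\<lambda>x. g (f x)) S"
  using assms(4,5)
proof (induction k arbitrary: g)
  case 0
  then show ?case using assms(3) by (auto intro: continuous_on_compose2)
next
  case (Suc k)
  have fT: "f x \<in> T" if "x \<in> S" for x using assms(3) that by blast
  have f: "Ck_on k f S" using Suc.prems Ck_on_Suc_imp by blast
  show ?case
  proof (rule Ck_on_SucI[OF assms(1)])
    fix x assume x: "x \<in> S"
    have g: "(g has_derivative fd g (f x)) (at (f x))"
      using Suc.prems fT[OF x] by (intro Ck_on_Suc_imp_has_derivative)
    have "((\<lambda>x. g (f x)) has_derivative (\<lambda>v. fd g (f x) (fd f x v))) (at x)"
      using Suc.prems x g by (intro has_derivative_compose[OF Ck_on_Suc_imp_has_derivative[of k f S]])
    moreover have "fd g (f x) (fd f x v) = (\<Sum>b\<in>Basis. (fd f x v \<bullet> b) *\<^sub>R fd g (f x) b)" for v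
      using g has_derivative_linear linear_basis_expand by blast
    ultimately show "((\<lambda>x. g (f x)) has_derivative
        (\<lambda>v. (\<Sum>b\<in>Basis. (fd f x v \<bullet> b) *\<^sub>R fd g (f x) b))) (at x)" by simp
  next
    fix v
    show "Ck_on k (\<lambda>x. \<Sum>b\<in>Basis. (fd f x v \<bullet> b) *\<^sub>R fd g (f x) b) S"
      using Suc.prems f
      by (intro Ck_on_sum[OF assms(1)] Ck_on_scaleR[OF assms(1)] Ck_on_inner[OF assms(1)] Suc.IH) auto
  qed
qed

lemma Ck_on_Pair:
  assumes "open S" "Ck_on k f S" "Ck_on k g S"
  shows "Ck_on k (\<lambda>x. (f x, g x)) S"
proof -
  have "Ck_on k (\<lambda>x. (f x, 0) + (0, g x)) S"
    by (intro Ck_on_add[OF assms(1)] Ck_on_linear_compose[OF assms(1) _ assms(2)] Ck_on_linear_compose[OF assms(1) _ assms(3)]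
        bounded_linear_Pair bounded_linear_ident bounded_linear_zero)
  then show ?thesis by simp
qed

lemma Ck_on_componentwise:
  fixes f :: "'a::euclidean_space \<Rightarrow> 'b::euclidean_space"
  assumes "open S" "\<And>b. b \<in> Basis \<Longrightarrow> Ck_on k (\<lambda>x. f x \<bullet> b) S"
  shows "Ck_on k f S"
proof -
  have "Ck_on k (\<lambda>x. \<Sum>b\<in>Basis. (f x \<bullet> b) *\<^sub>R b) S"
    by (intro Ck_on_sum[OF assms(1)] Ck_on_scaleR[OF assms(1)] assms(2) Ck_on_const)
  then show ?thesis by (simp add: euclidean_representation)
qed

lemma Ck_on_vec:
  fixes f :: "'a::euclidean_space \<Rightarrow> real ^ 'n"
  assumes "open S" "\<And>i. Ck_on k (\<lambda>x. f x $ i) S"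
  shows "Ck_on k f S"
  by (rule Ck_on_componentwise[OF assms(1)]) (auto simp: Basis_vec_def inner_axis assms(2))

lemma Ck_on_nth: "open S \<Longrightarrow> Ck_on k f S \<Longrightarrow> Ck_on k (\<lambda>x. f x $ i) S"
  by (rule Ck_on_linear_compose[OF _ bounded_linear_vec_nth])

section \<open>Smoothness of some elementary functions\<close>

lemma Ck_on_SucI_real:
  fixes f :: "real \<Rightarrow> real"
  assumes "open S" "\<And>x. x \<in> S \<Longrightarrow> (f has_field_derivative f' x) (at x)" "Ck_on k f' S"
  shows "Ck_on (Suc k) f S"
  by (rule Ck_on_SucI[OF assms(1) assms(2)[unfolded has_field_derivative_def]])
     (auto intro!: Ck_on_mult[OF assms(1)] assms(3))

lemma smooth_on_exp: "smooth_on UNIV (exp :: real \<Rightarrow> real)"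
proof -
  have "Ck_on k (exp :: real \<Rightarrow> real) UNIV" for k
    by (induction k) (auto intro!: continuous_intros Ck_on_SucI_real DERIV_exp simp del: Ck_on.simps(2))
  then show ?thesis by (simp add: smooth_on_def)
qed

lemma smooth_on_inverse: "smooth_on (- {0}) (inverse :: real \<Rightarrow> real)"
proof -
  have "Ck_on k (inverse :: real \<Rightarrow> real) (- {0})" for k
  proof (induction k)
    case (Suc k)
    have "Ck_on k (\<lambda>x::real. (-1) * (inverse x * inverse x)) (- {0})"
      using Suc by (intro Ck_on_mult Ck_on_const) auto
    then show ?case
      by (intro Ck_on_SucI_real) (auto intro!: derivative_eq_intros simp del: Ck_on.simps(2))
  qed (auto intro!: continuous_intros)
  then show ?thesis by (simp add: smooth_on_def)
qed

text \<open>Proved jointly, since each function is the derivative of the other up to sign.\<close>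

lemma smooth_on_sin_cos: "smooth_on UNIV (sin :: real \<Rightarrow> real) \<and> smooth_on UNIV (cos :: real \<Rightarrow> real)"
proof -
  have "Ck_on k (sin :: real \<Rightarrow> real) UNIV \<and> Ck_on k (cos :: real \<Rightarrow> real) UNIV" for k
  proof (induction k)
    case (Suc k)
    then have "Ck_on k (\<lambda>x::real. (-1) * sin x) UNIV" by (intro Ck_on_mult) auto
    with Suc show ?case
      by (auto intro!: Ck_on_SucI_real derivative_eq_intros simp del: Ck_on.simps(2))
  qed (auto intro!: continuous_intros)
  then show ?thesis by (simp add: smooth_on_def)
qed

section \<open>The calculus rules for smooth maps\<close>

lemma smooth_on_imp_continuous_on: "smooth_on S f \<Longrightarrow> continuous_on S f"
  unfolding smooth_on_def using Ck_on_imp_continuous_on by blast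

lemma smooth_on_imp_has_derivative: "smooth_on S f \<Longrightarrow> x \<in> S \<Longrightarrow> (f has_derivative fd f x) (at x)"
  unfolding smooth_on_def using Ck_on_Suc_imp_has_derivative by blast

lemma smooth_on_imp_differentiable: "smooth_on S f \<Longrightarrow> x \<in> S \<Longrightarrow> f differentiable (at x)"
  unfolding smooth_on_def by (metis Ck_on.simps(2))

lemma smooth_on_imp_linear_fd: "smooth_on S f \<Longrightarrow> x \<in> S \<Longrightarrow> linear (fd f x)"
  using linear_fd smooth_on_imp_differentiable by blast

lemma smooth_on_fd: "smooth_on S f \<Longrightarrow> smooth_on S (\<lambda>x. fd f x v)"
  unfolding smooth_on_def by (metis Ck_on.simps(2))

lemma smooth_on_cong: "open S \<Longrightarrow> (\<And>y. y \<in> S \<Longrightarrow> f y = g y) \<Longrightarrow> smooth_on S f \<longleftrightarrow> smooth_on S g"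
  unfolding smooth_on_def using Ck_on_cong by metis

lemma smooth_on_subset: "smooth_on S f \<Longrightarrow> T \<subseteq> S \<Longrightarrow> smooth_on T f"
  unfolding smooth_on_def using Ck_on_subset by blast

lemma smooth_on_const: "smooth_on S (\<lambda>x. c)"
  by (simp add: smooth_on_def)

lemma smooth_on_bounded_linear: "bounded_linear f \<Longrightarrow> smooth_on S f"
  by (simp add: smooth_on_def Ck_on_bounded_linear)

lemma smooth_on_ident: "smooth_on S (\<lambda>x. x)"
  by (rule smooth_on_bounded_linear[OF bounded_linear_ident])

lemma smooth_on_linear_compose: "open S \<Longrightarrow> bounded_linear L \<Longrightarrow> smooth_on S f \<Longrightarrow> smooth_on S (\<lambda>x. L (f x))"
  by (simp add: smooth_on_def Ck_on_linear_compose)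

lemma smooth_on_nth: "open S \<Longrightarrow> smooth_on S f \<Longrightarrow> smooth_on S (\<lambda>x. f x $ i)"
  by (simp add: smooth_on_def Ck_on_nth)

lemma smooth_on_vec:
  fixes f :: "'a::euclidean_space \<Rightarrow> real ^ 'n"
  shows "open S \<Longrightarrow> (\<And>i. smooth_on S (\<lambda>x. f x $ i)) \<Longrightarrow> smooth_on S f"
  unfolding smooth_on_def by (metis Ck_on_vec)

lemma smooth_on_add: "open S \<Longrightarrow> smooth_on S f \<Longrightarrow> smooth_on S g \<Longrightarrow> smooth_on S (\<lambda>x. f x + g x)"
  by (simp add: smooth_on_def Ck_on_add)

lemma smooth_on_scaleR:
  "open S \<Longrightarrow> smooth_on S f \<Longrightarrow> smooth_on S g \<Longrightarrow> smooth_on S (\<lambda>x. f x *\<^sub>R g x)"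
  by (simp add: smooth_on_def Ck_on_scaleR)

lemma smooth_on_mult:
  fixes f g :: "'a::euclidean_space \<Rightarrow> real"
  shows "open S \<Longrightarrow> smooth_on S f \<Longrightarrow> smooth_on S g \<Longrightarrow> smooth_on S (\<lambda>x. f x * g x)"
  by (simp add: smooth_on_def Ck_on_mult)

lemma smooth_on_minus: "open S \<Longrightarrow> smooth_on S f \<Longrightarrow> smooth_on S (\<lambda>x. - f x)"
  by (rule smooth_on_linear_compose[OF _ bounded_linear_minus[OF bounded_linear_ident]])

lemma smooth_on_diff:
  "open S \<Longrightarrow> smooth_on S f \<Longrightarrow> smooth_on S g \<Longrightarrow> smooth_on S (\<lambda>x. f x - g x)"
  using smooth_on_add[of S f "\<lambda>x. - g x"] smooth_on_minus[of S g] by simp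

lemma smooth_on_sum:
  "open S \<Longrightarrow> (\<And>i. i \<in> I \<Longrightarrow> smooth_on S (f i)) \<Longrightarrow> smooth_on S (\<lambda>x. \<Sum>i\<in>I. f i x)"
  by (simp add: smooth_on_def Ck_on_sum)

lemma smooth_on_compose:
  fixes f :: "'a::euclidean_space \<Rightarrow> 'b::euclidean_space"
  shows "open S \<Longrightarrow> open T \<Longrightarrow> f ` S \<subseteq> T \<Longrightarrow> smooth_on T g \<Longrightarrow> smooth_on S f \<Longrightarrow> smooth_on S (\<lambda>x. g (f x))"
  unfolding smooth_on_def by (metis Ck_on_compose)

lemma smooth_on_inverse_compose:
  fixes f :: "'a::euclidean_space \<Rightarrow> real"
  shows "open S \<Longrightarrow> smooth_on S f \<Longrightarrow> (\<And>x. x \<in> S \<Longrightarrow> f x \<noteq> 0) \<Longrightarrow> smooth_on S (\<lambda>x. inverse (f x))"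
  by (rule smooth_on_compose[OF _ _ _ smooth_on_inverse]) auto

lemma smooth_on_divide:
  fixes f g :: "'a::euclidean_space \<Rightarrow> real"
  shows "open S \<Longrightarrow> smooth_on S f \<Longrightarrow> smooth_on S g \<Longrightarrow> (\<And>x. x \<in> S \<Longrightarrow> g x \<noteq> 0)
    \<Longrightarrow> smooth_on S (\<lambda>x. f x / g x)"
  unfolding divide_inverse by (intro smooth_on_mult smooth_on_inverse_compose)

lemma smooth_on_SucI_real:
  fixes f :: "real \<Rightarrow> real"
  assumes "open S" "\<And>x. x \<in> S \<Longrightarrow> (f has_field_derivative f' x) (at x)" "smooth_on S f'"
  shows "smooth_on S f"
  unfolding smooth_on_def
proof
  fix k show "Ck_on k f S"
    using Ck_on_SucI_real[OF assms(1,2), of k] assms(3) Ck_on_Suc_imp unfolding smooth_on_def by blast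
qed

lemma smooth_on_ln: "smooth_on {0<..} (ln :: real \<Rightarrow> real)"
  by (rule smooth_on_SucI_real[where f' = inverse])
     (auto intro!: derivative_eq_intros smooth_on_subset[OF smooth_on_inverse] simp: inverse_eq_divide)

lemma smooth_on_arctan: "smooth_on UNIV (arctan :: real \<Rightarrow> real)"
proof (rule smooth_on_SucI_real)
  show "(arctan has_field_derivative inverse (1 + x * x)) (at x)" for x :: real
    using DERIV_arctan[of x] by (simp add: power2_eq_square)
  show "smooth_on UNIV (\<lambda>x::real. inverse (1 + x * x))"
    by (intro smooth_on_inverse_compose smooth_on_add smooth_on_mult smooth_on_const smooth_on_ident)
       (auto simp: add_nonneg_eq_0_iff)
qed auto

text \<open>The second difference quotient of \<open>f\<close>, symmetric in \<open>u\<close> and \<open>v\<close>, tends to either of the two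
  mixed derivatives.\<close>

lemma second_difference_bound:
  fixes f :: "'a::real_normed_vector \<Rightarrow> 'b::real_normed_vector"
  assumes "open S" "x \<in> S" and f: "\<And>y. y \<in> S \<Longrightarrow> f differentiable (at y)"
    and L: "((\<lambda>y. fd f y u) has_derivative L) (at x)" and "e > 0"
  shows "\<exists>d>0. \<forall>t. 0 < t \<and> t < d \<longrightarrow>
    norm (f (x + t *\<^sub>R u + t *\<^sub>R v) - f (x + t *\<^sub>R u) - f (x + t *\<^sub>R v) + f x - (t * t) *\<^sub>R L v) \<le> e * (t * t)"
proof -
  \<comment> \<open>For 0 <= s <= t the displacements s u + t v and s u have norm at most t K. Each
    of the two linearization errors below is then at most e' t K, over an interval of length t, and
    e' = e / (2 K) makes the total e t^2.\<close>
  define K where "K = norm u + norm v + 1"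
  have K: "K > 0" by (simp add: K_def add_nonneg_pos)
  define e' where "e' = e / (2 * K)"
  have e': "e' > 0" using assms K by (simp add: e'_def)
  obtain r where r: "r > 0" "ball x r \<subseteq> S" using assms(1,2) open_contains_ball by blast
  obtain d where d: "d > 0"
    "\<And>y. norm (y - x) < d \<Longrightarrow> norm (fd f y u - fd f x u - L (y - x)) \<le> e' * norm (y - x)"
    using L[unfolded has_derivative_at_alt] e' by blast
  interpret L: bounded_linear L using L has_derivative_bounded_linear by blast
  have main: "norm (f (x + t *\<^sub>R u + t *\<^sub>R v) - f (x + t *\<^sub>R u) - f (x + t *\<^sub>R v) + f x - (t * t) *\<^sub>R L v)
      \<le> e * (t * t)" if t: "0 < t" "t < min (d / K) (r / K)" for t
  proof -
    have tK: "t * K < d" "t * K < r" using t K by (auto simp: field_simps)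
    have small: "norm (s *\<^sub>R u + t *\<^sub>R v) \<le> t * K" "norm (s *\<^sub>R u) \<le> t * K" if "s \<in> {0..t}" for s
    proof -
      have "norm (s *\<^sub>R u + t *\<^sub>R v) \<le> s * norm u + t * norm v"
        using norm_triangle_ineq[of "s *\<^sub>R u" "t *\<^sub>R v"] that t by simp
      also have "\<dots> \<le> t * norm u + t * norm v" using that by (simp add: mult_right_mono)
      also have "\<dots> \<le> t * K" using t by (simp add: K_def algebra_simps)
      finally show "norm (s *\<^sub>R u + t *\<^sub>R v) \<le> t * K" .
      have "norm (s *\<^sub>R u) \<le> t * norm u" using that by (simp add: mult_right_mono)
      also have "\<dots> \<le> t * K" using t by (simp add: K_def algebra_simps)
      finally show "norm (s *\<^sub>R u) \<le> t * K" .
    qed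
    have inS: "x + s *\<^sub>R u + t *\<^sub>R v \<in> S" "x + s *\<^sub>R u \<in> S" if "s \<in> {0..t}" for s
      using small[OF that] tK r(2) by (auto simp: subset_iff dist_norm norm_minus_commute add.assoc)
    \<comment> \<open>The increment of this function over [0, t] is the second difference minus t^2
      L v, so the mean value inequality reduces the claim to a bound on its derivative.\<close>
    let ?\<phi> = "\<lambda>s. f (x + s *\<^sub>R u + t *\<^sub>R v) - f (x + s *\<^sub>R u) - (s * t) *\<^sub>R L v"
    let ?\<phi>' = "\<lambda>s. fd f (x + s *\<^sub>R u + t *\<^sub>R v) u - fd f (x + s *\<^sub>R u) u - t *\<^sub>R L v"
    have deriv: "(?\<phi> has_derivative (\<lambda>h. h *\<^sub>R ?\<phi>' s)) (at s within {0..t})" if s: "s \<in> {0..t}" for s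
    proof -
      have 1: "((\<lambda>s. f (x + s *\<^sub>R u + w)) has_derivative (\<lambda>h. fd f (x + s *\<^sub>R u + w) (h *\<^sub>R u))) (at s within {0..t})"
        if "x + s *\<^sub>R u + w \<in> S" for w
      proof -
        have "((\<lambda>s. x + s *\<^sub>R u + w) has_derivative (\<lambda>h. h *\<^sub>R u)) (at s within {0..t})"
          by (auto intro!: derivative_eq_intros)
        from has_derivative_compose[OF this fd_works[OF f[OF that]]] show ?thesis .
      qed
      have lin: "fd f (x + s *\<^sub>R u + w) (h *\<^sub>R u) = h *\<^sub>R fd f (x + s *\<^sub>R u + w) u" if "x + s *\<^sub>R u + w \<in> S" for w h
        using linear_fd[OF f[OF that]] by (simp add: linear_cmul)
      show ?thesis
        using 1[OF inS(1)[OF s]] 1[of 0] inS[OF s] lin[of 0] lin[OF inS(1)[OF s]]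
        by (auto intro!: derivative_eq_intros simp: algebra_simps)
    qed
    have "norm (?\<phi>' s) \<le> 2 * e' * (t * K)" if s: "s \<in> {0..t}" for s
    proof -
      have "norm (fd f (x + w) u - fd f x u - L w) \<le> e' * (t * K)" if "norm w \<le> t * K" for w
        using d(2)[of "x + w"] that tK e' by (smt (verit) add_diff_cancel_left' mult_left_mono)
      from this[OF small(1)[OF s]] this[OF small(2)[OF s]]
      have "norm ((fd f (x + (s *\<^sub>R u + t *\<^sub>R v)) u - fd f x u - L (s *\<^sub>R u + t *\<^sub>R v))
        - (fd f (x + s *\<^sub>R u) u - fd f x u - L (s *\<^sub>R u))) \<le> e' * (t * K) + e' * (t * K)"
        by (meson add_mono norm_triangle_ineq4 order_trans)
      then show ?thesis by (simp add: L.add L.scaleR algebra_simps)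
    qed
    then have "norm (?\<phi> t - ?\<phi> 0) \<le> 2 * e' * (t * K) * norm (t - 0)"
      using t by (intro differentiable_bound[OF convex_real_interval(5) deriv]) (auto intro!: onorm_le simp: mult.commute mult_left_mono)
    also have "\<dots> = e * (t * t)" using K t by (simp add: e'_def)
    finally show ?thesis by (simp add: algebra_simps)
  qed
  show ?thesis using main d r K by (intro exI[of _ "min (d / K) (r / K)"]) auto
qed

lemma fd_fd_commute:
  fixes f :: "'a::real_normed_vector \<Rightarrow> 'b::real_normed_vector"
  assumes S: "open S" "x \<in> S" and f: "\<And>y. y \<in> S \<Longrightarrow> f differentiable (at y)"
    and u: "(\<lambda>y. fd f y u) differentiable (at x)" and v: "(\<lambda>y. fd f y v) differentiable (at x)"
  shows "fd (\<lambda>y. fd f y u) x v = fd (\<lambda>y. fd f y v) x u"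
proof (rule ccontr)
  let ?a = "fd (\<lambda>y. fd f y u) x v" and ?b = "fd (\<lambda>y. fd f y v) x u"
  assume "?a \<noteq> ?b"
  \<comment> \<open>One third of the distance suffices for the contradiction: both candidates, times
    t^2, lie within e t^2 of the same second difference, which forces their distance to be at most
    two thirds of itself.\<close>
  then have e: "norm (?a - ?b) / 3 > 0" (is "?e > 0") by simp
  obtain d1 where d1: "d1 > 0" "\<And>t. 0 < t \<and> t < d1 \<Longrightarrow>
    norm (f (x + t *\<^sub>R u + t *\<^sub>R v) - f (x + t *\<^sub>R u) - f (x + t *\<^sub>R v) + f x - (t * t) *\<^sub>R ?a) \<le> ?e * (t * t)"
    using second_difference_bound[OF S f fd_works[OF u] e] by blast
  obtain d2 where d2: "d2 > 0" "\<And>t. 0 < t \<and> t < d2 \<Longrightarrow>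
    norm (f (x + t *\<^sub>R v + t *\<^sub>R u) - f (x + t *\<^sub>R v) - f (x + t *\<^sub>R u) + f x - (t * t) *\<^sub>R ?b) \<le> ?e * (t * t)"
    using second_difference_bound[OF S f fd_works[OF v] e] by blast
  define t where "t = min d1 d2 / 2"
  have t: "0 < t" "t < d1" "t < d2" using d1(1) d2(1) by (auto simp: t_def)
  let ?\<Delta> = "f (x + t *\<^sub>R u + t *\<^sub>R v) - f (x + t *\<^sub>R u) - f (x + t *\<^sub>R v) + f x"
  have 1: "norm (?\<Delta> - (t * t) *\<^sub>R ?a) \<le> ?e * (t * t)" using d1(2) t by blast
  have 2: "norm (?\<Delta> - (t * t) *\<^sub>R ?b) \<le> ?e * (t * t)" using d2(2)[of t] t by (simp add: algebra_simps)
  have "norm ((?\<Delta> - (t * t) *\<^sub>R ?b) - (?\<Delta> - (t * t) *\<^sub>R ?a)) \<le> ?e * (t * t) + ?e * (t * t)"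
    using 1 2 by (meson add_mono norm_triangle_ineq4 order_trans)
  then have "norm ((t * t) *\<^sub>R (?a - ?b)) \<le> 2 * ?e * (t * t)" by (simp add: algebra_simps)
  then have "norm (?a - ?b) * (t * t) \<le> 2 * ?e * (t * t)" using t by (simp add: mult.commute)
  then have "norm (?a - ?b) \<le> 2 * ?e" using t mult_le_cancel_right_pos[of "t * t"] mult_pos_pos[OF t(1) t(1)] by blast
  then show False using e by simp
qed

lemma smooth_on_fd_commute:
  assumes "open S" "smooth_on S f" "x \<in> S"
  shows "fd (\<lambda>y. fd f y u) x v = fd (\<lambda>y. fd f y v) x u"
  using assms smooth_on_imp_differentiable smooth_on_fd by (intro fd_fd_commute[OF assms(1,3)]) blast+

section \<open>Ordinary differential equations with parameters\<close>

lemma onorm_scaleR_left_le: "norm a \<le> c \<Longrightarrow> onorm (\<lambda>h::real. h *\<^sub>R a) \<le> c"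
  by (rule onorm_le) (simp add: mult.commute[of c] mult_left_mono)

text \<open>The Lipschitz constant \<open>1/4\<close> on times \<open>\<bar>t\<bar> \<le> 2\<close> makes the Picard operator a contraction. Nothing
  more is needed, since the flows considered below are those of small multiples of given fields.\<close>

lemma small_growth_bound:
  fixes a :: "real \<Rightarrow> 'a::real_normed_vector"
  assumes s: "0 \<le> s" "s \<le> 2"
    and deriv: "\<And>t. t \<in> {-s..s} \<Longrightarrow> (a has_vector_derivative a' t) (at t within {-s..s})"
    and bound: "\<And>t. t \<in> {-s..s} \<Longrightarrow> norm (a' t) \<le> 1/4 * norm (a t) + e"
    and init: "norm (a 0) \<le> e0"
    and t: "t \<in> {-s..s}"
  shows "norm (a t) \<le> 2 * e0 + 4 * e"
proof -
  have cont: "continuous_on {-s..s} a"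
    using deriv has_vector_derivative_continuous continuous_on_eq_continuous_within by blast
  \<comment> \<open>This replaces Gronwall's inequality: if m is the maximum of the norm, attained
    at \<open>t1\<close>, then integration over a length of at most 2 gives m <= e0 + 2 (m/4 + e),
    that is, m <= 2 e0 + 4 e.\<close>
  obtain t1 where t1: "t1 \<in> {-s..s}" "\<And>t. t \<in> {-s..s} \<Longrightarrow> norm (a t) \<le> norm (a t1)"
    using continuous_attains_sup[OF _ _ continuous_on_norm[OF cont]] t by fastforce
  let ?m = "norm (a t1)"
  have "norm (a t1 - a 0) \<le> (1/4 * ?m + e) * norm (t1 - 0)"
  proof (rule differentiable_bound[OF convex_real_interval(5)[of "-s" s]])
    show "(a has_derivative (\<lambda>h. h *\<^sub>R a' t)) (at t within {-s..s})" if "t \<in> {-s..s}" for t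
      using deriv[OF that] by (simp add: has_vector_derivative_def)
    show "onorm (\<lambda>h. h *\<^sub>R a' t) \<le> 1/4 * ?m + e" if "t \<in> {-s..s}" for t
      by (rule onorm_scaleR_left_le) (use bound[OF that] t1(2)[OF that] in simp)
  qed (use t1 s in auto)
  also have "\<dots> \<le> (1/4 * ?m + e) * 2"
  proof (rule mult_left_mono)
    show "norm (t1 - 0) \<le> 2" using t1 s by auto
    have "0 \<le> norm (a' t1)" by simp
    also have "\<dots> \<le> 1/4 * ?m + e" using bound[OF t1(1)] .
    finally show "0 \<le> 1/4 * ?m + e" .
  qed
  finally have "?m \<le> e0 + (1/4 * ?m + e) * 2"
    using init norm_triangle_ineq2[of "a t1" "a 0"] by linarith
  then have "?m \<le> 2 * e0 + 4 * e" by simp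
  then show ?thesis using t1(2)[OF t] by linarith
qed

text \<open>Banach's fixed point theorem for the Picard operator on bounded continuous functions;
  the Lipschitz constant 1/4 and times up to 2 give the contraction factor 1/2.\<close>

lemma ODE_exists:
  fixes G :: "real \<Rightarrow> 'e::euclidean_space \<Rightarrow> 'e"
  assumes s: "0 \<le> s" "s \<le> 2"
    and cont: "continuous_on ({-s..s} \<times> UNIV) (\<lambda>(t, x). G t x)"
    and lip: "\<And>t x y. t \<in> {-s..s} \<Longrightarrow> norm (G t x - G t y) \<le> 1/4 * norm (x - y)"
  shows "\<exists>u. u 0 = x0 \<and> (\<forall>t\<in>{-s..s}. (u has_vector_derivative G t (u t)) (at t within {-s..s}))"
proof -
  let ?K = "{-s..s}"
  \<comment> \<open>The integral is started at -s, the left end of the interval, so that the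
    fundamental theorem applies at all times, also negative ones; subtracting its value at 0
    restores the initial condition.\<close>
  define I where "I u \<tau> = x0 + integral {-s..\<tau>} (\<lambda>t. G t (u t)) - integral {-s..0} (\<lambda>t. G t (u t))"
    for u :: "real \<Rightarrow> 'e" and \<tau>
  \<comment> \<open>Clamping the time to [-s, s] lets the operator act on bounded continuous
    functions on the whole line, which form a complete space.\<close>
  define cl where "cl t = max (-s) (min s t)" for t :: real
  have cl: "cl t \<in> ?K" "t \<in> ?K \<Longrightarrow> cl t = t" for t using s by (auto simp: cl_def)
  have contcl: "continuous_on UNIV cl" unfolding cl_def by (intro continuous_intros)
  have contG: "continuous_on ?K (\<lambda>t. G t (u t))" if "continuous_on UNIV u" for u
  proof -
    have "continuous_on ?K (\<lambda>t. (t, u t))"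
      by (intro continuous_on_Pair continuous_on_id continuous_on_subset[OF that]) simp
    from continuous_on_compose2[OF cont this] show ?thesis by auto
  qed
  have derI: "(I u has_vector_derivative G t (u t)) (at t within ?K)"
    if "continuous_on UNIV u" "t \<in> ?K" for u t
    unfolding I_def using integral_has_vector_derivative[OF contG[OF that(1)] that(2)]
    by (auto intro!: derivative_eq_intros)
  have I0: "I u 0 = x0" for u by (simp add: I_def)
  have contI: "continuous_on ?K (I u)" if "continuous_on UNIV u" for u
    using derI[OF that] has_vector_derivative_continuous continuous_on_eq_continuous_within by blast
  define P where "P u = Bcontfun (\<lambda>t. I (apply_bcontfun u) (cl t))" for u :: "real \<Rightarrow>\<^sub>C 'e"
  have P: "apply_bcontfun (P u) = (\<lambda>t. I (apply_bcontfun u) (cl t))" for u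
  proof -
    have "continuous_on UNIV (\<lambda>t. I (apply_bcontfun u) (cl t))"
      using cl by (intro continuous_on_compose2[OF contI contcl]) auto
    moreover have "bounded (range (\<lambda>t. I (apply_bcontfun u) (cl t)))"
      by (rule bounded_subset[OF compact_imp_bounded[OF compact_continuous_image[OF contI[of u] compact_Icc]]])
         (use cl in auto)
    ultimately show ?thesis
      unfolding P_def by (intro Bcontfun_inverse) (simp add: bcontfun_def)
  qed
  have "dist (P u) (P v) \<le> 1/2 * dist u v" for u v
  proof (rule dist_bound)
    fix t
    let ?a = "\<lambda>t. I u t - I v t"
    have "norm (?a (cl t) - ?a 0) \<le> (1/4 * dist u v) * norm (cl t - 0)"
    proof (rule differentiable_bound[OF convex_real_interval(5)[of "-s" s]])
      show "(?a has_derivative (\<lambda>h. h *\<^sub>R (G t (u t) - G t (v t)))) (at t within ?K)" if "t \<in> ?K" for t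
        using has_vector_derivative_diff[OF derI[of u t] derI[of v t]] that
        by (simp add: has_vector_derivative_def)
      show "onorm (\<lambda>h. h *\<^sub>R (G t (u t) - G t (v t))) \<le> 1/4 * dist u v" if "t \<in> ?K" for t
      proof (rule onorm_scaleR_left_le)
        have "norm (G t (u t) - G t (v t)) \<le> 1/4 * norm (u t - v t)" by (rule lip[OF that])
        also have "\<dots> \<le> 1/4 * dist u v" using dist_bounded[of u t v] by (simp add: dist_norm)
        finally show "norm (G t (u t) - G t (v t)) \<le> 1/4 * dist u v" .
      qed
    qed (use cl s in auto)
    also have "\<dots> \<le> (1/4 * dist u v) * 2"
      by (rule mult_left_mono) (use cl[of t] s in auto)
    finally show "dist (P u t) (P v t) \<le> 1/2 * dist u v" by (simp add: P I0 dist_norm)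
  qed
  then obtain u where u: "P u = u"
    using banach_fix_type[of "1/2" P] by auto
  have eq: "u t = I u t" if "t \<in> ?K" for t
    using P[of u] u cl(2)[OF that] by metis
  show ?thesis
  proof (intro exI[of _ "I u"] conjI ballI I0)
    fix t assume t: "t \<in> ?K"
    show "(I u has_vector_derivative G t (I u t)) (at t within ?K)"
      using derI[of u t] t eq[OF t] by simp
  qed
qed

text \<open>The solutions are chosen separately for each parameter. Joint continuity follows by
  comparing the solutions for \<open>l\<close> and \<open>l0\<close>: their difference obeys the
  hypothesis of \<open>small_growth_bound\<close>, whose constant term is the change of
  \<open>F\<close> in the parameter along the single curve \<open>v l0\<close>. Compactness of the
  time interval makes that change small uniformly in time.\<close>

lemma ODE_exists_continuous:
  fixes F :: "(real \<times> 'l::metric_space) \<times> 'e::euclidean_space \<Rightarrow> 'e"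
  assumes s: "0 \<le> s" "s \<le> 2"
    and cont: "continuous_on (({-s..s} \<times> B) \<times> UNIV) F"
    and lip: "\<And>t l x y. t \<in> {-s..s} \<Longrightarrow> l \<in> B \<Longrightarrow> norm (F ((t, l), x) - F ((t, l), y)) \<le> 1/4 * norm (x - y)"
    and u0: "continuous_on B u0"
  shows "\<exists>u. continuous_on ({-s..s} \<times> B) u \<and> (\<forall>l\<in>B. u (0, l) = u0 l \<and>
    (\<forall>t\<in>{-s..s}. ((\<lambda>t. u (t, l)) has_vector_derivative F ((t, l), u (t, l))) (at t within {-s..s})))"
proof -
  let ?K = "{-s..s}"
  have "\<exists>v. l \<in> B \<longrightarrow> v 0 = u0 l \<and>
      (\<forall>t\<in>?K. (v has_vector_derivative F ((t, l), v t)) (at t within ?K))" for l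
  proof (cases "l \<in> B")
    case True
    have "continuous_on (?K \<times> UNIV) (\<lambda>(t, x). F ((t, l), x))"
      unfolding split_def using True
      by (intro continuous_on_compose2[OF cont] continuous_intros) auto
    then show ?thesis using ODE_exists[OF s, of "\<lambda>t x. F ((t, l), x)" "u0 l"] lip[OF _ True] by simp
  qed simp
  then obtain v where v: "\<And>l. l \<in> B \<Longrightarrow> v l 0 = u0 l"
    "\<And>l t. l \<in> B \<Longrightarrow> t \<in> ?K \<Longrightarrow> (v l has_vector_derivative F ((t, l), v l t)) (at t within ?K)"
    by metis
  have contv: "continuous_on ?K (v l)" if "l \<in> B" for l
    using v(2)[OF that] has_vector_derivative_continuous continuous_on_eq_continuous_within by blast
  have "continuous_on (?K \<times> B) (\<lambda>(t, l). v l t)"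
  proof (subst continuous_on_iff, intro ballI allI impI)
    fix z0 and e :: real
    assume "z0 \<in> ?K \<times> B" and e: "e > 0"
    then obtain t0 l0 where z0: "z0 = (t0, l0)" and t0: "t0 \<in> ?K" and l0: "l0 \<in> B" by auto
    have "continuous_on (B \<times> ?K) (\<lambda>p. v l0 (snd p))"
      by (rule continuous_on_compose2[OF contv[OF l0] continuous_on_snd[OF continuous_on_id]]) auto
    then have "continuous_on (B \<times> ?K) (\<lambda>p. ((snd p, fst p), v l0 (snd p)))"
      by (intro continuous_on_Pair continuous_on_fst continuous_on_snd continuous_on_id)
    then have c1: "continuous_on (B \<times> ?K) (\<lambda>p. F ((snd p, fst p), v l0 (snd p)))" (is "continuous_on _ ?g")
      by (rule continuous_on_compose2[OF cont]) auto
    \<comment> \<open>The initial values contribute 2 (e/8) and the change of the field 4 (e/16),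
      together e/2; a further e/4 is spent on the variation of \<open>v l0\<close> in time.\<close>
    have e16: "e / 16 > 0" using e by simp
    obtain X where X: "l0 \<in> X" "open X" "\<forall>l\<in>X \<inter> B. \<forall>t\<in>?K. dist (?g (l, t)) (?g (l0, t)) \<le> e / 16"
      by (rule continuous_on_prod_compactE[OF c1 compact_Icc l0 e16])
    obtain d1 where d1: "d1 > 0" "ball l0 d1 \<subseteq> X" using X open_contains_ball by blast
    obtain d2 where d2: "d2 > 0" "\<And>l. l \<in> B \<Longrightarrow> dist l l0 < d2 \<Longrightarrow> dist (u0 l) (u0 l0) < e / 8"
      using u0[unfolded continuous_on_iff, rule_format, OF l0, of "e/8"] e by auto
    obtain d3 where d3: "d3 > 0" "\<And>t. t \<in> ?K \<Longrightarrow> dist t t0 < d3 \<Longrightarrow> dist (v l0 t) (v l0 t0) < e / 4"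
      using contv[OF l0, unfolded continuous_on_iff, rule_format, OF t0, of "e/4"] e by auto
    have "dist (v l t) (v l0 t0) < e"
      if tl: "t \<in> ?K" "l \<in> B" "dist (t, l) (t0, l0) < min d1 (min d2 d3)" for t l
    proof -
      have dl: "dist l l0 < d1" "dist l l0 < d2" and dt: "dist t t0 < d3"
        using tl(3) dist_fst_le[of "(t, l)" "(t0, l0)"] dist_snd_le[of "(t, l)" "(t0, l0)"] by auto
      have lX: "l \<in> X \<inter> B" using dl d1 tl by (auto simp: subset_iff dist_commute)
      have "norm (v l t - v l0 t) \<le> 2 * (e / 8) + 4 * (e / 16)"
      proof (rule small_growth_bound[OF s, where a = "\<lambda>t. v l t - v l0 t"])
        show "((\<lambda>t. v l t - v l0 t) has_vector_derivative (F ((t, l), v l t) - F ((t, l0), v l0 t))) (at t within ?K)"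
          if "t \<in> ?K" for t
          using v(2)[OF tl(2) that] v(2)[OF l0 that] by (rule has_vector_derivative_diff)
        show "norm (F ((t, l), v l t) - F ((t, l0), v l0 t)) \<le> 1/4 * norm (v l t - v l0 t) + e / 16"
          if "t \<in> ?K" for t
        proof -
          have "norm (F ((t, l), v l0 t) - F ((t, l0), v l0 t)) \<le> e / 16"
            using X(3) lX that by (auto simp: dist_norm)
          moreover have "norm (F ((t, l), v l t) - F ((t, l), v l0 t)) \<le> 1/4 * norm (v l t - v l0 t)"
            by (rule lip[OF that tl(2)])
          ultimately show ?thesis
            using norm_triangle_ineq[of "F ((t, l), v l t) - F ((t, l), v l0 t)" "F ((t, l), v l0 t) - F ((t, l0), v l0 t)"]
            by simp
        qed
        show "norm (v l 0 - v l0 0) \<le> e / 8"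
          using d2(2)[OF tl(2) dl(2)] v(1) tl(2) l0 by (simp add: dist_norm)
      qed (use tl in auto)
      then have "dist (v l t) (v l0 t) \<le> e / 2" by (simp add: dist_norm)
      moreover have "dist (v l0 t) (v l0 t0) < e / 4" using d3(2)[OF tl(1) dt] .
      ultimately show ?thesis using dist_triangle[of "v l t" "v l0 t0" "v l0 t"] e by linarith
    qed
    then show "\<exists>d>0. \<forall>x'\<in>?K \<times> B. dist x' z0 < d \<longrightarrow>
      dist (case x' of (t, l) \<Rightarrow> v l t) (case z0 of (t, l) \<Rightarrow> v l t) < e"
      unfolding z0 using d1 d2 d3 by (intro exI[of _ "min d1 (min d2 d3)"]) auto
  qed
  then show ?thesis using v by (intro exI[of _ "\<lambda>(t, l). v l t"]) auto
qed

text \<open>The bound is uniform over the compact set because \<open>fd F\<close> is uniformly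
  continuous near it, one basis direction at a time. Since \<open>Ck_on\<close> controls only such
  directional derivatives, the operator norm is estimated by a sum over the basis, whence the share
  e / n with n the dimension. It is applied with \<open>Q\<close> the trace of a solution
  curve.\<close>

lemma Ck_on_1_uniform_linearization:
  fixes F :: "'a::euclidean_space \<Rightarrow> 'b::real_normed_vector"
  assumes F: "Ck_on (Suc k) F W" and W: "open W" and Q: "compact Q" "Q \<subseteq> W" and e: "e > 0"
  shows "\<exists>d>0. \<forall>q\<in>Q. \<forall>h::'a. norm h < d \<longrightarrow> norm (F (q + h) - F q - fd F q h) \<le> e * norm h"
proof -
  obtain r where r: "r > 0" "(\<Union>q\<in>Q. cball q r) \<subseteq> W"
    using compact_subset_open_imp_cball_epsilon_subset[OF Q(1) W Q(2)] by blast
  define n where "n = real DIM('a)"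
  have n: "n > 0" by (simp add: n_def)
  have lin: "linear (fd F x)" if "x \<in> W" for x
    using Ck_on_Suc_imp_has_derivative[OF F that] has_derivative_linear by blast
  have inW: "q + h \<in> W" if "q \<in> Q" "norm h \<le> r" for q h :: 'a
    using r(2) that by (force simp: dist_norm)
  have "\<forall>b\<in>Basis. \<forall>\<^sub>F h in nhds 0. \<forall>q\<in>Q. norm (fd F (q + h) b - fd F q b) \<le> e / n"
  proof
    fix b :: 'a assume "b \<in> Basis"
    have "continuous_on W (\<lambda>x. fd F x b)"
      using Ck_on_imp_continuous_on[OF Ck_on_Suc_imp_fd[OF F]] .
    then have c: "continuous_on (cball 0 r \<times> Q) (\<lambda>(h, q). fd F (q + h) b)"
      unfolding split_def by (rule continuous_on_compose2) (auto intro!: continuous_intros inW)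
    obtain X where X: "0 \<in> X" "open X"
      "\<forall>h\<in>X \<inter> cball 0 r. \<forall>q\<in>Q. dist (fd F (q + h) b) (fd F (q + 0) b) \<le> e / n"
      using continuous_on_prod_compactE[OF c Q(1), of 0 "e/n"] e n r(1) by auto
    show "\<forall>\<^sub>F h in nhds 0. \<forall>q\<in>Q. norm (fd F (q + h) b - fd F q b) \<le> e / n"
      unfolding eventually_nhds
      using X r(1) by (intro exI[of _ "X \<inter> ball 0 r"]) (auto simp: dist_norm)
  qed
  then have "\<forall>\<^sub>F h in nhds 0. \<forall>b\<in>Basis. \<forall>q\<in>Q. norm (fd F (q + h) b - fd F q b) \<le> e / n"
    by (intro eventually_ball_finite) auto
  then obtain d0 where d0: "d0 > 0"
    "\<And>h b q. norm h < d0 \<Longrightarrow> b \<in> Basis \<Longrightarrow> q \<in> Q \<Longrightarrow> norm (fd F (q + h) b - fd F q b) \<le> e / n"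
    unfolding eventually_nhds_metric by (auto simp: dist_norm)
  show ?thesis
  proof (intro exI[of _ "min d0 r"] conjI ballI allI impI)
    fix q h :: 'a assume q: "q \<in> Q" and h: "norm h < min d0 r"
    have W': "x \<in> W" if "x \<in> ball q (min d0 r)" for x
      using inW[OF q, of "x - q"] that by (auto simp: dist_norm norm_minus_commute)
    have "norm (F (q + h) - F q - fd F q (q + h - q)) \<le> norm (q + h - q) * e"
    proof (rule differentiable_bound_linearization[where S = "ball q (min d0 r)"])
      show "q + t *\<^sub>R (q + h - q) \<in> ball q (min d0 r)" if "t \<in> {0..1}" for t
      proof -
        have "norm (t *\<^sub>R h) \<le> norm h" using that by (simp add: mult_left_le_one_le)
        then show ?thesis using h by (simp add: dist_norm)
      qed
      show "(F has_derivative fd F x) (at x within ball q (min d0 r))" if "x \<in> ball q (min d0 r)" for x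
        using Ck_on_Suc_imp_has_derivative[OF F W'[OF that]] has_derivative_at_withinI by blast
      show "onorm (fd F x - fd F q) \<le> e" if x: "x \<in> ball q (min d0 r)" for x
      proof (rule onorm_le)
        fix v
        have "linear (\<lambda>v. fd F x v - fd F q v)"
          using lin[OF W'[OF x]] lin[of q] q Q by (intro linear_compose_sub) auto
        then have eqv: "fd F x v - fd F q v = (\<Sum>b\<in>Basis. (v \<bullet> b) *\<^sub>R (fd F x b - fd F q b))"
          by (rule linear_basis_expand)
        have "norm ((fd F x - fd F q) v) \<le> (\<Sum>b\<in>Basis. norm ((v \<bullet> b) *\<^sub>R (fd F x b - fd F q b)))"
          unfolding fun_diff_def eqv by (rule norm_sum)
        also have "\<dots> \<le> (\<Sum>b\<in>(Basis::'a set). norm v * (e / n))"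
        proof (rule sum_mono)
          fix b :: 'a assume b: "b \<in> Basis"
          have "norm (fd F (q + (x - q)) b - fd F q b) \<le> e / n"
            using x by (intro d0(2) b q) (auto simp: dist_norm norm_minus_commute)
          then show "norm ((v \<bullet> b) *\<^sub>R (fd F x b - fd F q b)) \<le> norm v * (e / n)"
            using mult_mono[OF Basis_le_norm[OF b, of v], of "norm (fd F x b - fd F q b)" "e / n"] by simp
        qed
        also have "\<dots> = e * norm v" using n by (simp add: n_def)
        finally show "norm ((fd F x - fd F q) v) \<le> e * norm v" .
      qed
    qed (use d0 r in auto)
    then show "norm (F (q + h) - F q - fd F q h) \<le> e * norm h" by (simp add: mult.commute)
  qed (use d0 r in auto)
qed

text \<open>Difference quotients in the second variable are bounded by \<open>c\<close>, hence so is
  their limit. Thus the linearized equation satisfies the same Lipschitz condition as the original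
  one, and the existence theorem applies to it again.\<close>

lemma has_derivative_Lipschitz_bound:
  fixes F :: "'z::real_normed_vector \<times> 'e::real_normed_vector \<Rightarrow> 'b::real_normed_vector"
  assumes der: "(F has_derivative L) (at (z, p))" and c: "c \<ge> 0"
    and lip: "\<And>x y. norm (F (z, x) - F (z, y)) \<le> c * norm (x - y)"
  shows "norm (L (0, w)) \<le> c * norm w"
proof (rule field_le_epsilon)
  fix e :: real assume e: "e > 0"
  interpret L: bounded_linear L using der has_derivative_bounded_linear by blast
  define e' where "e' = e / (norm w + 1)"
  have e': "e' > 0" using e by (simp add: e'_def add_nonneg_pos)
  obtain d where d: "d > 0"
    "\<And>y. norm (y - (z, p)) < d \<Longrightarrow> norm (F y - F (z, p) - L (y - (z, p))) \<le> e' * norm (y - (z, p))"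
    using der[unfolded has_derivative_at_alt] e' by blast
  define s where "s = d / (2 * (norm w + 1))"
  have nw: "norm w + 1 > 0" by (simp add: add_nonneg_pos)
  then have s: "s > 0" using d by (simp add: s_def)
  have "s * norm w \<le> s * (norm w + 1)" using s by simp
  also have "\<dots> = d / 2" using nw by (simp only: s_def) (simp add: divide_simps)
  also have "\<dots> < d" using d by simp
  finally have sd: "norm ((z, p + s *\<^sub>R w) - (z, p)) < d" using s by (simp add: norm_Pair)
  have "s * norm (L (0, w)) = norm (L (0, s *\<^sub>R w))"
    using L.scaleR[of s "(0, w)"] s by simp
  also have "\<dots> \<le> norm (F (z, p + s *\<^sub>R w) - F (z, p)) + e' * (s * norm w)"
  proof -
    have "norm (F (z, p + s *\<^sub>R w) - F (z, p) - L (0, s *\<^sub>R w)) \<le> e' * (s * norm w)"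
      using d(2)[OF sd] s by (simp add: norm_Pair)
    then show ?thesis
      using norm_triangle_ineq2[of "L (0, s *\<^sub>R w)" "F (z, p + s *\<^sub>R w) - F (z, p)"]
      by (simp add: norm_minus_commute)
  qed
  also have "\<dots> \<le> c * (s * norm w) + e' * (s * norm w)"
    using lip[of "p + s *\<^sub>R w" p] s by simp
  finally have "s * norm (L (0, w)) \<le> s * (c * norm w + e' * norm w)" by (simp add: algebra_simps)
  then have "norm (L (0, w)) \<le> c * norm w + e' * norm w" using s by simp
  also have "e' * norm w \<le> e' * (norm w + 1)" using e' by simp
  also have "\<dots> = e" using nw by (simp add: e'_def)
  finally show "norm (L (0, w)) \<le> c * norm w + e" by simp
qed

lemma continuous_on_compact_Times_bounded:
  fixes f :: "'a::topological_space \<times> 'b::topological_space \<Rightarrow> 'c::real_normed_vector"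
  assumes "continuous_on (K \<times> B) f" "compact K" "l \<in> B"
  shows "\<exists>M\<ge>0. \<forall>t\<in>K. norm (f (t, l)) \<le> M"
proof -
  have "continuous_on K (\<lambda>t. f (t, l))"
    by (rule continuous_on_compose2[OF assms(1)]) (use assms(3) in \<open>auto intro!: continuous_intros\<close>)
  then have "bounded ((\<lambda>t. f (t, l)) ` K)"
    using assms(2) compact_continuous_image compact_imp_bounded by blast
  then obtain M where "M > 0" "\<forall>y\<in>(\<lambda>t. f (t, l)) ` K. norm y \<le> M"
    unfolding bounded_pos by blast
  then show ?thesis by (intro exI[of _ M]) auto
qed

text \<open>The derivative of the solution in a parameter direction solves the linearized equation, which
  is again of the form considered here, on the same parameter and state spaces. So the order of
  differentiability can be raised by induction.\<close>

lemma ODE_solution_Ck: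
  fixes F :: "(real \<times> 'l::euclidean_space) \<times> 'e::euclidean_space \<Rightarrow> 'e"
  assumes B: "open B" and r: "0 < r" "r \<le> 2" and W: "open W" and F: "Ck_on k F W"
    and uW: "\<And>t l. \<bar>t\<bar> < r \<Longrightarrow> l \<in> B \<Longrightarrow> ((t, l), u (t, l)) \<in> W"
    and sol: "\<And>t l. \<bar>t\<bar> < r \<Longrightarrow> l \<in> B \<Longrightarrow>
      ((\<lambda>t. u (t, l)) has_vector_derivative F ((t, l), u (t, l))) (at t)"
    and lip: "\<And>t l x y. \<bar>t\<bar> < r \<Longrightarrow> l \<in> B \<Longrightarrow> norm (F ((t, l), x) - F ((t, l), y)) \<le> 1/4 * norm (x - y)"
    and cont: "continuous_on ({-r<..<r} \<times> B) u"
    and init: "Ck_on k (\<lambda>l. u (0, l)) B"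
  shows "Ck_on k u ({-r<..<r} \<times> B)"
  using r W F uW sol lip cont init
proof (induction k arbitrary: F u W r)
  case 0
  then show ?case by simp
next
  case (Suc k)
  note r = Suc.prems(1,2) and W = Suc.prems(3) and F = Suc.prems(4) and uW = Suc.prems(5)
    and sol = Suc.prems(6) and lip = Suc.prems(7) and cont = Suc.prems(8) and init = Suc.prems(9)
  let ?D = "\<lambda>s. {-s<..<s} \<times> B"
  have openD: "open (?D s)" for s :: real by (intro open_Times B) auto
  have uk: "Ck_on k u (?D r)"
    by (rule Suc.IH[OF r W Ck_on_Suc_imp[OF F] uW sol lip cont Ck_on_Suc_imp[OF init]])
  have derF: "(F has_derivative fd F q) (at q)" if "q \<in> W" for q
    using Ck_on_Suc_imp_has_derivative[OF F that] .
  have linF: "linear (fd F q)" if "q \<in> W" for q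
    using derF[OF that] has_derivative_linear by blast
  define P where "P z = (z, u z)" for z
  have PW: "P (t, l) \<in> W" if "\<bar>t\<bar> < r" "l \<in> B" for t l using uW[OF that] by (simp add: P_def)
  have PW': "P ` ?D r \<subseteq> W" using PW by auto
  have Pk: "Ck_on k P (?D r)"
    unfolding P_def by (intro Ck_on_Pair openD uk Ck_on_bounded_linear bounded_linear_ident)
  have fdP: "Ck_on k (\<lambda>z. fd F (P z) c) (?D r)" for c
    by (rule Ck_on_compose[OF openD W PW' Ck_on_Suc_imp_fd[OF F] Pk])
  \<comment> \<open>The linearized equation along \<open>u\<close> for the derivative in the
    parameter direction \<open>v\<close>. The time slot is 0 since time is not varied. The
    coefficient field is only of class C^k: one order is lost in \<open>fd F\<close>, and
    \<open>u\<close> itself is known to be C^k from the induction hypothesis.\<close>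
  define G where "G v q = fd F (P (fst q)) ((0, v), snd q)" for v q
  have lin_split: "fd F q ((0, v), w) = fd F q ((0, v), 0) + (\<Sum>b\<in>Basis. (w \<bullet> b) *\<^sub>R fd F q ((0, 0), b))"
    if "q \<in> W" for q v w
  proof -
    have "linear (\<lambda>w. fd F q ((0, 0), w))"
      using linear_compose[OF _ linF[OF that], of "\<lambda>w. ((0, 0), w)"]
      by (simp add: comp_def linear_iff)
    then have "fd F q ((0, 0), w) = (\<Sum>b\<in>Basis. (w \<bullet> b) *\<^sub>R fd F q ((0, 0), b))"
      by (rule linear_basis_expand)
    moreover have "fd F q ((0, v), w) = fd F q ((0, v), 0) + fd F q ((0, 0), w)"
      using linear_add[OF linF[OF that], of "((0, v), 0)" "((0, 0), w)"] by simp
    ultimately show ?thesis by simp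
  qed
  have Gk: "Ck_on k (G v) (?D r \<times> UNIV)" for v
  proof -
    have op: "open (?D r \<times> (UNIV :: 'e set))" by (intro open_Times openD) auto
    have c: "Ck_on k (\<lambda>q. fd F (P (fst q)) c) (?D r \<times> (UNIV :: 'e set))" for c
      by (rule Ck_on_compose[OF op openD _ fdP]) (auto intro!: Ck_on_bounded_linear bounded_linear_fst)
    have "Ck_on k (\<lambda>q. fd F (P (fst q)) ((0, v), 0)
        + (\<Sum>b\<in>Basis. (snd q \<bullet> b) *\<^sub>R fd F (P (fst q)) ((0, 0), b))) (?D r \<times> UNIV)"
      by (intro Ck_on_add[OF op] Ck_on_sum[OF op] Ck_on_scaleR[OF op] Ck_on_inner[OF op] Ck_on_const c
          Ck_on_bounded_linear bounded_linear_snd)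
    then show ?thesis
      unfolding G_def
    proof (rule Ck_on_cong[OF op, THEN iffD1, rotated])
      fix q assume "q \<in> ?D r \<times> (UNIV :: 'e set)"
      then have "P (fst q) \<in> W" using PW by auto
      from lin_split[OF this, of v "snd q"]
      show "fd F (P (fst q)) ((0, v), 0) + (\<Sum>b\<in>Basis. (snd q \<bullet> b) *\<^sub>R fd F (P (fst q)) ((0, 0), b))
        = fd F (P (fst q)) ((0, v), snd q)" by simp
    qed
  qed
  have Glip: "norm (G v ((t, l), x) - G v ((t, l), y)) \<le> 1/4 * norm (x - y)"
    if "\<bar>t\<bar> < r" "l \<in> B" for v t l x y
  proof -
    have "G v ((t, l), x) - G v ((t, l), y) = fd F (P (t, l)) (0, x - y)"
      using linear_diff[OF linF[OF PW[OF that]], of "((0, v), x)" "((0, v), y)"]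
      by (simp add: G_def)
    also have "norm \<dots> \<le> 1/4 * norm (x - y)"
      unfolding P_def
      by (rule has_derivative_Lipschitz_bound[OF derF[OF PW[OF that], unfolded P_def] _ lip[OF that]]) simp
    finally show ?thesis .
  qed
  have initd: "((\<lambda>l. u (0, l)) has_derivative fd (\<lambda>l. u (0, l)) l) (at l)" if "l \<in> B" for l
    using Ck_on_Suc_imp_has_derivative[OF init that] .
  \<comment> \<open>Restriction to a smaller closed interval [-s, s] provides the compact set of
    times that both the construction of \<open>w\<close> and the uniform linearization rely
    on.\<close>
  have main: "Ck_on (Suc k) u (?D s)" if s: "0 < s" "s < r" for s
  proof -
    let ?K = "{-s..s}"
    have Kr: "\<bar>t\<bar> < r" if "t \<in> ?K" for t using that s by auto
    have "\<exists>w. continuous_on (?K \<times> B) w \<and> (\<forall>l\<in>B. w (0, l) = fd (\<lambda>l. u (0, l)) l v \<and>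
      (\<forall>t\<in>?K. ((\<lambda>t. w (t, l)) has_vector_derivative G v ((t, l), w (t, l))) (at t within ?K)))" for v
    proof (rule ODE_exists_continuous)
      show "continuous_on ((?K \<times> B) \<times> UNIV) (G v)"
        by (rule continuous_on_subset[OF Ck_on_imp_continuous_on[OF Gk]]) (use s in auto)
      show "continuous_on B (\<lambda>l. fd (\<lambda>l. u (0, l)) l v)"
        using Ck_on_imp_continuous_on[OF Ck_on_Suc_imp_fd[OF init]] .
      show "norm (G v ((t, l), x) - G v ((t, l), y)) \<le> 1/4 * norm (x - y)"
        if "t \<in> ?K" "l \<in> B" for t l x y
        using Glip Kr that by blast
    qed (use s r in auto)
    then obtain w where wall: "\<And>v. continuous_on (?K \<times> B) (w v) \<and> (\<forall>l\<in>B. w v (0, l) = fd (\<lambda>l. u (0, l)) l v \<and>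
      (\<forall>t\<in>?K. ((\<lambda>t. w v (t, l)) has_vector_derivative G v ((t, l), w v (t, l))) (at t within ?K)))"
      by metis
    have wc: "\<And>v. continuous_on (?K \<times> B) (w v)"
      and w0: "\<And>v l. l \<in> B \<Longrightarrow> w v (0, l) = fd (\<lambda>l. u (0, l)) l v"
      and w: "\<And>v l t. l \<in> B \<Longrightarrow> t \<in> ?K \<Longrightarrow>
        ((\<lambda>t. w v (t, l)) has_vector_derivative G v ((t, l), w v (t, l))) (at t within ?K)"
      using wall by blast+
    have wk: "Ck_on k (w v) (?D s)" for v
    proof (rule Suc.IH)
      show "open ((?D r) \<times> (UNIV :: 'e set))" by (intro open_Times openD) auto
      show "Ck_on k (G v) (?D r \<times> UNIV)" by (rule Gk)
      show "((\<lambda>t. w v (t, l)) has_vector_derivative G v ((t, l), w v (t, l))) (at t)"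
        if "\<bar>t\<bar> < s" "l \<in> B" for t l
      proof -
        have "at t within ?K = at t" using that(1) by (intro at_within_interior) auto
        then show ?thesis using w[OF that(2), of t v] that(1) by (simp add: abs_less_iff)
      qed
      show "continuous_on (?D s) (w v)" by (rule continuous_on_subset[OF wc]) auto
      have "Ck_on k (\<lambda>l. fd (\<lambda>l. u (0, l)) l v) B" using init by simp
      then show "Ck_on k (\<lambda>l. w v (0, l)) B"
        by (rule Ck_on_cong[OF B, THEN iffD1, rotated]) (simp add: w0)
      show "norm (G v ((t, l), x) - G v ((t, l), y)) \<le> 1/4 * norm (x - y)"
        if "\<bar>t\<bar> < s" "l \<in> B" for t l x y
        by (rule Glip) (use that s in auto)
    qed (use s r in auto)
    \<comment> \<open>The solutions \<open>w v\<close> were chosen separately for each direction, so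
      nothing is known about linearity in \<open>v\<close>. The candidate for the parameter
      derivative is therefore assembled from the basis directions; linearity of the equation makes
      it a solution for every \<open>h\<close>.\<close>
    define wh where "wh z h = (\<Sum>b\<in>Basis. (h \<bullet> b) *\<^sub>R w b z)" for z h
    have wh_lin: "bounded_linear (wh z)" for z
      unfolding wh_def by (intro bounded_linear_sum bounded_linear_scaleR_const bounded_linear_inner_left)
    have whB: "wh z b = w b z" if "b \<in> Basis" for z b
    proof -
      have "wh z b = (\<Sum>b'\<in>Basis. if b = b' then w b z else 0)"
        unfolding wh_def by (intro sum.cong) (auto simp: inner_Basis that)
      then show ?thesis using that by simp
    qed
    have wh0: "wh (0, l) h = fd (\<lambda>l. u (0, l)) l h" if "l \<in> B" for l h
      using linear_basis_expand[of "fd (\<lambda>l. u (0, l)) l" h] has_derivative_linear[OF initd[OF that]]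
      by (simp add: wh_def w0 that)
    have wh': "((\<lambda>t. wh (t, l) h) has_vector_derivative fd F (P (t, l)) ((0, h), wh (t, l) h)) (at t within ?K)"
      if "l \<in> B" "t \<in> ?K" for l t h
    proof -
      have "linear (\<lambda>h. fd F (P (t, l)) ((0, h), wh (t, l) h))"
        using linear_compose[OF _ linF[OF PW[OF Kr[OF that(2)] that(1)]], of "\<lambda>h. ((0, h), wh (t, l) h)"]
          bounded_linear.linear[OF wh_lin[of "(t, l)"]]
        by (simp add: comp_def linear_iff)
      from linear_basis_expand[OF this, of h]
      have "fd F (P (t, l)) ((0, h), wh (t, l) h) = (\<Sum>b\<in>Basis. (h \<bullet> b) *\<^sub>R G b ((t, l), w b (t, l)))"
        by (simp add: G_def whB)
      moreover have "((\<lambda>t. wh (t, l) h) has_vector_derivative (\<Sum>b\<in>Basis. (h \<bullet> b) *\<^sub>R G b ((t, l), w b (t, l)))) (at t within ?K)"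
        unfolding wh_def using w[OF that]
        by (intro has_vector_derivative_sum bounded_linear.has_vector_derivative[OF bounded_linear_scaleR_right])
      ultimately show ?thesis by simp
    qed
    have param: "((\<lambda>l. u (t, l)) has_derivative wh (t, l)) (at l)" if t: "t \<in> ?K" and l: "l \<in> B" for t l
      unfolding has_derivative_at_alt
    proof (intro conjI allI impI wh_lin)
      fix e :: real assume e: "e > 0"
      have "\<exists>M\<ge>0. \<forall>t\<in>?K. norm (w b (t, l)) \<le> M" for b
        by (rule continuous_on_compact_Times_bounded[OF wc _ l]) auto
      then obtain M where "\<And>b. M b \<ge> 0 \<and> (\<forall>t\<in>?K. norm (w b (t, l)) \<le> M b)" by metis
      then have M: "\<And>b. M b \<ge> 0" "\<And>b t. t \<in> ?K \<Longrightarrow> norm (w b (t, l)) \<le> M b" by blast+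
      define C where "C = 1 + (\<Sum>b\<in>Basis. M b)"
      have C: "C \<ge> 1" using M(1) by (simp add: C_def sum_nonneg)
      have C': "norm ((0::real, h), wh (t, l) h) \<le> C * norm h" if "t \<in> ?K" for t and h :: 'l
      proof -
        have "norm (wh (t, l) h) \<le> (\<Sum>b\<in>Basis. norm ((h \<bullet> b) *\<^sub>R w b (t, l)))"
          unfolding wh_def by (rule norm_sum)
        also have "\<dots> \<le> (\<Sum>b\<in>Basis. norm h * M b)"
          using M(2)[OF that] Basis_le_norm by (intro sum_mono) (auto intro!: mult_mono)
        also have "\<dots> = norm h * (\<Sum>b\<in>Basis. M b)" by (simp add: sum_distrib_left)
        finally have "norm h + norm (wh (t, l) h) \<le> C * norm h" by (simp add: C_def algebra_simps)
        moreover have "norm ((0::real, h), wh (t, l) h) \<le> norm (0::real, h) + norm (wh (t, l) h)"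
          by (rule norm_Pair_le)
        ultimately show ?thesis by (simp add: norm_Pair)
      qed
      \<comment> \<open>The remainder u (t, m) - u (t, l) - wh (t, l) h starts with norm at most e1
        |h| and satisfies the differential inequality with constant term e1 C |h|. So
        \<open>small_growth_bound\<close> yields (2 e1 + 4 e1 C) |h|, and \<open>e1\<close> is
        chosen to make this e |h|.\<close>
      define e1 where "e1 = e / (2 + 4 * C)"
      have e1: "e1 > 0" "2 * e1 + 4 * e1 * C = e" using e C by (auto simp: e1_def) (simp add: divide_simps, simp add: algebra_simps)
      let ?Q = "(\<lambda>t. P (t, l)) ` ?K"
      have "continuous_on ?K (\<lambda>t. P (t, l))"
        by (rule continuous_on_compose2[OF Ck_on_imp_continuous_on[OF Pk]]) (use l s in \<open>auto intro!: continuous_intros\<close>)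
      then have Q: "compact ?Q" "?Q \<subseteq> W" using l Kr PW by (auto intro!: compact_continuous_image)
      obtain d1 where d1: "d1 > 0"
        "\<And>t \<delta>. t \<in> ?K \<Longrightarrow> norm \<delta> < d1 \<Longrightarrow> norm (F (P (t, l) + \<delta>) - F (P (t, l)) - fd F (P (t, l)) \<delta>) \<le> e1 * norm \<delta>"
        using Ck_on_1_uniform_linearization[OF F W Q e1(1)] by blast
      obtain d2 where d2: "d2 > 0" "\<And>m. norm (m - l) < d2 \<Longrightarrow>
          norm (u (0, m) - u (0, l) - fd (\<lambda>l. u (0, l)) l (m - l)) \<le> e1 * norm (m - l)"
        using initd[OF l, unfolded has_derivative_at_alt] e1 by blast
      obtain d3 where d3: "d3 > 0" "ball l d3 \<subseteq> B" using B l open_contains_ball by blast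
      have "norm (u (t, m) - u (t, l) - wh (t, l) (m - l)) \<le> e * norm (m - l)"
        if m: "norm (m - l) < min (d1 / C) (min d2 d3)" for m
      proof -
        define h where "h = m - l"
        have hC: "C * norm h < d1" using m C by (simp add: h_def field_simps)
        have mB: "m \<in> B" using m d3(2) by (auto simp: subset_iff dist_norm norm_minus_commute)
        have "norm (u (t, m) - u (t, l) - wh (t, l) h) \<le> 2 * (e1 * norm h) + 4 * (e1 * (C * norm h))"
        proof (rule small_growth_bound[where s = s and a = "\<lambda>t. u (t, m) - u (t, l) - wh (t, l) h"])
          fix t assume t: "t \<in> ?K"
          note tr = Kr[OF t]
          show "((\<lambda>t. u (t, m) - u (t, l) - wh (t, l) h) has_vector_derivative
              (F ((t, m), u (t, m)) - F ((t, l), u (t, l)) - fd F (P (t, l)) ((0, h), wh (t, l) h))) (at t within ?K)"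
            by (intro has_vector_derivative_diff wh'[OF l t] has_vector_derivative_at_within[OF sol] tr l mB)
          have 1: "norm (F ((t, m), u (t, m)) - F ((t, m), u (t, l) + wh (t, l) h))
              \<le> 1/4 * norm (u (t, m) - u (t, l) - wh (t, l) h)"
            using lip[OF tr mB, of "u (t, m)" "u (t, l) + wh (t, l) h"] by (simp add: diff_diff_eq)
          have "norm (F (P (t, l) + ((0, h), wh (t, l) h)) - F (P (t, l)) - fd F (P (t, l)) ((0, h), wh (t, l) h))
              \<le> e1 * norm ((0::real, h), wh (t, l) h)"
            using C'[OF t, of h] hC by (intro d1(2)[OF t]) simp
          also have "\<dots> \<le> e1 * (C * norm h)" using C'[OF t] e1 by simp
          finally have 2: "norm (F ((t, m), u (t, l) + wh (t, l) h) - F ((t, l), u (t, l))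
              - fd F (P (t, l)) ((0, h), wh (t, l) h)) \<le> e1 * (C * norm h)"
            by (simp add: P_def h_def)
          show "norm (F ((t, m), u (t, m)) - F ((t, l), u (t, l)) - fd F (P (t, l)) ((0, h), wh (t, l) h))
              \<le> 1/4 * norm (u (t, m) - u (t, l) - wh (t, l) h) + e1 * (C * norm h)"
            using norm_triangle_mono[OF 1 2] by (simp add: diff_add_eq diff_diff_eq2 algebra_simps)
        next
          show "norm (u (0, m) - u (0, l) - wh (0, l) h) \<le> e1 * norm h"
            using d2(2)[of m] m by (simp add: wh0 l h_def)
        qed (use s r t in auto)
        also have "\<dots> = (2 * e1 + 4 * e1 * C) * norm h" by (simp add: algebra_simps)
        finally show ?thesis by (simp add: e1(2) h_def)
      qed
      then show "\<exists>d>0. \<forall>m. norm (m - l) < d \<longrightarrow> norm (u (t, m) - u (t, l) - wh (t, l) (m - l)) \<le> e * norm (m - l)"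
        using d1(1) d2(1) d3(1) C by (intro exI[of _ "min (d1 / C) (min d2 d3)"]) auto
    qed
    show ?thesis
    proof (rule Ck_on_SucI[OF openD])
      fix z assume z: "z \<in> ?D s"
      then obtain t l where tl: "z = (t, l)" "t \<in> {-s<..<s}" "l \<in> B" by auto
      let ?I = "{-s<..<s}"
      \<comment> \<open>The total derivative comes from the partial ones, by a rule that asks for
        continuity of the partial derivative in the second variable. Time is put second, as the time
        derivative F (P z) is visibly continuous.\<close>
      have "((\<lambda>(l, t). u (t, l)) has_derivative (\<lambda>(h, \<tau>). wh (t, l) h + blinfun_scaleR_left (F (P (t, l))) \<tau>))
          (at (l, t) within B \<times> ?I)"
      proof (rule has_derivative_partialsI[where fy = "\<lambda>l t. blinfun_scaleR_left (F (P (t, l)))"])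
        show "((\<lambda>l. u (t, l)) has_derivative wh (t, l)) (at l within B)"
          using param[of t l] tl has_derivative_at_withinI by auto
        show "((\<lambda>t. u (t, l)) has_derivative blinfun_apply (blinfun_scaleR_left (F (P (t, l))))) (at t within ?I)"
          if "l \<in> B" "t \<in> ?I" for l t
        proof (rule has_derivative_at_withinI)
          have "\<bar>t\<bar> < r" using that s by auto
          from sol[OF this that(1)]
          show "((\<lambda>t. u (t, l)) has_derivative blinfun_apply (blinfun_scaleR_left (F (P (t, l))))) (at t)"
            by (simp add: has_vector_derivative_def P_def)
        qed
        have "continuous_on (?D r) (\<lambda>z. F (P z))"
          using Ck_on_imp_continuous_on[OF F] Ck_on_imp_continuous_on[OF Pk] PW'
          by (rule continuous_on_compose2)
        then have "continuous_on (B \<times> ?I) (\<lambda>p. F (P (snd p, fst p)))"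
          by (rule continuous_on_compose2) (use s in \<open>auto intro!: continuous_intros\<close>)
        then have "continuous_on (B \<times> ?I) (\<lambda>p. blinfun_scaleR_left (F (P (snd p, fst p))))"
          by (rule bounded_linear.continuous_on[OF bounded_linear_blinfun_scaleR_left])
        then show "continuous (at (l, t) within B \<times> ?I) (\<lambda>(l, t). blinfun_scaleR_left (F (P (t, l))))"
          using tl by (simp add: continuous_on_eq_continuous_within split_def)
      qed (use tl in auto)
      then have "((\<lambda>(l, t). u (t, l)) has_derivative (\<lambda>(h, \<tau>). wh (t, l) h + \<tau> *\<^sub>R F (P (t, l)))) (at (snd z, fst z))"
        using at_within_open[of "(l, t)" "B \<times> ?I"] tl B by (simp add: open_Times)
      then have "((\<lambda>y. (case (snd y, fst y) of (l, t) \<Rightarrow> u (t, l))) has_derivative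
          (\<lambda>y. (case (snd y, fst y) of (h, \<tau>) \<Rightarrow> wh (t, l) h + \<tau> *\<^sub>R F (P (t, l))))) (at z)"
        by (rule has_derivative_compose[rotated]) (auto intro!: derivative_eq_intros)
      then show "(u has_derivative (\<lambda>y. wh z (snd y) + fst y *\<^sub>R F (P z))) (at z)"
        by (simp add: tl)
    next
      fix v
      have sub: "?D s \<subseteq> ?D r" using s by auto
      have "Ck_on k (\<lambda>z. F (P z)) (?D r)"
        by (rule Ck_on_compose[OF openD W PW' Ck_on_Suc_imp[OF F] Pk])
      then show "Ck_on k (\<lambda>z. wh z (snd v) + fst v *\<^sub>R F (P z)) (?D s)"
        unfolding wh_def
        by (intro Ck_on_add[OF openD] Ck_on_sum[OF openD] Ck_on_scaleR[OF openD] Ck_on_const wk Ck_on_subset[OF _ sub])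
    qed
  qed
  show ?case
  proof (rule Ck_on_local)
    fix z assume "z \<in> ?D r"
    then obtain t l where z: "z = (t, l)" "\<bar>t\<bar> < r" "l \<in> B" by auto
    let ?s = "(\<bar>t\<bar> + r) / 2"
    have "Ck_on (Suc k) u (?D ?s)" using z by (intro main) auto
    moreover have "\<bar>t\<bar> < ?s" using z(2) by simp
    then have "- ?s < t \<and> t < ?s" by (meson abs_less_iff minus_less_iff)
    then have "z \<in> ?D ?s" using z by simp
    ultimately show "\<exists>T. open T \<and> z \<in> T \<and> Ck_on (Suc k) u T" using openD by blast
  qed
qed

section \<open>The inverse function theorem and straightening of commuting fields\<close>

lemma Ck_on_det:
  fixes A :: "'a::euclidean_space \<Rightarrow> real ^ 'n ^ 'n"
  assumes "open S" "\<And>i j. Ck_on k (\<lambda>x. A x $ i $ j) S"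
  shows "Ck_on k (\<lambda>x. det (A x)) S"
  unfolding det_def
  by (intro Ck_on_sum[OF assms(1)] Ck_on_mult[OF assms(1)] Ck_on_prod[OF assms(1)] Ck_on_const assms(2))

lemma Ck_on_inverse_compose:
  fixes f :: "'a::euclidean_space \<Rightarrow> real"
  assumes "open S" "Ck_on k f S" "\<And>x. x \<in> S \<Longrightarrow> f x \<noteq> 0"
  shows "Ck_on k (\<lambda>x. inverse (f x)) S"
  by (rule Ck_on_compose[OF assms(1), of "- {0}" f k inverse])
     (use assms smooth_on_inverse in \<open>auto simp: smooth_on_def\<close>)

text \<open>Cramer's rule writes the inverse as a rational function of the matrix entries, so it is
  as differentiable as they are.\<close>

lemma inv_linear_cramer:
  fixes L :: "real ^ 'n \<Rightarrow> real ^ 'n"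
  assumes "linear L" "bij L"
  shows "det (matrix L) \<noteq> 0"
    and "inv L v = (\<chi> k. det (\<chi> i j. if j = k then v $ i else matrix L $ i $ j) / det (matrix L))"
proof -
  have mv: "matrix L *v x = L x" for x by (simp add: matrix_works assms(1))
  show d: "det (matrix L) \<noteq> 0"
    using assms invertible_det_nz[of "matrix L"] invertible_eq_bij[of "matrix L"] mv
    by (simp add: bij_def inj_def surj_def)
  have "matrix L *v inv L v = v" using mv assms(2) by (simp add: bij_is_surj surj_f_inv_f)
  then show "inv L v = (\<chi> k. det (\<chi> i j. if j = k then v $ i else matrix L $ i $ j) / det (matrix L))"
    using cramer[OF d] by blast
qed

text \<open>The C^1 theorem provides \<open>g\<close> with derivative
  \<open>inv (fd f (g y))\<close>. By Cramer's rule this expression is as smooth as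
  \<open>g\<close>, so C^k for \<open>g\<close> implies C^(k+1), and induction gives
  smoothness.\<close>

lemma smooth_inverse_function:
  fixes f :: "real ^ 'n \<Rightarrow> real ^ 'n"
  assumes S: "open S" "smooth_on S f" "x0 \<in> S" and inj: "inj (fd f x0)"
  obtains U g where "open U" "x0 \<in> U" "U \<subseteq> S" "open (f ` U)" "inj_on f U" "smooth_on (f ` U) g"
    "\<And>x. x \<in> U \<Longrightarrow> g (f x) = x" "\<And>x v. x \<in> U \<Longrightarrow> fd g (f x) (fd f x v) = v"
    "\<And>x v. x \<in> U \<Longrightarrow> fd f x (fd g (f x) v) = v"
proof -
  define f' where "f' x = Blinfun (fd f x)" for x
  have der: "(f has_derivative fd f x) (at x)" if "x \<in> S" for x
    using smooth_on_imp_has_derivative[OF S(2) that] .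
  have f': "blinfun_apply (f' x) = fd f x" if "x \<in> S" for x
    unfolding f'_def using has_derivative_bounded_linear[OF der[OF that]] by (rule bounded_linear_Blinfun_apply)
  have contf': "continuous_on S f'"
  proof (rule continuous_on_blinfun_componentwise)
    fix i :: "real ^ 'n"
    have "continuous_on S (\<lambda>x. fd f x i)" using smooth_on_imp_continuous_on smooth_on_fd S by blast
    then show "continuous_on S (\<lambda>x. blinfun_apply (f' x) i)"
      by (rule continuous_on_eq) (simp add: f')
  qed
  have lin0: "linear (fd f x0)" using has_derivative_linear[OF der[OF S(3)]] .
  obtain h where h: "linear h" "h \<circ> fd f x0 = id"
    using linear_injective_left_inverse[OF lin0 inj] by blast
  have "blinfun_apply (Blinfun h) = h"
    using h(1) by (simp add: bounded_linear_Blinfun_apply linear_conv_bounded_linear)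
  then have invf: "Blinfun h o\<^sub>L f' x0 = id_blinfun"
    using h(2) f'[OF S(3)] by (intro blinfun_eqI) (auto simp: fun_eq_iff)
  have derf': "(f has_derivative blinfun_apply (f' x)) (at x)" if "x \<in> S" for x
    using der[OF that] f'[OF that] by simp
  obtain U V g g' where U: "open U" "U \<subseteq> S" "x0 \<in> U" and V: "open V" and hom: "homeomorphism U V f g"
    and g': "\<And>y. y \<in> V \<Longrightarrow> (g has_derivative (g' y)) (at y)"
      "\<And>y. y \<in> V \<Longrightarrow> g' y = inv (blinfun_apply (f' (g y)))"
    and bij: "\<And>y. y \<in> V \<Longrightarrow> bij (blinfun_apply (f' (g y)))"
    using inverse_function_theorem[OF S(1) derf' contf' S(3) invf] by metis
  have fU: "f ` U = V" and gf: "\<And>x. x \<in> U \<Longrightarrow> g (f x) = x" and gV: "g ` V = U"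
    using hom by (auto simp: homeomorphism_def)
  have gS: "g y \<in> S" if "y \<in> V" for y using gV U that by blast
  have bij': "bij (fd f (g y))" if "y \<in> V" for y using bij[OF that] f'[OF gS[OF that]] by simp
  have gder: "(g has_derivative inv (fd f (g y))) (at y)" if "y \<in> V" for y
    using g'[OF that] f'[OF gS[OF that]] by simp
  have "Ck_on k g V" for k
  proof (induction k)
    case 0
    then show ?case using hom by (simp add: homeomorphism_def)
  next
    case (Suc k)
    show ?case
    proof (rule Ck_on_SucI[OF V gder])
      fix v
      let ?L = "\<lambda>y. fd f (g y)"
      have lin: "linear (?L y)" if "y \<in> V" for y using has_derivative_linear[OF der[OF gS[OF that]]] .
      have m: "Ck_on k (\<lambda>y. matrix (?L y) $ i $ j) V" for i j
      proof -
        have "Ck_on k (\<lambda>y. ?L y (axis j 1)) V"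
        proof (rule Ck_on_compose[OF V S(1) _ _ Suc])
          show "Ck_on k (\<lambda>x. fd f x (axis j 1)) S" using smooth_on_fd[OF S(2)] by (simp add: smooth_on_def)
        qed (use gS in auto)
        from Ck_on_nth[OF V this] show ?thesis by (simp add: matrix_def)
      qed
      have "Ck_on k (\<lambda>y. \<chi> l. det (\<chi> i j. if j = l then v $ i else matrix (?L y) $ i $ j) / det (matrix (?L y))) V"
      proof (rule Ck_on_vec[OF V])
        fix l
        have "Ck_on k (\<lambda>y. det (\<chi> i j. if j = l then v $ i else matrix (?L y) $ i $ j)
            * inverse (det (matrix (?L y)))) V"
        proof (intro Ck_on_mult[OF V] Ck_on_inverse_compose[OF V] Ck_on_det[OF V] m)
          show "Ck_on k (\<lambda>y. (\<chi> i j. if j = l then v $ i else matrix (?L y) $ i $ j) $ i $ j) V" for i j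
            using m by (cases "j = l") auto
          show "det (matrix (?L y)) \<noteq> 0" if "y \<in> V" for y
            using inv_linear_cramer(1)[OF lin[OF that] bij'[OF that]] .
        qed
        then show "Ck_on k (\<lambda>y. (\<chi> l. det (\<chi> i j. if j = l then v $ i else matrix (?L y) $ i $ j) / det (matrix (?L y))) $ l) V"
          by (simp add: divide_inverse)
      qed
      then show "Ck_on k (\<lambda>y. inv (?L y) v) V"
        by (rule Ck_on_cong[OF V, THEN iffD1, rotated]) (rule inv_linear_cramer(2)[OF lin bij', symmetric])
    qed
  qed
  then have gs: "smooth_on (f ` U) g" using fU by (simp add: smooth_on_def)
  have fdg: "fd g (f x) = inv (fd f x)" "bij (fd f x)" if "x \<in> U" for x
    using fd_eqI[OF gder[of "f x"]] bij'[of "f x"] fU gf[OF that] that by auto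
  have 1: "fd g (f x) (fd f x v) = v" "fd f x (fd g (f x) v) = v" if "x \<in> U" for x v
    using fdg[OF that] by (simp_all add: bij_is_inj bij_is_surj surj_f_inv_f)
  have "inj_on f U" using gf by (metis inj_onI)
  then show ?thesis using that[of U g] U V fU gs gf 1 by blast
qed

lemma smooth_on_imp_Lipschitz:
  fixes f :: "'a::euclidean_space \<Rightarrow> 'b::real_normed_vector"
  assumes f: "smooth_on S f" and K: "compact K" "convex K" "K \<subseteq> S"
  obtains L where "L > 0" "\<And>x. x \<in> K \<Longrightarrow> norm (f x) \<le> L"
    "\<And>x y. x \<in> K \<Longrightarrow> y \<in> K \<Longrightarrow> norm (f x - f y) \<le> L * norm (x - y)"
proof -
  have bdd: "\<exists>M\<ge>0. \<forall>x\<in>K. norm (h x) \<le> M" if "smooth_on S h" for h :: "'a \<Rightarrow> 'b"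
  proof -
    have "compact (h ` K)"
      using smooth_on_imp_continuous_on[OF that] K continuous_on_subset compact_continuous_image by blast
    then obtain M where "M > 0" "\<forall>y\<in>h ` K. norm y \<le> M" using compact_imp_bounded bounded_pos by blast
    then show ?thesis by (intro exI[of _ M]) auto
  qed
  obtain M0 where M0: "M0 \<ge> 0" "\<And>x. x \<in> K \<Longrightarrow> norm (f x) \<le> M0" using bdd[OF f] by blast
  have "\<exists>M\<ge>0. \<forall>x\<in>K. norm (fd f x b) \<le> M" for b using bdd[OF smooth_on_fd[OF f]] .
  then obtain M where "\<And>b. M b \<ge> 0 \<and> (\<forall>x\<in>K. norm (fd f x b) \<le> M b)" by metis
  then have M: "\<And>b. M b \<ge> 0" "\<And>b x. x \<in> K \<Longrightarrow> norm (fd f x b) \<le> M b" by blast+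
  define L where "L = 1 + M0 + (\<Sum>b\<in>Basis. M b)"
  have sM: "(\<Sum>b\<in>Basis. M b) \<ge> 0" using M(1) by (simp add: sum_nonneg)
  have on: "onorm (fd f x) \<le> L" if x: "x \<in> K" for x
  proof (rule onorm_le)
    fix v
    have "linear (fd f x)" using smooth_on_imp_linear_fd[OF f] x K by blast
    from linear_basis_expand[OF this, of v]
    have "norm (fd f x v) \<le> (\<Sum>b\<in>Basis. norm ((v \<bullet> b) *\<^sub>R fd f x b))" by (simp only: norm_sum)
    also have "\<dots> \<le> (\<Sum>b\<in>Basis. norm v * M b)"
      using M(2)[OF x] Basis_le_norm by (intro sum_mono) (auto intro!: mult_mono)
    also have "\<dots> = (\<Sum>b\<in>Basis. M b) * norm v" by (simp add: sum_distrib_left mult.commute)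
    also have "\<dots> \<le> L * norm v" using M0(1) by (intro mult_right_mono) (auto simp: L_def)
    finally show "norm (fd f x v) \<le> L * norm v" .
  qed
  show ?thesis
  proof
    show "L > 0" using M0(1) sM by (simp add: L_def)
    show "norm (f x) \<le> L" if "x \<in> K" for x using M0(2)[OF that] sM by (simp add: L_def)
    show "norm (f x - f y) \<le> L * norm (x - y)" if "x \<in> K" "y \<in> K" for x y
    proof (rule differentiable_bound[OF K(2) _ on that])
      show "(f has_derivative fd f x) (at x within K)" if "x \<in> K" for x
        using smooth_on_imp_has_derivative[OF f, of x] K(3) that has_derivative_at_withinI by blast
    qed
  qed
qed

section \<open>Simultaneous straightening of two commuting fields\<close>

lemma vec_4_expand: "(a :: real ^ 4) = a $ 1 *\<^sub>R axis 1 1 + a $ 2 *\<^sub>R axis 2 1 + a $ 3 *\<^sub>R axis 3 1 + a $ 4 *\<^sub>R axis 4 1"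
  by (simp add: vec_eq_iff forall_4 axis_def)

lemma linear_vec_4:
  assumes "linear (L :: real ^ 4 \<Rightarrow> 'b::real_vector)"
  shows "L a = a $ 1 *\<^sub>R L (axis 1 1) + a $ 2 *\<^sub>R L (axis 2 1) + a $ 3 *\<^sub>R L (axis 3 1) + a $ 4 *\<^sub>R L (axis 4 1)"
  using arg_cong[OF vec_4_expand[of a], of L] by (simp only: linear_add[OF assms] linear_cmul[OF assms])

lemma smooth_on_imp_vector_derivative:
  fixes f :: "'a::euclidean_space \<Rightarrow> 'b::real_normed_vector"
  assumes "smooth_on S f" "(p has_vector_derivative p') (at t)" "p t \<in> S"
  shows "((\<lambda>t. f (p t)) has_vector_derivative fd f (p t) p') (at t)"
proof -
  have "((\<lambda>t. f (p t)) has_derivative (\<lambda>h. fd f (p t) (h *\<^sub>R p'))) (at t)"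
    using assms(2) smooth_on_imp_has_derivative[OF assms(1,3)] unfolding has_vector_derivative_def
    by (rule has_derivative_compose)
  then show ?thesis
    using smooth_on_imp_linear_fd[OF assms(1,3)] by (simp add: has_vector_derivative_def linear_cmul)
qed

text \<open>The new coordinates are the inverse of \<open>l \<mapsto> u (1, l)\<close>, where \<open>u (t, l)\<close> is the flow of the
  field \<open>l\<^sub>1 X\<^sub>1 + l\<^sub>2 X\<^sub>2\<close> started on the plane through \<open>x\<^sub>0\<close> spanned by \<open>w\<^sub>3\<close> and \<open>w\<^sub>4\<close>.\<close>

lemma straighten_commuting_fields:
  fixes X1 X2 :: "real ^ 4 \<Rightarrow> real ^ 4"
  assumes S: "open S" "x0 \<in> S" and X: "smooth_on S X1" "smooth_on S X2"
    and comm: "\<And>x. x \<in> S \<Longrightarrow> fd X1 x (X2 x) = fd X2 x (X1 x)"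
    and indep: "\<And>a :: real ^ 4. a $ 1 *\<^sub>R X1 x0 + a $ 2 *\<^sub>R X2 x0 + a $ 3 *\<^sub>R w3 + a $ 4 *\<^sub>R w4 = 0 \<Longrightarrow> a = 0"
  obtains \<Theta> U where "open U" "x0 \<in> U" "U \<subseteq> S" "smooth_on U (\<Theta> :: real ^ 4 \<Rightarrow> real ^ 4)"
    "\<And>x. x \<in> U \<Longrightarrow> fd \<Theta> x (X1 x) = axis 1 1" "\<And>x. x \<in> U \<Longrightarrow> fd \<Theta> x (X2 x) = axis 2 1"
    "\<And>x. x \<in> U \<Longrightarrow> inj (fd \<Theta> x)"
proof -
  obtain R where R: "R > 0" "cball x0 R \<subseteq> S" using S open_contains_cball by blast
  let ?K = "cball x0 R"
  obtain L1 where L1: "L1 > 0" "\<And>x. x \<in> ?K \<Longrightarrow> norm (X1 x) \<le> L1"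
    "\<And>x y. x \<in> ?K \<Longrightarrow> y \<in> ?K \<Longrightarrow> norm (X1 x - X1 y) \<le> L1 * norm (x - y)"
    by (rule smooth_on_imp_Lipschitz[OF X(1) compact_cball convex_cball R(2)]) (rule that)
  obtain L2 where L2: "L2 > 0" "\<And>x. x \<in> ?K \<Longrightarrow> norm (X2 x) \<le> L2"
    "\<And>x y. x \<in> ?K \<Longrightarrow> y \<in> ?K \<Longrightarrow> norm (X2 x - X2 y) \<le> L2 * norm (x - y)"
    by (rule smooth_on_imp_Lipschitz[OF X(2) compact_cball convex_cball R(2)]) (rule that)
  \<comment> \<open>Composition with the nearest-point projection extends the fields from the ball
    to bounded, globally Lipschitz fields; on the ball they are unchanged.\<close>
  define \<pi> where "\<pi> = closest_point ?K"
  have \<pi>: "\<pi> x \<in> ?K" "norm (\<pi> x - \<pi> y) \<le> norm (x - y)" for x y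
  proof -
    have "?K \<noteq> {}" using R by auto
    then show "\<pi> x \<in> ?K" "norm (\<pi> x - \<pi> y) \<le> norm (x - y)"
      unfolding \<pi>_def using closest_point_in_set[OF closed_cball, of x0 R x]
        closest_point_lipschitz[OF convex_cball closed_cball, of x0 R x y]
      by (auto simp: dist_norm)
  qed
  have \<pi>_id: "\<pi> x = x" if "x \<in> ?K" for x using that by (simp add: \<pi>_def closest_point_self)
  have cont\<pi>: "continuous_on UNIV \<pi>"
    unfolding \<pi>_def by (rule continuous_on_closest_point) (use R in auto)
  \<comment> \<open>Small coefficients make the flow exist up to time 2. The first bound on
    \<epsilon> below makes the Lipschitz constant of \<open>F\<close> at most 1/4; the second keeps
    solutions in the ball, as they move by at most 2 \<epsilon> (L1 + L2) from a starting point
    within \<epsilon> (norm w3 + norm w4) of x0, together at most \<epsilon> C <= R / 2.\<close>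
  define C where "C = norm w3 + norm w4 + 4 * (L1 + L2) + 1"
  have C: "C > 0" using L1(1) L2(1) by (simp add: C_def add_pos_nonneg add_nonneg_pos)
  define \<epsilon> where "\<epsilon> = min (1 / (4 * (L1 + L2))) (R / (2 * C))"
  have \<epsilon>: "\<epsilon> > 0" "\<epsilon> * (L1 + L2) \<le> 1/4" "\<epsilon> * C < R"
  proof -
    show "\<epsilon> > 0" using L1(1) L2(1) C R(1) by (simp add: \<epsilon>_def)
    have "\<epsilon> * (L1 + L2) \<le> 1 / (4 * (L1 + L2)) * (L1 + L2)"
      using L1(1) L2(1) by (intro mult_right_mono) (auto simp: \<epsilon>_def)
    also have "\<dots> = 1/4" using L1(1) L2(1) by (simp add: divide_simps)
    finally show "\<epsilon> * (L1 + L2) \<le> 1/4" .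
    have "\<epsilon> * C \<le> R / (2 * C) * C" using C by (intro mult_right_mono) (auto simp: \<epsilon>_def)
    also have "\<dots> = R / 2" using C by simp
    also have "\<dots> < R" using R by simp
    finally show "\<epsilon> * C < R" .
  qed
  let ?B = "ball (0 :: real ^ 4) \<epsilon>"
  have comp: "\<bar>l $ i\<bar> \<le> \<epsilon>" if "l \<in> ?B" for l :: "real ^ 4" and i
    using component_le_norm_cart[of l i] that by simp
  define F :: "(real \<times> (real ^ 4)) \<times> (real ^ 4) \<Rightarrow> real ^ 4"
    where "F q = snd (fst q) $ 1 *\<^sub>R X1 (\<pi> (snd q)) + snd (fst q) $ 2 *\<^sub>R X2 (\<pi> (snd q))" for q
  have Flip: "norm (F ((t, l), x) - F ((t, l), y)) \<le> 1/4 * norm (x - y)" if "l \<in> ?B" for t l x y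
  proof -
    have "F ((t, l), x) - F ((t, l), y) = l $ 1 *\<^sub>R (X1 (\<pi> x) - X1 (\<pi> y)) + l $ 2 *\<^sub>R (X2 (\<pi> x) - X2 (\<pi> y))"
      by (simp add: F_def algebra_simps)
    also have "norm \<dots> \<le> \<bar>l $ 1\<bar> * norm (X1 (\<pi> x) - X1 (\<pi> y)) + \<bar>l $ 2\<bar> * norm (X2 (\<pi> x) - X2 (\<pi> y))"
      by (rule norm_triangle_le) simp
    also have "\<dots> \<le> \<epsilon> * (L1 * norm (x - y)) + \<epsilon> * (L2 * norm (x - y))"
    proof (intro add_mono mult_mono comp[OF that])
      show "norm (X1 (\<pi> x) - X1 (\<pi> y)) \<le> L1 * norm (x - y)"
        using L1(3)[OF \<pi>(1) \<pi>(1), of x y] mult_left_mono[OF \<pi>(2)[of x y], of L1] L1(1) by linarith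
      show "norm (X2 (\<pi> x) - X2 (\<pi> y)) \<le> L2 * norm (x - y)"
        using L2(3)[OF \<pi>(1) \<pi>(1), of x y] mult_left_mono[OF \<pi>(2)[of x y], of L2] L2(1) by linarith
    qed (use \<epsilon> in auto)
    also have "\<dots> = \<epsilon> * (L1 + L2) * norm (x - y)" by (simp add: algebra_simps)
    also have "\<dots> \<le> 1/4 * norm (x - y)" using \<epsilon>(2) by (intro mult_right_mono) auto
    finally show ?thesis .
  qed
  have Fbd: "norm (F ((t, l), x)) \<le> \<epsilon> * (L1 + L2)" if "l \<in> ?B" for t l x
  proof -
    have "norm (F ((t, l), x)) \<le> \<bar>l $ 1\<bar> * norm (X1 (\<pi> x)) + \<bar>l $ 2\<bar> * norm (X2 (\<pi> x))"
      unfolding F_def by (rule norm_triangle_le) simp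
    also have "\<dots> \<le> \<epsilon> * L1 + \<epsilon> * L2"
      using \<epsilon>(1) by (intro add_mono mult_mono comp[OF that] L1(2) L2(2) \<pi>) auto
    finally show ?thesis by (simp add: algebra_simps)
  qed
  define u0 where "u0 l = x0 + l $ 3 *\<^sub>R w3 + l $ 4 *\<^sub>R w4" for l :: "real ^ 4"
  have u0_Ck: "Ck_on k u0 B" if "open B" for k B
    unfolding u0_def
    by (intro Ck_on_add[OF that] Ck_on_scaleR[OF that] Ck_on_const Ck_on_bounded_linear bounded_linear_vec_nth)
  have contF: "continuous_on UNIV F"
    unfolding F_def
    by (intro continuous_intros continuous_on_compose2[OF smooth_on_imp_continuous_on[OF X(1)]]
        continuous_on_compose2[OF smooth_on_imp_continuous_on[OF X(2)]] continuous_on_compose2[OF cont\<pi>])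
       (use \<pi>(1) R(2) in auto)
  have "\<exists>u. continuous_on ({-2..2} \<times> ?B) u \<and> (\<forall>l\<in>?B. u (0, l) = u0 l \<and>
      (\<forall>t\<in>{-2..2}. ((\<lambda>t. u (t, l)) has_vector_derivative F ((t, l), u (t, l))) (at t within {-2..2})))"
    by (rule ODE_exists_continuous[OF _ _ continuous_on_subset[OF contF] Flip
          Ck_on_imp_continuous_on[OF u0_Ck[OF open_ball, of 0]]]) auto
  then obtain u where uc: "continuous_on ({-2..2} \<times> ?B) u" and u_0: "\<And>l. l \<in> ?B \<Longrightarrow> u (0, l) = u0 l"
    and uder: "\<And>l t. l \<in> ?B \<Longrightarrow> t \<in> {-2..2} \<Longrightarrow>
      ((\<lambda>t. u (t, l)) has_vector_derivative F ((t, l), u (t, l))) (at t within {-2..2})"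
    by blast
  \<comment> \<open>The bound \<open>F0\<close> is left free for a second use: with F0 = 0 it shows
    that the solution is constant when the first two components of \<open>l\<close> vanish.\<close>
  have ubd: "norm (u (t, l) - u0 l) \<le> norm (F0 :: real) * 2"
    if l: "l \<in> ?B" and t: "t \<in> {-2..2}" and F0: "\<And>t x. norm (F ((t, l), x)) \<le> F0" for l t F0
  proof -
    have F0p: "F0 \<ge> 0" using F0[of 0 0] norm_ge_zero order_trans by blast
    have "norm (u (t, l) - u (0, l)) \<le> F0 * norm (t - 0)"
    proof (rule differentiable_bound[OF convex_real_interval(5)[of "-2" 2]])
      show "((\<lambda>t. u (t, l)) has_derivative (\<lambda>h. h *\<^sub>R F ((t, l), u (t, l)))) (at t within {-2..2})"
        if "t \<in> {-2..2}" for t using uder[OF l that] by (simp add: has_vector_derivative_def)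
      show "onorm (\<lambda>h. h *\<^sub>R F ((t, l), u (t, l))) \<le> F0" for t
        by (rule onorm_scaleR_left_le) (rule F0)
    qed (use t in auto)
    also have "\<dots> \<le> F0 * 2" using t F0p by (intro mult_left_mono) auto
    finally show ?thesis using u_0[OF l] F0p by simp
  qed
  have uR: "u (t, l) \<in> ball x0 R" if l: "l \<in> ?B" and t: "t \<in> {-2..2}" for l t
  proof -
    have "norm (u (t, l) - u0 l) \<le> \<epsilon> * (L1 + L2) * 2"
      using ubd[OF l t Fbd[OF l]] \<epsilon>(1) L1(1) L2(1) by (simp add: abs_mult)
    moreover have "norm (u0 l - x0) \<le> \<epsilon> * (norm w3 + norm w4)"
    proof -
      have "norm (u0 l - x0) \<le> \<bar>l $ 3\<bar> * norm w3 + \<bar>l $ 4\<bar> * norm w4"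
        unfolding u0_def using norm_triangle_ineq[of "l $ 3 *\<^sub>R w3" "l $ 4 *\<^sub>R w4"] by simp
      also have "\<dots> \<le> \<epsilon> * norm w3 + \<epsilon> * norm w4" by (intro add_mono mult_right_mono comp[OF l]) auto
      finally show ?thesis by (simp add: algebra_simps)
    qed
    moreover have "norm (u (t, l) - x0) \<le> norm (u (t, l) - u0 l) + norm (u0 l - x0)"
      using norm_triangle_ineq[of "u (t, l) - u0 l" "u0 l - x0"] by simp
    moreover have "\<epsilon> * (L1 + L2) * 2 + \<epsilon> * (norm w3 + norm w4) \<le> \<epsilon> * C"
      using \<epsilon>(1) L1(1) L2(1) by (simp add: C_def algebra_simps)
    ultimately show ?thesis using \<epsilon>(3) by (simp add: dist_norm norm_minus_commute)
  qed
  have uS: "u (t, l) \<in> S" if "l \<in> ?B" "t \<in> {-2..2}" for l t using uR[OF that] R(2) by auto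
  \<comment> \<open>The projection is only Lipschitz. As the solutions stay in the open ball,
    smoothness is needed only there, where \<open>F\<close> coincides with the projection-free
    \<open>F1\<close>.\<close>
  define F1 :: "(real \<times> (real ^ 4)) \<times> (real ^ 4) \<Rightarrow> real ^ 4"
    where "F1 q = snd (fst q) $ 1 *\<^sub>R X1 (snd q) + snd (fst q) $ 2 *\<^sub>R X2 (snd q)" for q
  let ?W = "(UNIV :: (real \<times> (real ^ 4)) set) \<times> ball x0 R"
  have W: "open ?W" by (intro open_Times) auto
  have FF1: "F q = F1 q" if "q \<in> ?W" for q using that \<pi>_id[of "snd q"] by (auto simp: F_def F1_def)
  have Fs: "smooth_on ?W F"
  proof (rule smooth_on_cong[OF W FF1, THEN iffD2])
    have Xs: "smooth_on ?W (\<lambda>q. Y (snd q))" if "smooth_on S Y" for Y :: "real ^ 4 \<Rightarrow> real ^ 4"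
      by (rule smooth_on_compose[OF W S(1) _ that smooth_on_bounded_linear[OF bounded_linear_snd]]) (use R in auto)
    have li: "smooth_on ?W (\<lambda>q. snd (fst q) $ i)" for i
      by (intro smooth_on_nth[OF W] smooth_on_bounded_linear bounded_linear_compose[OF bounded_linear_snd bounded_linear_fst])
    show "smooth_on ?W F1"
      unfolding F1_def by (intro smooth_on_add[OF W] smooth_on_scaleR[OF W] li Xs X)
  qed
  let ?D = "{-2<..<2::real} \<times> ?B"
  have D: "open ?D" by (intro open_Times) auto
  have uder': "((\<lambda>t. u (t, l)) has_vector_derivative F ((t, l), u (t, l))) (at t)"
    if "\<bar>t\<bar> < 2" "l \<in> ?B" for t l
  proof -
    have "at t within {-2..2} = at t" using that(1) by (intro at_within_interior) auto
    then show ?thesis using uder[OF that(2), of t] that(1) by (simp add: abs_less_iff)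
  qed
  have us: "smooth_on ?D u"
    unfolding smooth_on_def
  proof
    fix k
    show "Ck_on k u ?D"
    proof (rule ODE_solution_Ck[OF open_ball, where W = ?W and F = F])
      show "Ck_on k F ?W" using Fs by (simp add: smooth_on_def)
      show "((t, l), u (t, l)) \<in> ?W" if "\<bar>t\<bar> < 2" "l \<in> ?B" for t l
        using uR[of l t] that by (simp add: abs_less_iff)
      show "continuous_on ?D u" by (rule continuous_on_subset[OF uc]) auto
      show "Ck_on k (\<lambda>l. u (0, l)) ?B"
        by (rule Ck_on_cong[OF open_ball, THEN iffD1, rotated, OF u0_Ck[OF open_ball]]) (use u_0 in auto)
    qed (use W Flip uder' in auto)
  qed
  have fdu_t: "fd u y (1, 0) = F (y, u y)" if "y \<in> ?D" for y
  proof -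
    obtain t l where tl: "y = (t, l)" by (cases y)
    then have y: "y = (t, l)" "\<bar>t\<bar> < 2" "l \<in> ?B" using that by auto
    have "((\<lambda>t. (t, l)) has_vector_derivative (1, 0)) (at t)"
      by (auto intro!: derivative_eq_intros simp: has_vector_derivative_def)
    from smooth_on_imp_vector_derivative[OF us this] that
    have "((\<lambda>t. u (t, l)) has_vector_derivative fd u (t, l) (1, 0)) (at t)" by (simp add: y)
    then show ?thesis using uder'[OF y(2,3)] vector_derivative_unique_at y(1) by blast
  qed
  have fdF: "fd F ((t, l), x) ((0, h), w) = h $ 1 *\<^sub>R X1 x + h $ 2 *\<^sub>R X2 x + l $ 1 *\<^sub>R fd X1 x w + l $ 2 *\<^sub>R fd X2 x w"
    if x: "x \<in> ball x0 R" for t l x h w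
  proof -
    have xS: "x \<in> S" using x R by auto
    have Xd: "((\<lambda>q::(real \<times> (real ^ 4)) \<times> (real ^ 4). Y (snd q)) has_derivative (\<lambda>q. fd Y x (snd q))) (at ((t, l), x))"
      if "smooth_on S Y" for Y :: "real ^ 4 \<Rightarrow> real ^ 4"
      using has_derivative_compose[OF bounded_linear_imp_has_derivative[OF bounded_linear_snd, of "at ((t, l), x)"], of Y "fd Y x"]
        smooth_on_imp_has_derivative[OF that xS] by simp
    have ld: "((\<lambda>q::(real \<times> (real ^ 4)) \<times> (real ^ 4). snd (fst q) $ i) has_derivative (\<lambda>q. snd (fst q) $ i)) (at ((t, l), x))" for i
      by (intro bounded_linear_imp_has_derivative bounded_linear_compose[OF bounded_linear_vec_nth]
          bounded_linear_compose[OF bounded_linear_snd bounded_linear_fst])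
    have "(F1 has_derivative (\<lambda>q. (l $ 1 *\<^sub>R fd X1 x (snd q) + snd (fst q) $ 1 *\<^sub>R X1 x)
        + (l $ 2 *\<^sub>R fd X2 x (snd q) + snd (fst q) $ 2 *\<^sub>R X2 x))) (at ((t, l), x))"
      unfolding F1_def
      using has_derivative_add[OF has_derivative_scaleR[OF ld Xd[OF X(1)]] has_derivative_scaleR[OF ld Xd[OF X(2)]]]
      by simp
    from fd_eqI[OF this] fd_cong_open[OF W _ FF1, of "((t, l), x)"] x
    show ?thesis by simp
  qed
  have X12_lin: "linear (fd X1 x)" "linear (fd X2 x)" if "x \<in> S" for x
    using smooth_on_imp_linear_fd X that by blast+
  \<comment> \<open>The difference z of the parameter derivative of \<open>u\<close> and t Y(u)
    solves a homogeneous linear equation with z(0) = 0, so it vanishes; t = 1 gives the claim.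
    Commutation enters in the derivative of t Y(u): for the constant combination F = l_1 X1 + l_2 X2
    it says that DY applied to F equals DF applied to Y.\<close>
  have key: "fd u (1, l) (0, axis i 1) = Y (u (1, l))"
    if l: "l \<in> ?B" and Y: "i = 1 \<and> Y = X1 \<or> i = 2 \<and> Y = X2" for l i Y
  proof -
    let ?v = "(0 :: real, axis i 1 :: real ^ 4)"
    have Ys: "smooth_on S Y" using Y X by auto
    define z where "z t = fd u (t, l) ?v - t *\<^sub>R Y (u (t, l))" for t
    have "norm (z 1) \<le> 2 * 0 + 4 * 0"
    proof (rule small_growth_bound[where s = 1])
      fix t :: real assume t: "t \<in> {-1..1}"
      have tD: "(t, l) \<in> ?D" using t l by auto
      have uS': "u (t, l) \<in> S" using uS[OF l] t by auto
      have uR': "u (t, l) \<in> ball x0 R" using uR[OF l] t by auto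
      have vd: "((\<lambda>t. (t, l)) has_vector_derivative (1, 0)) (at t)"
        by (auto intro!: derivative_eq_intros simp: has_vector_derivative_def)
      have "((\<lambda>t. fd u (t, l) ?v) has_vector_derivative fd (\<lambda>y. fd u y ?v) (t, l) (1, 0)) (at t)"
        using smooth_on_imp_vector_derivative[OF smooth_on_fd[OF us] vd, of ?v] tD by simp
      also have "fd (\<lambda>y. fd u y ?v) (t, l) (1, 0) = fd (\<lambda>y. fd u y (1, 0)) (t, l) ?v"
        by (rule smooth_on_fd_commute[OF D us tD])
      also have "\<dots> = fd (\<lambda>y. F (y, u y)) (t, l) ?v"
        by (subst fd_cong_open[OF D tD fdu_t]) auto
      also have "\<dots> = fd F ((t, l), u (t, l)) (?v, fd u (t, l) ?v)"
      proof -
        have "((\<lambda>y. (y, u y)) has_derivative (\<lambda>h. (h, fd u (t, l) h))) (at (t, l))"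
          by (intro has_derivative_Pair has_derivative_ident smooth_on_imp_has_derivative[OF us tD])
        from has_derivative_compose[OF this smooth_on_imp_has_derivative[OF Fs]] uR'
        show ?thesis by (intro fun_cong[OF fd_eqI]) auto
      qed
      also have "\<dots> = Y (u (t, l)) + fd F ((t, l), u (t, l)) ((0, 0), fd u (t, l) ?v)"
        using Y fdF[OF uR'] by (auto simp: axis_def algebra_simps)
      finally have d1: "((\<lambda>t. fd u (t, l) ?v) has_vector_derivative
        (Y (u (t, l)) + fd F ((t, l), u (t, l)) ((0, 0), fd u (t, l) ?v))) (at t)" .
      have "((\<lambda>t. u (t, l)) has_vector_derivative F ((t, l), u (t, l))) (at t)"
        using uder'[OF _ l] t by auto
      from smooth_on_imp_vector_derivative[OF Ys this uS']
      have d2: "((\<lambda>t. t *\<^sub>R Y (u (t, l))) has_vector_derivative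
          (t *\<^sub>R fd Y (u (t, l)) (F ((t, l), u (t, l))) + Y (u (t, l)))) (at t)"
        by (auto intro!: derivative_eq_intros)
      have F_eq: "F ((t, l), u (t, l)) = l $ 1 *\<^sub>R X1 (u (t, l)) + l $ 2 *\<^sub>R X2 (u (t, l))"
        using FF1[of "((t, l), u (t, l))"] uR' by (simp add: F1_def)
      have "fd Y (u (t, l)) (F ((t, l), u (t, l))) = fd F ((t, l), u (t, l)) ((0, 0), Y (u (t, l)))"
        using Y fdF[OF uR', of t l 0] X12_lin[OF uS'] comm[OF uS']
        by (auto simp: F_eq linear_add linear_cmul zero_prod_def)
      then have eqz: "fd F ((t, l), u (t, l)) ((0, 0), z t) = fd F ((t, l), u (t, l)) ((0, 0), fd u (t, l) ?v)
          - t *\<^sub>R fd Y (u (t, l)) (F ((t, l), u (t, l)))"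
        using fdF[OF uR', of t l 0] X12_lin[OF uS']
        by (simp add: z_def linear_diff linear_cmul algebra_simps)
      have "(z has_vector_derivative fd F ((t, l), u (t, l)) ((0, 0), z t)) (at t)"
        unfolding eqz using has_vector_derivative_diff[OF d1 d2] by (simp add: z_def[abs_def] algebra_simps)
      then show "(z has_vector_derivative fd F ((t, l), u (t, l)) ((0, 0), z t)) (at t within {-1..1})"
        by (rule has_vector_derivative_at_within)
      have "norm (fd F ((t, l), u (t, l)) (0, z t)) \<le> 1/4 * norm (z t)"
        by (rule has_derivative_Lipschitz_bound[OF smooth_on_imp_has_derivative[OF Fs] _ Flip[OF l]]) (use uR' in auto)
      then show "norm (fd F ((t, l), u (t, l)) ((0, 0), z t)) \<le> 1/4 * norm (z t) + 0"
        by (simp add: zero_prod_def)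
    next
      have zl: "(0, l) \<in> ?D" using l by auto
      have "((\<lambda>m. u (0, m)) has_derivative (\<lambda>h. fd u (0, l) (0, h))) (at l)"
        using has_derivative_compose[OF has_derivative_Pair[OF has_derivative_const has_derivative_ident] smooth_on_imp_has_derivative[OF us zl]] .
      moreover have "((\<lambda>m. u (0, m)) has_derivative (\<lambda>h. h $ 3 *\<^sub>R w3 + h $ 4 *\<^sub>R w4)) (at l)"
      proof (rule has_derivative_cong_open[OF open_ball l u_0, THEN iffD2])
        show "(u0 has_derivative (\<lambda>h. h $ 3 *\<^sub>R w3 + h $ 4 *\<^sub>R w4)) (at l)"
          unfolding u0_def by (auto intro!: derivative_eq_intros bounded_linear_imp_has_derivative[OF bounded_linear_vec_nth])
      qed
      ultimately have "fd u (0, l) ?v = axis i 1 $ 3 *\<^sub>R w3 + axis i 1 $ 4 *\<^sub>R w4"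
        using has_derivative_unique by (metis (no_types, lifting))
      then show "norm (z 0) \<le> 0" using Y by (auto simp: z_def axis_def)
    qed auto
    then show ?thesis by (simp add: z_def)
  qed
  define \<Psi> where "\<Psi> l = u (1, l)" for l
  have \<Psi>s: "smooth_on ?B \<Psi>"
    unfolding \<Psi>_def
  proof (rule smooth_on_compose[OF open_ball D _ us])
    show "smooth_on ?B (\<lambda>l. (1 :: real, l))"
      unfolding smooth_on_def by (intro allI Ck_on_Pair open_ball Ck_on_const Ck_on_bounded_linear bounded_linear_ident)
  qed auto
  have fd\<Psi>: "fd \<Psi> l h = fd u (1, l) (0, h)" if "l \<in> ?B" for l h
    unfolding \<Psi>_def
    by (rule fun_cong[OF fd_eqI[OF has_derivative_compose[OF has_derivative_Pair[OF has_derivative_const has_derivative_ident]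
      smooth_on_imp_has_derivative[OF us]]]]) (use that in auto)
  have zero: "0 \<in> ?B" using \<epsilon> by simp
  have \<Psi>_plane: "\<Psi> l = u0 l" if "l \<in> ?B" "l $ 1 = 0" "l $ 2 = 0" for l
    using ubd[OF that(1), of 1 0] that by (simp add: F_def \<Psi>_def)
  \<comment> \<open>On the plane where the first two parameters vanish nothing flows, so there
    \<Psi> is the affine map \<open>u0\<close>.\<close>
  have \<Psi>34: "fd \<Psi> 0 (axis i 1) = w" if iw: "i = 3 \<and> w = w3 \<or> i = 4 \<and> w = w4" for i w
  proof -
    let ?p = "\<lambda>s. s *\<^sub>R (axis i 1 :: real ^ 4)"
    have p: "(?p has_vector_derivative axis i 1) (at 0)"
      by (auto intro!: derivative_eq_intros simp: has_vector_derivative_def)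
    have 1: "((\<lambda>s. \<Psi> (?p s)) has_vector_derivative fd \<Psi> 0 (axis i 1)) (at 0)"
      using smooth_on_imp_vector_derivative[OF \<Psi>s p] zero by simp
    have "\<Psi> (?p s) = x0 + s *\<^sub>R w" if "s \<in> ball 0 \<epsilon>" for s
    proof -
      have "?p s \<in> ?B" using that by simp
      moreover have "?p s $ 1 = 0" "?p s $ 2 = 0" using iw by (auto simp: axis_def)
      moreover have "u0 (?p s) = x0 + s *\<^sub>R w" using iw by (auto simp: u0_def axis_def)
      ultimately show ?thesis using \<Psi>_plane by simp
    qed
    then have "((\<lambda>s. \<Psi> (?p s)) has_vector_derivative w) (at 0)"
      unfolding has_vector_derivative_def
      by (subst has_derivative_cong_open[of "ball 0 \<epsilon>" _ _ "\<lambda>s. x0 + s *\<^sub>R w"])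
         (use \<epsilon> in \<open>auto intro!: derivative_eq_intros\<close>)
    then show ?thesis using 1 vector_derivative_unique_at by blast
  qed
  have \<Psi>0: "\<Psi> 0 = x0" using \<Psi>_plane[OF zero] by (simp add: u0_def)
  have \<Psi>12: "fd \<Psi> l (axis 1 1) = X1 (\<Psi> l)" "fd \<Psi> l (axis 2 1) = X2 (\<Psi> l)" if "l \<in> ?B" for l
    using key[OF that, of 1 X1] key[OF that, of 2 X2] fd\<Psi>[OF that] by (simp_all add: \<Psi>_def)
  have fd\<Psi>0: "fd \<Psi> 0 a = a $ 1 *\<^sub>R X1 x0 + a $ 2 *\<^sub>R X2 x0 + a $ 3 *\<^sub>R w3 + a $ 4 *\<^sub>R w4" for a
    using linear_vec_4[OF smooth_on_imp_linear_fd[OF \<Psi>s zero], of a] \<Psi>34[of 3 w3] \<Psi>34[of 4 w4] \<Psi>12[OF zero] \<Psi>0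
    by simp
  have inj0: "inj (fd \<Psi> 0)"
    unfolding linear_injective_0[OF smooth_on_imp_linear_fd[OF \<Psi>s zero]] fd\<Psi>0
    by (intro allI impI) (rule indep)
  obtain V \<Theta> where V: "open V" "0 \<in> V" "V \<subseteq> ?B" "open (\<Psi> ` V)" "inj_on \<Psi> V" "smooth_on (\<Psi> ` V) \<Theta>"
    and \<Theta>: "\<And>l. l \<in> V \<Longrightarrow> \<Theta> (\<Psi> l) = l" "\<And>l v. l \<in> V \<Longrightarrow> fd \<Theta> (\<Psi> l) (fd \<Psi> l v) = v"
      "\<And>l v. l \<in> V \<Longrightarrow> fd \<Psi> l (fd \<Theta> (\<Psi> l) v) = v"
    by (rule smooth_inverse_function[OF open_ball \<Psi>s zero inj0]) (rule that)
  show ?thesis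
  proof (rule that[OF V(4) _ _ V(6)])
    show "x0 \<in> \<Psi> ` V" using V(2) \<Psi>0 by force
    show "\<Psi> ` V \<subseteq> S" using V(3) uS by (auto simp: \<Psi>_def)
    show "fd \<Theta> x (X1 x) = axis 1 1" "fd \<Theta> x (X2 x) = axis 2 1" "inj (fd \<Theta> x)" if x: "x \<in> \<Psi> ` V" for x
    proof -
      obtain l where l: "l \<in> V" "x = \<Psi> l" using x by (elim imageE)
      show "fd \<Theta> x (X1 x) = axis 1 1" "fd \<Theta> x (X2 x) = axis 2 1"
        using \<Theta>(2)[OF l(1)] \<Psi>12[of l] V(3) l by (metis subsetD)+
      show "inj (fd \<Theta> x)" using \<Theta>(3)[OF l(1)] l(2) by (metis injI)
    qed
  qed
qed

section \<open>The Frobenius theorem\<close>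

lemma fd_comb:
  fixes e1 e2 :: "'a::euclidean_space \<Rightarrow> 'b::real_normed_vector" and p q :: "'a \<Rightarrow> real"
  assumes "smooth_on S e1" "smooth_on S e2" "smooth_on S p" "smooth_on S q" "x \<in> S"
  shows "fd (\<lambda>x. p x *\<^sub>R e1 x + q x *\<^sub>R e2 x) x v =
    (p x *\<^sub>R fd e1 x v + fd p x v *\<^sub>R e1 x) + (q x *\<^sub>R fd e2 x v + fd q x v *\<^sub>R e2 x)"
proof -
  have "((\<lambda>x. p x *\<^sub>R e1 x + q x *\<^sub>R e2 x) has_derivative
    (\<lambda>v. (p x *\<^sub>R fd e1 x v + fd p x v *\<^sub>R e1 x) + (q x *\<^sub>R fd e2 x v + fd q x v *\<^sub>R e2 x))) (at x)"
    by (intro has_derivative_add has_derivative_scaleR smooth_on_imp_has_derivative[OF _ assms(5)] assms)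
  from fd_eqI[OF this] show ?thesis by simp
qed

text \<open>Modulo the span of \<open>e1\<close> and \<open>e2\<close>, the bracket is bilinear over
  functions and alternating, so it is multiplied by the determinant of the coefficients. Hence
  involutivity survives a change of frame.\<close>

lemma bracket_comb:
  fixes e1 e2 :: "'a::euclidean_space \<Rightarrow> 'a"
  assumes e: "smooth_on S e1" "smooth_on S e2"
    and p: "smooth_on S p1" "smooth_on S q1" "smooth_on S p2" "smooth_on S q2" and x: "x \<in> S"
    and X: "X = (\<lambda>x. p1 x *\<^sub>R e1 x + q1 x *\<^sub>R e2 x)" and Y: "Y = (\<lambda>x. p2 x *\<^sub>R e1 x + q2 x *\<^sub>R e2 x)"
  shows "fd Y x (X x) - fd X x (Y x) = (fd p2 x (X x) - fd p1 x (Y x)) *\<^sub>R e1 x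
    + (fd q2 x (X x) - fd q1 x (Y x)) *\<^sub>R e2 x
    + (p1 x * q2 x - q1 x * p2 x) *\<^sub>R (fd e2 x (e1 x) - fd e1 x (e2 x))"
proof -
  have lin: "fd e x (a *\<^sub>R u + b *\<^sub>R v) = a *\<^sub>R fd e x u + b *\<^sub>R fd e x v"
    if "smooth_on S e" for e :: "'a \<Rightarrow> 'a" and a b u v
    using smooth_on_imp_linear_fd[OF that x] by (simp add: linear_add linear_cmul)
  have "fd Y x (X x) = (p2 x *\<^sub>R (p1 x *\<^sub>R fd e1 x (e1 x) + q1 x *\<^sub>R fd e1 x (e2 x)) + fd p2 x (X x) *\<^sub>R e1 x)
      + (q2 x *\<^sub>R (p1 x *\<^sub>R fd e2 x (e1 x) + q1 x *\<^sub>R fd e2 x (e2 x)) + fd q2 x (X x) *\<^sub>R e2 x)"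
    using fd_comb[OF e p(3,4) x, of "X x"] lin[OF e(1), of "p1 x" "e1 x" "q1 x" "e2 x"]
      lin[OF e(2), of "p1 x" "e1 x" "q1 x" "e2 x"] by (simp add: Y) (simp add: X)
  moreover have "fd X x (Y x) = (p1 x *\<^sub>R (p2 x *\<^sub>R fd e1 x (e1 x) + q2 x *\<^sub>R fd e1 x (e2 x)) + fd p1 x (Y x) *\<^sub>R e1 x)
      + (q1 x *\<^sub>R (p2 x *\<^sub>R fd e2 x (e1 x) + q2 x *\<^sub>R fd e2 x (e2 x)) + fd q1 x (Y x) *\<^sub>R e2 x)"
    using fd_comb[OF e p(1,2) x, of "Y x"] lin[OF e(1), of "p2 x" "e1 x" "q2 x" "e2 x"]
      lin[OF e(2), of "p2 x" "e1 x" "q2 x" "e2 x"] by (simp add: X) (simp add: Y)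
  ultimately show ?thesis by (simp add: algebra_simps)
qed

text \<open>The frame is normalized so that two fixed linear forms are constant on it; then the bracket of
  the normalized fields lies in their span and is annihilated by these forms, so it vanishes.\<close>

lemma frobenius:
  fixes e1 e2 :: "real ^ 4 \<Rightarrow> real ^ 4"
  assumes S: "open S" "x0 \<in> S" and e: "smooth_on S e1" "smooth_on S e2"
    and indep: "\<And>a :: real ^ 4. a $ 1 *\<^sub>R e1 x0 + a $ 2 *\<^sub>R e2 x0 + a $ 3 *\<^sub>R w3 + a $ 4 *\<^sub>R w4 = 0 \<Longrightarrow> a = 0"
    and invol: "\<And>x. x \<in> S \<Longrightarrow> \<exists>p q. fd e2 x (e1 x) - fd e1 x (e2 x) = p *\<^sub>R e1 x + q *\<^sub>R e2 x"
  obtains h U where "open U" "x0 \<in> U" "U \<subseteq> S" "smooth_on U (h :: real ^ 4 \<Rightarrow> real ^ 4)"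
    "\<And>x v. x \<in> U \<Longrightarrow> fd h x v $ 3 = 0 \<and> fd h x v $ 4 = 0 \<longleftrightarrow> (\<exists>a b. v = a *\<^sub>R e1 x + b *\<^sub>R e2 x)"
proof -
  define \<Lambda> where "\<Lambda> a = a $ 1 *\<^sub>R e1 x0 + a $ 2 *\<^sub>R e2 x0 + a $ 3 *\<^sub>R w3 + a $ 4 *\<^sub>R w4" for a :: "real ^ 4"
  have lin\<Lambda>: "linear \<Lambda>" by (rule linearI) (simp_all add: \<Lambda>_def algebra_simps)
  have "inj \<Lambda>" unfolding linear_injective_0[OF lin\<Lambda>] \<Lambda>_def by (intro allI impI) (rule indep)
  \<comment> \<open>\<xi> gives the coordinates with respect to the basis e1 x0, e2 x0, w3, w4; its
    first two components are the linear forms used for the normalization.\<close>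
  then obtain \<xi> where \<xi>: "linear \<xi>" "\<xi> \<circ> \<Lambda> = id" using linear_injective_left_inverse[OF lin\<Lambda>] by blast
  then have b\<xi>: "bounded_linear \<xi>" by (simp add: linear_conv_bounded_linear)
  have \<xi>\<Lambda>: "\<xi> (\<Lambda> a) = a" for a using \<xi>(2) by (simp add: fun_eq_iff)
  have \<xi>e: "\<xi> (e1 x0) = axis 1 1" "\<xi> (e2 x0) = axis 2 1"
    using \<xi>\<Lambda>[of "axis 1 1"] \<xi>\<Lambda>[of "axis 2 1"] by (simp_all add: \<Lambda>_def axis_def)
  \<comment> \<open>The values of the two forms on \<open>e1\<close> and \<open>e2\<close>: a matrix
    that is the identity at \<open>x0\<close> and has determinant \<open>d\<close>. The functions
    p1, q1, p2, q2 below are the entries of its inverse, defined where \<open>d\<close> does not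
    vanish.\<close>
  define m11 m12 m21 m22 d where m: "m11 = (\<lambda>x. \<xi> (e1 x) $ 1)" "m12 = (\<lambda>x. \<xi> (e2 x) $ 1)"
    "m21 = (\<lambda>x. \<xi> (e1 x) $ 2)" "m22 = (\<lambda>x. \<xi> (e2 x) $ 2)"
    and d: "d = (\<lambda>x. m11 x * m22 x - m12 x * m21 x)"
  have ms: "smooth_on S m11" "smooth_on S m12" "smooth_on S m21" "smooth_on S m22"
    unfolding m by (intro smooth_on_nth[OF S(1)] smooth_on_linear_compose[OF S(1) b\<xi>] e)+
  have ds: "smooth_on S d" unfolding d by (intro smooth_on_diff[OF S(1)] smooth_on_mult[OF S(1)] ms)
  have m0: "m11 x0 = 1" "m12 x0 = 0" "m21 x0 = 0" "m22 x0 = 1" "d x0 = 1"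
    by (simp_all add: d m \<xi>e axis_def)
  define S1 where "S1 = S \<inter> d -` (- {0})"
  have S1: "open S1" "x0 \<in> S1" "S1 \<subseteq> S" and dnz: "\<And>x. x \<in> S1 \<Longrightarrow> d x \<noteq> 0"
    using continuous_open_preimage[OF smooth_on_imp_continuous_on[OF ds] S(1), of "- {0}"] m0 S(2)
    by (auto simp: S1_def)
  define p1 q1 p2 q2 where pq: "p1 = (\<lambda>x. m22 x / d x)" "q1 = (\<lambda>x. - m21 x / d x)"
    "p2 = (\<lambda>x. - m12 x / d x)" "q2 = (\<lambda>x. m11 x / d x)"
  note mss = ms[THEN smooth_on_subset, OF S1(3)] and dss = smooth_on_subset[OF ds S1(3)]
  have pqs: "smooth_on S1 p1" "smooth_on S1 q1" "smooth_on S1 p2" "smooth_on S1 q2"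
    unfolding pq
    by (intro smooth_on_divide[OF S1(1)] smooth_on_minus[OF S1(1)] dnz mss dss; assumption)+
  note es = smooth_on_subset[OF e(1) S1(3)] smooth_on_subset[OF e(2) S1(3)]
  define X1 X2 where X: "X1 = (\<lambda>x. p1 x *\<^sub>R e1 x + q1 x *\<^sub>R e2 x)" "X2 = (\<lambda>x. p2 x *\<^sub>R e1 x + q2 x *\<^sub>R e2 x)"
  have Xs: "smooth_on S1 X1" "smooth_on S1 X2"
    unfolding X by (intro smooth_on_add[OF S1(1)] smooth_on_scaleR[OF S1(1)] pqs es)+
  have mp: "m11 x * p1 x + m12 x * q1 x = 1" "m21 x * p1 x + m22 x * q1 x = 0"
    "m11 x * p2 x + m12 x * q2 x = 0" "m21 x * p2 x + m22 x * q2 x = 1"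
    "m11 x * p1 x + m21 x * p2 x = 1" "m11 x * q1 x + m21 x * q2 x = 0"
    "m12 x * p1 x + m22 x * p2 x = 0" "m12 x * q1 x + m22 x * q2 x = 1" if "x \<in> S1" for x
  proof -
    have "m11 x * m22 x - m12 x * m21 x = d x" by (simp add: d)
    then have "(m11 x * m22 x - m12 x * m21 x) / d x = 1" using dnz[OF that] by simp
    then show "m11 x * p1 x + m12 x * q1 x = 1" "m21 x * p1 x + m22 x * q1 x = 0"
      "m11 x * p2 x + m12 x * q2 x = 0" "m21 x * p2 x + m22 x * q2 x = 1"
      "m11 x * p1 x + m21 x * p2 x = 1" "m11 x * q1 x + m21 x * q2 x = 0"
      "m12 x * p1 x + m22 x * p2 x = 0" "m12 x * q1 x + m22 x * q2 x = 1"
      by (simp_all add: pq diff_divide_distrib mult.commute)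
  qed
  have \<xi>X: "\<xi> (X1 x) $ 1 = 1" "\<xi> (X1 x) $ 2 = 0" "\<xi> (X2 x) $ 1 = 0" "\<xi> (X2 x) $ 2 = 1" if "x \<in> S1" for x
    using mp(1-4)[OF that] by (simp_all add: X linear_add[OF \<xi>(1)] linear_cmul[OF \<xi>(1)] m mult.commute)
  have comb0: "p = 0 \<and> q = 0"
    if x: "x \<in> S1" and z: "\<xi> (p *\<^sub>R e1 x + q *\<^sub>R e2 x) $ 1 = 0" "\<xi> (p *\<^sub>R e1 x + q *\<^sub>R e2 x) $ 2 = 0" for p q x
  proof -
    have 1: "p * m11 x + q * m12 x = 0" "p * m21 x + q * m22 x = 0"
      using z \<xi>(1) by (simp_all add: linear_add linear_cmul m)
    have 2: "p * d x = (p * m11 x + q * m12 x) * m22 x - (p * m21 x + q * m22 x) * m12 x"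
      "q * d x = (p * m21 x + q * m22 x) * m11 x - (p * m11 x + q * m12 x) * m21 x"
      by (simp_all add: d algebra_simps)
    have "p * d x = 0" "q * d x = 0" by (simp_all only: 2 1 mult_zero_left diff_self)
    then show ?thesis using dnz[OF x] by simp
  qed
  have comm: "fd X1 x (X2 x) = fd X2 x (X1 x)" if x: "x \<in> S1" for x
  proof -
    let ?B = "fd X2 x (X1 x) - fd X1 x (X2 x)"
    obtain p q where inv: "fd e2 x (e1 x) - fd e1 x (e2 x) = p *\<^sub>R e1 x + q *\<^sub>R e2 x"
      using invol[of x] x S1(3) by blast
    have "?B = (fd p2 x (X1 x) - fd p1 x (X2 x)) *\<^sub>R e1 x + (fd q2 x (X1 x) - fd q1 x (X2 x)) *\<^sub>R e2 x
        + (p1 x * q2 x - q1 x * p2 x) *\<^sub>R (p *\<^sub>R e1 x + q *\<^sub>R e2 x)"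
      using bracket_comb[OF es pqs x X] by (simp only: inv)
    also have "\<dots> = (fd p2 x (X1 x) - fd p1 x (X2 x) + (p1 x * q2 x - q1 x * p2 x) * p) *\<^sub>R e1 x
        + (fd q2 x (X1 x) - fd q1 x (X2 x) + (p1 x * q2 x - q1 x * p2 x) * q) *\<^sub>R e2 x"
      by (simp add: scaleR_add_left scaleR_add_right)
    finally obtain a b where B: "?B = a *\<^sub>R e1 x + b *\<^sub>R e2 x" by blast
    have const: "\<xi> (fd Y x v) $ i = 0"
      if Y: "smooth_on S1 Y" and c: "\<And>y. y \<in> S1 \<Longrightarrow> \<xi> (Y y) $ i = c" for Y :: "real ^ 4 \<Rightarrow> real ^ 4" and i c v
    proof -
      have "((\<lambda>y. \<xi> (Y y) $ i) has_derivative (\<lambda>v. \<xi> (fd Y x v) $ i)) (at x)"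
        by (intro bounded_linear.has_derivative[OF bounded_linear_vec_nth] bounded_linear.has_derivative[OF b\<xi>]
            smooth_on_imp_has_derivative[OF Y x])
      moreover have "((\<lambda>y. \<xi> (Y y) $ i) has_derivative (\<lambda>v. 0)) (at x)"
        by (rule has_derivative_cong_open[OF S1(1) x c, THEN iffD2]) auto
      ultimately have "(\<lambda>v. \<xi> (fd Y x v) $ i) = (\<lambda>v. 0)" by (rule has_derivative_unique)
      then show ?thesis by (rule fun_cong)
    qed
    have "\<xi> ?B $ 1 = 0" "\<xi> ?B $ 2 = 0"
      using const[OF Xs(1), of 1] const[OF Xs(1), of 2] const[OF Xs(2), of 1] const[OF Xs(2), of 2] \<xi>X \<xi>(1)
      by (simp_all add: linear_diff)
    then have "a = 0 \<and> b = 0" unfolding B by (rule comb0[OF x])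
    then show ?thesis using B by simp
  qed
  have X0: "X1 x0 = e1 x0" "X2 x0 = e2 x0" by (simp_all add: X pq m0)
  have indepX: "a = 0" if "a $ 1 *\<^sub>R X1 x0 + a $ 2 *\<^sub>R X2 x0 + a $ 3 *\<^sub>R w3 + a $ 4 *\<^sub>R w4 = 0" for a :: "real ^ 4"
    using that unfolding X0 by (rule indep)
  obtain \<Theta> U where U: "open U" "x0 \<in> U" "U \<subseteq> S1" "smooth_on U (\<Theta> :: real ^ 4 \<Rightarrow> real ^ 4)"
    and \<Theta>: "\<And>x. x \<in> U \<Longrightarrow> fd \<Theta> x (X1 x) = axis 1 1" "\<And>x. x \<in> U \<Longrightarrow> fd \<Theta> x (X2 x) = axis 2 1"
    and inj: "\<And>x. x \<in> U \<Longrightarrow> inj (fd \<Theta> x)"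
    by (rule straighten_commuting_fields[OF S1(1,2) Xs, of w3 w4]) (erule comm, erule indepX, rule that)
  \<comment> \<open>Components 3 and 4 of \<Theta> are the first integrals. Their differentials kill
    the straightened fields, and injectivity of the differential of \<Theta> shows that they kill
    nothing outside the span.\<close>
  show ?thesis
  proof (rule that[OF U(1,2) _ U(4)])
    show "U \<subseteq> S" using U(3) S1(3) by blast
    fix x v assume x: "x \<in> U"
    then have x1: "x \<in> S1" using U(3) by blast
    have lin: "linear (fd \<Theta> x)" by (rule smooth_on_imp_linear_fd[OF U(4) x])
    show "fd \<Theta> x v $ 3 = 0 \<and> fd \<Theta> x v $ 4 = 0 \<longleftrightarrow> (\<exists>a b. v = a *\<^sub>R e1 x + b *\<^sub>R e2 x)"
    proof
      assume z: "fd \<Theta> x v $ 3 = 0 \<and> fd \<Theta> x v $ 4 = 0"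
      let ?y = "fd \<Theta> x v"
      have "?y = ?y $ 1 *\<^sub>R axis 1 1 + ?y $ 2 *\<^sub>R axis 2 1 + ?y $ 3 *\<^sub>R axis 3 1 + ?y $ 4 *\<^sub>R axis 4 1"
        by (rule vec_4_expand)
      also have "\<dots> = ?y $ 1 *\<^sub>R axis 1 1 + ?y $ 2 *\<^sub>R axis 2 1" using z by simp
      also have "\<dots> = fd \<Theta> x (?y $ 1 *\<^sub>R X1 x + ?y $ 2 *\<^sub>R X2 x)"
        using \<Theta>[OF x] lin by (simp add: linear_add linear_cmul)
      finally have "v = ?y $ 1 *\<^sub>R X1 x + ?y $ 2 *\<^sub>R X2 x" using inj[OF x] by (simp only: inj_eq)
      also have "\<dots> = (?y $ 1 * p1 x + ?y $ 2 * p2 x) *\<^sub>R e1 x + (?y $ 1 * q1 x + ?y $ 2 * q2 x) *\<^sub>R e2 x"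
        by (simp add: X algebra_simps)
      finally show "\<exists>a b. v = a *\<^sub>R e1 x + b *\<^sub>R e2 x" by blast
    next
      assume "\<exists>a b. v = a *\<^sub>R e1 x + b *\<^sub>R e2 x"
      then obtain a b where v: "v = a *\<^sub>R e1 x + b *\<^sub>R e2 x" by blast
      have "e1 x = m11 x *\<^sub>R X1 x + m21 x *\<^sub>R X2 x" "e2 x = m12 x *\<^sub>R X1 x + m22 x *\<^sub>R X2 x"
      proof -
        have "m11 x *\<^sub>R X1 x + m21 x *\<^sub>R X2 x
            = (m11 x * p1 x + m21 x * p2 x) *\<^sub>R e1 x + (m11 x * q1 x + m21 x * q2 x) *\<^sub>R e2 x"
          "m12 x *\<^sub>R X1 x + m22 x *\<^sub>R X2 x
            = (m12 x * p1 x + m22 x * p2 x) *\<^sub>R e1 x + (m12 x * q1 x + m22 x * q2 x) *\<^sub>R e2 x"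
          by (simp_all add: X algebra_simps)
        then show "e1 x = m11 x *\<^sub>R X1 x + m21 x *\<^sub>R X2 x" "e2 x = m12 x *\<^sub>R X1 x + m22 x *\<^sub>R X2 x"
          using mp[OF x1] by simp_all
      qed
      then have "fd \<Theta> x (e1 x) = m11 x *\<^sub>R axis 1 1 + m21 x *\<^sub>R axis 2 1"
        "fd \<Theta> x (e2 x) = m12 x *\<^sub>R axis 1 1 + m22 x *\<^sub>R axis 2 1"
        by (simp_all only: linear_add[OF lin] linear_cmul[OF lin] \<Theta>[OF x])
      then show "fd \<Theta> x v $ 3 = 0 \<and> fd \<Theta> x v $ 4 = 0"
        using lin by (simp add: v linear_add linear_cmul axis_def)
    qed
  qed
qed

section \<open>Charts and tangent vectors\<close>

text \<open>Product rule for a derivative applied to a moving vector. Symmetry of the second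
  derivative moves \<open>v\<close> to the inner slot, the form in which the second-order terms
  cancel in the transformation of Lie brackets.\<close>

lemma fd_fd_apply:
  fixes \<phi> :: "'a::euclidean_space \<Rightarrow> 'b::real_normed_vector"
  assumes S: "open S" "smooth_on S \<phi>" "x \<in> S" and w: "w differentiable (at x)"
  shows "fd (\<lambda>y. fd \<phi> y (w y)) x v = fd \<phi> x (fd w x v) + fd (\<lambda>y. fd \<phi> y v) x (w x)"
proof -
  note lin = smooth_on_imp_linear_fd[OF S(2)]
  have d: "((\<lambda>y. fd \<phi> y b) has_derivative fd (\<lambda>y. fd \<phi> y b) x) (at x)" for b
    by (rule smooth_on_imp_has_derivative[OF smooth_on_fd[OF S(2)] S(3)])
  have "((\<lambda>y. \<Sum>b\<in>Basis. (w y \<bullet> b) *\<^sub>R fd \<phi> y b) has_derivative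
    (\<lambda>v. \<Sum>b\<in>Basis. (w x \<bullet> b) *\<^sub>R fd (\<lambda>y. fd \<phi> y b) x v + (fd w x v \<bullet> b) *\<^sub>R fd \<phi> x b)) (at x)"
    by (intro has_derivative_sum has_derivative_scaleR d has_derivative_inner_left fd_works w)
  then have "((\<lambda>y. fd \<phi> y (w y)) has_derivative
    (\<lambda>v. \<Sum>b\<in>Basis. (w x \<bullet> b) *\<^sub>R fd (\<lambda>y. fd \<phi> y b) x v + (fd w x v \<bullet> b) *\<^sub>R fd \<phi> x b)) (at x)"
    by (rule has_derivative_cong_open[OF S(1) S(3), THEN iffD1, rotated]) (rule linear_basis_expand[OF lin, symmetric])
  from fun_cong[OF fd_eqI[OF this], of v]
  have "fd (\<lambda>y. fd \<phi> y (w y)) x v = (\<Sum>b\<in>Basis. (w x \<bullet> b) *\<^sub>R fd (\<lambda>y. fd \<phi> y b) x v)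
      + (\<Sum>b\<in>Basis. (fd w x v \<bullet> b) *\<^sub>R fd \<phi> x b)"
    by (simp only: sum.distrib)
  also have "(\<Sum>b\<in>Basis. (w x \<bullet> b) *\<^sub>R fd (\<lambda>y. fd \<phi> y b) x v) = (\<Sum>b\<in>Basis. (w x \<bullet> b) *\<^sub>R fd (\<lambda>y. fd \<phi> y v) x b)"
    by (intro sum.cong refl arg_cong2[where f = scaleR] smooth_on_fd_commute[OF S(1,2,3)])
  also have "\<dots> = fd (\<lambda>y. fd \<phi> y v) x (w x)"
    by (rule linear_basis_expand[symmetric]) (rule smooth_on_imp_linear_fd[OF smooth_on_fd[OF S(2)] S(3)])
  also have "(\<Sum>b\<in>Basis. (fd w x v \<bullet> b) *\<^sub>R fd \<phi> x b) = fd \<phi> x (fd w x v)"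
    by (rule linear_basis_expand[symmetric]) (rule lin[OF S(3)])
  finally show ?thesis by simp
qed

locale mfd =
  fixes T :: "'a topology" and A :: "('a, 'n::finite) chart set"
  assumes mfd: "smooth_manifold T A"
begin

lemma is_chart: "c \<in> A \<Longrightarrow> is_chart T c"
  and compatible: "c \<in> A \<Longrightarrow> d \<in> A \<Longrightarrow> compatible c d"
  and maximal: "is_chart T c \<Longrightarrow> (\<And>d. d \<in> A \<Longrightarrow> compatible c d) \<Longrightarrow> c \<in> A"
  and cover: "(\<Union>c\<in>A. cdom c) = topspace T"
  using mfd unfolding smooth_manifold_def by blast+

lemma open_cdom: "c \<in> A \<Longrightarrow> openin T (cdom c)"
  and open_cmap: "c \<in> A \<Longrightarrow> open (cmap c ` cdom c)"
  and homeo: "c \<in> A \<Longrightarrow> homeomorphic_map (subtopology T (cdom c)) (top_of_set (cmap c ` cdom c)) (cmap c)"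
  using is_chart unfolding is_chart_def by blast+

lemma topspace_cdom: "c \<in> A \<Longrightarrow> topspace (subtopology T (cdom c)) = cdom c"
  using openin_subset[OF open_cdom] by (simp add: inf.absorb2)

lemma inj_cmap: "c \<in> A \<Longrightarrow> inj_on (cmap c) (cdom c)"
  using homeo[of c] topspace_cdom[of c] by (simp add: homeomorphic_eq_everything_map)

lemma cinv_cmap: "c \<in> A \<Longrightarrow> p \<in> cdom c \<Longrightarrow> cinv c (cmap c p) = p"
  unfolding cinv_def by (rule inv_into_f_f[OF inj_cmap])

lemma cmap_cinv: "x \<in> cmap c ` cdom c \<Longrightarrow> cmap c (cinv c x) = x"
  unfolding cinv_def by (rule f_inv_into_f)

lemma cinv_cdom: "x \<in> cmap c ` cdom c \<Longrightarrow> cinv c x \<in> cdom c"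
  unfolding cinv_def by (rule inv_into_into)

lemma open_cmap_image:
  assumes "c \<in> A" "openin T W" "W \<subseteq> cdom c"
  shows "open (cmap c ` W)"
proof -
  have "openin (subtopology T (cdom c)) W"
    using assms(2,3) by (simp add: openin_subset_topspace_eq openin_subtopology) blast
  then have "openin (top_of_set (cmap c ` cdom c)) (cmap c ` W)"
    using homeomorphic_imp_open_map[OF homeo[OF assms(1)]] by (simp add: open_map_def)
  then show ?thesis using openin_open_eq[OF open_cmap[OF assms(1)]] by blast
qed

lemma cinv_image_eq: "c \<in> A \<Longrightarrow> X \<subseteq> cmap c ` cdom c \<Longrightarrow> cinv c ` X = {p \<in> cdom c. cmap c p \<in> X}"
proof (intro equalityI subsetI)
  assume c: "c \<in> A" and X: "X \<subseteq> cmap c ` cdom c"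
  show "p \<in> {p \<in> cdom c. cmap c p \<in> X}" if p: "p \<in> cinv c ` X" for p
  proof -
    obtain x where x: "x \<in> X" "p = cinv c x" using p by blast
    then have "x \<in> cmap c ` cdom c" using X by blast
    with x show ?thesis using cmap_cinv[of x c] cinv_cdom[of x c] by simp
  qed
  show "p \<in> cinv c ` X" if p: "p \<in> {p \<in> cdom c. cmap c p \<in> X}" for p
    using p cinv_cmap[OF c, of p] by (metis (no_types, lifting) image_eqI mem_Collect_eq)
qed

lemma open_cinv_image:
  assumes "c \<in> A" "open X" "X \<subseteq> cmap c ` cdom c"
  shows "openin T (cinv c ` X)"
proof -
  have "openin (top_of_set (cmap c ` cdom c)) X" using assms(2,3) by (rule open_subset[rotated])
  then have "openin (subtopology T (cdom c)) {p \<in> cdom c. cmap c p \<in> X}"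
    using openin_continuous_map_preimage[OF homeomorphic_imp_continuous_map[OF homeo[OF assms(1)]], of X]
    unfolding topspace_cdom[OF assms(1)] by blast
  then show ?thesis
    unfolding cinv_image_eq[OF assms(1,3)] using openin_trans_full open_cdom[OF assms(1)] by blast
qed

lemma cmap_cinv_image: "X \<subseteq> cmap c ` cdom c \<Longrightarrow> cmap c ` cinv c ` X = X"
proof -
  assume X: "X \<subseteq> cmap c ` cdom c"
  have "(\<lambda>x. cmap c (cinv c x)) ` X = (\<lambda>x. x) ` X"
    by (rule image_cong[OF refl]) (rule cmap_cinv, rule subsetD[OF X])
  then show ?thesis by (simp add: image_image)
qed

lemma cinv_mem: "c \<in> A \<Longrightarrow> W \<subseteq> cdom c \<Longrightarrow> x \<in> cmap c ` W \<Longrightarrow> cinv c x \<in> W"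
proof -
  assume c: "c \<in> A" "W \<subseteq> cdom c" and "x \<in> cmap c ` W"
  then obtain p where "p \<in> W" "x = cmap c p" by blast
  then show ?thesis using cinv_cmap[OF c(1), of p] c(2) by auto
qed

lemma smooth_transition:
  "c \<in> A \<Longrightarrow> d \<in> A \<Longrightarrow> smooth_on (cmap c ` (cdom c \<inter> cdom d)) (transition c d)"
  using compatible[of c d] by (simp add: compatible_def)

lemma open_overlap: "c \<in> A \<Longrightarrow> d \<in> A \<Longrightarrow> open (cmap c ` (cdom c \<inter> cdom d))"
  by (rule open_cmap_image) (auto intro: open_cdom)

lemma transition_cmap: "c \<in> A \<Longrightarrow> p \<in> cdom c \<Longrightarrow> transition c d (cmap c p) = cmap d p"
  by (simp add: transition_def cinv_cmap)

lemma cinv_transition: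
  "c \<in> A \<Longrightarrow> d \<in> A \<Longrightarrow> x \<in> cmap c ` (cdom c \<inter> cdom d) \<Longrightarrow> cinv d (transition c d x) = cinv c x"
  by (auto simp: transition_cmap cinv_cmap)

section \<open>Differentials of coordinate changes and tangent vectors\<close>

definition tmap :: "('a, 'n) chart \<Rightarrow> ('a, 'n) chart \<Rightarrow> 'a \<Rightarrow> real ^ 'n \<Rightarrow> real ^ 'n" where
  "tmap c d p = fd (transition c d) (cmap c p)"

lemma transition_has_derivative:
  assumes "c \<in> A" "d \<in> A" "p \<in> cdom c" "p \<in> cdom d"
  shows "(transition c d has_derivative tmap c d p) (at (cmap c p))"
  unfolding tmap_def using smooth_transition[OF assms(1,2)] assms(3,4)
  by (intro smooth_on_imp_has_derivative) auto

lemma tmap_linear: "c \<in> A \<Longrightarrow> d \<in> A \<Longrightarrow> p \<in> cdom c \<Longrightarrow> p \<in> cdom d \<Longrightarrow> linear (tmap c d p)"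
  using transition_has_derivative has_derivative_linear by blast

lemma tmap_self: "c \<in> A \<Longrightarrow> p \<in> cdom c \<Longrightarrow> tmap c c p v = v"
proof -
  assume c: "c \<in> A" "p \<in> cdom c"
  have "fd (transition c c) (cmap c p) = fd (\<lambda>x. x) (cmap c p)"
    by (rule fd_cong_open[OF open_cmap[OF c(1)]]) (use c in \<open>auto simp: transition_cmap\<close>)
  also have "\<dots> = (\<lambda>v. v)" by (rule fd_eqI) (rule has_derivative_ident)
  finally show ?thesis by (simp add: tmap_def)
qed

lemma tmap_compose:
  assumes "c \<in> A" "d \<in> A" "e \<in> A" "p \<in> cdom c" "p \<in> cdom d" "p \<in> cdom e"
  shows "tmap d e p (tmap c d p v) = tmap c e p v"
proof -
  let ?S = "cmap c ` (cdom c \<inter> cdom d \<inter> cdom e)"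
  have S: "open ?S" by (rule open_cmap_image) (auto intro!: openin_Int open_cdom assms)
  have pS: "cmap c p \<in> ?S" using assms by blast
  have td: "(transition d e has_derivative tmap d e p) (at (transition c d (cmap c p)))"
    using transition_has_derivative[of d e p] assms by (simp add: transition_cmap)
  have "((\<lambda>x. transition d e (transition c d x)) has_derivative (\<lambda>v. tmap d e p (tmap c d p v))) (at (cmap c p))"
    by (rule has_derivative_compose[OF transition_has_derivative td]) (use assms in auto)
  then have "(transition c e has_derivative (\<lambda>v. tmap d e p (tmap c d p v))) (at (cmap c p))"
    by (rule has_derivative_cong_open[OF S pS, THEN iffD1, rotated]) (use assms in \<open>auto simp: transition_cmap\<close>)
  from fd_eqI[OF this] show ?thesis by (simp add: tmap_def)
qed

lemma tmap_inverse:
  assumes "c \<in> A" "d \<in> A" "p \<in> cdom c" "p \<in> cdom d"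
  shows "tmap d c p (tmap c d p v) = v"
  using tmap_compose[of c d c p v] tmap_self[of c p v] assms by simp

text \<open>Every tangent vector at \<open>p\<close> is \<open>tv c p u\<close> for exactly one
  \<open>u\<close>, namely its component vector in \<open>c\<close> (see \<open>tangent_eq\<close>
  and \<open>tv_inj\<close>). This reduces statements about families of components to statements in
  one chart.\<close>

definition tv :: "('a, 'n) chart \<Rightarrow> 'a \<Rightarrow> real ^ 'n \<Rightarrow> ('a, 'n) tvec" where
  "tv c p u = (\<lambda>d. if d \<in> charts_at A p then tmap c d p u else 0)"

lemma coord_field_eq: "coord_field A c i p = tv c p (axis i 1)"
  by (auto simp: coord_field_def tv_def tmap_def)

lemma tv_component: "d \<in> A \<Longrightarrow> p \<in> cdom d \<Longrightarrow> tv c p u d = tmap c d p u"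
  by (simp add: tv_def charts_at_def)

lemma tv_component_self: "c \<in> A \<Longrightarrow> p \<in> cdom c \<Longrightarrow> tv c p u c = u"
  by (simp add: tv_component tmap_self)

lemma tv_tangent: "c \<in> A \<Longrightarrow> p \<in> cdom c \<Longrightarrow> tv c p u \<in> tangent_space A p"
  unfolding tangent_space_def
  by (auto simp: tv_def charts_at_def tmap_def[symmetric] tmap_compose)

lemma tangent_eq: "c \<in> A \<Longrightarrow> p \<in> cdom c \<Longrightarrow> v \<in> tangent_space A p \<Longrightarrow> v = tv c p (v c)"
proof (rule ext)
  fix d assume "c \<in> A" "p \<in> cdom c" and "v \<in> tangent_space A p"
  then have c: "c \<in> charts_at A p" by (simp add: charts_at_def)
  note v = \<open>v \<in> tangent_space A p\<close>[unfolded tangent_space_def mem_Collect_eq]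
  show "v d = tv c p (v c) d"
  proof (cases "d \<in> charts_at A p")
    case True
    then have "v d = fd (transition c d) (cmap c p) (v c)" using v c by blast
    then show ?thesis by (simp only: tv_def tmap_def True if_True)
  next
    case False
    then have "v d = 0" using v by blast
    then show ?thesis by (simp only: tv_def False if_False)
  qed
qed

lemma tv_change:
  assumes "c \<in> A" "d \<in> A" "p \<in> cdom c" "p \<in> cdom d"
  shows "tv c p u = tv d p (tmap c d p u)"
proof -
  have "tv c p u = tv d p (tv c p u d)"
    by (rule tangent_eq[OF assms(2,4) tv_tangent[OF assms(1,3)]])
  then show ?thesis by (simp only: tv_component[OF assms(2,4)])
qed

lemma tv_lincomb:
  assumes "c \<in> A" "p \<in> cdom c"
  shows "tv c p (a *\<^sub>R u + b *\<^sub>R v) = lincomb a (tv c p u) b (tv c p v)"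
  unfolding tv_def lincomb_def
  using tmap_linear[OF assms(1) _ assms(2)] by (auto simp: charts_at_def linear_add linear_cmul)

lemma tv_inj: "c \<in> A \<Longrightarrow> p \<in> cdom c \<Longrightarrow> tv c p u = tv c p v \<longleftrightarrow> u = v"
  using tv_component_self by metis

lemma tv_0: "c \<in> A \<Longrightarrow> p \<in> cdom c \<Longrightarrow> tv c p 0 = (\<lambda>_. 0)"
  using tv_lincomb[of c p 0 0 0 0] by (simp add: lincomb_def)

section \<open>Smooth functions on open subsets\<close>

lemma smooth_fun_onD:
  "smooth_fun_on A W f \<Longrightarrow> c \<in> A \<Longrightarrow> W \<subseteq> cdom c \<Longrightarrow> smooth_on (cmap c ` W) (\<lambda>x. f (cinv c x))"
  unfolding smooth_fun_on_def by (auto simp: comp_def inf.absorb2)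

text \<open>\<open>smooth_fun_on\<close> quantifies over all charts of the atlas; composition with
  the smooth transition maps reduces this to a single chart containing the set.\<close>

lemma smooth_fun_onI:
  assumes c: "c \<in> A" and W: "openin T W" "W \<subseteq> cdom c" and f: "smooth_on (cmap c ` W) (\<lambda>x. f (cinv c x))"
  shows "smooth_fun_on A W f"
  unfolding smooth_fun_on_def
proof
  fix d assume d: "d \<in> A"
  let ?S = "cmap d ` (cdom d \<inter> W)"
  have S: "open ?S" by (rule open_cmap_image[OF d]) (use open_cdom[OF d] W in auto)
  have "smooth_on ?S (\<lambda>x. f (cinv c (transition d c x)))"
  proof (rule smooth_on_compose[OF S open_cmap_image[OF c W] _ f])
    show "transition d c ` ?S \<subseteq> cmap c ` W" using d by (auto simp: transition_cmap)
    show "smooth_on ?S (transition d c)"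
      by (rule smooth_on_subset[OF smooth_transition[OF d c]]) (use W in auto)
  qed
  then show "smooth_on ?S (f \<circ> cinv d)"
  proof (rule smooth_on_cong[OF S, THEN iffD1, rotated])
    fix x assume "x \<in> ?S"
    then have "cinv c (transition d c x) = cinv d x" using W by (intro cinv_transition c d) auto
    then show "f (cinv c (transition d c x)) = (f \<circ> cinv d) x" by simp
  qed
qed

lemma smooth_fun_on_compose:
  fixes h :: "real \<Rightarrow> real"
  assumes W: "openin T W" and f: "smooth_fun_on A W f" and X: "open X" "smooth_on X h" "\<And>p. p \<in> W \<Longrightarrow> f p \<in> X"
  shows "smooth_fun_on A W (\<lambda>p. h (f p))"
  unfolding smooth_fun_on_def
proof
  fix c assume c: "c \<in> A"
  let ?S = "cmap c ` (cdom c \<inter> W)"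
  have S: "open ?S" by (rule open_cmap_image[OF c]) (use open_cdom[OF c] W in auto)
  have "smooth_on ?S (\<lambda>x. h ((f \<circ> cinv c) x))"
  proof (rule smooth_on_compose[OF S X(1) _ X(2)])
    show "smooth_on ?S (f \<circ> cinv c)" using f c by (simp add: smooth_fun_on_def)
    show "(f \<circ> cinv c) ` ?S \<subseteq> X" using X(3) cinv_cmap[OF c] by auto
  qed
  then show "smooth_on ?S ((\<lambda>p. h (f p)) \<circ> cinv c)" by (simp add: comp_def)
qed

lemma smooth_fun_on_mult:
  assumes W: "openin T W" and f: "smooth_fun_on A W f" "smooth_fun_on A W g"
  shows "smooth_fun_on A W (\<lambda>p. f p * g p)"
  unfolding smooth_fun_on_def
proof
  fix c assume c: "c \<in> A"
  have S: "open (cmap c ` (cdom c \<inter> W))" by (rule open_cmap_image[OF c]) (use open_cdom[OF c] W in auto)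
  show "smooth_on (cmap c ` (cdom c \<inter> W)) ((\<lambda>p. f p * g p) \<circ> cinv c)"
    using smooth_on_mult[OF S, of "f \<circ> cinv c" "g \<circ> cinv c"] f c
    by (simp add: smooth_fun_on_def comp_def)
qed

lemma smooth_fun_on_add:
  assumes W: "openin T W" and f: "smooth_fun_on A W f" "smooth_fun_on A W g"
  shows "smooth_fun_on A W (\<lambda>p. f p + g p)"
  unfolding smooth_fun_on_def
proof
  fix c assume c: "c \<in> A"
  have S: "open (cmap c ` (cdom c \<inter> W))" by (rule open_cmap_image[OF c]) (use open_cdom[OF c] W in auto)
  show "smooth_on (cmap c ` (cdom c \<inter> W)) ((\<lambda>p. f p + g p) \<circ> cinv c)"
    using smooth_on_add[OF S, of "f \<circ> cinv c" "g \<circ> cinv c"] f c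
    by (simp add: smooth_fun_on_def comp_def)
qed

lemma smooth_fun_on_cong:
  assumes W: "openin T W" and eq: "\<And>p. p \<in> W \<Longrightarrow> f p = g p" and g: "smooth_fun_on A W g"
  shows "smooth_fun_on A W f"
  unfolding smooth_fun_on_def
proof
  fix c assume c: "c \<in> A"
  have S: "open (cmap c ` (cdom c \<inter> W))" by (rule open_cmap_image[OF c]) (use open_cdom[OF c] W in auto)
  show "smooth_on (cmap c ` (cdom c \<inter> W)) (f \<circ> cinv c)"
    by (rule smooth_on_cong[OF S, THEN iffD2, of _ "g \<circ> cinv c"])
       (use g c eq cinv_cmap[OF c] in \<open>auto simp: smooth_fun_on_def\<close>)
qed

lemma smooth_fun_on_const: "smooth_fun_on A W (\<lambda>p. k)"
  by (simp add: smooth_fun_on_def comp_def smooth_on_const)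

text \<open>By the inverse function theorem \<Phi> composed with the old coordinates is a chart near
  \<open>p\<close> compatible with the atlas, and maximality makes it a member. All special
  coordinates below are produced in this way, and its last conclusion is what computes the
  components of tangent vectors in them.\<close>

lemma chart_change:
  assumes c: "c \<in> A" "p \<in> cdom c" and W: "openin T W" "p \<in> W" "W \<subseteq> cdom c"
    and \<Phi>: "smooth_on (cmap c ` W) \<Phi>" "inj (fd \<Phi> (cmap c p))"
  obtains c' where "c' \<in> A" "p \<in> cdom c'" "cdom c' \<subseteq> W"
    "\<And>q. q \<in> cdom c' \<Longrightarrow> cmap c' q = \<Phi> (cmap c q)"
    "\<And>q v. q \<in> cdom c' \<Longrightarrow> tmap c c' q v = fd \<Phi> (cmap c q) v"
proof -
  have oW: "open (cmap c ` W)" by (rule open_cmap_image[OF c(1) W(1,3)])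
  have pW: "cmap c p \<in> cmap c ` W" using W by blast
  obtain U g where U: "open U" "cmap c p \<in> U" "U \<subseteq> cmap c ` W" "open (\<Phi> ` U)" "inj_on \<Phi> U" "smooth_on (\<Phi> ` U) g"
    and g: "\<And>x. x \<in> U \<Longrightarrow> g (\<Phi> x) = x" "\<And>x v. x \<in> U \<Longrightarrow> fd g (\<Phi> x) (fd \<Phi> x v) = v"
    "\<And>x v. x \<in> U \<Longrightarrow> fd \<Phi> x (fd g (\<Phi> x) v) = v"
    by (rule smooth_inverse_function[OF oW \<Phi>(1) pW \<Phi>(2)]) (rule that)
  have Us: "U \<subseteq> cmap c ` cdom c" using U(3) W(3) by blast
  define N where "N = cinv c ` U"
  have N: "N = {q \<in> cdom c. cmap c q \<in> U}" unfolding N_def by (rule cinv_image_eq[OF c(1) Us])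
  have oN: "openin T N" unfolding N_def by (rule open_cinv_image[OF c(1) U(1) Us])
  have cN: "cmap c ` N = U" unfolding N_def by (rule cmap_cinv_image[OF Us])
  have Nc: "N \<subseteq> cdom c" using N by blast
  define c' where "c' = (N, \<Phi> \<circ> cmap c)"
  have c': "cdom c' = N" "cmap c' = \<Phi> \<circ> cmap c" by (simp_all add: c'_def)
  have im: "cmap c' ` N = \<Phi> ` U" using cN by (simp only: c' image_comp[symmetric])
  have "homeomorphic_map (subtopology T N) (top_of_set (\<Phi> ` U)) (\<Phi> \<circ> cmap c)"
  proof (rule homeomorphic_map_compose)
    have "homeomorphic_map (subtopology (subtopology T (cdom c)) N)
        (subtopology (top_of_set (cmap c ` cdom c)) U) (cmap c)"
      by (rule homeomorphic_map_subtopologies[OF homeo[OF c(1)]])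
         (use topspace_cdom[OF c(1)] cN Nc Us in \<open>auto simp: inf.absorb2\<close>)
    then show "homeomorphic_map (subtopology T N) (top_of_set U) (cmap c)"
      using Nc Us by (simp add: subtopology_subtopology inf.absorb2)
    have "homeomorphic_maps (top_of_set U) (top_of_set (\<Phi> ` U)) \<Phi> g"
      unfolding homeomorphic_maps_def continuous_map_subtopology_eu
      using smooth_on_imp_continuous_on[OF smooth_on_subset[OF \<Phi>(1) U(3)]] smooth_on_imp_continuous_on[OF U(6)] g(1)
      by auto
    then show "homeomorphic_map (top_of_set U) (top_of_set (\<Phi> ` U)) \<Phi>"
      using homeomorphic_map_maps by blast
  qed
  then have ch: "is_chart T c'" using oN U(4) im by (simp add: is_chart_def c')
  have injN: "inj_on (cmap c') N"
    using U(5) cN inj_on_subset[OF inj_cmap[OF c(1)] Nc] by (simp add: c' comp_inj_on)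
  have cinv': "cinv c' (\<Phi> x) = cinv c x" if "x \<in> U" for x
  proof -
    have "cinv c x \<in> N" using that by (simp add: N_def)
    moreover have "cmap c' (cinv c x) = \<Phi> x" using cmap_cinv[of x c] that Us by (auto simp: c')
    ultimately show ?thesis unfolding cinv_def c'(1) using inv_into_f_f[OF injN] by (metis cinv_def)
  qed
  have "compatible c' d" if d: "d \<in> A" for d
    unfolding compatible_def
  proof
    let ?S = "cmap c ` (N \<inter> cdom d)"
    have S: "open ?S" "?S \<subseteq> U" by (rule open_cmap_image[OF c(1)]) (use oN open_cdom[OF d] Nc cN in auto)
    have im': "cmap c' ` (N \<inter> cdom d) = \<Phi> ` ?S" by (simp add: c' image_comp)
    have \<Phi>S: "\<Phi> ` ?S = \<Phi> ` U \<inter> g -` ?S"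
    proof (intro equalityI subsetI)
      show "y \<in> \<Phi> ` U \<inter> g -` ?S" if y: "y \<in> \<Phi> ` ?S" for y
      proof -
        obtain x where "x \<in> ?S" "y = \<Phi> x" using y by blast
        then show ?thesis using S(2) g(1)[of x] by auto
      qed
      show "y \<in> \<Phi> ` ?S" if y: "y \<in> \<Phi> ` U \<inter> g -` ?S" for y
      proof -
        obtain x where "x \<in> U" "y = \<Phi> x" using y by blast
        then show ?thesis using y g(1)[of x] by auto
      qed
    qed
    have o: "open (\<Phi> ` ?S)"
      unfolding \<Phi>S by (rule continuous_open_preimage[OF smooth_on_imp_continuous_on[OF U(6)] U(4) S(1)])
    have "smooth_on (\<Phi> ` ?S) (\<lambda>y. transition c d (g y))"
    proof (rule smooth_on_compose[OF o open_overlap[OF c(1) d] _ smooth_transition[OF c(1) d]])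
      show "smooth_on (\<Phi> ` ?S) g" by (rule smooth_on_subset[OF U(6)]) (use S(2) in auto)
      show "g ` \<Phi> ` ?S \<subseteq> cmap c ` (cdom c \<inter> cdom d)"
        unfolding \<Phi>S using Nc by blast
    qed
    then show "smooth_on (cmap c' ` (cdom c' \<inter> cdom d)) (transition c' d)"
      unfolding c'(1) im'
    proof (rule smooth_on_cong[OF o, THEN iffD1, rotated])
      fix y assume "y \<in> \<Phi> ` ?S"
      then obtain x where x: "x \<in> ?S" "y = \<Phi> x" by (rule imageE)
      then have "x \<in> U" using S(2) by blast
      then show "transition c d (g y) = transition c' d y"
        using x(2) g(1) cinv' by (simp add: transition_def)
    qed
    let ?R = "cmap d ` (cdom d \<inter> N)"
    have R: "open ?R" by (rule open_cmap_image[OF d]) (use oN open_cdom[OF d] in auto)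
    have "smooth_on ?R (\<lambda>x. \<Phi> (transition d c x))"
    proof (rule smooth_on_compose[OF R oW _ \<Phi>(1)])
      show "transition d c ` ?R \<subseteq> cmap c ` W"
      proof clarify
        fix q assume "q \<in> cdom d" "q \<in> N"
        then have "cmap c q \<in> U" "transition d c (cmap d q) = cmap c q"
          using cN transition_cmap[OF d, of q c] by auto
        then show "transition d c (cmap d q) \<in> cmap c ` W" using U(3) by auto
      qed
      show "smooth_on ?R (transition d c)"
        by (rule smooth_on_subset[OF smooth_transition[OF d c(1)]]) (use Nc in auto)
    qed
    then show "smooth_on (cmap d ` (cdom c' \<inter> cdom d)) (transition d c')"
      by (simp add: c' Int_commute transition_def comp_def)
  qed
  then have cA: "c' \<in> A" by (rule maximal[OF ch])
  have val: "cmap c' q = \<Phi> (cmap c q)" for q by (simp add: c')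
  show ?thesis
  proof (rule that[OF cA])
    show "p \<in> cdom c'" using c U(2) by (simp add: c' N)
    show "cdom c' \<subseteq> W"
    proof
      fix q assume "q \<in> cdom c'"
      then have q: "q \<in> cdom c" "cmap c q \<in> cmap c ` W" using U(3) by (auto simp: c' N)
      then show "q \<in> W" using cinv_mem[OF c(1) W(3) q(2)] cinv_cmap[OF c(1) q(1)] by simp
    qed
    show "tmap c c' q v = fd \<Phi> (cmap c q) v" if q: "q \<in> cdom c'" for q v
    proof -
      have qU: "cmap c q \<in> U" using q by (simp add: c' N)
      have "fd (transition c c') (cmap c q) = fd \<Phi> (cmap c q)"
      proof (rule fd_cong_open[OF U(1) qU])
        fix y assume "y \<in> U"
        then show "transition c c' y = \<Phi> y" using cmap_cinv[of y c] Us by (auto simp: transition_def c')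
      qed
      then show ?thesis by (simp add: tmap_def)
    qed
  qed (rule val)
qed

end

section \<open>Lie brackets and coordinate distributions\<close>

lemma vec_sum_axis: "(v :: real ^ 'n) = (\<Sum>j\<in>UNIV. v $ j *\<^sub>R axis j 1)"
  by (simp add: vec_eq_iff axis_def if_distrib sum.delta cong: if_cong)

lemma linear_sum_axis:
  fixes L :: "real ^ 'n \<Rightarrow> 'b::real_vector"
  assumes "linear L"
  shows "L v = (\<Sum>j\<in>UNIV. v $ j *\<^sub>R L (axis j 1))"
proof -
  have "L v = L (\<Sum>j\<in>UNIV. v $ j *\<^sub>R axis j 1)" using vec_sum_axis[of v] by (rule arg_cong)
  then show ?thesis by (simp only: linear_sum[OF assms] linear_cmul[OF assms])
qed

lemma fd_nth: "f differentiable (at x) \<Longrightarrow> fd (\<lambda>y. f y $ i) x v = fd f x v $ i"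
  by (rule fun_cong[OF fd_eqI]) (rule bounded_linear.has_derivative[OF bounded_linear_vec_nth fd_works])

context mfd
begin

section \<open>The Lie bracket in charts\<close>

lemma smooth_vector_field_component:
  assumes X: "smooth_vector_field_on A V X" and V: "openin T V" and c: "c \<in> A"
  shows "smooth_on (cmap c ` (cdom c \<inter> V)) (\<lambda>x. X (cinv c x) c)"
proof (rule smooth_on_vec)
  show "open (cmap c ` (cdom c \<inter> V))" by (rule open_cmap_image[OF c]) (auto intro!: openin_Int open_cdom c V)
  fix i
  have "smooth_fun_on A (cdom c \<inter> V) (\<lambda>p. X p c $ i)"
    using X c unfolding smooth_vector_field_on_def by blast
  then show "smooth_on (cmap c ` (cdom c \<inter> V)) (\<lambda>x. X (cinv c x) c $ i)"
    by (rule smooth_fun_onD[OF _ c]) simp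
qed

text \<open>Turns the sum over coordinates into a directional derivative of component maps on
  Euclidean space, to which the chain rule and symmetry of second derivatives apply.\<close>

lemma lie_bracket_eq:
  assumes X: "smooth_vector_field_on A V X" and Y: "smooth_vector_field_on A V Y"
    and V: "openin T V" "p \<in> V" and c: "c \<in> A" "p \<in> cdom c"
  shows "lie_bracket A X Y p c = fd (\<lambda>x. Y (cinv c x) c) (cmap c p) (X p c)
    - fd (\<lambda>x. X (cinv c x) c) (cmap c p) (Y p c)"
proof -
  let ?x = "cmap c p"
  have x: "?x \<in> cmap c ` (cdom c \<inter> V)" using V c by blast
  have *: "(\<Sum>j\<in>UNIV. v $ j * coord_deriv c j (\<lambda>q. Z q c $ i) p) = fd (\<lambda>x. Z (cinv c x) c) ?x v $ i"
    if Z: "smooth_vector_field_on A V Z" for Z i v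
  proof -
    have sm: "smooth_on (cmap c ` (cdom c \<inter> V)) (\<lambda>x. Z (cinv c x) c)"
      by (rule smooth_vector_field_component[OF Z V(1) c(1)])
    have dif: "(\<lambda>x. Z (cinv c x) c) differentiable (at ?x)"
      by (rule smooth_on_imp_differentiable[OF sm x])
    have "coord_deriv c j (\<lambda>q. Z q c $ i) p = fd (\<lambda>x. Z (cinv c x) c) ?x (axis j 1) $ i" for j
      unfolding coord_deriv_def comp_def by (rule fd_nth[OF dif])
    then show ?thesis
      using linear_sum_axis[OF linear_fd[OF dif], of v] by simp
  qed
  have "c \<in> charts_at A p" using c by (simp add: charts_at_def)
  then show ?thesis
    unfolding lie_bracket_def vec_eq_iff by (simp add: sum_subtractf *[OF X] *[OF Y])
qed

lemma tangent_component:
  "v \<in> tangent_space A p \<Longrightarrow> c \<in> A \<Longrightarrow> d \<in> A \<Longrightarrow> p \<in> cdom c \<Longrightarrow> p \<in> cdom d \<Longrightarrow> v d = tmap c d p (v c)"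
  unfolding tangent_space_def mem_Collect_eq tmap_def charts_at_def by blast

text \<open>The bracket is defined chart by chart, so its components must be shown to transform by
  \<open>tmap\<close>. Each of the two derivatives picks up a second derivative of the transition
  map evaluated on X and Y; by symmetry these cancel in the difference.\<close>

lemma lie_bracket_tangent:
  assumes X: "smooth_vector_field_on A V X" and Y: "smooth_vector_field_on A V Y"
    and V: "openin T V" "p \<in> V"
  shows "lie_bracket A X Y p \<in> tangent_space A p"
proof -
  have main: "lie_bracket A X Y p d = tmap c d p (lie_bracket A X Y p c)"
    if c: "c \<in> A" "p \<in> cdom c" and d: "d \<in> A" "p \<in> cdom d" for c d
  proof -
    let ?\<phi> = "transition c d" and ?x = "cmap c p"
    let ?S = "cmap c ` (cdom c \<inter> (cdom d \<inter> V))"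
    have S: "open ?S" by (rule open_cmap_image[OF c(1)]) (auto intro!: openin_Int open_cdom c d V)
    have x: "?x \<in> ?S" using c d V by blast
    have \<phi>: "smooth_on ?S ?\<phi>" by (rule smooth_on_subset[OF smooth_transition[OF c(1) d(1)]]) blast
    have trans: "fd (\<lambda>y. Z (cinv d y) d) (cmap d p) (tmap c d p v) =
        tmap c d p (fd (\<lambda>x. Z (cinv c x) c) ?x v) + fd (\<lambda>x. fd ?\<phi> x v) ?x (Z p c)"
      if Z: "smooth_vector_field_on A V Z" for Z v
    proof -
      have sc: "smooth_on (cmap c ` (cdom c \<inter> V)) (\<lambda>x. Z (cinv c x) c)"
        by (rule smooth_vector_field_component[OF Z V(1) c(1)])
      have sd: "smooth_on (cmap d ` (cdom d \<inter> V)) (\<lambda>x. Z (cinv d x) d)"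
        by (rule smooth_vector_field_component[OF Z V(1) d(1)])
      have dc: "(\<lambda>x. Z (cinv c x) c) differentiable (at ?x)"
        by (rule smooth_on_imp_differentiable[OF sc]) (use c V in blast)
      have dd: "((\<lambda>y. Z (cinv d y) d) has_derivative fd (\<lambda>y. Z (cinv d y) d) (cmap d p)) (at (?\<phi> ?x))"
        unfolding transition_cmap[OF c] by (rule smooth_on_imp_has_derivative[OF sd]) (use d V in blast)
      have "((\<lambda>x. Z (cinv d (?\<phi> x)) d) has_derivative (\<lambda>v. fd (\<lambda>y. Z (cinv d y) d) (cmap d p) (tmap c d p v))) (at ?x)"
        by (rule has_derivative_compose[OF transition_has_derivative[OF c(1) d(1) c(2) d(2)] dd])
      then have "fd (\<lambda>x. Z (cinv d (?\<phi> x)) d) ?x v = fd (\<lambda>y. Z (cinv d y) d) (cmap d p) (tmap c d p v)"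
        by (rule fun_cong[OF fd_eqI])
      moreover have "fd (\<lambda>x. Z (cinv d (?\<phi> x)) d) ?x = fd (\<lambda>x. fd ?\<phi> x (Z (cinv c x) c)) ?x"
      proof (rule fd_cong_open[OF S x])
        fix y assume "y \<in> ?S"
        then obtain q where q: "q \<in> cdom c" "q \<in> cdom d" "q \<in> V" "y = cmap c q" by blast
        have "Z q \<in> tangent_space A q" using Z q(3) unfolding smooth_vector_field_on_def by blast
        from tangent_component[OF this c(1) d(1) q(1,2)]
        show "Z (cinv d (?\<phi> y)) d = fd ?\<phi> y (Z (cinv c y) c)"
          using cinv_cmap[OF c(1) q(1)] cinv_cmap[OF d(1) q(2)] transition_cmap[OF c(1) q(1), of d]
          by (simp add: q(4) tmap_def)
      qed
      moreover have "fd (\<lambda>x. fd ?\<phi> x (Z (cinv c x) c)) ?x v =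
          fd ?\<phi> ?x (fd (\<lambda>x. Z (cinv c x) c) ?x v) + fd (\<lambda>x. fd ?\<phi> x v) ?x (Z (cinv c ?x) c)"
        by (rule fd_fd_apply[OF S \<phi> x dc])
      ultimately show ?thesis by (simp add: tmap_def cinv_cmap[OF c])
    qed
    have tX: "X p d = tmap c d p (X p c)" and tY: "Y p d = tmap c d p (Y p c)"
      using X Y V(2) c d unfolding smooth_vector_field_on_def by (blast intro: tangent_component)+
    have "fd (\<lambda>x. fd ?\<phi> x (X p c)) ?x (Y p c) = fd (\<lambda>x. fd ?\<phi> x (Y p c)) ?x (X p c)"
      by (rule smooth_on_fd_commute[OF S \<phi> x])
    then show ?thesis
      unfolding lie_bracket_eq[OF X Y V c] lie_bracket_eq[OF X Y V d] tX tY trans[OF X] trans[OF Y]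
      by (simp add: linear_diff[OF tmap_linear[OF c(1) d(1) c(2) d(2)]])
  qed
  have zero: "lie_bracket A X Y p c = 0" if "c \<notin> charts_at A p" for c
    unfolding lie_bracket_def using that by (rule if_not_P)
  show ?thesis
    unfolding tangent_space_def mem_Collect_eq tmap_def[symmetric]
  proof (intro conjI ballI allI impI)
    show "lie_bracket A X Y p d = tmap c d p (lie_bracket A X Y p c)"
      if "c \<in> charts_at A p" "d \<in> charts_at A p" for c d
      by (rule main) (use that in \<open>auto simp: charts_at_def\<close>)
  qed (rule zero)
qed

section \<open>Distributions spanned by two coordinate fields\<close>

lemma span_coord_fields:
  assumes c: "c \<in> A" "p \<in> cdom c"
  shows "{lincomb a (coord_field A c i p) b (coord_field A c j p) | a b. True}
    = {tv c p u | u. \<exists>a b. u = a *\<^sub>R axis i 1 + b *\<^sub>R axis j 1}"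
  unfolding coord_field_eq tv_lincomb[OF c, symmetric] by blast

text \<open>For sections, the components with index other than \<open>i\<close> and \<open>j\<close>
  vanish identically on an open set. Hence their derivatives vanish, and so do the same components
  of the bracket.\<close>

lemma integrable_coord_distribution:
  assumes c: "c \<in> A" and sp: "spanned_by_coord_fields A c i j D"
  shows "integrable_distribution_on T A (cdom c) D"
  unfolding integrable_distribution_on_def
proof (intro allI impI ballI, elim conjE)
  fix V X Y p
  assume V: "openin T V" "V \<subseteq> cdom c" and X: "smooth_vector_field_on A V X" and Y: "smooth_vector_field_on A V Y"
    and XY: "\<forall>p\<in>V. X p \<in> D p \<and> Y p \<in> D p" and p: "p \<in> V"
  have pc: "p \<in> cdom c" using V(2) p by blast
  have D: "D q = {tv c q u | u. \<exists>a b. u = a *\<^sub>R axis i 1 + b *\<^sub>R axis j 1}" if "q \<in> cdom c" for q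
    using sp span_coord_fields[OF c that, of i j] that unfolding spanned_by_coord_fields_def by blast
  have S: "open (cmap c ` V)" by (rule open_cmap_image[OF c V])
  have px: "cmap c p \<in> cmap c ` V" using p by blast
  have zero: "Z q c $ k = 0" if Z: "\<forall>p\<in>V. Z p \<in> D p" and k: "k \<noteq> i" "k \<noteq> j" and q: "q \<in> V" for Z k q
  proof -
    have qc: "q \<in> cdom c" using q V(2) by blast
    obtain a b where "Z q = tv c q (a *\<^sub>R axis i 1 + b *\<^sub>R axis j 1)"
      using Z q D[OF qc] by blast
    then show ?thesis using k tv_component_self[OF c qc] by (simp add: axis_def)
  qed
  have fdz: "fd (\<lambda>x. Z (cinv c x) c) (cmap c p) v $ k = 0"
    if Z: "smooth_vector_field_on A V Z" "\<forall>p\<in>V. Z p \<in> D p" and k: "k \<noteq> i" "k \<noteq> j" for Z k v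
  proof -
    have "smooth_on (cmap c ` (cdom c \<inter> V)) (\<lambda>x. Z (cinv c x) c)"
      by (rule smooth_vector_field_component[OF Z(1) V(1) c])
    then have dif: "(\<lambda>x. Z (cinv c x) c) differentiable (at (cmap c p))"
      by (rule smooth_on_imp_differentiable) (use p pc in blast)
    have "fd (\<lambda>x. Z (cinv c x) c $ k) (cmap c p) = fd (\<lambda>x. 0) (cmap c p)"
    proof (rule fd_cong_open[OF S px])
      fix y assume "y \<in> cmap c ` V"
      then show "Z (cinv c y) c $ k = 0" using cinv_mem[OF c V(2)] zero[OF Z(2) k] by blast
    qed
    also have "\<dots> = (\<lambda>v. 0)" by (rule fd_eqI) (rule has_derivative_const)
    finally show ?thesis using fd_nth[OF dif, of k v] by simp
  qed
  let ?u = "lie_bracket A X Y p c"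
  have k0: "?u $ k = 0" if "k \<noteq> i" "k \<noteq> j" for k
    unfolding lie_bracket_eq[OF X Y V(1) p c pc] using fdz[OF X _ that] fdz[OF Y _ that] XY by simp
  have "?u = (\<Sum>k\<in>UNIV. ?u $ k *\<^sub>R axis k 1)" by (rule vec_sum_axis)
  also have "\<dots> = (\<Sum>k\<in>{i, j}. ?u $ k *\<^sub>R axis k 1)"
    by (rule sum.mono_neutral_right) (use k0 in auto)
  \<comment> \<open>The conditional avoids counting the single component twice when
    \<open>i = j\<close>.\<close>
  also have "\<dots> = ?u $ i *\<^sub>R axis i 1 + (if i = j then 0 else ?u $ j) *\<^sub>R axis j 1"
    by (cases "i = j") simp_all
  finally have "\<exists>a b. ?u = a *\<^sub>R axis i 1 + b *\<^sub>R axis j 1" by blast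
  moreover have "lie_bracket A X Y p = tv c p ?u"
    by (rule tangent_eq[OF c pc lie_bracket_tangent[OF X Y V(1) p]])
  ultimately show "lie_bracket A X Y p \<in> D p" unfolding D[OF pc] by blast
qed

lemma smooth_vector_field_tv:
  assumes c: "c \<in> A"
  shows "smooth_vector_field_on A (cdom c) (\<lambda>p. tv c p u)"
  unfolding smooth_vector_field_on_def
proof (intro conjI ballI allI)
  show "tv c p u \<in> tangent_space A p" if "p \<in> cdom c" for p using tv_tangent[OF c that] .
  fix d i assume d: "d \<in> A"
  have o: "openin T (cdom d \<inter> cdom c)" by (intro openin_Int open_cdom c d)
  show "smooth_fun_on A (cdom d \<inter> cdom c) (\<lambda>p. tv c p u d $ i)"
  proof (rule smooth_fun_onI[OF c o])
    have S: "open (cmap c ` (cdom d \<inter> cdom c))" by (rule open_cmap_image[OF c o]) simp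
    have "smooth_on (cmap c ` (cdom d \<inter> cdom c)) (\<lambda>x. fd (transition c d) x u $ i)"
      using smooth_on_nth[OF S smooth_on_fd] smooth_transition[OF c d] by (simp add: Int_commute)
    then show "smooth_on (cmap c ` (cdom d \<inter> cdom c)) (\<lambda>x. tv c (cinv c x) u d $ i)"
    proof (rule smooth_on_cong[OF S, THEN iffD1, rotated])
      fix x assume "x \<in> cmap c ` (cdom d \<inter> cdom c)"
      then obtain q where q: "q \<in> cdom d" "q \<in> cdom c" "x = cmap c q" by blast
      show "fd (transition c d) x u $ i = tv c (cinv c x) u d $ i"
        using cinv_cmap[OF c q(2)] tv_component[OF d q(1)] by (simp add: q(3) tmap_def)
    qed
  qed simp
qed

lemma subbundle_coord_distribution:
  assumes c: "c \<in> A" and sp: "spanned_by_coord_fields A c i j D" and ij: "i \<noteq> j"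
  shows "subbundle_on T A (cdom c) 2 D"
  unfolding subbundle_on_def
proof
  fix p assume p: "p \<in> cdom c"
  define E where "E k = coord_field A c (if k = (0::nat) then i else j)" for k
  have sum2: "(\<lambda>d. \<Sum>k<2. a k *\<^sub>R E k q d) = lincomb (a 0) (coord_field A c i q) (a 1) (coord_field A c j q)" for a q
    by (rule ext) (simp add: lincomb_def E_def numeral_2_eq_2)
  show "\<exists>V E. openin T V \<and> p \<in> V \<and> V \<subseteq> cdom c \<and> (\<forall>i<2. smooth_vector_field_on A V (E i)) \<and>
        (\<forall>q\<in>V. D q = {(\<lambda>c. \<Sum>i<2. a i *\<^sub>R E i q c) | a :: nat \<Rightarrow> real. True} \<and>
               (\<forall>a :: nat \<Rightarrow> real. (\<lambda>c. \<Sum>i<2. a i *\<^sub>R E i q c) = (\<lambda>_. 0) \<longrightarrow> (\<forall>i<2. a i = 0)))"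
  proof (intro exI[of _ "cdom c"] exI[of _ E] conjI allI impI ballI)
    show "smooth_vector_field_on A (cdom c) (E k)" for k
    proof -
      have "E k = (\<lambda>p. tv c p (axis (if k = 0 then i else j) 1))" by (rule ext) (simp add: E_def coord_field_eq)
      then show ?thesis using smooth_vector_field_tv[OF c] by simp
    qed
    fix q assume q: "q \<in> cdom c"
    have "D q = {lincomb a (coord_field A c i q) b (coord_field A c j q) | a b. True}"
      using sp q unfolding spanned_by_coord_fields_def by blast
    also have "\<dots> = {(\<lambda>d. \<Sum>k<2. a k *\<^sub>R E k q d) | a :: nat \<Rightarrow> real. True}"
      unfolding sum2
    proof (intro equalityI subsetI)
      show "z \<in> {lincomb (a 0) (coord_field A c i q) (a 1) (coord_field A c j q) | a :: nat \<Rightarrow> real. True}"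
        if z: "z \<in> {lincomb a (coord_field A c i q) b (coord_field A c j q) | a b. True}" for z
      proof -
        obtain a b where "z = lincomb a (coord_field A c i q) b (coord_field A c j q)" using z by blast
        then show ?thesis by (intro CollectI exI[of _ "\<lambda>k. if k = 0 then a else b"]) simp
      qed
    qed blast
    finally show "D q = {(\<lambda>c. \<Sum>i<2. a i *\<^sub>R E i q c) | a :: nat \<Rightarrow> real. True}" .
    fix a :: "nat \<Rightarrow> real" and k :: nat
    assume z: "(\<lambda>c. \<Sum>i<2. a i *\<^sub>R E i q c) = (\<lambda>_. 0)" and k: "k < 2"
    have "tv c q (a 0 *\<^sub>R axis i 1 + a 1 *\<^sub>R axis j 1) = tv c q 0"
      using z unfolding sum2 coord_field_eq tv_lincomb[OF c q] tv_0[OF c q] .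
    then have e: "a 0 *\<^sub>R axis i 1 + a 1 *\<^sub>R axis j 1 = (0 :: real ^ 'n)" unfolding tv_inj[OF c q] .
    have "a 0 = 0" "a 1 = 0"
      using arg_cong[OF e, of "\<lambda>v. v $ i"] arg_cong[OF e, of "\<lambda>v. v $ j"] ij by (auto simp: axis_def)
    then show "a k = 0" using less_2_cases[OF k] by auto
  qed (use p open_cdom[OF c] in auto)
qed

end

section \<open>Tensors and the Levi-Civita connection\<close>

lemma bilinear_sum_axis:
  fixes B :: "real ^ 'n \<Rightarrow> real ^ 'n \<Rightarrow> real"
  assumes l: "\<And>v. linear (\<lambda>u. B u v)" and r: "\<And>u. linear (B u)"
  shows "B u v = (\<Sum>i\<in>UNIV. \<Sum>j\<in>UNIV. (u $ i * v $ j) * B (axis i 1) (axis j 1))"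
proof -
  have "B u v = (\<Sum>i\<in>UNIV. u $ i *\<^sub>R B (axis i 1) v)" by (rule linear_sum_axis[OF l])
  also have "\<dots> = (\<Sum>i\<in>UNIV. u $ i *\<^sub>R (\<Sum>j\<in>UNIV. v $ j *\<^sub>R B (axis i 1) (axis j 1)))"
    by (intro sum.cong refl arg_cong2[where f = scaleR] linear_sum_axis[OF r])
  finally show ?thesis by (simp add: sum_distrib_left mult.assoc)
qed

text \<open>Expansion over the standard basis reduces this to products of scalar functions. The
  first term on the right differentiates the form with both arguments frozen.\<close>

lemma fd_bilinear:
  fixes B :: "'a::euclidean_space \<Rightarrow> real ^ 'n \<Rightarrow> real ^ 'n \<Rightarrow> real"
  assumes S: "open S" "x \<in> S"
    and l: "\<And>y v. y \<in> S \<Longrightarrow> linear (\<lambda>u. B y u v)" and r: "\<And>y u. y \<in> S \<Longrightarrow> linear (B y u)"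
    and B: "\<And>i j. (\<lambda>y. B y (axis i 1) (axis j 1)) differentiable (at x)"
    and a: "a differentiable (at x)" and b: "b differentiable (at x)"
  shows "fd (\<lambda>y. B y (a y) (b y)) x w =
    fd (\<lambda>y. B y (a x) (b x)) x w + B x (fd a x w) (b x) + B x (a x) (fd b x w)"
proof -
  let ?E = "\<lambda>i. axis i (1 :: real)"
  have eq: "B y u v = (\<Sum>i\<in>UNIV. \<Sum>j\<in>UNIV. (u $ i * v $ j) * B y (?E i) (?E j))" if "y \<in> S" for y u v
    by (rule bilinear_sum_axis[OF l[OF that] r[OF that]])
  have comp: "((\<lambda>y. c y $ i) has_derivative (\<lambda>w. fd c x w $ i)) (at x)"
    if "c differentiable (at x)" for c :: "'a \<Rightarrow> real ^ 'n" and i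
    by (rule bounded_linear.has_derivative[OF bounded_linear_vec_nth fd_works[OF that]])
  have d: "((\<lambda>y. B y (a' y) (b' y)) has_derivative
      (\<lambda>w. \<Sum>i\<in>UNIV. \<Sum>j\<in>UNIV. (a' x $ i * b' x $ j) * fd (\<lambda>y. B y (?E i) (?E j)) x w
        + (a' x $ i * fd b' x w $ j + fd a' x w $ i * b' x $ j) * B x (?E i) (?E j))) (at x)"
    if a': "a' differentiable (at x)" and b': "b' differentiable (at x)" for a' b'
  proof (rule has_derivative_cong_open[OF S eq, THEN iffD2])
    show "((\<lambda>y. \<Sum>i\<in>UNIV. \<Sum>j\<in>UNIV. (a' y $ i * b' y $ j) * B y (?E i) (?E j)) has_derivative
      (\<lambda>w. \<Sum>i\<in>UNIV. \<Sum>j\<in>UNIV. (a' x $ i * b' x $ j) * fd (\<lambda>y. B y (?E i) (?E j)) x w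
        + (a' x $ i * fd b' x w $ j + fd a' x w $ i * b' x $ j) * B x (?E i) (?E j))) (at x)"
      by (intro has_derivative_sum has_derivative_mult comp a' b' fd_works[OF B])
  qed
  have cd: "(\<lambda>y. c) differentiable (at x)" and c0: "fd (\<lambda>y. c) x w = 0" for c :: "real ^ 'n" and w
    using fd_eqI[OF has_derivative_const[of c "at x"]] by auto
  have 1: "fd (\<lambda>y. B y (a y) (b y)) x w = (\<Sum>i\<in>UNIV. \<Sum>j\<in>UNIV. (a x $ i * b x $ j) * fd (\<lambda>y. B y (?E i) (?E j)) x w
        + (a x $ i * fd b x w $ j + fd a x w $ i * b x $ j) * B x (?E i) (?E j))"
    by (rule fun_cong[OF fd_eqI[OF d[OF a b]]])
  have 2: "fd (\<lambda>y. B y (a x) (b x)) x w = (\<Sum>i\<in>UNIV. \<Sum>j\<in>UNIV. (a x $ i * b x $ j) * fd (\<lambda>y. B y (?E i) (?E j)) x w)"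
    using fun_cong[OF fd_eqI[OF d[OF cd[of "a x"] cd[of "b x"]]], of w] by (simp add: c0)
  show ?thesis
    unfolding 1 2 eq[OF S(2), of "fd a x w" "b x"] eq[OF S(2), of "a x" "fd b x w"]
    by (simp add: sum.distrib distrib_right)
qed

section \<open>Components of (0,2) tensors and their derivatives\<close>

locale tensor_mfd = mfd T A for T :: "'a topology" and A :: "('a, 'n::finite) chart set" +
  fixes W :: "'a set"
  assumes W: "openin T W"
begin

text \<open>With component vectors in place of indices, the tensor becomes a bilinear form on
  Euclidean space depending on the point. Transformation laws then need no index sums.\<close>

definition cmp :: "('a, 'n) chart \<Rightarrow> ('a, 'n) tensor02 \<Rightarrow> 'a \<Rightarrow> real ^ 'n \<Rightarrow> real ^ 'n \<Rightarrow> real" where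
  "cmp c h p u v = h p (tv c p u) (tv c p v)"

definition der :: "('a, 'n) chart \<Rightarrow> ('a, 'n) tensor02 \<Rightarrow> 'a \<Rightarrow> real ^ 'n \<Rightarrow> real ^ 'n \<Rightarrow> real ^ 'n \<Rightarrow> real" where
  "der c h p w u v = fd (\<lambda>x. cmp c h (cinv c x) u v) (cmap c p) w"

definition smooth_tensor02 :: "('a, 'n) tensor02 \<Rightarrow> bool" where
  "smooth_tensor02 h \<longleftrightarrow> tensor02_on A W h \<and> (\<forall>c\<in>A. \<forall>i j. smooth_fun_on A (cdom c \<inter> W) (comp02 A c h i j))"

lemma comp02_eq: "comp02 A c h i j p = cmp c h p (axis i 1) (axis j 1)"
  by (simp add: comp02_def cmp_def coord_field_eq)

lemma cmp_bilinear:
  assumes "tensor02_on A W h" "c \<in> A" "p \<in> cdom c" "p \<in> W"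
  shows "linear (\<lambda>u. cmp c h p u v)" "linear (cmp c h p u)"
proof -
  have t: "\<And>u v w a b. u \<in> tangent_space A p \<Longrightarrow> v \<in> tangent_space A p \<Longrightarrow> w \<in> tangent_space A p \<Longrightarrow>
      h p (lincomb a u b v) w = a * h p u w + b * h p v w \<and> h p w (lincomb a u b v) = a * h p w u + b * h p w v"
    using assms(1,4) unfolding tensor02_on_def by blast
  have 1: "cmp c h p (a *\<^sub>R u + b *\<^sub>R u') v = a * cmp c h p u v + b * cmp c h p u' v"
    "cmp c h p v (a *\<^sub>R u + b *\<^sub>R u') = a * cmp c h p v u + b * cmp c h p v u'" for a b u u' v
    unfolding cmp_def tv_lincomb[OF assms(2,3)]
    using t[OF tv_tangent[OF assms(2,3)] tv_tangent[OF assms(2,3)] tv_tangent[OF assms(2,3)]] by blast+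
  show "linear (\<lambda>u. cmp c h p u v)"
    using 1(1)[of 1 _ 1] 1(1)[of _ _ 0 0] by (intro linearI) simp_all
  show "linear (cmp c h p u)"
    using 1(2)[of _ 1 _ 1] 1(2)[of _ _ _ 0 0] by (intro linearI) simp_all
qed

lemma cmp_linear:
  assumes "smooth_tensor02 h" "c \<in> A" "p \<in> cdom c" "p \<in> W"
  shows "linear (\<lambda>u. cmp c h p u v)" "linear (cmp c h p u)"
  using cmp_bilinear[OF _ assms(2-4)] assms(1) unfolding smooth_tensor02_def by blast+

lemma open_WS: "c \<in> A \<Longrightarrow> open (cmap c ` (cdom c \<inter> W))"
  by (rule open_cmap_image) (auto intro!: openin_Int open_cdom W)

lemma cmp_smooth:
  assumes h: "smooth_tensor02 h" and c: "c \<in> A"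
  shows "smooth_on (cmap c ` (cdom c \<inter> W)) (\<lambda>x. cmp c h (cinv c x) u v)"
proof -
  let ?S = "cmap c ` (cdom c \<inter> W)"
  note S = open_WS[OF c]
  have "smooth_fun_on A (cdom c \<inter> W) (comp02 A c h i j)" for i j
    using h c unfolding smooth_tensor02_def by blast
  from smooth_fun_onD[OF this c] have s: "smooth_on ?S (\<lambda>x. cmp c h (cinv c x) (axis i 1) (axis j 1))" for i j
    by (simp add: comp02_eq)
  have "smooth_on ?S (\<lambda>x. \<Sum>i\<in>UNIV. \<Sum>j\<in>UNIV. (u $ i * v $ j) * cmp c h (cinv c x) (axis i 1) (axis j 1))"
    by (intro smooth_on_sum[OF S] smooth_on_mult[OF S] smooth_on_const s)
  then show ?thesis
  proof (rule smooth_on_cong[OF S, THEN iffD1, rotated])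
    fix x assume "x \<in> ?S"
    then have q: "cinv c x \<in> cdom c" "cinv c x \<in> W" using cinv_mem[OF c, of "cdom c \<inter> W" x] by blast+
    show "(\<Sum>i\<in>UNIV. \<Sum>j\<in>UNIV. (u $ i * v $ j) * cmp c h (cinv c x) (axis i 1) (axis j 1)) = cmp c h (cinv c x) u v"
      by (rule bilinear_sum_axis[symmetric]) (rule cmp_linear[OF h c q])+
  qed
qed

lemma cmp_differentiable:
  "smooth_tensor02 h \<Longrightarrow> c \<in> A \<Longrightarrow> p \<in> cdom c \<Longrightarrow> p \<in> W \<Longrightarrow>
    (\<lambda>x. cmp c h (cinv c x) u v) differentiable (at (cmap c p))"
  by (rule smooth_on_imp_differentiable[OF cmp_smooth]) auto

lemma cmp_change:
  assumes "c \<in> A" "d \<in> A" "p \<in> cdom c" "p \<in> cdom d"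
  shows "cmp c h p u v = cmp d h p (tmap c d p u) (tmap c d p v)"
  unfolding cmp_def tv_change[OF assms, of u] tv_change[OF assms, of v] ..

lemma der_product:
  assumes h: "smooth_tensor02 h" and c: "c \<in> A" "p \<in> cdom c" "p \<in> W"
    and a: "a differentiable (at (cmap c p))" and b: "b differentiable (at (cmap c p))"
  shows "fd (\<lambda>x. cmp c h (cinv c x) (a x) (b x)) (cmap c p) w =
    der c h p w (a (cmap c p)) (b (cmap c p)) + cmp c h p (fd a (cmap c p) w) (b (cmap c p))
    + cmp c h p (a (cmap c p)) (fd b (cmap c p) w)"
proof -
  have x: "cmap c p \<in> cmap c ` (cdom c \<inter> W)" using c by blast
  have q: "cinv c y \<in> cdom c" "cinv c y \<in> W" if "y \<in> cmap c ` (cdom c \<inter> W)" for y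
    using cinv_mem[OF c(1), of "cdom c \<inter> W" y] that by blast+
  have "fd (\<lambda>x. cmp c h (cinv c x) (a x) (b x)) (cmap c p) w =
      fd (\<lambda>x. cmp c h (cinv c x) (a (cmap c p)) (b (cmap c p))) (cmap c p) w
      + cmp c h (cinv c (cmap c p)) (fd a (cmap c p) w) (b (cmap c p))
      + cmp c h (cinv c (cmap c p)) (a (cmap c p)) (fd b (cmap c p) w)"
    by (rule fd_bilinear[OF open_WS[OF c(1)] x])
       (rule cmp_linear[OF h c(1) q(1) q(2)] cmp_differentiable[OF h c] a b | assumption)+
  then show ?thesis by (simp only: der_def cinv_cmap[OF c(1,2)])
qed

text \<open>The second derivative of the coordinate change, which is the inhomogeneous term in the
  transformation law of derivatives of tensors.\<close>

definition hess :: "('a, 'n) chart \<Rightarrow> ('a, 'n) chart \<Rightarrow> 'a \<Rightarrow> real ^ 'n \<Rightarrow> real ^ 'n \<Rightarrow> real ^ 'n" where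
  "hess c d p w u = fd (\<lambda>x. fd (transition c d) x u) (cmap c p) w"

lemma hess_sym:
  assumes "c \<in> A" "d \<in> A" "p \<in> cdom c" "p \<in> cdom d"
  shows "hess c d p w u = hess c d p u w"
  unfolding hess_def
  by (rule smooth_on_fd_commute[OF open_overlap smooth_transition]) (use assms in auto)

text \<open>Obtained by differentiating \<open>cmp_change\<close>: the differentials of the
  transition map inside the two arguments also depend on the point, and each contributes one
  \<open>hess\<close> term.\<close>

lemma der_change:
  assumes h: "smooth_tensor02 h" and c: "c \<in> A" "p \<in> cdom c" and d: "d \<in> A" "p \<in> cdom d" and p: "p \<in> W"
  shows "der c h p w u v = der d h p (tmap c d p w) (tmap c d p u) (tmap c d p v)
    + cmp d h p (hess c d p w u) (tmap c d p v) + cmp d h p (tmap c d p u) (hess c d p w v)"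
proof -
  let ?\<phi> = "transition c d" and ?x = "cmap c p"
  let ?S = "cmap c ` (cdom c \<inter> (cdom d \<inter> W))"
  have S: "open ?S" by (rule open_cmap_image[OF c(1)]) (auto intro!: openin_Int open_cdom c d W)
  have x: "?x \<in> ?S" using c d p by blast
  have \<phi>: "smooth_on ?S ?\<phi>" by (rule smooth_on_subset[OF smooth_transition[OF c(1) d(1)]]) blast
  let ?B = "\<lambda>y u v. cmp d h (cinv d (?\<phi> y)) u v"
  have q: "cinv d (?\<phi> y) \<in> cdom d \<and> cinv d (?\<phi> y) \<in> W \<and> cinv d (?\<phi> y) \<in> cdom c \<and> cinv d (?\<phi> y) = cinv c y
      \<and> cmap c (cinv c y) = y" if y: "y \<in> ?S" for y
  proof -
    obtain q where q: "q \<in> cdom c" "q \<in> cdom d" "q \<in> W" "y = cmap c q" using y by blast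
    have "cinv d (?\<phi> y) = q" using transition_cmap[OF c(1) q(1), of d] cinv_cmap[OF d(1) q(2)] by (simp only: q(4))
    moreover have "cinv c y = q" using cinv_cmap[OF c(1) q(1)] by (simp only: q(4))
    ultimately show ?thesis using q by metis
  qed
  have Bder: "((\<lambda>y. ?B y u v) has_derivative (\<lambda>w. der d h p (tmap c d p w) u v)) (at ?x)" for u v
  proof -
    have "((\<lambda>y. cmp d h (cinv d y) u v) has_derivative (\<lambda>w. der d h p w u v)) (at (?\<phi> ?x))"
      unfolding der_def transition_cmap[OF c] by (rule fd_works[OF cmp_differentiable[OF h d p]])
    from has_derivative_compose[OF transition_has_derivative[OF c(1) d(1) c(2) d(2)] this] show ?thesis .
  qed
  have "der c h p w u v = fd (\<lambda>y. ?B y (fd ?\<phi> y u) (fd ?\<phi> y v)) ?x w"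
    unfolding der_def
  proof (rule fun_cong[OF fd_cong_open[OF S x]])
    fix y assume y: "y \<in> ?S"
    note qy = q[OF y]
    have qc: "cinv c y \<in> cdom c" "cinv c y \<in> cdom d" using qy by metis+
    have "cmp c h (cinv c y) u v = cmp d h (cinv c y) (tmap c d (cinv c y) u) (tmap c d (cinv c y) v)"
      by (rule cmp_change[OF c(1) d(1) qc])
    then show "cmp c h (cinv c y) u v = ?B y (fd ?\<phi> y u) (fd ?\<phi> y v)"
      using qy by (simp only: tmap_def)
  qed
  also have "\<dots> = fd (\<lambda>y. ?B y (fd ?\<phi> ?x u) (fd ?\<phi> ?x v)) ?x w
      + ?B ?x (fd (\<lambda>y. fd ?\<phi> y u) ?x w) (fd ?\<phi> ?x v) + ?B ?x (fd ?\<phi> ?x u) (fd (\<lambda>y. fd ?\<phi> y v) ?x w)"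
  proof (rule fd_bilinear[OF S x])
    show "linear (\<lambda>u. ?B y u v)" "linear (?B y u)" if "y \<in> ?S" for y u v
      using q[OF that] by (auto intro!: cmp_linear[OF h d(1)])
    show "(\<lambda>y. ?B y (axis i 1) (axis j 1)) differentiable (at ?x)" for i j
      using Bder unfolding differentiable_def by blast
    show "(\<lambda>y. fd ?\<phi> y u) differentiable (at ?x)" "(\<lambda>y. fd ?\<phi> y v) differentiable (at ?x)"
      by (rule smooth_on_imp_differentiable[OF smooth_on_fd[OF \<phi>] x])+
  qed
  also have "fd (\<lambda>y. ?B y (fd ?\<phi> ?x u) (fd ?\<phi> ?x v)) ?x w = der d h p (tmap c d p w) (tmap c d p u) (tmap c d p v)"
    unfolding tmap_def[of c d p, symmetric] by (rule fun_cong[OF fd_eqI[OF Bder]])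
  finally show ?thesis
    unfolding transition_cmap[OF c] cinv_cmap[OF d] hess_def tmap_def .
qed

lemma der_linear:
  assumes h: "smooth_tensor02 h" and c: "c \<in> A" "p \<in> cdom c" "p \<in> W"
  shows "linear (\<lambda>w. der c h p w u v)" "linear (\<lambda>u. der c h p w u v)" "linear (\<lambda>v. der c h p w u v)"
proof -
  note cd = cmp_differentiable[OF h c]
  show "linear (\<lambda>w. der c h p w u v)" unfolding der_def by (rule linear_fd[OF cd])
  have S: "open (cmap c ` (cdom c \<inter> W))" by (rule open_WS[OF c(1)])
  have x: "cmap c p \<in> cmap c ` (cdom c \<inter> W)" using c by blast
  have q: "cinv c y \<in> cdom c" "cinv c y \<in> W" if "y \<in> cmap c ` (cdom c \<inter> W)" for y
    using cinv_mem[OF c(1), of "cdom c \<inter> W" y] that by blast+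
  note lin = cmp_linear[OF h c(1) q]
  have 1: "der c h p w (a *\<^sub>R u + b *\<^sub>R u') v = a * der c h p w u v + b * der c h p w u' v" for a b u u' v
  proof -
    have "((\<lambda>x. cmp c h (cinv c x) (a *\<^sub>R u + b *\<^sub>R u') v) has_derivative
        (\<lambda>w. a * der c h p w u v + b * der c h p w u' v)) (at (cmap c p))"
    proof (rule has_derivative_cong_open[OF S x, THEN iffD2])
      show "cmp c h (cinv c y) (a *\<^sub>R u + b *\<^sub>R u') v = a * cmp c h (cinv c y) u v + b * cmp c h (cinv c y) u' v"
        if "y \<in> cmap c ` (cdom c \<inter> W)" for y
        using linear_add[OF lin(1)[OF that that]] linear_cmul[OF lin(1)[OF that that]] by simp
      show "((\<lambda>y. a * cmp c h (cinv c y) u v + b * cmp c h (cinv c y) u' v) has_derivative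
        (\<lambda>w. a * der c h p w u v + b * der c h p w u' v)) (at (cmap c p))"
        unfolding der_def by (intro has_derivative_add has_derivative_mult_right fd_works cd)
    qed
    from fun_cong[OF fd_eqI[OF this], of w] show ?thesis unfolding der_def .
  qed
  have 2: "der c h p w v (a *\<^sub>R u + b *\<^sub>R u') = a * der c h p w v u + b * der c h p w v u'" for a b u u' v
  proof -
    have "((\<lambda>x. cmp c h (cinv c x) v (a *\<^sub>R u + b *\<^sub>R u')) has_derivative
        (\<lambda>w. a * der c h p w v u + b * der c h p w v u')) (at (cmap c p))"
    proof (rule has_derivative_cong_open[OF S x, THEN iffD2])
      show "cmp c h (cinv c y) v (a *\<^sub>R u + b *\<^sub>R u') = a * cmp c h (cinv c y) v u + b * cmp c h (cinv c y) v u'"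
        if "y \<in> cmap c ` (cdom c \<inter> W)" for y
        using linear_add[OF lin(2)[OF that that]] linear_cmul[OF lin(2)[OF that that]] by simp
      show "((\<lambda>y. a * cmp c h (cinv c y) v u + b * cmp c h (cinv c y) v u') has_derivative
        (\<lambda>w. a * der c h p w v u + b * der c h p w v u')) (at (cmap c p))"
        unfolding der_def by (intro has_derivative_add has_derivative_mult_right fd_works cd)
    qed
    from fun_cong[OF fd_eqI[OF this], of w] show ?thesis unfolding der_def .
  qed
  show "linear (\<lambda>u. der c h p w u v)"
    using 1[of 1 _ 1] 1[of _ _ 0 0] by (intro linearI) simp_all
  show "linear (\<lambda>v. der c h p w u v)"
    using 2[of _ 1 _ 1] 2[of _ _ _ 0 0] by (intro linearI) simp_all
qed

end

section \<open>Almost Hermitian structures and the covariant derivative of J\<close>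

locale herm = tensor_mfd T A W for T :: "'a topology" and A :: "('a, 'n::finite) chart set" and W :: "'a set" +
  fixes g :: "('a, 'n) tensor02" and J :: "('a, 'n) tensor11"
  assumes riem: "riemannian_metric_on A W g" and acs: "almost_complex_structure_on A W J"
    and skew: "\<forall>p\<in>W. \<forall>u\<in>tangent_space A p. \<forall>v\<in>tangent_space A p. g p (J p u) v = - g p (J p v) u"
begin

text \<open>The Kaehler form. The locale has every ingredient of \<open>kaehler_on\<close> except
  parallelism of J, which is a conclusion in one half of the theorem and a hypothesis in the
  other.\<close>

definition om :: "('a, 'n) tensor02" where
  "om p u v = g p (J p u) v"

definition Jm :: "('a, 'n) chart \<Rightarrow> 'a \<Rightarrow> real ^ 'n \<Rightarrow> real ^ 'n" where
  "Jm c p u = J p (tv c p u) c"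

text \<open>For \<open>u, v\<close> constant in the chart \<open>c\<close>, \<open>kos c p u v w\<close> is \<open>g (\<nabla>\<^sub>u v, w)\<close>, by Koszul's formula, and
  \<open>par\<close> is the covariant derivative of \<open>om\<close>, that is, of \<open>J\<close> with lowered index.\<close>

definition kos :: "('a, 'n) chart \<Rightarrow> 'a \<Rightarrow> real ^ 'n \<Rightarrow> real ^ 'n \<Rightarrow> real ^ 'n \<Rightarrow> real" where
  "kos c p u v w = 1/2 * (der c g p u v w + der c g p v u w - der c g p w u v)"

definition par :: "('a, 'n) chart \<Rightarrow> 'a \<Rightarrow> real ^ 'n \<Rightarrow> real ^ 'n \<Rightarrow> real ^ 'n \<Rightarrow> real" where
  "par c p u v w = der c om p u v w + kos c p u v (Jm c p w) - kos c p u w (Jm c p v)"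

lemma g_smooth: "smooth_tensor02 g"
  using riem unfolding smooth_tensor02_def riemannian_metric_on_def by blast

context
  fixes c p assumes c: "c \<in> A" "p \<in> cdom c" "p \<in> W"
begin

lemma J_tv: "J p (tv c p u) = tv c p (Jm c p u)"
proof -
  have "J p (tv c p u) \<in> tangent_space A p"
    using acs tv_tangent[OF c(1,2), of u] c(3) unfolding almost_complex_structure_on_def tensor11_on_def by blast
  from tangent_eq[OF c(1,2) this] show ?thesis unfolding Jm_def .
qed

lemma Jm_linear: "linear (Jm c p)"
proof -
  have "J p (lincomb a (tv c p u) b (tv c p v)) = lincomb a (J p (tv c p u)) b (J p (tv c p v))" for a b u v
    using acs tv_tangent[OF c(1,2), of u] tv_tangent[OF c(1,2), of v] c(3)
    unfolding almost_complex_structure_on_def tensor11_on_def by blast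
  then have 1: "Jm c p (a *\<^sub>R u + b *\<^sub>R v) = a *\<^sub>R Jm c p u + b *\<^sub>R Jm c p v" for a b u v
    unfolding Jm_def tv_lincomb[OF c(1,2)] by (simp add: lincomb_def)
  show ?thesis using 1[of 1 _ 1] 1[of _ _ 0 0] by (intro linearI) simp_all
qed

lemma Jm_Jm: "Jm c p (Jm c p u) = - u"
proof -
  have "J p (J p (tv c p u)) = (\<lambda>d. - tv c p u d)"
    using acs tv_tangent[OF c(1,2), of u] c(3) unfolding almost_complex_structure_on_def by blast
  from fun_cong[OF this, of c] show ?thesis
    unfolding J_tv tv_component_self[OF c(1,2)] .
qed

lemma cmp_om: "cmp c om p u v = cmp c g p (Jm c p u) v"
  by (simp add: cmp_def om_def J_tv)

lemma g_sym: "cmp c g p u v = cmp c g p v u"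
  unfolding cmp_def using riem tv_tangent[OF c(1,2), of u] tv_tangent[OF c(1,2), of v] c(3)
  unfolding riemannian_metric_on_def by blast

lemma g_pos: "u \<noteq> 0 \<Longrightarrow> cmp c g p u u > 0"
proof -
  assume "u \<noteq> 0"
  then have "tv c p u \<noteq> (\<lambda>_. 0)" using tv_inj[OF c(1,2), of u 0] tv_0[OF c(1,2)] by metis
  then show ?thesis
    unfolding cmp_def using riem tv_tangent[OF c(1,2), of u] c(3) unfolding riemannian_metric_on_def by blast
qed

lemma g_skew: "cmp c g p (Jm c p u) v = - cmp c g p (Jm c p v) u"
  unfolding cmp_def J_tv[symmetric]
  using skew tv_tangent[OF c(1,2), of u] tv_tangent[OF c(1,2), of v] c(3) by blast

lemma g_linear: "linear (\<lambda>u. cmp c g p u v)" "linear (cmp c g p u)"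
  using cmp_linear[OF g_smooth c] by blast+

end

lemma Jm_smooth:
  assumes c: "c \<in> A"
  shows "smooth_on (cmap c ` (cdom c \<inter> W)) (\<lambda>x. Jm c (cinv c x) (axis j 1))"
proof (rule smooth_on_vec[OF open_WS[OF c]])
  fix k
  have "smooth_fun_on A (cdom c \<inter> W) (comp11 A c J k j)"
    using acs c unfolding almost_complex_structure_on_def by blast
  from smooth_fun_onD[OF this c]
  show "smooth_on (cmap c ` (cdom c \<inter> W)) (\<lambda>x. Jm c (cinv c x) (axis j 1) $ k)"
    by (simp add: comp11_def Jm_def coord_field_eq)
qed

lemma om_smooth: "smooth_tensor02 om"
  unfolding smooth_tensor02_def
proof (intro conjI ballI allI)
  have J: "\<And>p u v a b. p \<in> W \<Longrightarrow> u \<in> tangent_space A p \<Longrightarrow> v \<in> tangent_space A p \<Longrightarrow>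
      J p u \<in> tangent_space A p \<and> J p (lincomb a u b v) = lincomb a (J p u) b (J p v)"
    using acs unfolding almost_complex_structure_on_def tensor11_on_def by blast
  have t: "\<And>p u v w a b. p \<in> W \<Longrightarrow> u \<in> tangent_space A p \<Longrightarrow> v \<in> tangent_space A p \<Longrightarrow> w \<in> tangent_space A p \<Longrightarrow>
      g p (lincomb a u b v) w = a * g p u w + b * g p v w \<and> g p w (lincomb a u b v) = a * g p w u + b * g p w v"
    using riem unfolding riemannian_metric_on_def tensor02_on_def by blast
  show "tensor02_on A W om"
    unfolding tensor02_on_def om_def
  proof (intro ballI allI)
    fix p u v w a b assume a: "p \<in> W" "u \<in> tangent_space A p" "v \<in> tangent_space A p" "w \<in> tangent_space A p"
    have Ju: "J p u \<in> tangent_space A p" and Jv: "J p v \<in> tangent_space A p" and Jw: "J p w \<in> tangent_space A p"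
      and Jl: "J p (lincomb a u b v) = lincomb a (J p u) b (J p v)" using J a by blast+
    show "g p (J p (lincomb a u b v)) w = a * g p (J p u) w + b * g p (J p v) w \<and>
        g p (J p w) (lincomb a u b v) = a * g p (J p w) u + b * g p (J p w) v"
      unfolding Jl using t[OF a(1) Ju Jv a(4)] t[OF a(1,2,3) Jw] by blast
  qed
  fix c i j assume c: "c \<in> A"
  let ?S = "cmap c ` (cdom c \<inter> W)"
  note S = open_WS[OF c]
  show "smooth_fun_on A (cdom c \<inter> W) (comp02 A c om i j)"
  proof (rule smooth_fun_onI[OF c])
    have "smooth_on ?S (\<lambda>x. \<Sum>k\<in>UNIV. Jm c (cinv c x) (axis i 1) $ k * cmp c g (cinv c x) (axis k 1) (axis j 1))"
      by (intro smooth_on_sum[OF S] smooth_on_mult[OF S] smooth_on_nth[OF S] Jm_smooth c cmp_smooth[OF g_smooth])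
    then show "smooth_on ?S (\<lambda>x. comp02 A c om i j (cinv c x))"
    proof (rule smooth_on_cong[OF S, THEN iffD1, rotated])
      fix x assume "x \<in> ?S"
      then have q: "cinv c x \<in> cdom c" "cinv c x \<in> W" using cinv_mem[OF c, of "cdom c \<inter> W" x] by blast+
      show "(\<Sum>k\<in>UNIV. Jm c (cinv c x) (axis i 1) $ k * cmp c g (cinv c x) (axis k 1) (axis j 1))
          = comp02 A c om i j (cinv c x)"
        unfolding comp02_eq cmp_om[OF c q]
        using linear_sum_axis[OF g_linear(1)[OF c q], of "Jm c (cinv c x) (axis i 1)" "axis j 1"] by simp
    qed
  qed (auto intro!: openin_Int open_cdom c W)
qed

context
  fixes c p assumes c: "c \<in> A" "p \<in> cdom c" "p \<in> W"
begin

lemma der_g_sym: "der c g p w u v = der c g p w v u"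
proof -
  have "fd (\<lambda>x. cmp c g (cinv c x) u v) (cmap c p) = fd (\<lambda>x. cmp c g (cinv c x) v u) (cmap c p)"
  proof (rule fd_cong_open[OF open_WS[OF c(1)]])
    fix y assume "y \<in> cmap c ` (cdom c \<inter> W)"
    then have q: "cinv c y \<in> cdom c" "cinv c y \<in> W" using cinv_mem[OF c(1), of "cdom c \<inter> W" y] by blast+
    show "cmp c g (cinv c y) u v = cmp c g (cinv c y) v u" by (rule g_sym[OF c(1) q])
  qed (use c in blast)
  then show ?thesis by (simp add: der_def)
qed

text \<open>The Levi-Civita connection is torsion-free.\<close>

lemma kos_sym: "kos c p u v w = kos c p v u w"
  unfolding kos_def using der_g_sym[of w u v] by simp

text \<open>The Levi-Civita connection is compatible with the metric.\<close>

lemma kos_sum: "kos c p u v w + kos c p u w v = der c g p u v w"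
  unfolding kos_def using der_g_sym[of u w v] der_g_sym[of v u w] der_g_sym[of w u v] by (simp add: field_simps)

lemma kos_linear:
  "linear (\<lambda>u. kos c p u v w)" "linear (\<lambda>v. kos c p u v w)" "linear (\<lambda>w. kos c p u v w)"
  unfolding kos_def real_scaleR_def[symmetric]
  by (intro linear_compose_scale_right linear_compose_sub linear_compose_add der_linear[OF g_smooth c])+

lemma par_linear:
  "linear (\<lambda>u. par c p u v w)" "linear (\<lambda>v. par c p u v w)" "linear (\<lambda>w. par c p u v w)"
proof -
  note J = linear_compose[OF Jm_linear[OF c], unfolded comp_def]
  show "linear (\<lambda>u. par c p u v w)" "linear (\<lambda>v. par c p u v w)" "linear (\<lambda>w. par c p u v w)"
    unfolding par_def
    by (intro linear_compose_sub linear_compose_add der_linear[OF om_smooth c] kos_linear J)+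
qed

end

text \<open>The derivative of \<open>om\<close> produces two \<open>hess\<close> terms and each
  Koszul term one; they cancel in pairs because J is skew-adjoint. So vanishing of
  \<open>par\<close> has to be checked in one chart only, although \<open>parallel11_on\<close>
  speaks of all charts.\<close>

lemma par_change:
  assumes c: "c \<in> A" "p \<in> cdom c" and d: "d \<in> A" "p \<in> cdom d" and p: "p \<in> W"
  shows "par c p u v w = par d p (tmap c d p u) (tmap c d p v) (tmap c d p w)"
proof -
  let ?L = "tmap c d p" and ?Q = "hess c d p"
  have JL: "?L (Jm c p x) = Jm d p (?L x)" for x
  proof -
    have "tv c p (Jm c p x) = J p (tv c p x)" by (rule J_tv[OF c p, symmetric])
    also have "\<dots> = J p (tv d p (?L x))"
      by (rule arg_cong[where f = "J p"]) (rule tv_change[OF c(1) d(1) c(2) d(2)])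
    also have "\<dots> = tv d p (Jm d p (?L x))" by (rule J_tv[OF d p])
    finally have "tv c p (Jm c p x) d = tv d p (Jm d p (?L x)) d" by (rule fun_cong)
    then show ?thesis unfolding tv_component[OF d] tmap_self[OF d] .
  qed
  have Q: "?Q x y = ?Q y x" for x y by (rule hess_sym[OF c(1) d(1) c(2) d(2)])
  have k: "kos c p x y z = kos d p (?L x) (?L y) (?L z) + cmp d g p (?Q x y) (?L z)" for x y z
    unfolding kos_def der_change[OF g_smooth c d p]
    using Q[of z x] Q[of z y] Q[of y x] g_sym[OF d p, of "?L y" "?Q x z"] g_sym[OF d p, of "?L x" "?Q y z"]
    by (simp add: field_simps)
  have "der c om p u v w = der d om p (?L u) (?L v) (?L w)
      + cmp d g p (Jm d p (?Q u v)) (?L w) + cmp d g p (Jm d p (?L v)) (?Q u w)"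
    unfolding der_change[OF om_smooth c d p] cmp_om[OF d p] ..
  then show ?thesis
    unfolding par_def k JL
    using g_skew[OF d p, of "?Q u v" "?L w"] g_sym[OF d p, of "?Q u v" "Jm d p (?L w)"]
      g_sym[OF d p, of "?Q u w" "Jm d p (?L v)"]
    by simp
qed

lemma par_zero_change:
  assumes c: "c \<in> A" "p \<in> cdom c" and d: "d \<in> A" "p \<in> cdom d" and p: "p \<in> W"
    and z: "\<And>u v w. par d p u v w = 0"
  shows "par c p u v w = 0"
  unfolding par_change[OF c d p] by (rule z)

text \<open>Lowering the upper index removes the inverse metric from the Christoffel symbols, so
  that everything further is linear in the derivatives of the components of g.\<close>

lemma lowered_christoffel:
  assumes c: "c \<in> A" "p \<in> cdom c" "p \<in> W"
  shows "cmp c g p w (\<chi> k. christoffel A c g k i j p) = kos c p (axis i 1) (axis j 1) w"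
proof -
  let ?E = "\<lambda>i. axis i (1 :: real)"
  define M :: "real ^ 'n ^ 'n" where "M = (\<chi> i j. comp02 A c g i j p)"
  have Mv: "(M *v x) $ n = cmp c g p (?E n) x" for x n
    using linear_sum_axis[OF g_linear(2)[OF c], of "?E n" x]
    by (simp add: M_def matrix_vector_mult_def comp02_eq mult.commute)
  \<comment> \<open>The Gram matrix is invertible because a vector in its kernel would satisfy g(x,
    x) = 0.\<close>
  have "x = 0" if "M *v x = 0" for x
  proof (rule ccontr)
    assume "x \<noteq> 0"
    then have "cmp c g p x x > 0" by (rule g_pos[OF c])
    moreover have "cmp c g p x x = (\<Sum>n\<in>UNIV. x $ n * cmp c g p (?E n) x)"
      using linear_sum_axis[OF g_linear(1)[OF c], of x x] by simp
    moreover have "cmp c g p (?E n) x = 0" for n using Mv[of x n] that by simp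
    ultimately show False by simp
  qed
  then have "invertible M"
    unfolding invertible_left_inverse matrix_left_invertible_ker by blast
  then have MI: "M ** matrix_inv M = mat 1"
    unfolding invertible_def matrix_inv_def by (rule someI2_ex) (rule conjunct1)
  have dd: "coord_deriv c i (comp02 A c g j l) p = der c g p (?E i) (?E j) (?E l)" for i j l
    by (simp add: coord_deriv_def der_def comp_def comp02_eq)
  have ch: "(\<chi> k. christoffel A c g k i j p) = matrix_inv M *v (\<chi> l. kos c p (?E i) (?E j) (?E l))"
    unfolding vec_eq_iff
    by (simp add: christoffel_def inverse_metric_def M_def[symmetric] dd kos_def matrix_vector_mult_def sum_distrib_left
        mult.left_commute)
  have "M *v (\<chi> k. christoffel A c g k i j p) = (\<chi> l. kos c p (?E i) (?E j) (?E l))"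
    unfolding ch matrix_vector_mul_assoc MI by (rule matrix_vector_mul_lid)
  then have n: "cmp c g p (?E n) (\<chi> k. christoffel A c g k i j p) = kos c p (?E i) (?E j) (?E n)" for n
    using Mv[of "\<chi> k. christoffel A c g k i j p" n] by simp
  show ?thesis
    unfolding linear_sum_axis[OF g_linear(1)[OF c], of w] linear_sum_axis[OF kos_linear(3)[OF c, of "?E i" "?E j"], of w] n ..
qed

text \<open>The product rule for \<open>om\<close>, that is g(J . , . ), trades the derivative of J
  for those of \<open>om\<close> and of g. The latter is split by \<open>kos_sum\<close>, and one of
  its halves cancels the Koszul term coming from the Christoffel symbols.\<close>

lemma nabla_par:
  assumes c: "c \<in> A" "p \<in> cdom c" "p \<in> W"
  shows "cmp c g p (axis n 1) (\<chi> k. nabla11 A c g J i k j p) = par c p (axis i 1) (axis j 1) (axis n 1)"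
proof -
  let ?E = "\<lambda>i. axis i (1 :: real)"
  let ?G = "\<lambda>i j. \<chi> k. christoffel A c g k i j p"
  let ?x = "cmap c p"
  have x: "?x \<in> cmap c ` (cdom c \<inter> W)" using c by blast
  have dJ: "(\<lambda>x. Jm c (cinv c x) (?E j)) differentiable (at ?x)"
    by (rule smooth_on_imp_differentiable[OF Jm_smooth[OF c(1)] x])
  let ?D = "fd (\<lambda>x. Jm c (cinv c x) (?E j)) ?x (?E i)"
  have cJ: "comp11 A c J k j q = Jm c q (?E j) $ k" for k j q
    by (simp add: comp11_def Jm_def coord_field_eq)
  have "coord_deriv c i (comp11 A c J k j) p = ?D $ k" for k
    unfolding coord_deriv_def comp_def cJ by (rule fd_nth[OF dJ])
  then have "(\<chi> k. nabla11 A c g J i k j p)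
      = ?D + (\<Sum>l\<in>UNIV. Jm c p (?E j) $ l *\<^sub>R ?G i l) - Jm c p (?G i j)"
    using linear_sum_axis[OF Jm_linear[OF c], of "?G i j"]
    by (simp add: vec_eq_iff nabla11_def cJ mult.commute)
  then have "cmp c g p (?E n) (\<chi> k. nabla11 A c g J i k j p) =
      cmp c g p (?E n) ?D + (\<Sum>l\<in>UNIV. Jm c p (?E j) $ l * cmp c g p (?E n) (?G i l)) - cmp c g p (?E n) (Jm c p (?G i j))"
    by (simp only: linear_diff[OF g_linear(2)[OF c]] linear_add[OF g_linear(2)[OF c]]
        linear_sum[OF g_linear(2)[OF c]] linear_cmul[OF g_linear(2)[OF c]] real_scaleR_def)
  also have "(\<Sum>l\<in>UNIV. Jm c p (?E j) $ l * cmp c g p (?E n) (?G i l)) = kos c p (?E i) (Jm c p (?E j)) (?E n)"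
    unfolding lowered_christoffel[OF c]
    using linear_sum_axis[OF kos_linear(2)[OF c, of "?E i" "?E n"], of "Jm c p (?E j)"] by simp
  also have "cmp c g p (?E n) (Jm c p (?G i j)) = - kos c p (?E i) (?E j) (Jm c p (?E n))"
    using g_sym[OF c, of "?E n" "Jm c p (?G i j)"] g_skew[OF c, of "?G i j" "?E n"]
      lowered_christoffel[OF c, of "Jm c p (?E n)" i j] by simp
  finally have 1: "cmp c g p (?E n) (\<chi> k. nabla11 A c g J i k j p) =
      cmp c g p (?E n) ?D + kos c p (?E i) (Jm c p (?E j)) (?E n) + kos c p (?E i) (?E j) (Jm c p (?E n))" by simp
  have "der c om p (?E i) (?E j) (?E n) = fd (\<lambda>x. cmp c g (cinv c x) (Jm c (cinv c x) (?E j)) (?E n)) ?x (?E i)"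
    unfolding der_def
  proof (rule fun_cong[OF fd_cong_open[OF open_WS[OF c(1)] x]])
    fix y assume "y \<in> cmap c ` (cdom c \<inter> W)"
    then have q: "cinv c y \<in> cdom c" "cinv c y \<in> W" using cinv_mem[OF c(1), of "cdom c \<inter> W" y] by blast+
    show "cmp c om (cinv c y) (?E j) (?E n) = cmp c g (cinv c y) (Jm c (cinv c y) (?E j)) (?E n)"
      by (rule cmp_om[OF c(1) q])
  qed
  also have "\<dots> = der c g p (?E i) (Jm c (cinv c ?x) (?E j)) (?E n) + cmp c g p ?D (?E n)
      + cmp c g p (Jm c (cinv c ?x) (?E j)) (fd (\<lambda>x. ?E n) ?x (?E i))"
    by (rule der_product[OF g_smooth c dJ]) (rule differentiable_const)
  also have "fd (\<lambda>x. ?E n) ?x (?E i) = 0" using fd_eqI[OF has_derivative_const[of "?E n" "at ?x"]] by simp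
  finally have 2: "der c om p (?E i) (?E j) (?E n) = der c g p (?E i) (Jm c p (?E j)) (?E n) + cmp c g p ?D (?E n)"
    by (simp add: cinv_cmap[OF c(1,2)] linear_0[OF g_linear(2)[OF c]])
  show ?thesis
    unfolding 1 par_def 2 kos_sum[OF c, symmetric, of "?E i" "Jm c p (?E j)" "?E n"]
    using g_sym[OF c, of "?E n" ?D] by simp
qed

text \<open>Lowering the index with a positive definite metric loses no information, and a trilinear
  form vanishes once it does on basis vectors.\<close>

lemma nabla_zero_iff:
  assumes c: "c \<in> A" "p \<in> cdom c" "p \<in> W"
  shows "(\<forall>i k j. nabla11 A c g J i k j p = 0) \<longleftrightarrow> (\<forall>u v w. par c p u v w = 0)"
proof
  assume z: "\<forall>i k j. nabla11 A c g J i k j p = 0"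
  have "par c p (axis i 1) (axis j 1) (axis n 1) = 0" for i j n
  proof -
    have "(\<chi> k. nabla11 A c g J i k j p) = 0" by (simp add: vec_eq_iff z)
    then show ?thesis using nabla_par[OF c, of n i j] linear_0[OF g_linear(2)[OF c]] by simp
  qed
  then have "par c p u (axis j 1) (axis n 1) = 0" for u j n
    using linear_sum_axis[OF par_linear(1)[OF c, of "axis j 1" "axis n 1"], of u] by simp
  then have pz: "par c p u v (axis n 1) = 0" for u v n
    using linear_sum_axis[OF par_linear(2)[OF c, of u "axis n 1"], of v] by simp
  show "\<forall>u v w. par c p u v w = 0"
  proof (intro allI)
    fix u v w
    show "par c p u v w = 0"
      using linear_sum_axis[OF par_linear(3)[OF c, of u v], of w] by (simp add: pz)
  qed
next
  assume z: "\<forall>u v w. par c p u v w = 0"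
  show "\<forall>i k j. nabla11 A c g J i k j p = 0"
  proof (intro allI)
    fix i k j
    let ?N = "\<chi> k. nabla11 A c g J i k j p"
    have "cmp c g p (axis n 1) ?N = 0" for n using nabla_par[OF c, of n i j] z by simp
    then have "cmp c g p ?N ?N = 0"
      unfolding linear_sum_axis[OF g_linear(1)[OF c], of ?N] by simp
    then have "?N = 0" using g_pos[OF c, of ?N] by fastforce
    then show "nabla11 A c g J i k j p = 0" by (simp add: vec_eq_iff)
  qed
qed

end

section \<open>The normal form\<close>

context tensor_mfd
begin

text \<open>The coordinate formulas yield smooth components in the single chart \<open>c\<close>,
  whereas \<open>riemannian_metric_on\<close> asks for every chart meeting the domain. The Jacobians
  supply the rest.\<close>

lemma smooth_comp02_all_charts:
  assumes c: "c \<in> A" "W = cdom c" and h: "tensor02_on A W h"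
    and sm: "\<And>i j. smooth_fun_on A (cdom c) (comp02 A c h i j)" and d: "d \<in> A"
  shows "smooth_fun_on A (cdom d \<inter> W) (comp02 A d h i j)"
proof (rule smooth_fun_onI[OF d])
  show "openin T (cdom d \<inter> W)" by (intro openin_Int open_cdom d W)
  let ?S = "cmap d ` (cdom d \<inter> W)"
  note S = open_WS[OF d]
  have tr: "smooth_on ?S (\<lambda>x. fd (transition d c) x u $ a)" for u a
    using smooth_on_nth[OF S smooth_on_fd] smooth_transition[OF d c(1)] by (simp add: c(2))
  have sm': "smooth_on ?S (\<lambda>x. comp02 A c h a b (cinv d x))" for a b
    using sm[of a b] d unfolding smooth_fun_on_def by (simp add: comp_def c(2))
  have "smooth_on ?S (\<lambda>x. \<Sum>a\<in>UNIV. \<Sum>b\<in>UNIV. (fd (transition d c) x (axis i 1) $ a * fd (transition d c) x (axis j 1) $ b)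
      * comp02 A c h a b (cinv d x))"
    by (intro smooth_on_sum[OF S] smooth_on_mult[OF S] tr sm')
  then show "smooth_on ?S (\<lambda>x. comp02 A d h i j (cinv d x))"
  proof (rule smooth_on_cong[OF S, THEN iffD1, rotated])
    fix x assume "x \<in> ?S"
    then obtain q where q: "q \<in> cdom d" "q \<in> W" "x = cmap d q" by blast
    have qc: "q \<in> cdom c" using q(2) c(2) by simp
    have "cmp d h q (axis i 1) (axis j 1) = cmp c h q (tmap d c q (axis i 1)) (tmap d c q (axis j 1))"
      by (rule cmp_change[OF d c(1) q(1) qc])
    also have "\<dots> = (\<Sum>a\<in>UNIV. \<Sum>b\<in>UNIV. (tmap d c q (axis i 1) $ a * tmap d c q (axis j 1) $ b)
        * cmp c h q (axis a 1) (axis b 1))"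
      by (rule bilinear_sum_axis) (rule cmp_bilinear[OF h c(1) qc q(2)])+
    finally show "(\<Sum>a\<in>UNIV. \<Sum>b\<in>UNIV. (fd (transition d c) x (axis i 1) $ a * fd (transition d c) x (axis j 1) $ b)
      * comp02 A c h a b (cinv d x)) = comp02 A d h i j (cinv d x)"
      by (simp only: q(3) cinv_cmap[OF d q(1)] comp02_eq tmap_def)
  qed
qed simp

lemma smooth_comp11_all_charts:
  assumes c: "c \<in> A" "W = cdom c" and J: "tensor11_on A W J"
    and sm: "\<And>k j. smooth_fun_on A (cdom c) (comp11 A c J k j)" and d: "d \<in> A"
  shows "smooth_fun_on A (cdom d \<inter> W) (comp11 A d J k j)"
proof (rule smooth_fun_onI[OF d])
  show "openin T (cdom d \<inter> W)" by (intro openin_Int open_cdom d W)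
  let ?S = "cmap d ` (cdom d \<inter> W)"
  note S = open_WS[OF d]
  have trs: "smooth_on ?S (transition d c)" using smooth_transition[OF d c(1)] by (simp add: c(2))
  have tr: "smooth_on ?S (\<lambda>x. fd (transition d c) x u $ a)" for u a
    by (rule smooth_on_nth[OF S smooth_on_fd[OF trs]])
  have tr': "smooth_on ?S (\<lambda>x. fd (transition c d) (transition d c x) u $ a)" for u a
  proof (rule smooth_on_nth[OF S])
    show "smooth_on ?S (\<lambda>x. fd (transition c d) (transition d c x) u)"
    proof (rule smooth_on_compose[OF S open_overlap[OF c(1) d] _ smooth_on_fd[OF smooth_transition[OF c(1) d]] trs])
      show "transition d c ` ?S \<subseteq> cmap c ` (cdom c \<inter> cdom d)"
      proof clarify
        fix q assume "q \<in> cdom d" "q \<in> W"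
        then show "transition d c (cmap d q) \<in> cmap c ` (cdom c \<inter> cdom d)"
          using transition_cmap[OF d, of q c] c(2) by simp
      qed
    qed
  qed
  have sm': "smooth_on ?S (\<lambda>x. comp11 A c J a b (cinv d x))" for a b
    using sm[of a b] d unfolding smooth_fun_on_def by (simp add: comp_def c(2))
  have "smooth_on ?S (\<lambda>x. \<Sum>a\<in>UNIV. (\<Sum>b\<in>UNIV. fd (transition d c) x (axis j 1) $ b * comp11 A c J a b (cinv d x))
      * fd (transition c d) (transition d c x) (axis a 1) $ k)"
    by (intro smooth_on_sum[OF S] smooth_on_mult[OF S] tr tr' sm')
  then show "smooth_on ?S (\<lambda>x. comp11 A d J k j (cinv d x))"
  proof (rule smooth_on_cong[OF S, THEN iffD1, rotated])
    fix x assume "x \<in> ?S"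
    then obtain q where q: "q \<in> cdom d" "q \<in> W" "x = cmap d q" by blast
    have qc: "q \<in> cdom c" using q(2) c(2) by simp
    have tan: "J q (tv c q u) \<in> tangent_space A q"
      and lin: "J q (lincomb a (tv c q u) b (tv c q v)) = lincomb a (J q (tv c q u)) b (J q (tv c q v))" for a b u v
      using J tv_tangent[OF c(1) qc, of u] tv_tangent[OF c(1) qc, of v] q(2) unfolding tensor11_on_def by blast+
    have 1: "J q (tv c q (a *\<^sub>R u + b *\<^sub>R v)) c = a *\<^sub>R J q (tv c q u) c + b *\<^sub>R J q (tv c q v) c" for a b u v
      unfolding tv_lincomb[OF c(1) qc] lin by (simp add: lincomb_def)
    have Jl: "linear (\<lambda>u. J q (tv c q u) c)"
      using 1[of 1 _ 1] 1[of _ _ 0 0] by (intro linearI) simp_all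
    let ?v = "tmap d c q (axis j 1)"
    have e: "J q (tv d q (axis j 1)) d = tmap c d q (J q (tv c q ?v) c)"
      unfolding tv_change[OF d c(1) q(1) qc] by (rule tangent_component[OF tan c(1) d qc q(1)])
    have "J q (tv c q ?v) c $ a = (\<Sum>b\<in>UNIV. ?v $ b * comp11 A c J a b q)" for a
      using linear_sum_axis[OF Jl, of ?v] by (simp add: comp11_def coord_field_eq)
    then have "tmap c d q (J q (tv c q ?v) c) $ k
        = (\<Sum>a\<in>UNIV. (\<Sum>b\<in>UNIV. ?v $ b * comp11 A c J a b q) * tmap c d q (axis a 1) $ k)"
      using linear_sum_axis[OF tmap_linear[OF c(1) d qc q(1)], of "J q (tv c q ?v) c"] by simp
    then show "(\<Sum>a\<in>UNIV. (\<Sum>b\<in>UNIV. fd (transition d c) x (axis j 1) $ b * comp11 A c J a b (cinv d x))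
      * fd (transition c d) (transition d c x) (axis a 1) $ k) = comp11 A d J k j (cinv d x)"
      unfolding q(3) cinv_cmap[OF d q(1)] comp11_def[of A d] coord_field_eq[of d] e tmap_def transition_cmap[OF d q(1)] by simp
  qed
qed simp

end

text \<open>The equations are left out of the locale: in the first half of the theorem they are
  assumed, in the second they are deduced from parallelism within the same setting.\<close>

locale normal_form = mfd T A for T :: "'a topology" and A :: "('a, 4) chart set" +
  fixes c :: "('a, 4) chart" and g :: "('a, 4) tensor02" and J :: "('a, 4) tensor11"
    and \<alpha> \<beta> \<gamma> \<delta> :: "'a \<Rightarrow> real"
  assumes c: "c \<in> A" and adm: "admissible_functions A c \<alpha> \<beta> \<gamma> \<delta>"
    and t02: "tensor02_on A (cdom c) g" and mf: "metric_formula A c g \<alpha> \<beta> \<gamma> \<delta>"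
    and t11: "tensor11_on A (cdom c) J" and csf: "complex_structure_formula A c g J"
begin

sublocale tensor_mfd T A "cdom c"
  by unfold_locales (rule open_cdom[OF c])

lemma smooth_functions:
  "smooth_fun_on A (cdom c) \<alpha>" "smooth_fun_on A (cdom c) \<beta>" "smooth_fun_on A (cdom c) \<gamma>" "smooth_fun_on A (cdom c) \<delta>"
  using adm unfolding admissible_functions_def by blast+

lemma cos_pos: "p \<in> cdom c \<Longrightarrow> cos (\<alpha> p) > 0" "p \<in> cdom c \<Longrightarrow> cos (\<gamma> p) > 0"
  using adm unfolding admissible_functions_def by (auto intro!: cos_gt_zero_pi)

text \<open>\<open>ga\<close>, \<open>gb\<close>, \<open>gc\<close> are g_11, g_12, g_22, and
  \<open>ha\<close>, \<open>hb\<close>, \<open>hc\<close> are g_33, g_34, g_44. Through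
  \<open>det\<close> they can be handled as variables subject to one polynomial relation per block,
  which turns most later steps into polynomial algebra.\<close>

definition "ga p = exp (- \<beta> p) * sec (\<alpha> p)"
definition "gb p = tan (\<alpha> p)"
definition "gc p = exp (\<beta> p) * sec (\<alpha> p)"
definition "ha p = exp (- \<delta> p) * sec (\<gamma> p)"
definition "hb p = tan (\<gamma> p)"
definition "hc p = exp (\<delta> p) * sec (\<gamma> p)"

lemmas g_defs = ga_def gb_def gc_def ha_def hb_def hc_def

lemma sec_sq: "cos x \<noteq> 0 \<Longrightarrow> sec x * sec x = 1 + tan x * tan x"
proof -
  assume x: "cos x \<noteq> 0"
  have "1 + tan x * tan x = (cos x * cos x + sin x * sin x) / (cos x * cos x)"
    using x by (simp add: tan_def add_divide_distrib del: sin_cos_squared_add3)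
  also have "\<dots> = 1 / (cos x * cos x)" by (simp only: sin_cos_squared_add3)
  finally show ?thesis by (simp add: sec_def)
qed

lemma det: "p \<in> cdom c \<Longrightarrow> ga p * gc p = 1 + gb p * gb p" "p \<in> cdom c \<Longrightarrow> ha p * hc p = 1 + hb p * hb p"
proof -
  assume p: "p \<in> cdom c"
  have e: "exp (- x) * s * (exp x * s) = s * s" for x s :: real
    using exp_minus_inverse[of x] by (simp add: mult.assoc mult.left_commute exp_minus)
  show "ga p * gc p = 1 + gb p * gb p" "ha p * hc p = 1 + hb p * hb p"
    unfolding g_defs e using sec_sq cos_pos[OF p] by simp_all
qed

lemma g_positive: "p \<in> cdom c \<Longrightarrow> ga p > 0" "p \<in> cdom c \<Longrightarrow> gc p > 0" "p \<in> cdom c \<Longrightarrow> ha p > 0" "p \<in> cdom c \<Longrightarrow> hc p > 0"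
  using cos_pos[of p] by (simp_all add: g_defs sec_def)

lemma comp02_values:
  assumes "p \<in> cdom c"
  shows "comp02 A c g 1 1 p = ga p" "comp02 A c g 1 2 p = gb p" "comp02 A c g 2 1 p = gb p" "comp02 A c g 2 2 p = gc p"
    "comp02 A c g 3 3 p = ha p" "comp02 A c g 3 4 p = hb p" "comp02 A c g 4 3 p = hb p" "comp02 A c g 4 4 p = hc p"
    "comp02 A c g 1 3 p = 0" "comp02 A c g 1 4 p = 0" "comp02 A c g 2 3 p = 0" "comp02 A c g 2 4 p = 0"
    "comp02 A c g 3 1 p = 0" "comp02 A c g 4 1 p = 0" "comp02 A c g 3 2 p = 0" "comp02 A c g 4 2 p = 0"
  using mf[unfolded metric_formula_def Let_def, rule_format, OF assms] unfolding g_defs by metis+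

lemma comp11_values:
  assumes "p \<in> cdom c"
  shows "comp11 A c J 1 1 p = - gb p" "comp11 A c J 1 2 p = - gc p" "comp11 A c J 2 1 p = ga p" "comp11 A c J 2 2 p = gb p"
    "comp11 A c J 3 3 p = - hb p" "comp11 A c J 3 4 p = - hc p" "comp11 A c J 4 3 p = ha p" "comp11 A c J 4 4 p = hb p"
    "comp11 A c J 1 3 p = 0" "comp11 A c J 1 4 p = 0" "comp11 A c J 2 3 p = 0" "comp11 A c J 2 4 p = 0"
    "comp11 A c J 3 1 p = 0" "comp11 A c J 4 1 p = 0" "comp11 A c J 3 2 p = 0" "comp11 A c J 4 2 p = 0"
  using csf[unfolded complex_structure_formula_def Let_def, rule_format, OF assms] comp02_values[OF assms] by simp_all

lemma cmp_formula:
  assumes p: "p \<in> cdom c"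
  shows "cmp c g p u v = ga p * (u $ 1 * v $ 1) + gb p * (u $ 1 * v $ 2 + u $ 2 * v $ 1) + gc p * (u $ 2 * v $ 2)
    + (ha p * (u $ 3 * v $ 3) + hb p * (u $ 3 * v $ 4 + u $ 4 * v $ 3) + hc p * (u $ 4 * v $ 4))"
proof -
  have "cmp c g p u v = (\<Sum>i\<in>UNIV. \<Sum>j\<in>UNIV. (u $ i * v $ j) * comp02 A c g i j p)"
    unfolding comp02_eq by (rule bilinear_sum_axis) (rule cmp_bilinear[OF t02 c p p])+
  then show ?thesis unfolding sum_4 comp02_values[OF p] by (simp add: algebra_simps)
qed

lemma J_formula:
  assumes p: "p \<in> cdom c"
  shows "J p (tv c p u) c $ 1 = - gb p * u $ 1 - gc p * u $ 2" "J p (tv c p u) c $ 2 = ga p * u $ 1 + gb p * u $ 2"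
    "J p (tv c p u) c $ 3 = - hb p * u $ 3 - hc p * u $ 4" "J p (tv c p u) c $ 4 = ha p * u $ 3 + hb p * u $ 4"
proof -
  have lin: "J p (lincomb a (tv c p u) b (tv c p v)) = lincomb a (J p (tv c p u)) b (J p (tv c p v))" for a b u v
    using t11 tv_tangent[OF c p, of u] tv_tangent[OF c p, of v] p unfolding tensor11_on_def by blast
  have 1: "J p (tv c p (a *\<^sub>R u + b *\<^sub>R v)) c = a *\<^sub>R J p (tv c p u) c + b *\<^sub>R J p (tv c p v) c" for a b u v
    unfolding tv_lincomb[OF c p] lin by (simp add: lincomb_def)
  have Jl: "linear (\<lambda>u. J p (tv c p u) c)"
    using 1[of 1 _ 1] 1[of _ _ 0 0] by (intro linearI) simp_all
  have eqJ: "J p (tv c p u) c $ k = (\<Sum>j\<in>UNIV. u $ j * comp11 A c J k j p)" for k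
    using linear_sum_axis[OF Jl, of u] by (simp add: comp11_def coord_field_eq)
  show "J p (tv c p u) c $ 1 = - gb p * u $ 1 - gc p * u $ 2" "J p (tv c p u) c $ 2 = ga p * u $ 1 + gb p * u $ 2"
    "J p (tv c p u) c $ 3 = - hb p * u $ 3 - hc p * u $ 4" "J p (tv c p u) c $ 4 = ha p * u $ 3 + hb p * u $ 4"
    unfolding eqJ sum_4 comp11_values[OF p] by (simp_all add: mult.commute)
qed

lemma smooth_g: "smooth_fun_on A (cdom c) ga" "smooth_fun_on A (cdom c) gb" "smooth_fun_on A (cdom c) gc"
  "smooth_fun_on A (cdom c) ha" "smooth_fun_on A (cdom c) hb" "smooth_fun_on A (cdom c) hc"
proof -
  note o = open_cdom[OF c]
  have neg: "smooth_fun_on A (cdom c) (\<lambda>p. - f p)" if "smooth_fun_on A (cdom c) f" for f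
    by (rule smooth_fun_on_compose[OF o that open_UNIV]) (auto intro: smooth_on_minus smooth_on_ident)
  have ex: "smooth_fun_on A (cdom c) (\<lambda>p. exp (f p))" if "smooth_fun_on A (cdom c) f" for f
    by (rule smooth_fun_on_compose[OF o that open_UNIV smooth_on_exp]) simp
  have sc: "smooth_fun_on A (cdom c) (\<lambda>p. sec (f p)) \<and> smooth_fun_on A (cdom c) (\<lambda>p. tan (f p))"
    if f: "smooth_fun_on A (cdom c) f" and pos: "\<And>p. p \<in> cdom c \<Longrightarrow> cos (f p) > 0" for f
  proof -
    have co: "smooth_fun_on A (cdom c) (\<lambda>p. cos (f p))" and si: "smooth_fun_on A (cdom c) (\<lambda>p. sin (f p))"
      using smooth_on_sin_cos by (auto intro!: smooth_fun_on_compose[OF o f open_UNIV])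
    have se: "smooth_fun_on A (cdom c) (\<lambda>p. inverse (cos (f p)))"
      by (rule smooth_fun_on_compose[OF o co _ smooth_on_inverse]) (auto dest: pos)
    show ?thesis
      using se smooth_fun_on_mult[OF o si se] by (simp add: sec_def tan_def inverse_eq_divide)
  qed
  show "smooth_fun_on A (cdom c) ga" "smooth_fun_on A (cdom c) gb" "smooth_fun_on A (cdom c) gc"
    "smooth_fun_on A (cdom c) ha" "smooth_fun_on A (cdom c) hb" "smooth_fun_on A (cdom c) hc"
    unfolding g_defs
    using sc[OF smooth_functions(1) cos_pos(1)] sc[OF smooth_functions(3) cos_pos(2)]
      ex[OF smooth_functions(2)] ex[OF neg[OF smooth_functions(2)]] ex[OF smooth_functions(4)] ex[OF neg[OF smooth_functions(4)]]
    by (auto intro!: smooth_fun_on_mult[OF o])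
qed

lemma smooth_comp02: "smooth_fun_on A (cdom c) (comp02 A c g i j)"
proof -
  have s: "smooth_fun_on A (cdom c) (comp02 A c g i j)"
    if "\<And>p. p \<in> cdom c \<Longrightarrow> comp02 A c g i j p = f p" "smooth_fun_on A (cdom c) f" for f i j
    by (rule smooth_fun_on_cong[OF open_cdom[OF c] that])
  have "\<forall>i j. smooth_fun_on A (cdom c) (comp02 A c g i j)"
    unfolding forall_4
    by (intro conjI; (rule s, erule comp02_values, (rule smooth_g smooth_fun_on_const)))
  then show ?thesis by blast
qed

lemma smooth_comp11: "smooth_fun_on A (cdom c) (comp11 A c J k j)"
proof -
  note o = open_cdom[OF c]
  have s: "smooth_fun_on A (cdom c) (comp11 A c J i j)"
    if "\<And>p. p \<in> cdom c \<Longrightarrow> comp11 A c J i j p = f p" "smooth_fun_on A (cdom c) f" for f i j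
    by (rule smooth_fun_on_cong[OF o that])
  have neg: "smooth_fun_on A (cdom c) (\<lambda>p. - f p)" if "smooth_fun_on A (cdom c) f" for f
    by (rule smooth_fun_on_compose[OF o that open_UNIV]) (auto intro: smooth_on_minus smooth_on_ident)
  have "\<forall>i j. smooth_fun_on A (cdom c) (comp11 A c J i j)"
    unfolding forall_4
    by (intro conjI; (rule s, erule comp11_values, (rule smooth_g smooth_fun_on_const | (rule neg, rule smooth_g))))
  then show ?thesis by blast
qed

text \<open>Completing the square: \<open>a\<close> times the form is (a x + b y)^2 + y^2, since a e
  - b^2 = 1.\<close>

lemma quadratic_form_pos:
  fixes x y :: real
  assumes "a > 0" "a * e = 1 + b * b" "x \<noteq> 0 \<or> y \<noteq> 0"
  shows "a * (x * x) + b * (x * y + y * x) + e * (y * y) > 0"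
proof -
  have "a * (a * (x * x) + b * (x * y + y * x) + e * (y * y)) = (a * x + b * y) * (a * x + b * y) + (a * e - b * b) * (y * y)"
    by (simp add: algebra_simps)
  also have "\<dots> = (a * x + b * y) * (a * x + b * y) + y * y" using assms(2) by simp
  also have "\<dots> > 0"
  proof (cases "y = 0")
    case True
    then have "a * x \<noteq> 0" using assms by simp
    then have "(a * x) * (a * x) > 0" by (metis not_real_square_gt_zero)
    then show ?thesis using True by simp
  next
    case False
    then have "y * y > 0" by (metis not_real_square_gt_zero)
    then show ?thesis using zero_le_square[of "a * x + b * y"] by linarith
  qed
  finally show ?thesis using assms(1) by (simp add: zero_less_mult_iff)
qed

lemma cmp_pos:
  assumes p: "p \<in> cdom c" and u: "u \<noteq> 0"
  shows "cmp c g p u u > 0"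
proof -
  let ?h = "ga p * (u $ 1 * u $ 1) + gb p * (u $ 1 * u $ 2 + u $ 2 * u $ 1) + gc p * (u $ 2 * u $ 2)"
  let ?v = "ha p * (u $ 3 * u $ 3) + hb p * (u $ 3 * u $ 4 + u $ 4 * u $ 3) + hc p * (u $ 4 * u $ 4)"
  have h: "u $ 1 \<noteq> 0 \<or> u $ 2 \<noteq> 0 \<Longrightarrow> ?h > 0" by (rule quadratic_form_pos[OF g_positive(1)[OF p] det(1)[OF p]])
  have v: "u $ 3 \<noteq> 0 \<or> u $ 4 \<noteq> 0 \<Longrightarrow> ?v > 0" by (rule quadratic_form_pos[OF g_positive(3)[OF p] det(2)[OF p]])
  have h0: "\<not> (u $ 1 \<noteq> 0 \<or> u $ 2 \<noteq> 0) \<Longrightarrow> ?h = 0" by simp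
  have v0: "\<not> (u $ 3 \<noteq> 0 \<or> u $ 4 \<noteq> 0) \<Longrightarrow> ?v = 0" by simp
  have "(u $ 1 \<noteq> 0 \<or> u $ 2 \<noteq> 0) \<or> (u $ 3 \<noteq> 0 \<or> u $ 4 \<noteq> 0)"
    using u unfolding vec_eq_iff forall_4 by simp
  then have "?h + ?v > 0" using h v h0 v0 by (smt (verit))
  then show ?thesis unfolding cmp_formula[OF p] .
qed

text \<open>A pointwise matter: in a plane with a metric of determinant one, the block of J given by
  the formula is the rotation by a right angle. The identity for the square of J and its skewness
  are polynomial consequences of \<open>det\<close>.\<close>

lemma herm: "herm T A (cdom c) g J"
proof unfold_locales
  have tan: "\<exists>x. u = tv c p x" if "p \<in> cdom c" "u \<in> tangent_space A p" for p u
    using tangent_eq[OF c that] by blast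
  have Jt: "J p (tv c p u) = tv c p (J p (tv c p u) c)" if p: "p \<in> cdom c" for p u
  proof -
    have "J p (tv c p u) \<in> tangent_space A p"
      using t11 tv_tangent[OF c p, of u] p unfolding tensor11_on_def by blast
    from tangent_eq[OF c p this] show ?thesis .
  qed
  show "riemannian_metric_on A (cdom c) g"
    unfolding riemannian_metric_on_def
  proof (intro conjI ballI allI impI t02)
    show "smooth_fun_on A (cdom d \<inter> cdom c) (comp02 A d g i j)" if "d \<in> A" for d i j
      by (rule smooth_comp02_all_charts[OF c refl t02 smooth_comp02 that])
    fix p u assume p: "p \<in> cdom c" and "u \<in> tangent_space A p"
    then obtain x where x: "u = tv c p x" using tan by blast
    show "g p u v = g p v u" if v: "v \<in> tangent_space A p" for v
    proof -
      obtain y where y: "v = tv c p y" using tan[OF p v] by blast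
      have "cmp c g p x y = cmp c g p y x" unfolding cmp_formula[OF p] by (simp add: algebra_simps)
      then show ?thesis unfolding x y cmp_def .
    qed
    show "g p u u > 0" if "u \<noteq> (\<lambda>_. 0)"
    proof -
      have "x \<noteq> 0" using that x tv_0[OF c p] by blast
      from cmp_pos[OF p this] show ?thesis unfolding x cmp_def .
    qed
  qed
  show "almost_complex_structure_on A (cdom c) J"
    unfolding almost_complex_structure_on_def
  proof (intro conjI ballI allI t11)
    show "smooth_fun_on A (cdom d \<inter> cdom c) (comp11 A d J k j)" if "d \<in> A" for d k j
      by (rule smooth_comp11_all_charts[OF c refl t11 smooth_comp11 that])
    fix p u assume p: "p \<in> cdom c" and "u \<in> tangent_space A p"
    then obtain x where x: "u = tv c p x" using tan by blast
    have "J p (tv c p (J p (tv c p x) c)) c = - x"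
    proof -
      have d: "ga p * gc p = 1 + gb p * gb p" "ha p * hc p = 1 + hb p * hb p" by (rule det[OF p])+
      have 1: "- gb p * (- gb p * x $ 1 - gc p * x $ 2) - gc p * (ga p * x $ 1 + gb p * x $ 2) = - x $ 1"
        "ga p * (- gb p * x $ 1 - gc p * x $ 2) + gb p * (ga p * x $ 1 + gb p * x $ 2) = - x $ 2"
        "- hb p * (- hb p * x $ 3 - hc p * x $ 4) - hc p * (ha p * x $ 3 + hb p * x $ 4) = - x $ 3"
        "ha p * (- hb p * x $ 3 - hc p * x $ 4) + hb p * (ha p * x $ 3 + hb p * x $ 4) = - x $ 4"
        using d by algebra+
      show ?thesis unfolding vec_eq_iff forall_4 J_formula[OF p] using 1 by simp
    qed
    then have 2: "tv c p (J p (tv c p (J p (tv c p x) c)) c) = tv c p ((-1) *\<^sub>R x + 0 *\<^sub>R x)" by simp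
    have 1: "J p u = tv c p (J p (tv c p x) c)" unfolding x by (rule Jt[OF p])
    have "J p (J p u) = J p (tv c p (J p (tv c p x) c))" by (rule arg_cong[OF 1])
    also have "\<dots> = tv c p (J p (tv c p (J p (tv c p x) c)) c)" by (rule Jt[OF p])
    also have "\<dots> = tv c p ((-1) *\<^sub>R x + 0 *\<^sub>R x)" by (rule 2)
    also have "\<dots> = (\<lambda>d. - tv c p x d)" unfolding tv_lincomb[OF c p] by (simp add: lincomb_def)
    finally show "J p (J p u) = (\<lambda>d. - u d)" unfolding x .
  qed
  show "\<forall>p\<in>cdom c. \<forall>u\<in>tangent_space A p. \<forall>v\<in>tangent_space A p. g p (J p u) v = - g p (J p v) u"
  proof (intro ballI)
    fix p u v assume p: "p \<in> cdom c" and "u \<in> tangent_space A p" "v \<in> tangent_space A p"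
    then obtain x y where x: "u = tv c p x" and y: "v = tv c p y" using tan by blast
    have "cmp c g p (J p (tv c p x) c) y = - cmp c g p (J p (tv c p y) c) x"
      unfolding cmp_formula[OF p] J_formula[OF p] by (simp add: algebra_simps)
    then show "g p (J p u) v = - g p (J p v) u"
      unfolding x y cmp_def Jt[OF p, symmetric] .
  qed
qed

end

text \<open>The components of \<open>par\<close> with the geometry abstracted away.
  \<open>D k i j\<close> stands for the derivative of g_ij along \<partial>_k, \<open>K m n\<close>
  for \<open>J\<^sup>m\<^sub>n\<close>, unprimed letters for the first block and primed ones for the
  second. The left side is \<open>par\<close> for a constant Kaehler form. The hypotheses
  \<open>det\<close> are the differentiated determinant relations; \<open>H\<close> and
  \<open>V\<close> express the derivative of one block along J\<partial>_n, with n in the other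
  block, through its derivative along \<partial>_n, which is the holomorphy condition.\<close>

lemma parallel_algebra:
  fixes D :: "4 \<Rightarrow> 4 \<Rightarrow> 4 \<Rightarrow> real" and K :: "4 \<Rightarrow> 4 \<Rightarrow> real" and A B C A' B' C' :: "4 \<Rightarrow> real"
  assumes D: "\<And>k. D k 1 1 = A k" "\<And>k. D k 1 2 = B k" "\<And>k. D k 2 1 = B k" "\<And>k. D k 2 2 = C k"
      "\<And>k. D k 3 3 = A' k" "\<And>k. D k 3 4 = B' k" "\<And>k. D k 4 3 = B' k" "\<And>k. D k 4 4 = C' k"
      "\<And>k. D k 1 3 = 0" "\<And>k. D k 1 4 = 0" "\<And>k. D k 2 3 = 0" "\<And>k. D k 2 4 = 0"
      "\<And>k. D k 3 1 = 0" "\<And>k. D k 4 1 = 0" "\<And>k. D k 3 2 = 0" "\<And>k. D k 4 2 = 0"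
    and K: "K 1 1 = - b" "K 1 2 = - e" "K 2 1 = a" "K 2 2 = b" "K 3 3 = - b'" "K 3 4 = - e'" "K 4 3 = a'" "K 4 4 = b'"
      "K 1 3 = 0" "K 1 4 = 0" "K 2 3 = 0" "K 2 4 = 0" "K 3 1 = 0" "K 4 1 = 0" "K 3 2 = 0" "K 4 2 = 0"
    and det: "\<And>k. e * A k + a * C k = 2 * (b * B k)" "\<And>k. e' * A' k + a' * C' k = 2 * (b' * B' k)"
    and H: "\<And>n. K 3 n * A 3 + K 4 n * A 4 = (if n = 3 \<or> n = 4 then b * A n - a * B n else 0)"
      "\<And>n. K 3 n * B 3 + K 4 n * B 4 = (if n = 3 \<or> n = 4 then e * A n - b * B n else 0)"
      "\<And>n. K 3 n * C 3 + K 4 n * C 4 = (if n = 3 \<or> n = 4 then e * B n - b * C n else 0)"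
    and V: "\<And>n. K 1 n * A' 1 + K 2 n * A' 2 = (if n = 1 \<or> n = 2 then b' * A' n - a' * B' n else 0)"
      "\<And>n. K 1 n * B' 1 + K 2 n * B' 2 = (if n = 1 \<or> n = 2 then e' * A' n - b' * B' n else 0)"
      "\<And>n. K 1 n * C' 1 + K 2 n * C' 2 = (if n = 1 \<or> n = 2 then e' * B' n - b' * C' n else 0)"
  shows "(\<Sum>m\<in>UNIV. K m n * (1/2 * (D i j m + D j i m - D m i j)))
    - (\<Sum>m\<in>UNIV. K m j * (1/2 * (D i n m + D n i m - D m i n))) = 0"
proof -
  note det' = det(1)[of 1] det(1)[of 2] det(1)[of 3] det(1)[of 4] det(2)[of 1] det(2)[of 2] det(2)[of 3] det(2)[of 4]
  have HV: "- b' * A 3 + a' * A 4 = b * A 3 - a * B 3" "- e' * A 3 + b' * A 4 = b * A 4 - a * B 4"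
    "- b' * B 3 + a' * B 4 = e * A 3 - b * B 3" "- e' * B 3 + b' * B 4 = e * A 4 - b * B 4"
    "- b' * C 3 + a' * C 4 = e * B 3 - b * C 3" "- e' * C 3 + b' * C 4 = e * B 4 - b * C 4"
    "- b * A' 1 + a * A' 2 = b' * A' 1 - a' * B' 1" "- e * A' 1 + b * A' 2 = b' * A' 2 - a' * B' 2"
    "- b * B' 1 + a * B' 2 = e' * A' 1 - b' * B' 1" "- e * B' 1 + b * B' 2 = e' * A' 2 - b' * B' 2"
    "- b * C' 1 + a * C' 2 = e' * B' 1 - b' * C' 1" "- e * C' 1 + b * C' 2 = e' * B' 2 - b' * C' 2"
    using H[of 3] H[of 4] V[of 1] V[of 2] K by simp_all
  \<comment> \<open>Each of the 64 components is an algebraic consequence of the relations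
    \<open>HV\<close> and \<open>det'\<close>.\<close>
  have "\<forall>i j n. (\<Sum>m\<in>UNIV. K m n * (1/2 * (D i j m + D j i m - D m i j)))
    - (\<Sum>m\<in>UNIV. K m j * (1/2 * (D i n m + D n i m - D m i n))) = 0"
    unfolding sum_4 forall_4 D K
    by (intro conjI; insert HV det'; ((simp add: field_simps; fail) | algebra))
  then show ?thesis by blast
qed

section \<open>Parallelism in normal form and the differential equations\<close>

context normal_form
begin

sublocale herm T A "cdom c" g J
  by (rule herm)

definition dd :: "'a \<Rightarrow> ('a \<Rightarrow> real) \<Rightarrow> real ^ 4 \<Rightarrow> real" where
  "dd p f w = fd (\<lambda>x. f (cinv c x)) (cmap c p) w"

lemma coord_deriv_dd: "coord_deriv c i f p = dd p f (axis i 1)"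
  by (simp add: coord_deriv_def dd_def comp_def)

context
  fixes p assumes p: "p \<in> cdom c"
begin

lemma dd_has_derivative:
  "smooth_fun_on A (cdom c) f \<Longrightarrow> ((\<lambda>x. f (cinv c x)) has_derivative dd p f) (at (cmap c p))"
  unfolding dd_def
  by (rule smooth_on_imp_has_derivative[OF smooth_fun_onD[OF _ c]]) (use p in auto)

text \<open>Stated for a generic pair, to be used for \<alpha>, \<beta> and for \<gamma>, \<delta>.
  The derivatives of the entries of a block are polynomial in these entries and linear in the
  differentials of the two functions, so trigonometric functions and exponentials disappear from
  here on.\<close>

lemma dd_block:
  assumes s: "smooth_fun_on A (cdom c) f" "smooth_fun_on A (cdom c) h" and cp: "cos (f p) > 0"
  shows "dd p (\<lambda>p. exp (- h p) * sec (f p)) w = exp (- h p) * sec (f p) * (tan (f p) * dd p f w - dd p h w)"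
    "dd p (\<lambda>p. tan (f p)) w = (1 + tan (f p) * tan (f p)) * dd p f w"
    "dd p (\<lambda>p. exp (h p) * sec (f p)) w = exp (h p) * sec (f p) * (tan (f p) * dd p f w + dd p h w)"
proof -
  let ?x = "cmap c p"
  have pp: "cinv c ?x = p" by (rule cinv_cmap[OF c p])
  note df = dd_has_derivative[OF s(1)] and dh = dd_has_derivative[OF s(2)]
  have cn: "cos (f p) \<noteq> 0" using cp by simp
  have dtan: "(tan has_field_derivative (1 + tan (f p) * tan (f p))) (at (f (cinv c ?x)))"
  proof -
    have "inverse ((cos (f p))\<^sup>2) = sec (f p) * sec (f p)"
      by (simp add: sec_def power2_eq_square inverse_eq_divide)
    also have "\<dots> = 1 + tan (f p) * tan (f p)" by (rule sec_sq[OF cn])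
    finally show ?thesis using DERIV_tan[OF cn] by (simp add: pp)
  qed
  have dsec: "(sec has_field_derivative (sec (f p) * tan (f p))) (at (f (cinv c ?x)))"
    unfolding pp sec_def[abs_def]
    using cn by (auto intro!: derivative_eq_intros simp: tan_def power2_eq_square)
  note t = DERIV_compose_FDERIV[OF dtan df] and se = DERIV_compose_FDERIV[OF dsec df]
  show "dd p (\<lambda>p. tan (f p)) w = (1 + tan (f p) * tan (f p)) * dd p f w"
    using fun_cong[OF fd_eqI[OF t], of w] by (simp add: dd_def mult.commute)
  have e1: "((\<lambda>x. exp (- h (cinv c x))) has_derivative (\<lambda>w. exp (- h p) * - dd p h w)) (at ?x)"
    using has_derivative_exp[OF has_derivative_minus[OF dh]] by (simp add: pp mult.commute)
  have e2: "((\<lambda>x. exp (h (cinv c x))) has_derivative (\<lambda>w. exp (h p) * dd p h w)) (at ?x)"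
    using has_derivative_exp[OF dh] by (simp add: pp mult.commute)
  have "dd p (\<lambda>p. exp (- h p) * sec (f p)) w = exp (- h p) * (dd p f w * (sec (f p) * tan (f p))) + exp (- h p) * - dd p h w * sec (f p)"
    using fun_cong[OF fd_eqI[OF has_derivative_mult[OF e1 se]], of w] by (simp add: dd_def pp)
  then show "dd p (\<lambda>p. exp (- h p) * sec (f p)) w = exp (- h p) * sec (f p) * (tan (f p) * dd p f w - dd p h w)"
    by (simp add: algebra_simps)
  have "dd p (\<lambda>p. exp (h p) * sec (f p)) w = exp (h p) * (dd p f w * (sec (f p) * tan (f p))) + exp (h p) * dd p h w * sec (f p)"
    using fun_cong[OF fd_eqI[OF has_derivative_mult[OF e2 se]], of w] by (simp add: dd_def pp)
  then show "dd p (\<lambda>p. exp (h p) * sec (f p)) w = exp (h p) * sec (f p) * (tan (f p) * dd p f w + dd p h w)"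
    by (simp add: algebra_simps)
qed

lemma dd_g:
  "dd p ga w = ga p * (gb p * dd p \<alpha> w - dd p \<beta> w)" "dd p gb w = (1 + gb p * gb p) * dd p \<alpha> w"
  "dd p gc w = gc p * (gb p * dd p \<alpha> w + dd p \<beta> w)" "dd p ha w = ha p * (hb p * dd p \<gamma> w - dd p \<delta> w)"
  "dd p hb w = (1 + hb p * hb p) * dd p \<gamma> w" "dd p hc w = hc p * (hb p * dd p \<gamma> w + dd p \<delta> w)"
  using dd_block[OF smooth_functions(1,2) cos_pos(1)[OF p]] dd_block[OF smooth_functions(3,4) cos_pos(2)[OF p]]
  unfolding g_defs by blast+

lemma der_comp:
  assumes "\<And>q. q \<in> cdom c \<Longrightarrow> comp02 A c g i j q = f q"
  shows "der c g p w (axis i 1) (axis j 1) = dd p f w"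
  unfolding der_def dd_def
proof (rule fun_cong[OF fd_cong_open[OF open_cmap[OF c]]])
  fix y assume "y \<in> cmap c ` cdom c"
  then have "cinv c y \<in> cdom c" by (rule cinv_cdom)
  then show "cmp c g (cinv c y) (axis i 1) (axis j 1) = f (cinv c y)"
    using assms by (simp add: comp02_eq)
qed (use p in blast)

lemma dd_const: "dd p (\<lambda>p. k) w = 0"
  unfolding dd_def by (rule fun_cong[OF fd_eqI]) (rule has_derivative_const)

lemma der_values:
  "der c g p w (axis 1 1) (axis 1 1) = dd p ga w" "der c g p w (axis 1 1) (axis 2 1) = dd p gb w"
  "der c g p w (axis 2 1) (axis 1 1) = dd p gb w" "der c g p w (axis 2 1) (axis 2 1) = dd p gc w"
  "der c g p w (axis 3 1) (axis 3 1) = dd p ha w" "der c g p w (axis 3 1) (axis 4 1) = dd p hb w"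
  "der c g p w (axis 4 1) (axis 3 1) = dd p hb w" "der c g p w (axis 4 1) (axis 4 1) = dd p hc w"
  "der c g p w (axis 1 1) (axis 3 1) = 0" "der c g p w (axis 1 1) (axis 4 1) = 0"
  "der c g p w (axis 2 1) (axis 3 1) = 0" "der c g p w (axis 2 1) (axis 4 1) = 0"
  "der c g p w (axis 3 1) (axis 1 1) = 0" "der c g p w (axis 4 1) (axis 1 1) = 0"
  "der c g p w (axis 3 1) (axis 2 1) = 0" "der c g p w (axis 4 1) (axis 2 1) = 0"
proof -
  have z: "der c g p w (axis i 1) (axis j 1) = 0" if "\<And>q. q \<in> cdom c \<Longrightarrow> comp02 A c g i j q = 0" for i j
    using der_comp[OF that, of w] dd_const by simp
  show "der c g p w (axis 1 1) (axis 1 1) = dd p ga w" "der c g p w (axis 1 1) (axis 2 1) = dd p gb w"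
    "der c g p w (axis 2 1) (axis 1 1) = dd p gb w" "der c g p w (axis 2 1) (axis 2 1) = dd p gc w"
    "der c g p w (axis 3 1) (axis 3 1) = dd p ha w" "der c g p w (axis 3 1) (axis 4 1) = dd p hb w"
    "der c g p w (axis 4 1) (axis 3 1) = dd p hb w" "der c g p w (axis 4 1) (axis 4 1) = dd p hc w"
    by (rule der_comp, erule comp02_values)+
  show "der c g p w (axis 1 1) (axis 3 1) = 0" "der c g p w (axis 1 1) (axis 4 1) = 0"
    "der c g p w (axis 2 1) (axis 3 1) = 0" "der c g p w (axis 2 1) (axis 4 1) = 0"
    "der c g p w (axis 3 1) (axis 1 1) = 0" "der c g p w (axis 4 1) (axis 1 1) = 0"
    "der c g p w (axis 3 1) (axis 2 1) = 0" "der c g p w (axis 4 1) (axis 2 1) = 0"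
    by (rule z, erule comp02_values)+
qed

lemma der_om: "der c om p w u v = 0"
proof -
  have "fd (\<lambda>x. cmp c om (cinv c x) u v) (cmap c p) = fd (\<lambda>x. u $ 1 * v $ 2 - u $ 2 * v $ 1 + (u $ 3 * v $ 4 - u $ 4 * v $ 3)) (cmap c p)"
  proof (rule fd_cong_open[OF open_cmap[OF c]])
    fix y assume "y \<in> cmap c ` cdom c"
    then have q: "cinv c y \<in> cdom c" by (rule cinv_cdom)
    have d: "ga (cinv c y) * gc (cinv c y) = 1 + gb (cinv c y) * gb (cinv c y)"
      "ha (cinv c y) * hc (cinv c y) = 1 + hb (cinv c y) * hb (cinv c y)" by (rule det[OF q])+
    have "cmp c om (cinv c y) u v = (ga (cinv c y) * gc (cinv c y) - gb (cinv c y) * gb (cinv c y)) * (u $ 1 * v $ 2 - u $ 2 * v $ 1)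
        + (ha (cinv c y) * hc (cinv c y) - hb (cinv c y) * hb (cinv c y)) * (u $ 3 * v $ 4 - u $ 4 * v $ 3)"
      unfolding cmp_om[OF c q q] cmp_formula[OF q] Jm_def J_formula[OF q] by (simp add: algebra_simps)
    then show "cmp c om (cinv c y) u v = u $ 1 * v $ 2 - u $ 2 * v $ 1 + (u $ 3 * v $ 4 - u $ 4 * v $ 3)"
      unfolding d by simp
  qed (use p in blast)
  also have "\<dots> = (\<lambda>w. 0)" by (rule fd_eqI) (rule has_derivative_const)
  finally show ?thesis unfolding der_def by (rule fun_cong)
qed

text \<open>The derivative of the Kaehler form drops out by \<open>der_om\<close>; what remains is
  the expression treated in \<open>parallel_algebra\<close>.\<close>

lemma par_basis:
  "par c p (axis i 1) (axis j 1) (axis n 1) =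
    (\<Sum>m\<in>UNIV. comp11 A c J m n p * (1/2 * (der c g p (axis i 1) (axis j 1) (axis m 1)
      + der c g p (axis j 1) (axis i 1) (axis m 1) - der c g p (axis m 1) (axis i 1) (axis j 1))))
    - (\<Sum>m\<in>UNIV. comp11 A c J m j p * (1/2 * (der c g p (axis i 1) (axis n 1) (axis m 1)
      + der c g p (axis n 1) (axis i 1) (axis m 1) - der c g p (axis m 1) (axis i 1) (axis n 1))))"
proof -
  have K: "comp11 A c J m n p = Jm c p (axis n 1) $ m" for m n by (simp add: comp11_def Jm_def coord_field_eq)
  have "kos c p u v (Jm c p (axis n 1)) = (\<Sum>m\<in>UNIV. comp11 A c J m n p * kos c p u v (axis m 1))" for u v n
    unfolding K using linear_sum_axis[OF kos_linear(3)[OF c p p, of u v], of "Jm c p (axis n 1)"] by simp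
  then show ?thesis unfolding par_def der_om kos_def by simp
qed

end

text \<open>The signs match the metric: \<open>exp ((-1) ^ p * \<delta>) * sec \<gamma>\<close> is
  \<open>ha\<close> for p = 3 and \<open>hc\<close> for p = 4, and tan \<gamma> is
  \<open>hb\<close>; likewise for the first block. So the equations are bilinear in the metric
  entries and the differentials.\<close>

lemma pde_iff:
  "pde_system c \<alpha> \<beta> \<gamma> \<delta> \<longleftrightarrow> (\<forall>p\<in>cdom c.
    - dd p \<beta> (axis 3 1) = dd p \<alpha> (axis 4 1) * ha p - dd p \<alpha> (axis 3 1) * hb p \<and>
    dd p \<beta> (axis 4 1) = dd p \<alpha> (axis 3 1) * hc p - dd p \<alpha> (axis 4 1) * hb p \<and>
    - dd p \<delta> (axis 1 1) = dd p \<gamma> (axis 2 1) * ga p - dd p \<gamma> (axis 1 1) * gb p \<and>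
    dd p \<delta> (axis 2 1) = dd p \<gamma> (axis 1 1) * gc p - dd p \<gamma> (axis 2 1) * gb p)"
proof -
  have doub: "(\<forall>p q. {p, q} = {a, b} \<longrightarrow> P p q) \<longleftrightarrow> P a b \<and> P b a" for a b :: nat and P
    by (auto simp: doubleton_eq_iff)
  have n: "(of_nat 1 :: 4) = 1" "(of_nat 2 :: 4) = 2" "(of_nat 3 :: 4) = 3" "(of_nat 4 :: 4) = 4"
    using of_nat_numeral[where 'a = 4] by (metis of_nat_1 of_nat_numeral)+
  have pw: "(-1 :: real) ^ 3 = -1" "(-1 :: real) ^ 4 = 1" "(-1 :: real) ^ 1 = -1" "(-1 :: real) ^ 2 = 1" by simp_all
  show ?thesis
    unfolding pde_system_def Let_def doub coord_deriv_dd n pw g_defs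
    by (simp add: mult.assoc)
qed

lemma pde_imp_par:
  assumes pde: "pde_system c \<alpha> \<beta> \<gamma> \<delta>" and p: "p \<in> cdom c"
  shows "par c p u v w = 0"
proof -
  let ?K = "\<lambda>m n. comp11 A c J m n p" and ?D = "\<lambda>k i j. der c g p (axis k 1) (axis i 1) (axis j 1)"
  let ?d = "\<lambda>f k. dd p f (axis k 1)"
  note K = comp11_values[OF p]
  note d = det[OF p]
  have e: "- ?d \<beta> 3 = ?d \<alpha> 4 * ha p - ?d \<alpha> 3 * hb p" "?d \<beta> 4 = ?d \<alpha> 3 * hc p - ?d \<alpha> 4 * hb p"
    "- ?d \<delta> 1 = ?d \<gamma> 2 * ga p - ?d \<gamma> 1 * gb p" "?d \<delta> 2 = ?d \<gamma> 1 * gc p - ?d \<gamma> 2 * gb p"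
    using pde p unfolding pde_iff by blast+
  have basis: "par c p (axis i 1) (axis j 1) (axis n 1) = 0" for i j n
    unfolding par_basis[OF p]
  proof (rule parallel_algebra[where D = ?D and K = ?K and a = "ga p" and b = "gb p" and e = "gc p"
        and a' = "ha p" and b' = "hb p" and e' = "hc p"
        and A = "?d ga" and B = "?d gb" and C = "?d gc" and A' = "?d ha" and B' = "?d hb" and C' = "?d hc",
        OF der_values[OF p] K])
    show "gc p * ?d ga k + ga p * ?d gc k = 2 * (gb p * ?d gb k)" for k
      unfolding dd_g[OF p] using d(1) by algebra
    show "hc p * ?d ha k + ha p * ?d hc k = 2 * (hb p * ?d hb k)" for k
      unfolding dd_g[OF p] using d(2) by algebra
    \<comment> \<open>The system as Cauchy-Riemann equations: d\<alpha> composed with J is -d\<beta>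
      and d\<beta> composed with J is d\<alpha> on V, and the same for \<gamma>, \<delta> on H. The
      equations with d\<alpha> and d\<gamma> on the left are the system itself; the others follow
      from them by the determinant relations.\<close>
    have J: "?K 3 3 * ?d \<alpha> 3 + ?K 4 3 * ?d \<alpha> 4 = - ?d \<beta> 3" "?K 3 4 * ?d \<alpha> 3 + ?K 4 4 * ?d \<alpha> 4 = - ?d \<beta> 4"
      "?K 3 3 * ?d \<beta> 3 + ?K 4 3 * ?d \<beta> 4 = ?d \<alpha> 3" "?K 3 4 * ?d \<beta> 3 + ?K 4 4 * ?d \<beta> 4 = ?d \<alpha> 4"
      "?K 1 1 * ?d \<gamma> 1 + ?K 2 1 * ?d \<gamma> 2 = - ?d \<delta> 1" "?K 1 2 * ?d \<gamma> 1 + ?K 2 2 * ?d \<gamma> 2 = - ?d \<delta> 2"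
      "?K 1 1 * ?d \<delta> 1 + ?K 2 1 * ?d \<delta> 2 = ?d \<gamma> 1" "?K 1 2 * ?d \<delta> 1 + ?K 2 2 * ?d \<delta> 2 = ?d \<gamma> 2"
      unfolding K using e d by algebra+
    \<comment> \<open>One identity serves both blocks: k1, k2 is a column of J, the x and y are the
      partial derivatives of the pair of functions, with xn, yn those along the coordinate vector of
      that column, and a, b, c are the entries of the block.\<close>
    have blk: "k1 * (a * (b * x1 - y1)) + k2 * (a * (b * x2 - y2)) = b * (a * (b * xn - yn)) - a * ((1 + b * b) * xn)
        \<and> k1 * ((1 + b * b) * x1) + k2 * ((1 + b * b) * x2) = c * (a * (b * xn - yn)) - b * ((1 + b * b) * xn)
        \<and> k1 * (c * (b * x1 + y1)) + k2 * (c * (b * x2 + y2)) = c * ((1 + b * b) * xn) - b * (c * (b * xn + yn))"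
      if "k1 * x1 + k2 * x2 = - yn" "k1 * y1 + k2 * y2 = xn" "a * c = 1 + b * b"
      for k1 k2 a b c x1 x2 xn y1 y2 yn :: real
      using that by (intro conjI; algebra)
    have n0: "?K 3 n = 0 \<and> ?K 4 n = 0" if "\<not> (n = 3 \<or> n = 4)" for n
      using exhaust_4[of n] that K by metis
    have n0': "?K 1 n = 0 \<and> ?K 2 n = 0" if "\<not> (n = 1 \<or> n = 2)" for n
      using exhaust_4[of n] that K by metis
    have H: "?K 3 n * ?d ga 3 + ?K 4 n * ?d ga 4 = gb p * ?d ga n - ga p * ?d gb n
        \<and> ?K 3 n * ?d gb 3 + ?K 4 n * ?d gb 4 = gc p * ?d ga n - gb p * ?d gb n
        \<and> ?K 3 n * ?d gc 3 + ?K 4 n * ?d gc 4 = gc p * ?d gb n - gb p * ?d gc n" if "n = 3 \<or> n = 4" for n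
      unfolding dd_g[OF p] by (rule blk[OF _ _ d(1)]) (use that J in blast)+
    have V: "?K 1 n * ?d ha 1 + ?K 2 n * ?d ha 2 = hb p * ?d ha n - ha p * ?d hb n
        \<and> ?K 1 n * ?d hb 1 + ?K 2 n * ?d hb 2 = hc p * ?d ha n - hb p * ?d hb n
        \<and> ?K 1 n * ?d hc 1 + ?K 2 n * ?d hc 2 = hc p * ?d hb n - hb p * ?d hc n" if "n = 1 \<or> n = 2" for n
      unfolding dd_g[OF p] by (rule blk[OF _ _ d(2)]) (use that J in blast)+
    show "?K 3 n * ?d ga 3 + ?K 4 n * ?d ga 4 = (if n = 3 \<or> n = 4 then gb p * ?d ga n - ga p * ?d gb n else 0)"
      "?K 3 n * ?d gb 3 + ?K 4 n * ?d gb 4 = (if n = 3 \<or> n = 4 then gc p * ?d ga n - gb p * ?d gb n else 0)"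
      "?K 3 n * ?d gc 3 + ?K 4 n * ?d gc 4 = (if n = 3 \<or> n = 4 then gc p * ?d gb n - gb p * ?d gc n else 0)" for n
      using H[of n] n0[of n] by (cases "n = 3 \<or> n = 4"; simp)+
    show "?K 1 n * ?d ha 1 + ?K 2 n * ?d ha 2 = (if n = 1 \<or> n = 2 then hb p * ?d ha n - ha p * ?d hb n else 0)"
      "?K 1 n * ?d hb 1 + ?K 2 n * ?d hb 2 = (if n = 1 \<or> n = 2 then hc p * ?d ha n - hb p * ?d hb n else 0)"
      "?K 1 n * ?d hc 1 + ?K 2 n * ?d hc 2 = (if n = 1 \<or> n = 2 then hc p * ?d hb n - hb p * ?d hc n else 0)" for n
      using V[of n] n0'[of n] by (cases "n = 1 \<or> n = 2"; simp)+
  qed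
  have 1: "par c p u (axis j 1) (axis n 1) = 0" for u j n
    using linear_sum_axis[OF par_linear(1)[OF c p p, of "axis j 1" "axis n 1"], of u] by (simp add: basis)
  have 2: "par c p u v (axis n 1) = 0" for u v n
    using linear_sum_axis[OF par_linear(2)[OF c p p, of u "axis n 1"], of v] by (simp add: 1)
  show ?thesis
    using linear_sum_axis[OF par_linear(3)[OF c p p, of u v], of w] by (simp add: 2)
qed

text \<open>The equations are read off from the components of \<open>par\<close> with indices
  (1,2,3), (1,2,4), (3,4,1) and (3,4,2). Each is one equation times 1 + b^2, with b the off-diagonal
  entry of the block being differentiated.\<close>

lemma par_imp_pde:
  assumes par: "\<And>p u v w. p \<in> cdom c \<Longrightarrow> par c p u v w = 0"
  shows "pde_system c \<alpha> \<beta> \<gamma> \<delta>"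
  unfolding pde_iff
proof
  fix p assume p: "p \<in> cdom c"
  let ?d = "\<lambda>f k. dd p f (axis k 1)"
  note d = det[OF p]
  have pos: "1 + x * x \<noteq> 0" for x :: real using zero_le_square[of x] by linarith
  have canc: "y = z" if "(1 + b * b) * (y - z) = 0" for b y z :: real using that pos[of b] by simp
  have b3: "- hb p * ?d gb 3 + ha p * ?d gb 4 = gc p * ?d ga 3 - gb p * ?d gb 3"
    using par[OF p, of "axis 1 1" "axis 2 1" "axis 3 1"]
    unfolding par_basis[OF p] sum_4 comp11_values[OF p] der_values[OF p] by (simp add: field_simps)
  have b4: "- hc p * ?d gb 3 + hb p * ?d gb 4 = gc p * ?d ga 4 - gb p * ?d gb 4"
    using par[OF p, of "axis 1 1" "axis 2 1" "axis 4 1"]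
    unfolding par_basis[OF p] sum_4 comp11_values[OF p] der_values[OF p] by (simp add: field_simps)
  have h1: "- gb p * ?d hb 1 + ga p * ?d hb 2 = hc p * ?d ha 1 - hb p * ?d hb 1"
    using par[OF p, of "axis 3 1" "axis 4 1" "axis 1 1"]
    unfolding par_basis[OF p] sum_4 comp11_values[OF p] der_values[OF p] by (simp add: field_simps)
  have h2: "- gc p * ?d hb 1 + gb p * ?d hb 2 = hc p * ?d ha 2 - hb p * ?d hb 2"
    using par[OF p, of "axis 3 1" "axis 4 1" "axis 2 1"]
    unfolding par_basis[OF p] sum_4 comp11_values[OF p] der_values[OF p] by (simp add: field_simps)
  have 1: "- ?d \<beta> 3 = ?d \<alpha> 4 * ha p - ?d \<alpha> 3 * hb p"
    by (rule canc[of "gb p"]) (use b3 d in \<open>unfold dd_g[OF p]; algebra\<close>)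
  have 2: "?d \<beta> 4 = ?d \<alpha> 3 * hc p - ?d \<alpha> 4 * hb p"
    by (rule canc[of "gb p"]) (use b4 d in \<open>unfold dd_g[OF p]; algebra\<close>)
  have 3: "- ?d \<delta> 1 = ?d \<gamma> 2 * ga p - ?d \<gamma> 1 * gb p"
    by (rule canc[of "hb p"]) (use h1 d in \<open>unfold dd_g[OF p]; algebra\<close>)
  have 4: "?d \<delta> 2 = ?d \<gamma> 1 * gc p - ?d \<gamma> 2 * gb p"
    by (rule canc[of "hb p"]) (use h2 d in \<open>unfold dd_g[OF p]; algebra\<close>)
  show "- ?d \<beta> 3 = ?d \<alpha> 4 * ha p - ?d \<alpha> 3 * hb p \<and> ?d \<beta> 4 = ?d \<alpha> 3 * hc p - ?d \<alpha> 4 * hb p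
    \<and> - ?d \<delta> 1 = ?d \<gamma> 2 * ga p - ?d \<gamma> 1 * gb p \<and> ?d \<delta> 2 = ?d \<gamma> 1 * gc p - ?d \<gamma> 2 * gb p"
    using 1 2 3 4 by blast
qed

end

section \<open>Kaehler splittings\<close>

context mfd
begin

lemma orthogonal_direct_sum_coordI:
  assumes c: "c \<in> A" "p \<in> cdom c" and i: "\<And>u :: real ^ 'n. \<exists>!z. z \<in> X \<times> Y \<and> u = fst z + snd z"
    and H: "H = tv c p ` X" and V: "V = tv c p ` Y" and u: "u \<in> tangent_space A p"
  shows "\<exists>!z. z \<in> H \<times> V \<and> u = lincomb 1 (fst z) 1 (snd z)"
proof -
  have lc: "lincomb 1 (tv c p a) 1 (tv c p b) = tv c p (a + b)" for a b
    using tv_lincomb[OF c, of 1 a 1 b] by simp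
  have ue: "u = tv c p (u c)" by (rule tangent_eq[OF c u])
  obtain z where z: "z \<in> X \<times> Y" "u c = fst z + snd z"
    and un: "\<And>y. y \<in> X \<times> Y \<Longrightarrow> u c = fst y + snd y \<Longrightarrow> y = z"
    using i[of "u c"] by (elim ex1E) blast
  show ?thesis
  proof (rule ex1I[of _ "(tv c p (fst z), tv c p (snd z))"])
    show "(tv c p (fst z), tv c p (snd z)) \<in> H \<times> V \<and>
        u = lincomb 1 (fst (tv c p (fst z), tv c p (snd z))) 1 (snd (tv c p (fst z), tv c p (snd z)))"
    proof
      show "(tv c p (fst z), tv c p (snd z)) \<in> H \<times> V" using z(1) by (auto simp: H V)
      have "u = tv c p (fst z + snd z)" using ue unfolding z(2) .
      then show "u = lincomb 1 (fst (tv c p (fst z), tv c p (snd z))) 1 (snd (tv c p (fst z), tv c p (snd z)))"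
        unfolding fst_conv snd_conv lc .
    qed
    fix y assume y: "y \<in> H \<times> V \<and> u = lincomb 1 (fst y) 1 (snd y)"
    then obtain a b where ab: "a \<in> X" "b \<in> Y" "y = (tv c p a, tv c p b)" by (auto simp: H V)
    have "tv c p (u c) = tv c p (a + b)" using y ue unfolding ab(3) fst_conv snd_conv lc by metis
    then have "u c = a + b" unfolding tv_inj[OF c] .
    then have "(a, b) = z" using un[of "(a, b)"] ab by simp
    then show "y = (tv c p (fst z), tv c p (snd z))" unfolding ab(3) by auto
  qed
qed

end

lemma block_decomposition:
  fixes u :: "real ^ 4"
  shows "\<exists>!z. z \<in> {v :: real ^ 4. v $ 3 = 0 \<and> v $ 4 = 0} \<times> {v :: real ^ 4. v $ 1 = 0 \<and> v $ 2 = 0} \<and> u = fst z + snd z"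
proof (rule ex1I[of _ "(u $ 1 *\<^sub>R axis 1 1 + u $ 2 *\<^sub>R axis 2 1, u $ 3 *\<^sub>R axis 3 1 + u $ 4 *\<^sub>R axis 4 1)"])
  show "(u $ 1 *\<^sub>R axis 1 1 + u $ 2 *\<^sub>R axis 2 1, u $ 3 *\<^sub>R axis 3 1 + u $ 4 *\<^sub>R axis 4 1)
      \<in> {v :: real ^ 4. v $ 3 = 0 \<and> v $ 4 = 0} \<times> {v :: real ^ 4. v $ 1 = 0 \<and> v $ 2 = 0} \<and>
    u = fst (u $ 1 *\<^sub>R axis 1 1 + u $ 2 *\<^sub>R axis 2 1 :: real ^ 4, u $ 3 *\<^sub>R axis 3 1 + u $ 4 *\<^sub>R axis 4 1 :: real ^ 4)
      + snd (u $ 1 *\<^sub>R axis 1 1 + u $ 2 *\<^sub>R axis 2 1 :: real ^ 4, u $ 3 *\<^sub>R axis 3 1 + u $ 4 *\<^sub>R axis 4 1 :: real ^ 4)"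
    by (simp add: vec_eq_iff forall_4 axis_def)
  fix z :: "(real ^ 4) \<times> (real ^ 4)"
  assume z: "z \<in> {v :: real ^ 4. v $ 3 = 0 \<and> v $ 4 = 0} \<times> {v :: real ^ 4. v $ 1 = 0 \<and> v $ 2 = 0} \<and> u = fst z + snd z"
  obtain a b where ab: "z = (a, b)" by (cases z)
  then show "z = (u $ 1 *\<^sub>R axis 1 1 + u $ 2 *\<^sub>R axis 2 1, u $ 3 *\<^sub>R axis 3 1 + u $ 4 *\<^sub>R axis 4 1)"
    using z by (simp add: vec_eq_iff forall_4 axis_def)
qed

lemma span_12: "(\<exists>a b. u = a *\<^sub>R axis 1 1 + b *\<^sub>R axis 2 1) \<longleftrightarrow> (u :: real ^ 4) $ 3 = 0 \<and> u $ 4 = 0"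
proof
  show "u $ 3 = 0 \<and> u $ 4 = 0 \<Longrightarrow> \<exists>a b. u = a *\<^sub>R axis 1 1 + b *\<^sub>R axis 2 1"
    by (intro exI[of _ "u $ 1"] exI[of _ "u $ 2"]) (simp add: vec_eq_iff forall_4 axis_def)
qed (auto simp: axis_def)

lemma span_34: "(\<exists>a b. u = a *\<^sub>R axis 3 1 + b *\<^sub>R axis 4 1) \<longleftrightarrow> (u :: real ^ 4) $ 1 = 0 \<and> u $ 2 = 0"
proof
  show "u $ 1 = 0 \<and> u $ 2 = 0 \<Longrightarrow> \<exists>a b. u = a *\<^sub>R axis 3 1 + b *\<^sub>R axis 4 1"
    by (intro exI[of _ "u $ 3"] exI[of _ "u $ 4"]) (simp add: vec_eq_iff forall_4 axis_def)
qed (auto simp: axis_def)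

lemma (in normal_form) kaehler_splitting:
  assumes pde: "pde_system c \<alpha> \<beta> \<gamma> \<delta>"
    and H: "spanned_by_coord_fields A c 1 2 H" and V: "spanned_by_coord_fields A c 3 4 V"
  shows "kaehler_on A (cdom c) g J \<and> integrable_complex_splitting_on T A (cdom c) g J H V"
proof
  show "kaehler_on A (cdom c) g J"
    unfolding kaehler_on_def
  proof (intro conjI riem acs skew)
    show "parallel11_on A (cdom c) g J"
      unfolding parallel11_on_def
    proof (intro ballI)
      fix d p assume d: "d \<in> A" and "p \<in> cdom d \<inter> cdom c"
      then have p: "p \<in> cdom d" "p \<in> cdom c" by blast+
      \<comment> \<open>The equations are used in the chart \<open>c\<close>; tensoriality carries
        the result to the arbitrary chart \<open>d\<close>.\<close>
      have "par d p u v w = 0" for u v w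
        by (rule par_zero_change[OF d p(1) c p(2,2)]) (rule pde_imp_par[OF pde p(2)])
      then show "\<forall>i k j. nabla11 A d g J i k j p = 0"
        using nabla_zero_iff[OF d p] by blast
    qed
  qed
  have Hp: "H p = tv c p ` {v. v $ 3 = 0 \<and> v $ 4 = 0}" if "p \<in> cdom c" for p
    using H[unfolded spanned_by_coord_fields_def, rule_format, OF that]
    unfolding span_coord_fields[OF c that] span_12 by blast
  have Vp: "V p = tv c p ` {v. v $ 1 = 0 \<and> v $ 2 = 0}" if "p \<in> cdom c" for p
    using V[unfolded spanned_by_coord_fields_def, rule_format, OF that]
    unfolding span_coord_fields[OF c that] span_34 by blast
  show "integrable_complex_splitting_on T A (cdom c) g J H V"
    unfolding integrable_complex_splitting_on_def
  proof (intro conjI integrable_coord_distribution[OF c H] integrable_coord_distribution[OF c V])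
    show "complex_line_subbundle_on T A (cdom c) J H"
      unfolding complex_line_subbundle_on_def
    proof (intro conjI ballI subbundle_coord_distribution[OF c H])
      fix p u assume p: "p \<in> cdom c" and "u \<in> H p"
      then obtain x where x: "u = tv c p x" "x $ 3 = 0" "x $ 4 = 0" unfolding Hp[OF p] by blast
      have "Jm c p x $ 3 = 0 \<and> Jm c p x $ 4 = 0" unfolding Jm_def J_formula[OF p] x(2,3) by simp
      then show "J p u \<in> H p" unfolding x(1) J_tv[OF c p p] Hp[OF p] by blast
    qed simp
    show "complex_line_subbundle_on T A (cdom c) J V"
      unfolding complex_line_subbundle_on_def
    proof (intro conjI ballI subbundle_coord_distribution[OF c V])
      fix p u assume p: "p \<in> cdom c" and "u \<in> V p"
      then obtain x where x: "u = tv c p x" "x $ 1 = 0" "x $ 2 = 0" unfolding Vp[OF p] by blast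
      have "Jm c p x $ 1 = 0 \<and> Jm c p x $ 2 = 0" unfolding Jm_def J_formula[OF p] x(2,3) by simp
      then show "J p u \<in> V p" unfolding x(1) J_tv[OF c p p] Vp[OF p] by blast
    qed simp
    show "orthogonal_direct_sum_on A (cdom c) g H V"
      unfolding orthogonal_direct_sum_on_def
    proof (intro ballI conjI)
      fix p assume p: "p \<in> cdom c"
      show "g p h v = 0" if h: "h \<in> H p" and v: "v \<in> V p" for h v
      proof -
        obtain x where x: "h = tv c p x" "x $ 3 = 0" "x $ 4 = 0" using h unfolding Hp[OF p] by blast
        obtain y where y: "v = tv c p y" "y $ 1 = 0" "y $ 2 = 0" using v unfolding Vp[OF p] by blast
        have "cmp c g p x y = 0" unfolding cmp_formula[OF p] x(2,3) y(2,3) by simp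
        then show ?thesis unfolding cmp_def x(1) y(1) .
      qed
      show "\<exists>!z. z \<in> H p \<times> V p \<and> u = lincomb 1 (fst z) 1 (snd z)" if "u \<in> tangent_space A p" for u
        by (rule orthogonal_direct_sum_coordI[OF c p block_decomposition Hp[OF p] Vp[OF p] that])
    qed
  qed
qed

section \<open>Charts adapted to the splitting\<close>

locale kaehler_split = mfd T A for T :: "'a topology" and A :: "('a, 4) chart set" +
  fixes g :: "('a, 4) tensor02" and J :: "('a, 4) tensor11" and H V :: "('a, 4) distribution"
  assumes kaehler: "kaehler_on A (topspace T) g J"
    and split: "integrable_complex_splitting_on T A (topspace T) g J H V"
begin

sublocale herm T A "topspace T" g J
proof unfold_locales
  show "openin T (topspace T)" by (rule openin_topspace)
  show "riemannian_metric_on A (topspace T) g" "almost_complex_structure_on A (topspace T) J"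
    "\<forall>p\<in>topspace T. \<forall>u\<in>tangent_space A p. \<forall>v\<in>tangent_space A p. g p (J p u) v = - g p (J p v) u"
    using kaehler unfolding kaehler_on_def by blast+
qed

lemma cdom_topspace: "c \<in> A \<Longrightarrow> p \<in> cdom c \<Longrightarrow> p \<in> topspace T"
  using openin_subset[OF open_cdom] by blast

lemma par_zero:
  assumes c: "c \<in> A" "p \<in> cdom c"
  shows "par c p u v w = 0"
proof -
  note pT = cdom_topspace[OF c]
  have "parallel11_on A (topspace T) g J" using kaehler unfolding kaehler_on_def by blast
  then have "\<forall>i k j. nabla11 A c g J i k j p = 0"
    unfolding parallel11_on_def using c pT by blast
  then show ?thesis unfolding nabla_zero_iff[OF c pT] by blast
qed

text \<open>Translates the subbundle and its integrability into Euclidean data in one given chart: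
  two independent smooth fields whose bracket lies in their span, as \<open>frobenius\<close>
  requires.\<close>

lemma local_frame:
  assumes D: "subbundle_on T A (topspace T) 2 D" and I: "integrable_distribution_on T A (topspace T) D"
    and c: "c \<in> A" "p \<in> cdom c"
  obtains N e1 e2 where "openin T N" "p \<in> N" "N \<subseteq> cdom c"
    "smooth_on (cmap c ` N) e1" "smooth_on (cmap c ` N) (e2 :: real ^ 4 \<Rightarrow> real ^ 4)"
    "\<And>q. q \<in> N \<Longrightarrow> D q = {tv c q (a *\<^sub>R e1 (cmap c q) + b *\<^sub>R e2 (cmap c q)) | a b. True}"
    "\<And>q a b. q \<in> N \<Longrightarrow> a *\<^sub>R e1 (cmap c q) + b *\<^sub>R e2 (cmap c q) = 0 \<Longrightarrow> a = 0 \<and> b = 0"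
    "\<And>x. x \<in> cmap c ` N \<Longrightarrow> \<exists>a b. fd e2 x (e1 x) - fd e1 x (e2 x) = a *\<^sub>R e1 x + b *\<^sub>R e2 x"
proof -
  from D[unfolded subbundle_on_def, rule_format, OF cdom_topspace[OF c]]
  obtain M E where ME: "openin T M \<and> p \<in> M \<and> M \<subseteq> topspace T \<and> (\<forall>i<2. smooth_vector_field_on A M (E i)) \<and>
      (\<forall>q\<in>M. D q = {(\<lambda>c. \<Sum>i<2. a i *\<^sub>R E i q c) | a :: nat \<Rightarrow> real. True} \<and>
        (\<forall>a :: nat \<Rightarrow> real. (\<lambda>c. \<Sum>i<2. a i *\<^sub>R E i q c) = (\<lambda>_. 0) \<longrightarrow> (\<forall>i<2. a i = 0)))"
    by (elim exE) (rule that)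
  then have M: "openin T M" "p \<in> M" "M \<subseteq> topspace T" by simp_all
  have E: "smooth_vector_field_on A M (E i)" if "i < 2" for i
    by (rule ME[THEN conjunct2, THEN conjunct2, THEN conjunct2, THEN conjunct1, rule_format, OF that])
  have DE: "D q = {(\<lambda>c. \<Sum>i<2. a i *\<^sub>R E i q c) | a :: nat \<Rightarrow> real. True}" if q: "q \<in> M" for q
    by (rule ME[THEN conjunct2, THEN conjunct2, THEN conjunct2, THEN conjunct2, THEN bspec, OF q, THEN conjunct1])
  have ind: "\<forall>i<2. a i = 0" if q: "q \<in> M" and a: "(\<lambda>c. \<Sum>i<2. a i *\<^sub>R E i q c) = (\<lambda>_. 0)" for q and a :: "nat \<Rightarrow> real"
    by (rule ME[THEN conjunct2, THEN conjunct2, THEN conjunct2, THEN conjunct2, THEN bspec, OF q, THEN conjunct2, THEN spec, THEN mp, OF a])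
  define N where "N = cdom c \<inter> M"
  have N: "openin T N" "p \<in> N" "N \<subseteq> cdom c" using M c open_cdom[OF c(1)] by (auto simp: N_def)
  define e1 where "e1 x = E 0 (cinv c x) c" for x
  define e2 where "e2 x = E 1 (cinv c x) c" for x
  have E01: "smooth_vector_field_on A M (E 0)" "smooth_vector_field_on A M (E 1)" using E by simp_all
  have sm: "smooth_on (cmap c ` N) e1" "smooth_on (cmap c ` N) e2"
    unfolding e1_def e2_def N_def using smooth_vector_field_component[OF _ M(1) c(1)] E01 by blast+
  have sum2: "(\<lambda>d. \<Sum>i<2. a i *\<^sub>R E i q d) = tv c q (a 0 *\<^sub>R e1 (cmap c q) + a 1 *\<^sub>R e2 (cmap c q))"
    if q: "q \<in> N" for a :: "nat \<Rightarrow> real" and q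
  proof -
    have qc: "q \<in> cdom c" "q \<in> M" using q by (auto simp: N_def)
    have t: "E 0 q = tv c q (E 0 q c)" "E 1 q = tv c q (E 1 q c)"
      using E01 qc(2) unfolding smooth_vector_field_on_def by (blast intro: tangent_eq[OF c(1) qc(1)])+
    have "(\<lambda>d. \<Sum>i<2. a i *\<^sub>R E i q d) = lincomb (a 0) (E 0 q) (a 1) (E 1 q)"
      by (rule ext) (simp add: lincomb_def numeral_2_eq_2)
    also have "\<dots> = lincomb (a 0) (tv c q (E 0 q c)) (a 1) (tv c q (E 1 q c))"
      using t by (rule arg_cong2[where f = "\<lambda>x y. lincomb (a 0) x (a 1) y"])
    also have "\<dots> = tv c q (a 0 *\<^sub>R e1 (cmap c q) + a 1 *\<^sub>R e2 (cmap c q))"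
      unfolding tv_lincomb[OF c(1) qc(1)] e1_def e2_def cinv_cmap[OF c(1) qc(1)] ..
    finally show ?thesis .
  qed
  have DN: "D q = {tv c q (a *\<^sub>R e1 (cmap c q) + b *\<^sub>R e2 (cmap c q)) | a b. True}" if q: "q \<in> N" for q
  proof -
    have "D q = {tv c q (a 0 *\<^sub>R e1 (cmap c q) + a 1 *\<^sub>R e2 (cmap c q)) | a :: nat \<Rightarrow> real. True}"
      using DE[of q] q unfolding sum2[OF q] by (simp add: N_def)
    also have "\<dots> = {tv c q (a *\<^sub>R e1 (cmap c q) + b *\<^sub>R e2 (cmap c q)) | a b. True}"
    proof (intro equalityI subsetI)
      show "z \<in> {tv c q (a 0 *\<^sub>R e1 (cmap c q) + a 1 *\<^sub>R e2 (cmap c q)) | a :: nat \<Rightarrow> real. True}"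
        if z: "z \<in> {tv c q (a *\<^sub>R e1 (cmap c q) + b *\<^sub>R e2 (cmap c q)) | a b. True}" for z
      proof -
        obtain a b where "z = tv c q (a *\<^sub>R e1 (cmap c q) + b *\<^sub>R e2 (cmap c q))" using z by blast
        then show ?thesis by (intro CollectI exI[of _ "\<lambda>k. if k = 0 then a else b"]) simp
      qed
    qed blast
    finally show ?thesis .
  qed
  have indN: "a = 0 \<and> b = 0" if q: "q \<in> N" and z: "a *\<^sub>R e1 (cmap c q) + b *\<^sub>R e2 (cmap c q) = 0" for q a b
  proof -
    have qc: "q \<in> cdom c" "q \<in> M" using q by (auto simp: N_def)
    let ?a = "\<lambda>k :: nat. if k = 0 then a else b"
    have "(\<lambda>d. \<Sum>i<2. ?a i *\<^sub>R E i q d) = (\<lambda>_. 0)"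
      using sum2[OF q, of ?a] z tv_0[OF c(1) qc(1)] by simp
    note z2 = ind[OF qc(2) this]
    have "?a 0 = 0" by (rule z2[rule_format]) simp
    moreover have "?a 1 = 0" by (rule z2[rule_format]) simp
    ultimately show ?thesis by simp
  qed
  have inv: "\<exists>a b. fd e2 x (e1 x) - fd e1 x (e2 x) = a *\<^sub>R e1 x + b *\<^sub>R e2 x" if x: "x \<in> cmap c ` N" for x
  proof -
    obtain q where q: "q \<in> N" "x = cmap c q" using x by blast
    have qc: "q \<in> cdom c" "q \<in> M" using q by (auto simp: N_def)
    have ED: "E i r \<in> D r" if "r \<in> M" "i < 2" for i r
    proof -
      \<comment> \<open>The frame fields are themselves sections, with Kronecker delta coefficients,
        so integrability applies to their bracket.\<close>
      have "E i r = (\<lambda>c. \<Sum>k<2. (if k = i then 1 else 0) *\<^sub>R E k r c)"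
        using that(2) by (auto simp: fun_eq_iff if_distrib[of "\<lambda>x. x *\<^sub>R _"] numeral_2_eq_2 less_Suc_eq)
      then show ?thesis unfolding DE[OF that(1)] by (intro CollectI exI[of _ "\<lambda>k. if k = i then 1 else 0"]) simp
    qed
    have ED01: "\<forall>r\<in>M. E 0 r \<in> D r \<and> E 1 r \<in> D r" using ED by simp
    have "\<forall>r\<in>M. lie_bracket A (E 0) (E 1) r \<in> D r"
      by (rule I[unfolded integrable_distribution_on_def, THEN spec, THEN spec, THEN spec, THEN mp])
         (intro conjI M E01 ED01)
    then have "lie_bracket A (E 0) (E 1) q \<in> D q" using qc(2) by blast
    then obtain a b where "lie_bracket A (E 0) (E 1) q = tv c q (a *\<^sub>R e1 (cmap c q) + b *\<^sub>R e2 (cmap c q))"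
      unfolding DN[OF q(1)] by blast
    then have "lie_bracket A (E 0) (E 1) q c = a *\<^sub>R e1 x + b *\<^sub>R e2 x"
      using tv_component_self[OF c(1) qc(1)] q(2) by simp
    moreover have "lie_bracket A (E 0) (E 1) q c = fd e2 x (e1 x) - fd e1 x (e2 x)"
      unfolding lie_bracket_eq[OF E01 M(1) qc(2) c(1) qc(1)] q(2) e1_def[abs_def] e2_def[abs_def]
      by (simp add: cinv_cmap[OF c(1) qc(1)])
    ultimately show ?thesis by metis
  qed
  show ?thesis by (rule that[OF N sm DN indN inv])
qed

lemmas split_facts = split[unfolded integrable_complex_splitting_on_def complex_line_subbundle_on_def orthogonal_direct_sum_on_def]

text \<open>Frobenius for H yields two functions h_3, h_4 constant along the leaves of H, and
  Frobenius for V yields k_3, k_4 constant along those of V. The new coordinates are (k_3, k_4, h_3,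
  h_4), crosswise: H is then the common kernel of the last two differentials and V that of the first
  two. In each application the frame of the other distribution serves as the complement.\<close>

lemma adapted_chart:
  assumes p: "p \<in> topspace T"
  obtains c where "c \<in> A" "p \<in> cdom c"
    "\<And>q. q \<in> cdom c \<Longrightarrow> H q = tv c q ` {v. v $ 3 = 0 \<and> v $ 4 = 0}"
    "\<And>q. q \<in> cdom c \<Longrightarrow> V q = tv c q ` {v. v $ 1 = 0 \<and> v $ 2 = 0}"
proof -
  obtain c where c: "c \<in> A" "p \<in> cdom c" using p cover by blast
  have subH: "subbundle_on T A (topspace T) 2 H" and intH: "integrable_distribution_on T A (topspace T) H"
    and subV: "subbundle_on T A (topspace T) 2 V" and intV: "integrable_distribution_on T A (topspace T) V"
    using split_facts by blast+
  obtain N e1 e2 where N: "openin T N" "p \<in> N" "N \<subseteq> cdom c"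
    and e: "smooth_on (cmap c ` N) e1" "smooth_on (cmap c ` N) (e2 :: real ^ 4 \<Rightarrow> real ^ 4)"
    and HN: "\<And>q. q \<in> N \<Longrightarrow> H q = {tv c q (a *\<^sub>R e1 (cmap c q) + b *\<^sub>R e2 (cmap c q)) | a b. True}"
    and ei: "\<And>q a b. q \<in> N \<Longrightarrow> a *\<^sub>R e1 (cmap c q) + b *\<^sub>R e2 (cmap c q) = 0 \<Longrightarrow> a = 0 \<and> b = 0"
    and ev: "\<And>x. x \<in> cmap c ` N \<Longrightarrow> \<exists>a b. fd e2 x (e1 x) - fd e1 x (e2 x) = a *\<^sub>R e1 x + b *\<^sub>R e2 x"
    by (rule local_frame[OF subH intH c]) (rule that)
  obtain M f1 f2 where M: "openin T M" "p \<in> M" "M \<subseteq> cdom c"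
    and f: "smooth_on (cmap c ` M) f1" "smooth_on (cmap c ` M) (f2 :: real ^ 4 \<Rightarrow> real ^ 4)"
    and VM: "\<And>q. q \<in> M \<Longrightarrow> V q = {tv c q (a *\<^sub>R f1 (cmap c q) + b *\<^sub>R f2 (cmap c q)) | a b. True}"
    and fi: "\<And>q a b. q \<in> M \<Longrightarrow> a *\<^sub>R f1 (cmap c q) + b *\<^sub>R f2 (cmap c q) = 0 \<Longrightarrow> a = 0 \<and> b = 0"
    and fv: "\<And>x. x \<in> cmap c ` M \<Longrightarrow> \<exists>a b. fd f2 x (f1 x) - fd f1 x (f2 x) = a *\<^sub>R f1 x + b *\<^sub>R f2 x"
    by (rule local_frame[OF subV intV c]) (rule that)
  let ?x0 = "cmap c p"
  have oN: "open (cmap c ` N)" and oM: "open (cmap c ` M)"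
    using open_cmap_image[OF c(1)] N M by blast+
  have xN: "?x0 \<in> cmap c ` N" and xM: "?x0 \<in> cmap c ` M" using N M by blast+
  \<comment> \<open>H and V meet only in 0, since such a vector is orthogonal to itself.\<close>
  have perp: "u = 0" if q: "q \<in> N" "q \<in> M" and u: "u = a *\<^sub>R e1 (cmap c q) + b *\<^sub>R e2 (cmap c q)"
    and v: "u = a' *\<^sub>R f1 (cmap c q) + b' *\<^sub>R f2 (cmap c q)" for q u a b a' b'
  proof (rule ccontr)
    assume "u \<noteq> 0"
    have qc: "q \<in> cdom c" using q N by blast
    have "tv c q u \<in> H q" unfolding HN[OF q(1)] u by blast
    moreover have "tv c q u \<in> V q" unfolding VM[OF q(2)] v by blast
    ultimately have "g q (tv c q u) (tv c q u) = 0"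
      using split_facts cdom_topspace[OF c(1) qc] by blast
    then show False using g_pos[OF c(1) qc cdom_topspace[OF c(1) qc] \<open>u \<noteq> 0\<close>] by (simp add: cmp_def)
  qed
  have indep: "a = 0 \<and> b = 0 \<and> a' = 0 \<and> b' = 0"
    if z: "a *\<^sub>R e1 ?x0 + b *\<^sub>R e2 ?x0 + (a' *\<^sub>R f1 ?x0 + b' *\<^sub>R f2 ?x0) = 0" for a b a' b'
  proof -
    have "a *\<^sub>R e1 ?x0 + b *\<^sub>R e2 ?x0 = (- a') *\<^sub>R f1 ?x0 + (- b') *\<^sub>R f2 ?x0"
      using z by (simp add: add_eq_0_iff2)
    from perp[OF N(2) M(2) refl this] have 1: "a *\<^sub>R e1 ?x0 + b *\<^sub>R e2 ?x0 = 0" .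
    then have 2: "a' *\<^sub>R f1 ?x0 + b' *\<^sub>R f2 ?x0 = 0" using z by simp
    show ?thesis using ei[OF N(2) 1] fi[OF M(2) 2] by blast
  qed
  have ind1: "a = 0" if "a $ 1 *\<^sub>R e1 ?x0 + a $ 2 *\<^sub>R e2 ?x0 + a $ 3 *\<^sub>R f1 ?x0 + a $ 4 *\<^sub>R f2 ?x0 = 0" for a :: "real ^ 4"
    using indep[of "a $ 1" "a $ 2" "a $ 3" "a $ 4"] that by (simp add: vec_eq_iff forall_4 add.assoc)
  have ind2: "a = 0" if "a $ 1 *\<^sub>R f1 ?x0 + a $ 2 *\<^sub>R f2 ?x0 + a $ 3 *\<^sub>R e1 ?x0 + a $ 4 *\<^sub>R e2 ?x0 = 0" for a :: "real ^ 4"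
    using indep[of "a $ 3" "a $ 4" "a $ 1" "a $ 2"] that by (simp add: vec_eq_iff forall_4 algebra_simps)
  obtain h U where U: "open U" "?x0 \<in> U" "U \<subseteq> cmap c ` N" "smooth_on U (h :: real ^ 4 \<Rightarrow> real ^ 4)"
    and h: "\<And>x v. x \<in> U \<Longrightarrow> fd h x v $ 3 = 0 \<and> fd h x v $ 4 = 0 \<longleftrightarrow> (\<exists>a b. v = a *\<^sub>R e1 x + b *\<^sub>R e2 x)"
    by (rule frobenius[OF oN xN e, of "f1 ?x0" "f2 ?x0"]) (erule ind1, erule ev, rule that)
  obtain k Z where Z: "open Z" "?x0 \<in> Z" "Z \<subseteq> cmap c ` M" "smooth_on Z (k :: real ^ 4 \<Rightarrow> real ^ 4)"
    and k: "\<And>x v. x \<in> Z \<Longrightarrow> fd k x v $ 3 = 0 \<and> fd k x v $ 4 = 0 \<longleftrightarrow> (\<exists>a b. v = a *\<^sub>R f1 x + b *\<^sub>R f2 x)"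
    by (rule frobenius[OF oM xM f, of "e1 ?x0" "e2 ?x0"]) (erule ind2, erule fv, rule that)
  let ?S = "U \<inter> Z"
  define \<Phi> :: "real ^ 4 \<Rightarrow> real ^ 4"
    where "\<Phi> x = k x $ 3 *\<^sub>R axis 1 1 + k x $ 4 *\<^sub>R axis 2 1 + h x $ 3 *\<^sub>R axis 3 1 + h x $ 4 *\<^sub>R axis 4 1" for x
  have oS: "open ?S" using U Z by blast
  have hs: "smooth_on ?S h" and ks: "smooth_on ?S k" using U Z by (blast intro: smooth_on_subset)+
  have \<Phi>s: "smooth_on ?S \<Phi>"
    unfolding \<Phi>_def
    by (intro smooth_on_add[OF oS] smooth_on_scaleR[OF oS] smooth_on_nth[OF oS] hs ks smooth_on_const)
  have \<Phi>d: "fd \<Phi> x v = fd k x v $ 3 *\<^sub>R axis 1 1 + fd k x v $ 4 *\<^sub>R axis 2 1 + fd h x v $ 3 *\<^sub>R axis 3 1 + fd h x v $ 4 *\<^sub>R axis 4 1"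
    if x: "x \<in> ?S" for x v
    unfolding \<Phi>_def
    by (rule fun_cong[OF fd_eqI])
       (intro has_derivative_add bounded_linear.has_derivative[OF bounded_linear_scaleR_left]
          bounded_linear.has_derivative[OF bounded_linear_vec_nth] smooth_on_imp_has_derivative[OF hs x]
          smooth_on_imp_has_derivative[OF ks x])
  have comp: "fd \<Phi> x v $ 1 = fd k x v $ 3" "fd \<Phi> x v $ 2 = fd k x v $ 4" "fd \<Phi> x v $ 3 = fd h x v $ 3" "fd \<Phi> x v $ 4 = fd h x v $ 4"
    if "x \<in> ?S" for x v
    unfolding \<Phi>d[OF that] by (simp_all add: axis_def)
  define W' where "W' = cinv c ` ?S"
  have Sc: "?S \<subseteq> cmap c ` cdom c" using U(3) N(3) by blast
  have W': "openin T W'" "W' \<subseteq> cdom c" "cmap c ` W' = ?S"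
    unfolding W'_def using open_cinv_image[OF c(1) oS Sc] cinv_image_eq[OF c(1) Sc] cmap_cinv_image[OF Sc] by auto
  have NM: "q \<in> N \<and> q \<in> M \<and> q \<in> cdom c \<and> cmap c q \<in> ?S" if q: "q \<in> W'" for q
  proof -
    have x: "q \<in> cdom c" "cmap c q \<in> ?S" using q W' by blast+
    have "cmap c q \<in> cmap c ` N" "cmap c q \<in> cmap c ` M" using x(2) U(3) Z(3) by blast+
    then have "cinv c (cmap c q) \<in> N" "cinv c (cmap c q) \<in> M"
      using cinv_mem[OF c(1) N(3)] cinv_mem[OF c(1) M(3)] by blast+
    then show ?thesis using x cinv_cmap[OF c(1) x(1)] by simp
  qed
  have pW': "p \<in> W'"
    using cinv_image_eq[OF c(1) Sc] c U(2) Z(2) unfolding W'_def by blast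
  \<comment> \<open>A vector killed by the differential lies in H, by the components from
    \<open>h\<close>, and in V, by those from \<open>k\<close>.\<close>
  have inj: "inj (fd \<Phi> ?x0)"
    unfolding linear_injective_0[OF smooth_on_imp_linear_fd[OF \<Phi>s, of ?x0, OF IntI[OF U(2) Z(2)]]]
  proof (intro allI impI)
    fix v assume v: "fd \<Phi> ?x0 v = 0"
    have x: "?x0 \<in> ?S" using U(2) Z(2) by blast
    obtain a b where 1: "v = a *\<^sub>R e1 ?x0 + b *\<^sub>R e2 ?x0"
      using h[OF U(2), of v] comp[OF x, of v] v by auto
    obtain a' b' where 2: "v = a' *\<^sub>R f1 ?x0 + b' *\<^sub>R f2 ?x0"
      using k[OF Z(2), of v] comp[OF x, of v] v by auto
    show "v = 0" by (rule perp[OF N(2) M(2) 1 2])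
  qed
  obtain c' where c': "c' \<in> A" "p \<in> cdom c'" "cdom c' \<subseteq> W'"
    and "\<And>q. q \<in> cdom c' \<Longrightarrow> cmap c' q = \<Phi> (cmap c q)"
    and t: "\<And>q v. q \<in> cdom c' \<Longrightarrow> tmap c c' q v = fd \<Phi> (cmap c q) v"
    by (rule chart_change[OF c W'(1) pW' W'(2) \<Phi>s[folded W'(3)] inj]) (rule that)
  show ?thesis
  proof (rule that[OF c'(1,2)])
    fix q assume q: "q \<in> cdom c'"
    have qW: "q \<in> W'" using q c'(3) by blast
    have qs: "q \<in> N" "q \<in> M" "q \<in> cdom c" "cmap c q \<in> ?S" using NM[OF qW] by blast+
    have U': "cmap c q \<in> U" and Z': "cmap c q \<in> Z" using qs(4) by blast+
    have tvc: "tv c q v = tv c' q (fd \<Phi> (cmap c q) v)" for v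
      unfolding t[OF q, symmetric] by (rule tv_change[OF c(1) c'(1) qs(3) q])
    \<comment> \<open>Surjectivity of the differential gives the inclusions of the coordinate planes
      in H and V.\<close>
    have sur: "\<exists>v. w = fd \<Phi> (cmap c q) v" for w
      using tmap_inverse[OF c'(1) c(1) q qs(3), of w] t[OF q] by metis
    show "H q = tv c' q ` {v. v $ 3 = 0 \<and> v $ 4 = 0}"
    proof (intro equalityI subsetI)
      fix z assume "z \<in> H q"
      then obtain a b where z: "z = tv c q (a *\<^sub>R e1 (cmap c q) + b *\<^sub>R e2 (cmap c q))" unfolding HN[OF qs(1)] by blast
      let ?v = "a *\<^sub>R e1 (cmap c q) + b *\<^sub>R e2 (cmap c q)"
      have "fd \<Phi> (cmap c q) ?v \<in> {v. v $ 3 = 0 \<and> v $ 4 = 0}"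
        using h[OF U', of ?v] comp(3,4)[OF qs(4), of ?v] by auto
      then show "z \<in> tv c' q ` {v. v $ 3 = 0 \<and> v $ 4 = 0}" unfolding z tvc by (rule imageI)
    next
      fix z assume "z \<in> tv c' q ` {v. v $ 3 = 0 \<and> v $ 4 = 0}"
      then obtain w where w: "z = tv c' q w" "w $ 3 = 0" "w $ 4 = 0" by blast
      obtain v where v: "w = fd \<Phi> (cmap c q) v" using sur by blast
      have "\<exists>a b. v = a *\<^sub>R e1 (cmap c q) + b *\<^sub>R e2 (cmap c q)"
        using h[OF U', of v] comp(3,4)[OF qs(4), of v] w(2,3) unfolding v by simp
      then show "z \<in> H q" unfolding w(1) v tvc[symmetric] HN[OF qs(1)] by blast
    qed
    show "V q = tv c' q ` {v. v $ 1 = 0 \<and> v $ 2 = 0}"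
    proof (intro equalityI subsetI)
      fix z assume "z \<in> V q"
      then obtain a b where z: "z = tv c q (a *\<^sub>R f1 (cmap c q) + b *\<^sub>R f2 (cmap c q))" unfolding VM[OF qs(2)] by blast
      let ?v = "a *\<^sub>R f1 (cmap c q) + b *\<^sub>R f2 (cmap c q)"
      have "fd \<Phi> (cmap c q) ?v \<in> {v. v $ 1 = 0 \<and> v $ 2 = 0}"
        using k[OF Z', of ?v] comp(1,2)[OF qs(4), of ?v] by auto
      then show "z \<in> tv c' q ` {v. v $ 1 = 0 \<and> v $ 2 = 0}" unfolding z tvc by (rule imageI)
    next
      fix z assume "z \<in> tv c' q ` {v. v $ 1 = 0 \<and> v $ 2 = 0}"
      then obtain w where w: "z = tv c' q w" "w $ 1 = 0" "w $ 2 = 0" by blast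
      obtain v where v: "w = fd \<Phi> (cmap c q) v" using sur by blast
      have "\<exists>a b. v = a *\<^sub>R f1 (cmap c q) + b *\<^sub>R f2 (cmap c q)"
        using k[OF Z', of v] comp(1,2)[OF qs(4), of v] w(2,3) unfolding v by simp
      then show "z \<in> V q" unfolding w(1) v tvc[symmetric] VM[OF qs(2)] by blast
    qed
  qed
qed

end

text \<open>Only the derivative in the direction of the segment is controlled. This is what is
  available for a function of two of the four coordinates, when the other two are moved.\<close>

lemma constant_along_segment:
  fixes f :: "'a::euclidean_space \<Rightarrow> real"
  assumes B: "convex B" "smooth_on B f" and x: "x \<in> B" "y \<in> B" and z: "\<And>z. z \<in> B \<Longrightarrow> fd f z (y - x) = 0"
  shows "f y = f x"
proof -
  let ?p = "\<lambda>t. x + t *\<^sub>R (y - x)"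
  have pB: "?p t \<in> B" if "t \<in> {0..1}" for t
  proof -
    have "?p t = (1 - t) *\<^sub>R x + t *\<^sub>R y" by (simp add: algebra_simps)
    then show ?thesis using convexD[OF B(1) x, of "1 - t" t] that by simp
  qed
  have "norm (f (?p 1) - f (?p 0)) \<le> 0 * norm (1 - 0 :: real)"
  proof (rule differentiable_bound[OF convex_real_interval(5)[of 0 1]])
    fix t :: real assume t: "t \<in> {0..1}"
    have "(?p has_vector_derivative (y - x)) (at t)"
      by (auto intro!: derivative_eq_intros simp: has_vector_derivative_def)
    from smooth_on_imp_vector_derivative[OF B(2) this pB[OF t]]
    have "((\<lambda>t. f (?p t)) has_vector_derivative 0) (at t)" unfolding z[OF pB[OF t]] .
    then show "((\<lambda>t. f (?p t)) has_derivative (\<lambda>h. 0)) (at t within {0..1})"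
      unfolding has_vector_derivative_def scaleR_zero_right by (rule has_derivative_at_withinI)
    show "onorm (\<lambda>h :: real. 0 :: real) \<le> 0" by (simp add: onorm_zero)
  qed auto
  then show ?thesis by simp
qed

section \<open>The Kaehler form in adapted charts and unit-area coordinates\<close>

context kaehler_split
begin

definition adapted :: "('a, 4) chart \<Rightarrow> bool" where
  "adapted c \<longleftrightarrow> c \<in> A \<and> (\<forall>q\<in>cdom c. H q = tv c q ` {v. v $ 3 = 0 \<and> v $ 4 = 0}
    \<and> V q = tv c q ` {v. v $ 1 = 0 \<and> v $ 2 = 0})"

lemma adaptedD:
  assumes "adapted c"
  shows "c \<in> A" "q \<in> cdom c \<Longrightarrow> H q = tv c q ` {v. v $ 3 = 0 \<and> v $ 4 = 0}"
    "q \<in> cdom c \<Longrightarrow> V q = tv c q ` {v. v $ 1 = 0 \<and> v $ 2 = 0}"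
  using assms unfolding adapted_def by blast+

lemma om_antisym:
  assumes "c \<in> A" "q \<in> cdom c"
  shows "cmp c om q u v = - cmp c om q v u"
  unfolding cmp_om[OF assms cdom_topspace[OF assms]] by (rule g_skew[OF assms cdom_topspace[OF assms]])

text \<open>J is an isometry, by skewness and since its square is -1; so \<omega>(u, Ju) = g(Ju, Ju)
  = g(u, u).\<close>

lemma om_J_pos:
  assumes c: "c \<in> A" "q \<in> cdom c" and u: "u \<noteq> 0"
  shows "cmp c om q u (Jm c q u) = cmp c g q u u" "cmp c om q u (Jm c q u) > 0"
proof -
  note qT = cdom_topspace[OF c]
  have "cmp c g q (Jm c q u) (Jm c q u) = - cmp c g q (Jm c q (Jm c q u)) u" by (rule g_skew[OF c qT])
  also have "\<dots> = cmp c g q u u"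
    unfolding Jm_Jm[OF c qT] using linear_neg[OF g_linear(1)[OF c qT, of u], of u] by simp
  finally show "cmp c om q u (Jm c q u) = cmp c g q u u" unfolding cmp_om[OF c qT] .
  then show "cmp c om q u (Jm c q u) > 0" using g_pos[OF c qT u] by simp
qed

context
  fixes c q assumes ad: "adapted c" and q: "q \<in> cdom c"
begin

lemma g_blocks:
  assumes "u $ 3 = 0" "u $ 4 = 0" "v $ 1 = 0" "v $ 2 = 0"
  shows "cmp c g q u v = 0"
proof -
  have "tv c q u \<in> H q" unfolding adaptedD(2)[OF ad q] using assms by blast
  moreover have "tv c q v \<in> V q" unfolding adaptedD(3)[OF ad q] using assms by blast
  moreover have "q \<in> topspace T" by (rule cdom_topspace[OF adaptedD(1)[OF ad] q])
  ultimately show ?thesis using split_facts unfolding cmp_def by blast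
qed

lemma Jm_H: "u $ 3 = 0 \<Longrightarrow> u $ 4 = 0 \<Longrightarrow> Jm c q u $ 3 = 0 \<and> Jm c q u $ 4 = 0"
proof -
  assume u: "u $ 3 = 0" "u $ 4 = 0"
  note c = adaptedD(1)[OF ad] and qT = cdom_topspace[OF adaptedD(1)[OF ad] q]
  have "tv c q u \<in> H q" unfolding adaptedD(2)[OF ad q] using u by blast
  then have "J q (tv c q u) \<in> H q" using split_facts qT by blast
  then obtain v where v: "tv c q (Jm c q u) = tv c q v" "v $ 3 = 0" "v $ 4 = 0"
    unfolding adaptedD(2)[OF ad q] J_tv[OF c q qT] by blast
  then show ?thesis unfolding tv_inj[OF c q] by simp
qed

lemma Jm_V: "u $ 1 = 0 \<Longrightarrow> u $ 2 = 0 \<Longrightarrow> Jm c q u $ 1 = 0 \<and> Jm c q u $ 2 = 0"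
proof -
  assume u: "u $ 1 = 0" "u $ 2 = 0"
  note c = adaptedD(1)[OF ad] and qT = cdom_topspace[OF adaptedD(1)[OF ad] q]
  have "tv c q u \<in> V q" unfolding adaptedD(3)[OF ad q] using u by blast
  then have "J q (tv c q u) \<in> V q" using split_facts qT by blast
  then obtain v where v: "tv c q (Jm c q u) = tv c q v" "v $ 1 = 0" "v $ 2 = 0"
    unfolding adaptedD(3)[OF ad q] J_tv[OF c q qT] by blast
  then show ?thesis unfolding tv_inj[OF c q] by simp
qed

lemma om_blocks: "u $ 3 = 0 \<Longrightarrow> u $ 4 = 0 \<Longrightarrow> v $ 1 = 0 \<Longrightarrow> v $ 2 = 0 \<Longrightarrow> cmp c om q u v = 0"
  unfolding cmp_om[OF adaptedD(1)[OF ad] q cdom_topspace[OF adaptedD(1)[OF ad] q]]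
  using Jm_H g_blocks by blast

text \<open>H and V are J-invariant and orthogonal, hence also orthogonal for the Kaehler form,
  which is therefore determined by one area coefficient on each.\<close>

lemma om_formula:
  "cmp c om q x y = cmp c om q (axis 1 1) (axis 2 1) * (x $ 1 * y $ 2 - x $ 2 * y $ 1)
    + cmp c om q (axis 3 1) (axis 4 1) * (x $ 3 * y $ 4 - x $ 4 * y $ 3)"
proof -
  note c = adaptedD(1)[OF ad] and qT = cdom_topspace[OF adaptedD(1)[OF ad] q]
  let ?o = "\<lambda>i j. cmp c om q (axis i 1) (axis j 1)"
  have 0: "?o 1 3 = 0" "?o 1 4 = 0" "?o 2 3 = 0" "?o 2 4 = 0" by (rule om_blocks; simp add: axis_def)+
  have 1: "?o 3 1 = 0" "?o 4 1 = 0" "?o 3 2 = 0" "?o 4 2 = 0"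
    using om_antisym[OF c q, of "axis 3 1" "axis 1 1"] om_antisym[OF c q, of "axis 4 1" "axis 1 1"]
      om_antisym[OF c q, of "axis 3 1" "axis 2 1"] om_antisym[OF c q, of "axis 4 1" "axis 2 1"] 0 by simp_all
  have 2: "?o i i = 0" for i using om_antisym[OF c q, of "axis i 1" "axis i 1"] by simp
  have 3: "?o 2 1 = - ?o 1 2" "?o 4 3 = - ?o 3 4" by (rule om_antisym[OF c q])+
  have "cmp c om q x y = (\<Sum>i\<in>UNIV. \<Sum>j\<in>UNIV. (x $ i * y $ j) * ?o i j)"
    by (rule bilinear_sum_axis) (rule cmp_linear[OF om_smooth c q qT])+
  then show ?thesis unfolding sum_4 0 1 2 3 by (simp add: algebra_simps)
qed

text \<open>J\<partial>_1 stays in H, so if the coefficient on H vanished, \<omega>(\<partial>_1,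
  J\<partial>_1) would be 0, contrary to positivity; likewise on V.\<close>

lemma om_nonzero: "cmp c om q (axis 1 1) (axis 2 1) \<noteq> 0" "cmp c om q (axis 3 1) (axis 4 1) \<noteq> 0"
proof -
  note c = adaptedD(1)[OF ad]
  have a: "axis i 1 \<noteq> (0 :: real ^ 4)" for i by (simp add: axis_eq_0_iff)
  have J1: "Jm c q (axis 1 1) $ 3 = 0 \<and> Jm c q (axis 1 1) $ 4 = 0" by (rule Jm_H) (simp_all add: axis_def)
  have J3: "Jm c q (axis 3 1) $ 1 = 0 \<and> Jm c q (axis 3 1) $ 2 = 0" by (rule Jm_V) (simp_all add: axis_def)
  show "cmp c om q (axis 1 1) (axis 2 1) \<noteq> 0"
    using om_J_pos(2)[OF c q a[of 1]] J1 unfolding om_formula[of "axis 1 1" "Jm c q (axis 1 1)"] by (auto simp: axis_def)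
  show "cmp c om q (axis 3 1) (axis 4 1) \<noteq> 0"
    using om_J_pos(2)[OF c q a[of 3]] J3 unfolding om_formula[of "axis 3 1" "Jm c q (axis 3 1)"] by (auto simp: axis_def)
qed

text \<open>The cyclic sum of the covariant derivatives of the Kaehler form is its exterior derivative.\<close>

lemma der_om_closed: "der c om q w u v + der c om q u v w + der c om q v w u = 0"
proof -
  note c = adaptedD(1)[OF ad] and qT = cdom_topspace[OF adaptedD(1)[OF ad] q]
  have "par c q w u v + par c q u v w + par c q v w u = 0" by (simp add: par_zero[OF c q])
  then show ?thesis
    unfolding par_def
    using kos_sym[OF c q qT, of w u "Jm c q v"] kos_sym[OF c q qT, of w v "Jm c q u"] kos_sym[OF c q qT, of u v "Jm c q w"]
    by simp
qed

lemma der_om_blocks: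
  assumes uv: "u $ 3 = 0" "u $ 4 = 0" "v $ 1 = 0" "v $ 2 = 0"
  shows "der c om q w u v = 0" "der c om q w v u = 0"
proof -
  note c = adaptedD(1)[OF ad]
  have S: "open (cmap c ` cdom c)" by (rule open_cmap[OF c])
  have x: "cmap c q \<in> cmap c ` cdom c" using q by blast
  have z0: "fd (\<lambda>x. 0 :: real) (cmap c q) = (\<lambda>w. 0)" by (rule fd_eqI) (rule has_derivative_const)
  have z: "cmp c om (cinv c y) u v = 0" "cmp c om (cinv c y) v u = 0" if "y \<in> cmap c ` cdom c" for y
  proof -
    note qy = cinv_cdom[OF that]
    have "tv c (cinv c y) u \<in> H (cinv c y)" unfolding adaptedD(2)[OF ad qy] using uv by blast
    moreover have "tv c (cinv c y) v \<in> V (cinv c y)" unfolding adaptedD(3)[OF ad qy] using uv by blast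
    ultimately have "cmp c om (cinv c y) u v = 0"
      unfolding cmp_def om_def using split_facts cdom_topspace[OF c qy] by blast
    then show "cmp c om (cinv c y) u v = 0" "cmp c om (cinv c y) v u = 0"
      using om_antisym[OF c qy, of v u] by simp_all
  qed
  have "fd (\<lambda>x. cmp c om (cinv c x) u v) (cmap c q) = fd (\<lambda>x. 0) (cmap c q)"
    "fd (\<lambda>x. cmp c om (cinv c x) v u) (cmap c q) = fd (\<lambda>x. 0) (cmap c q)"
    by (rule fd_cong_open[OF S x], erule z)+
  then show "der c om q w u v = 0" "der c om q w v u = 0" unfolding der_def z0 by simp_all
qed

text \<open>In the closedness identity for a vector \<open>w\<close> of V together with \<partial>_1
  and \<partial>_2, the other two terms differentiate mixed components, which vanish
  identically.\<close>

lemma der_om_12: "w $ 1 = 0 \<Longrightarrow> w $ 2 = 0 \<Longrightarrow> der c om q w (axis 1 1) (axis 2 1) = 0"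
  using der_om_closed[of w "axis 1 1" "axis 2 1"] der_om_blocks[of "axis 2 1" w] der_om_blocks[of "axis 1 1" w]
  by (simp add: axis_def)

lemma der_om_34: "w $ 3 = 0 \<Longrightarrow> w $ 4 = 0 \<Longrightarrow> der c om q w (axis 3 1) (axis 4 1) = 0"
  using der_om_closed[of w "axis 3 1" "axis 4 1"] der_om_blocks[of w "axis 4 1"] der_om_blocks[of w "axis 3 1"]
  by (simp add: axis_def)

end

text \<open>Since the Kaehler form is closed, its coefficient \<open>f\<close> on \<open>H\<close> depends on \<open>x\<^sup>1, x\<^sup>2\<close> only and its
  coefficient \<open>k\<close> on \<open>V\<close> on \<open>x\<^sup>3, x\<^sup>4\<close> only. So \<open>\<partial>\<^sub>1 / f\<close> and \<open>\<partial>\<^sub>3 / k\<close> commute, and straightening them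
  provides primitives of \<open>f\<close> and \<open>k\<close> with respect to \<open>x\<^sup>1\<close> and \<open>x\<^sup>3\<close>, which are made independent of the
  other pair of coordinates by freezing the latter.\<close>

lemma area_chart:
  assumes ad: "adapted c" and p: "p \<in> cdom c"
  obtains c' where "adapted c'" "p \<in> cdom c'"
    "\<And>q. q \<in> cdom c' \<Longrightarrow> cmp c' om q (axis 1 1) (axis 2 1) = 1 \<and> cmp c' om q (axis 3 1) (axis 4 1) = 1"
proof -
  note c = adaptedD(1)[OF ad]
  let ?S = "cmap c ` cdom c" and ?x0 = "cmap c p"
  let ?E = "\<lambda>i. axis i (1 :: real) :: real ^ 4"
  have S: "open ?S" by (rule open_cmap[OF c])
  obtain r where r: "r > 0" "ball ?x0 r \<subseteq> ?S" using S p open_contains_ball by blast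
  let ?B = "ball ?x0 r"
  define f where "f x = cmp c om (cinv c x) (?E 1) (?E 2)" for x
  define k where "k x = cmp c om (cinv c x) (?E 3) (?E 4)" for x
  have cT: "cdom c \<inter> topspace T = cdom c" using cdom_topspace[OF c] by blast
  have qx: "cinv c x \<in> cdom c" "cmap c (cinv c x) = x" if "x \<in> ?B" for x
    using r that cinv_cdom[of x c] cmap_cinv[of x c] by blast+
  have fs: "smooth_on ?B f" and ks: "smooth_on ?B k"
    unfolding f_def k_def using cmp_smooth[OF om_smooth c] smooth_on_subset[OF _ r(2)] unfolding cT by blast+
  have fnz: "f x \<noteq> 0" and knz: "k x \<noteq> 0" if "x \<in> ?B" for x
    unfolding f_def k_def using om_nonzero[OF ad qx(1)[OF that]] by blast+
  have fdf: "fd f x w = 0" if "x \<in> ?B" "w $ 1 = 0" "w $ 2 = 0" for x w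
    using der_om_12[OF ad qx(1)[OF that(1)] that(2,3)] unfolding der_def qx(2)[OF that(1)] f_def[abs_def] .
  have fdk: "fd k x w = 0" if "x \<in> ?B" "w $ 3 = 0" "w $ 4 = 0" for x w
    using der_om_34[OF ad qx(1)[OF that(1)] that(2,3)] unfolding der_def qx(2)[OF that(1)] k_def[abs_def] .
  define X1 where "X1 x = inverse (f x) *\<^sub>R ?E 1" for x
  define X2 where "X2 x = inverse (k x) *\<^sub>R ?E 3" for x
  have Xs: "smooth_on ?B X1" "smooth_on ?B X2"
    unfolding X1_def X2_def
    by (rule smooth_on_scaleR[OF open_ball smooth_on_inverse_compose[OF open_ball fs fnz] smooth_on_const]; assumption)
       (rule smooth_on_scaleR[OF open_ball smooth_on_inverse_compose[OF open_ball ks knz] smooth_on_const]; assumption)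
  have Xd: "fd (\<lambda>x. inverse (h x) *\<^sub>R e) x w = 0"
    if h: "smooth_on ?B h" "h x \<noteq> 0" "x \<in> ?B" "fd h x w = 0" for h :: "real ^ 4 \<Rightarrow> real" and x w and e :: "real ^ 4"
  proof -
    have "((\<lambda>x. inverse (h x)) has_derivative (\<lambda>w. - (inverse (h x) * fd h x w * inverse (h x)))) (at x)"
      by (rule Deriv.has_derivative_inverse[OF h(2) smooth_on_imp_has_derivative[OF h(1,3)]])
    from bounded_linear.has_derivative[OF bounded_linear_scaleR_left this, of e]
    have "fd (\<lambda>x. inverse (h x) *\<^sub>R e) x w = (- (inverse (h x) * fd h x w * inverse (h x))) *\<^sub>R e"
      by (rule fun_cong[OF fd_eqI])
    then show ?thesis by (simp add: h(4))
  qed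
  have comm: "fd X1 x (X2 x) = fd X2 x (X1 x)" if x: "x \<in> ?B" for x
  proof -
    have "fd f x (X2 x) = 0" "fd k x (X1 x) = 0"
      by (rule fdf[OF x] fdk[OF x]; simp add: X1_def X2_def axis_def)+
    then have "fd X1 x (X2 x) = 0" "fd X2 x (X1 x) = 0"
      unfolding X1_def[abs_def] X2_def[abs_def]
      using Xd[OF fs fnz[OF x] x] Xd[OF ks knz[OF x] x] by blast+
    then show ?thesis by simp
  qed
  have xB: "?x0 \<in> ?B" using r by simp
  have indep: "a = 0" if "a $ 1 *\<^sub>R X1 ?x0 + a $ 2 *\<^sub>R X2 ?x0 + a $ 3 *\<^sub>R ?E 2 + a $ 4 *\<^sub>R ?E 4 = 0" for a :: "real ^ 4"
    using that fnz[OF xB] knz[OF xB] by (simp add: X1_def X2_def vec_eq_iff forall_4 axis_def)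
  obtain \<Theta> U where U: "open U" "?x0 \<in> U" "U \<subseteq> ?B" "smooth_on U (\<Theta> :: real ^ 4 \<Rightarrow> real ^ 4)"
    and \<Theta>: "\<And>x. x \<in> U \<Longrightarrow> fd \<Theta> x (X1 x) = axis 1 1" "\<And>x. x \<in> U \<Longrightarrow> fd \<Theta> x (X2 x) = axis 2 1"
    and "\<And>x. x \<in> U \<Longrightarrow> inj (fd \<Theta> x)"
    by (rule straighten_commuting_fields[OF open_ball xB Xs, of "?E 2" "?E 4"]) (erule comm, erule indep, rule that)
  obtain r' where r': "r' > 0" "ball ?x0 r' \<subseteq> U" using U open_contains_ball by blast
  let ?B' = "ball ?x0 r'"
  have BB: "?B' \<subseteq> ?B" using r' U by blast
  define P1 where "P1 v = v $ 1 *\<^sub>R ?E 1 + v $ 2 *\<^sub>R ?E 2" for v :: "real ^ 4"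
  define P2 where "P2 v = v $ 3 *\<^sub>R ?E 3 + v $ 4 *\<^sub>R ?E 4" for v :: "real ^ 4"
  have P: "bounded_linear P1" "bounded_linear P2"
    unfolding P1_def P2_def
    by (intro bounded_linear_add bounded_linear_compose[OF bounded_linear_scaleR_left bounded_linear_vec_nth])+
  have Pn: "norm (P1 v) \<le> norm v" "norm (P2 v) \<le> norm v" for v
  proof -
    have "\<forall>i. norm (P1 v $ i) \<le> norm (v $ i) \<and> norm (P2 v $ i) \<le> norm (v $ i)"
      unfolding forall_4 by (simp add: P1_def P2_def axis_def)
    then show "norm (P1 v) \<le> norm v" "norm (P2 v) \<le> norm v" by (blast intro: norm_le_componentwise_cart)+
  qed
  \<comment> \<open>\<open>\<pi>1\<close> resets the coordinates 3 and 4 to their values at the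
    center of the ball, and \<open>\<pi>2\<close> does so with 1 and 2. As the projections do not
    increase the norm, the ball is preserved.\<close>
  define \<pi>1 where "\<pi>1 x = ?x0 + P1 (x - ?x0)" for x
  define \<pi>2 where "\<pi>2 x = ?x0 + P2 (x - ?x0)" for x
  have \<pi>B: "\<pi>1 x \<in> ?B'" "\<pi>2 x \<in> ?B'" if "x \<in> ?B'" for x
    using that Pn[of "x - ?x0"] by (simp_all add: \<pi>1_def \<pi>2_def dist_norm norm_minus_commute)
  have \<pi>d: "(\<pi>1 has_derivative P1) (at x)" "(\<pi>2 has_derivative P2) (at x)" for x
  proof -
    have *: "((\<lambda>x. ?x0 + L (x - ?x0)) has_derivative L) (at x)" if "bounded_linear L" for L :: "real ^ 4 \<Rightarrow> real ^ 4"
      using has_derivative_add[OF has_derivative_const bounded_linear.has_derivative[OF that has_derivative_diff[OF has_derivative_ident has_derivative_const]]]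
      by simp
    show "(\<pi>1 has_derivative P1) (at x)" "(\<pi>2 has_derivative P2) (at x)"
      unfolding \<pi>1_def[abs_def] \<pi>2_def[abs_def] by (rule *[OF P(1)], rule *[OF P(2)])
  qed
  have \<pi>s: "smooth_on ?B' \<pi>1" "smooth_on ?B' \<pi>2"
    unfolding \<pi>1_def \<pi>2_def
    by (intro smooth_on_add[OF open_ball] smooth_on_const smooth_on_linear_compose[OF open_ball P(1)]
        smooth_on_linear_compose[OF open_ball P(2)] smooth_on_diff[OF open_ball] smooth_on_ident)+
  have f\<pi>: "f (\<pi>1 x) = f x" and k\<pi>: "k (\<pi>2 x) = k x" if x: "x \<in> ?B'" for x
  proof -
    have xb: "x \<in> ?B" "\<pi>1 x \<in> ?B" "\<pi>2 x \<in> ?B" using x \<pi>B[OF x] BB by blast+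
    show "f (\<pi>1 x) = f x"
      by (rule constant_along_segment[OF convex_ball fs xb(1,2)], rule fdf) (simp_all add: \<pi>1_def P1_def axis_def)
    show "k (\<pi>2 x) = k x"
      by (rule constant_along_segment[OF convex_ball ks xb(1,3)], rule fdk) (simp_all add: \<pi>2_def P2_def axis_def)
  qed
  \<comment> \<open>The first component of \<Theta> is a primitive of \<open>f\<close> in the first
    coordinate, and its second component one of \<open>k\<close> in the third: \<Theta> sends
    \<open>X2\<close> to the second axis. They replace the coordinates 1 and 3; the coordinates 2
    and 4 are kept.\<close>
  define \<Phi> where "\<Phi> x = \<Theta> (\<pi>1 x) $ 1 *\<^sub>R ?E 1 + x $ 2 *\<^sub>R ?E 2 + \<Theta> (\<pi>2 x) $ 2 *\<^sub>R ?E 3 + x $ 4 *\<^sub>R ?E 4" for x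
  have \<Theta>\<pi>: "smooth_on ?B' (\<lambda>x. \<Theta> (\<pi>1 x))" "smooth_on ?B' (\<lambda>x. \<Theta> (\<pi>2 x))"
    by (rule smooth_on_compose[OF open_ball U(1) _ U(4) \<pi>s(1)], use \<pi>B(1) r'(2) in blast)
       (rule smooth_on_compose[OF open_ball U(1) _ U(4) \<pi>s(2)], use \<pi>B(2) r'(2) in blast)
  have \<Phi>s: "smooth_on ?B' \<Phi>"
    unfolding \<Phi>_def
    by (intro smooth_on_add[OF open_ball] smooth_on_scaleR[OF open_ball] smooth_on_nth[OF open_ball] \<Theta>\<pi>
        smooth_on_ident smooth_on_const)
  have \<Phi>d: "fd \<Phi> x v = fd \<Theta> (\<pi>1 x) (P1 v) $ 1 *\<^sub>R ?E 1 + v $ 2 *\<^sub>R ?E 2 + fd \<Theta> (\<pi>2 x) (P2 v) $ 2 *\<^sub>R ?E 3 + v $ 4 *\<^sub>R ?E 4"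
    if x: "x \<in> ?B'" for x v
  proof -
    have \<Theta>d: "(\<Theta> has_derivative fd \<Theta> (\<pi>1 x)) (at (\<pi>1 x))" "(\<Theta> has_derivative fd \<Theta> (\<pi>2 x)) (at (\<pi>2 x))"
      using smooth_on_imp_has_derivative[OF U(4)] \<pi>B[OF x] r'(2) by blast+
    show ?thesis
      unfolding \<Phi>_def
      by (rule fun_cong[OF fd_eqI])
         (intro has_derivative_add bounded_linear.has_derivative[OF bounded_linear_scaleR_left]
          bounded_linear.has_derivative[OF bounded_linear_vec_nth] has_derivative_ident
          has_derivative_compose[OF \<pi>d(1) \<Theta>d(1)] has_derivative_compose[OF \<pi>d(2) \<Theta>d(2)])
  qed
  \<comment> \<open>The Jacobian consists of two triangular blocks with diagonals f, 1 and k, 1. The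
    off-diagonal entries \<kappa>1 and \<kappa>2 do not affect the area forms, which are multiplied
    by f and k.\<close>
  define \<kappa>1 where "\<kappa>1 x = fd \<Theta> (\<pi>1 x) (?E 2) $ 1" for x
  define \<kappa>2 where "\<kappa>2 x = fd \<Theta> (\<pi>2 x) (?E 4) $ 2" for x
  have \<Phi>c: "fd \<Phi> x v $ 1 = f x * v $ 1 + \<kappa>1 x * v $ 2" "fd \<Phi> x v $ 2 = v $ 2"
    "fd \<Phi> x v $ 3 = k x * v $ 3 + \<kappa>2 x * v $ 4" "fd \<Phi> x v $ 4 = v $ 4" if x: "x \<in> ?B'" for x v
  proof -
    have y: "\<pi>1 x \<in> U" "\<pi>2 x \<in> U" using \<pi>B[OF x] r'(2) by blast+
    have yB: "\<pi>1 x \<in> ?B" "\<pi>2 x \<in> ?B" using y U(3) by blast+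
    note lin = smooth_on_imp_linear_fd[OF U(4) y(1)] smooth_on_imp_linear_fd[OF U(4) y(2)]
    have "f (\<pi>1 x) *\<^sub>R fd \<Theta> (\<pi>1 x) (X1 (\<pi>1 x)) = fd \<Theta> (\<pi>1 x) (?E 1)"
      using fnz[OF yB(1)] unfolding linear_cmul[OF lin(1), symmetric] X1_def by simp
    then have 1: "fd \<Theta> (\<pi>1 x) (?E 1) = f x *\<^sub>R axis 1 1" unfolding \<Theta>(1)[OF y(1)] f\<pi>[OF x] by simp
    have "k (\<pi>2 x) *\<^sub>R fd \<Theta> (\<pi>2 x) (X2 (\<pi>2 x)) = fd \<Theta> (\<pi>2 x) (?E 3)"
      using knz[OF yB(2)] unfolding linear_cmul[OF lin(2), symmetric] X2_def by simp
    then have 2: "fd \<Theta> (\<pi>2 x) (?E 3) = k x *\<^sub>R axis 2 1" unfolding \<Theta>(2)[OF y(2)] k\<pi>[OF x] by simp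
    have 3: "fd \<Theta> (\<pi>1 x) (P1 v) $ 1 = f x * v $ 1 + \<kappa>1 x * v $ 2" "fd \<Theta> (\<pi>2 x) (P2 v) $ 2 = k x * v $ 3 + \<kappa>2 x * v $ 4"
      unfolding P1_def P2_def linear_add[OF lin(1)] linear_cmul[OF lin(1)] linear_add[OF lin(2)] linear_cmul[OF lin(2)]
        1 2 \<kappa>1_def \<kappa>2_def by (simp_all add: axis_def)
    show "fd \<Phi> x v $ 1 = f x * v $ 1 + \<kappa>1 x * v $ 2" "fd \<Phi> x v $ 2 = v $ 2"
      "fd \<Phi> x v $ 3 = k x * v $ 3 + \<kappa>2 x * v $ 4" "fd \<Phi> x v $ 4 = v $ 4"
      unfolding \<Phi>d[OF x] 3 by (simp_all add: axis_def)
  qed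
  have x0': "?x0 \<in> ?B'" using r' by simp
  have inj: "inj (fd \<Phi> ?x0)"
    unfolding linear_injective_0[OF smooth_on_imp_linear_fd[OF \<Phi>s x0']]
  proof (intro allI impI)
    fix v assume "fd \<Phi> ?x0 v = 0"
    then show "v = 0"
      using \<Phi>c[OF x0', of v] fnz[OF xB] knz[OF xB] by (simp add: vec_eq_iff[of v] forall_4)
  qed
  have B'S: "?B' \<subseteq> ?S" using BB r(2) by blast
  define W' where "W' = cinv c ` ?B'"
  have W': "openin T W'" "W' \<subseteq> cdom c" "cmap c ` W' = ?B'" "p \<in> W'"
    unfolding W'_def using open_cinv_image[OF c open_ball B'S] cinv_image_eq[OF c B'S] cmap_cinv_image[OF B'S] p x0' by auto
  obtain c' where c': "c' \<in> A" "p \<in> cdom c'" "cdom c' \<subseteq> W'"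
    and "\<And>q. q \<in> cdom c' \<Longrightarrow> cmap c' q = \<Phi> (cmap c q)"
    and t: "\<And>q v. q \<in> cdom c' \<Longrightarrow> tmap c c' q v = fd \<Phi> (cmap c q) v"
    by (rule chart_change[OF c p W'(1,4,2) \<Phi>s[folded W'(3)] inj]) (rule that)
  have tq: "q \<in> cdom c \<and> cmap c q \<in> ?B'" if "q \<in> cdom c'" for q using that c'(3) W' by blast
  have tvc: "tv c q v = tv c' q (fd \<Phi> (cmap c q) v)" if q: "q \<in> cdom c'" for q v
    unfolding t[OF q, symmetric] using tq[OF q] by (intro tv_change c c'(1) q) blast
  have sur: "\<exists>v. w = fd \<Phi> (cmap c q) v" if q: "q \<in> cdom c'" for q w
  proof -
    have "tmap c c' q (tmap c' c q w) = w" using tq[OF q] by (intro tmap_inverse c'(1) c q) blast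
    then show ?thesis unfolding t[OF q] by metis
  qed
  have ad': "adapted c'"
    unfolding adapted_def
  proof (intro conjI ballI c'(1))
    fix q assume q: "q \<in> cdom c'"
    have qc: "q \<in> cdom c" and qb: "cmap c q \<in> ?B'" using tq[OF q] by blast+
    have qB: "cmap c q \<in> ?B" using qb BB by blast
    note F = \<Phi>c[OF qb]
    show "H q = tv c' q ` {v. v $ 3 = 0 \<and> v $ 4 = 0}"
      unfolding adaptedD(2)[OF ad qc]
    proof (intro equalityI subsetI)
      fix z assume "z \<in> tv c q ` {v. v $ 3 = 0 \<and> v $ 4 = 0}"
      then obtain v where v: "z = tv c q v" "v $ 3 = 0" "v $ 4 = 0" by blast
      have "fd \<Phi> (cmap c q) v \<in> {v. v $ 3 = 0 \<and> v $ 4 = 0}" using F(3,4)[of v] v by simp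
      then show "z \<in> tv c' q ` {v. v $ 3 = 0 \<and> v $ 4 = 0}" unfolding v(1) tvc[OF q] by (rule imageI)
    next
      fix z assume "z \<in> tv c' q ` {v. v $ 3 = 0 \<and> v $ 4 = 0}"
      then obtain w where w: "z = tv c' q w" "w $ 3 = 0" "w $ 4 = 0" by blast
      obtain v where v: "w = fd \<Phi> (cmap c q) v" using sur[OF q] by blast
      have "v \<in> {v. v $ 3 = 0 \<and> v $ 4 = 0}" using F(3,4)[of v] w(2,3) knz[OF qB] unfolding v by simp
      then show "z \<in> tv c q ` {v. v $ 3 = 0 \<and> v $ 4 = 0}" unfolding w(1) v tvc[OF q, symmetric] by (rule imageI)
    qed
    show "V q = tv c' q ` {v. v $ 1 = 0 \<and> v $ 2 = 0}"
      unfolding adaptedD(3)[OF ad qc]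
    proof (intro equalityI subsetI)
      fix z assume "z \<in> tv c q ` {v. v $ 1 = 0 \<and> v $ 2 = 0}"
      then obtain v where v: "z = tv c q v" "v $ 1 = 0" "v $ 2 = 0" by blast
      have "fd \<Phi> (cmap c q) v \<in> {v. v $ 1 = 0 \<and> v $ 2 = 0}" using F(1,2)[of v] v by simp
      then show "z \<in> tv c' q ` {v. v $ 1 = 0 \<and> v $ 2 = 0}" unfolding v(1) tvc[OF q] by (rule imageI)
    next
      fix z assume "z \<in> tv c' q ` {v. v $ 1 = 0 \<and> v $ 2 = 0}"
      then obtain w where w: "z = tv c' q w" "w $ 1 = 0" "w $ 2 = 0" by blast
      obtain v where v: "w = fd \<Phi> (cmap c q) v" using sur[OF q] by blast
      have "v \<in> {v. v $ 1 = 0 \<and> v $ 2 = 0}" using F(1,2)[of v] w(2,3) fnz[OF qB] unfolding v by simp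
      then show "z \<in> tv c q ` {v. v $ 1 = 0 \<and> v $ 2 = 0}" unfolding w(1) v tvc[OF q, symmetric] by (rule imageI)
    qed
  qed
  show ?thesis
  proof (rule that[OF ad' c'(2)])
    fix q assume q: "q \<in> cdom c'"
    have qc: "q \<in> cdom c" and qb: "cmap c q \<in> ?B'" using tq[OF q] by blast+
    have qB: "cmap c q \<in> ?B" using qb BB by blast
    note F = \<Phi>c[OF qb]
    \<comment> \<open>Expressing the old area coefficients f and k through the new chart gives the
      new coefficients times f and k, so the new ones are 1.\<close>
    have ch: "cmp c om q x y = cmp c' om q (fd \<Phi> (cmap c q) x) (fd \<Phi> (cmap c q) y)" for x y
      unfolding t[OF q, symmetric] by (rule cmp_change[OF c c'(1) qc q])
    have "f (cmap c q) = cmp c' om q (?E 1) (?E 2) * f (cmap c q)"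
      using ch[of "?E 1" "?E 2"] unfolding om_formula[OF ad' q, of "fd \<Phi> (cmap c q) (?E 1)"] F f_def cinv_cmap[OF c qc]
      by (simp add: axis_def)
    moreover have "k (cmap c q) = cmp c' om q (?E 3) (?E 4) * k (cmap c q)"
      using ch[of "?E 3" "?E 4"] unfolding om_formula[OF ad' q, of "fd \<Phi> (cmap c q) (?E 3)"] F k_def cinv_cmap[OF c qc]
      by (simp add: axis_def)
    ultimately show "cmp c' om q (?E 1) (?E 2) = 1 \<and> cmp c' om q (?E 3) (?E 4) = 1"
      using fnz[OF qB] knz[OF qB] by simp
  qed
qed

end

section \<open>From unit-area coordinates to \<alpha>, \<beta>, \<gamma>, \<delta>\<close>

context kaehler_split
begin

text \<open>In an invariant coordinate plane of unit area, \<omega> determines J: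
  \<omega>(\<partial>_i, J\<partial>_i) = g_ii fixes the component of J\<partial>_i along
  \<partial>_j, and \<omega>(\<partial>_i, \<partial>_i) = 0 the one along \<partial>_i; likewise
  for J\<partial>_j. Then \<omega>(\<partial>_i, \<partial>_j) = 1 becomes the determinant
  relation.\<close>

lemma unit_area_block:
  assumes c: "c \<in> A" "q \<in> cdom c" and ij: "cmp c om q (axis i 1) (axis j 1) = 1" "i \<noteq> j"
    and J: "\<exists>a b. Jm c q (axis i 1) = a *\<^sub>R axis i 1 + b *\<^sub>R axis j 1"
      "\<exists>a b. Jm c q (axis j 1) = a *\<^sub>R axis i 1 + b *\<^sub>R axis j 1"
  shows "comp02 A c g i i q * comp02 A c g j j q = 1 + comp02 A c g i j q * comp02 A c g i j q"
    "comp02 A c g i i q > 0" "comp02 A c g j j q > 0"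
    "Jm c q (axis i 1) = (- comp02 A c g i j q) *\<^sub>R axis i 1 + comp02 A c g i i q *\<^sub>R axis j 1"
    "Jm c q (axis j 1) = (- comp02 A c g j j q) *\<^sub>R axis i 1 + comp02 A c g i j q *\<^sub>R axis j 1"
proof -
  note qT = cdom_topspace[OF c]
  let ?G = "\<lambda>i j. comp02 A c g i j q" and ?E = "\<lambda>i. axis i (1 :: real) :: real ^ 4"
  obtain s t where st: "Jm c q (?E i) = s *\<^sub>R ?E i + t *\<^sub>R ?E j" using J(1) by blast
  obtain s' t' where st': "Jm c q (?E j) = s' *\<^sub>R ?E i + t' *\<^sub>R ?E j" using J(2) by blast
  have sym: "?G j i = ?G i j" unfolding comp02_eq by (rule g_sym[OF c qT])
  have g1: "cmp c g q (a *\<^sub>R ?E i + b *\<^sub>R ?E j) v = a * cmp c g q (?E i) v + b * cmp c g q (?E j) v" for a b v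
    using linear_add[OF g_linear(1)[OF c qT]] linear_cmul[OF g_linear(1)[OF c qT]] by simp
  note oml = cmp_linear(2)[OF om_smooth c qT]
  have o: "cmp c om q u (a *\<^sub>R ?E i + b *\<^sub>R ?E j) = a * cmp c om q u (?E i) + b * cmp c om q u (?E j)" for a b u
    by (simp only: linear_add[OF oml] linear_cmul[OF oml] real_scaleR_def)
  have oii: "cmp c om q x x = 0" for x using om_antisym[OF c, of x x] by simp
  have oji: "cmp c om q (?E j) (?E i) = -1" using om_antisym[OF c, of "?E j" "?E i"] ij by simp
  have pos: "?G i i > 0" "?G j j > 0"
    unfolding comp02_eq by (rule g_pos[OF c qT]; simp add: axis_eq_0_iff)+
  have "cmp c om q (?E i) (Jm c q (?E i)) = ?G i i" unfolding comp02_eq by (rule om_J_pos(1)[OF c]) (simp add: axis_eq_0_iff)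
  then have t: "t = ?G i i" unfolding st o oii ij by simp
  have "cmp c om q (?E j) (Jm c q (?E j)) = ?G j j" unfolding comp02_eq by (rule om_J_pos(1)[OF c]) (simp add: axis_eq_0_iff)
  then have s': "s' = - ?G j j" unfolding st' o oii oji by simp
  have "s * ?G i i + t * ?G j i = 0"
    using oii[of "?E i"] unfolding cmp_om[OF c qT] st g1 comp02_eq .
  then have "(s + ?G i j) * ?G i i = 0" unfolding t sym by (simp add: algebra_simps)
  then have s: "s = - ?G i j" using pos(1) by simp
  have "s' * ?G i j + t' * ?G j j = 0"
    using oii[of "?E j"] unfolding cmp_om[OF c qT] st' g1 comp02_eq .
  then have "(t' - ?G i j) * ?G j j = 0" unfolding s' by (simp add: algebra_simps)
  then have t': "t' = ?G i j" using pos(2) by simp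
  have "s * ?G i j + t * ?G j j = 1" using ij(1) unfolding cmp_om[OF c qT] st g1 comp02_eq .
  then show "?G i i * ?G j j = 1 + ?G i j * ?G i j" unfolding s t by simp
  show "?G i i > 0" "?G j j > 0" by (rule pos)+
  show "Jm c q (?E i) = (- ?G i j) *\<^sub>R ?E i + ?G i i *\<^sub>R ?E j" unfolding st s t ..
  show "Jm c q (?E j) = (- ?G j j) *\<^sub>R ?E i + ?G i j *\<^sub>R ?E j" unfolding st' s' t' ..
qed

text \<open>Inverts the parametrization. If \<alpha> = arctan b then sec \<alpha> is the square root
  of 1 + b^2, so exp \<beta> must be \<open>e\<close> divided by that root, and the determinant
  relation gives the remaining entry.\<close>

lemma normal_form_values:
  fixes a b e :: real
  assumes "a * e = 1 + b * b" "e > 0"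
  shows "exp (- (ln e - ln (1 + b * b) / 2)) * sec (arctan b) = a" "tan (arctan b) = b"
    "exp (ln e - ln (1 + b * b) / 2) * sec (arctan b) = e"
proof -
  have p: "1 + b * b > 0" using zero_le_square[of b] by linarith
  have r: "ln (1 + b * b) / 2 = ln (sqrt (1 + b * b))" using p by (simp add: ln_sqrt)
  have rp: "sqrt (1 + b * b) > 0" using p by simp
  have s: "sec (arctan b) = sqrt (1 + b * b)" by (simp add: sec_def cos_arctan power2_eq_square)
  have x: "exp (ln e - ln (1 + b * b) / 2) = e / sqrt (1 + b * b)"
    unfolding r exp_diff using assms(2) rp by simp
  show "exp (ln e - ln (1 + b * b) / 2) * sec (arctan b) = e" unfolding x s using rp by simp
  have "exp (- (ln e - ln (1 + b * b) / 2)) * sec (arctan b) = sqrt (1 + b * b) * sqrt (1 + b * b) / e"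
    unfolding exp_minus x s by (simp add: inverse_eq_divide)
  also have "\<dots> = a" using p assms by (simp add: field_simps)
  finally show "exp (- (ln e - ln (1 + b * b) / 2)) * sec (arctan b) = a" .
qed (rule tan_arctan)

lemma normal_form_chart:
  assumes p: "p \<in> topspace T"
  shows "\<exists>c\<in>A. p \<in> cdom c \<and> (\<exists>\<alpha> \<beta> \<gamma> \<delta>. admissible_functions A c \<alpha> \<beta> \<gamma> \<delta> \<and>
    metric_formula A c g \<alpha> \<beta> \<gamma> \<delta> \<and> complex_structure_formula A c g J \<and>
    spanned_by_coord_fields A c 1 2 H \<and> spanned_by_coord_fields A c 3 4 V \<and> pde_system c \<alpha> \<beta> \<gamma> \<delta>)"
proof -
  obtain c0 where c0: "c0 \<in> A" "p \<in> cdom c0"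
    "\<And>q. q \<in> cdom c0 \<Longrightarrow> H q = tv c0 q ` {v. v $ 3 = 0 \<and> v $ 4 = 0}"
    "\<And>q. q \<in> cdom c0 \<Longrightarrow> V q = tv c0 q ` {v. v $ 1 = 0 \<and> v $ 2 = 0}"
    by (rule adapted_chart[OF p]) (rule that)
  have ad0: "adapted c0" unfolding adapted_def using c0 by blast
  obtain c where ad: "adapted c" and pc: "p \<in> cdom c"
    and area: "\<And>q. q \<in> cdom c \<Longrightarrow> cmp c om q (axis 1 1) (axis 2 1) = 1 \<and> cmp c om q (axis 3 1) (axis 4 1) = 1"
    by (rule area_chart[OF ad0 c0(2)]) (rule that)
  note c = adaptedD(1)[OF ad]
  note o = open_cdom[OF c]
  let ?G = "\<lambda>i j. comp02 A c g i j" and ?E = "\<lambda>i. axis i (1 :: real) :: real ^ 4"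
  have area12: "cmp c om q (?E 1) (?E 2) = 1" and area34: "cmp c om q (?E 3) (?E 4) = 1" if "q \<in> cdom c" for q
    using area[OF that] by blast+
  have J12: "\<exists>a b. Jm c q (?E i) = a *\<^sub>R ?E 1 + b *\<^sub>R ?E 2" if "q \<in> cdom c" "i = 1 \<or> i = 2" for q i
    unfolding span_12 by (rule Jm_H[OF ad that(1)]) (use that(2) in \<open>auto simp: axis_def\<close>)
  have J34: "\<exists>a b. Jm c q (?E i) = a *\<^sub>R ?E 3 + b *\<^sub>R ?E 4" if "q \<in> cdom c" "i = 3 \<or> i = 4" for q i
    unfolding span_34 by (rule Jm_V[OF ad that(1)]) (use that(2) in \<open>auto simp: axis_def\<close>)
  have bl: "1 \<noteq> (2 :: 4)" "3 \<noteq> (4 :: 4)" by simp_all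
  note B = unit_area_block[OF c _ area12 bl(1) J12 J12]
  note B' = unit_area_block[OF c _ area34 bl(2) J34 J34]
  have b: "?G 1 1 q * ?G 2 2 q = 1 + ?G 1 2 q * ?G 1 2 q" "?G 1 1 q > 0" "?G 2 2 q > 0"
    "Jm c q (?E 1) = (- ?G 1 2 q) *\<^sub>R ?E 1 + ?G 1 1 q *\<^sub>R ?E 2"
    "Jm c q (?E 2) = (- ?G 2 2 q) *\<^sub>R ?E 1 + ?G 1 2 q *\<^sub>R ?E 2" if q: "q \<in> cdom c" for q
    by (rule B[OF q q q _ q]; simp)+
  have b': "?G 3 3 q * ?G 4 4 q = 1 + ?G 3 4 q * ?G 3 4 q" "?G 3 3 q > 0" "?G 4 4 q > 0"
    "Jm c q (?E 3) = (- ?G 3 4 q) *\<^sub>R ?E 3 + ?G 3 3 q *\<^sub>R ?E 4"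
    "Jm c q (?E 4) = (- ?G 4 4 q) *\<^sub>R ?E 3 + ?G 3 4 q *\<^sub>R ?E 4" if q: "q \<in> cdom c" for q
    by (rule B'[OF q q q _ q]; simp)+
  define \<alpha> where "\<alpha> q = arctan (?G 1 2 q)" for q
  define \<beta> where "\<beta> q = ln (?G 2 2 q) - ln (1 + ?G 1 2 q * ?G 1 2 q) / 2" for q
  define \<gamma> where "\<gamma> q = arctan (?G 3 4 q)" for q
  define \<delta> where "\<delta> q = ln (?G 4 4 q) - ln (1 + ?G 3 4 q * ?G 3 4 q) / 2" for q
  have sG: "smooth_fun_on A (cdom c) (?G i j)" for i j
  proof -
    have "smooth_fun_on A (cdom c \<inter> topspace T) (?G i j)"
      using riem c unfolding riemannian_metric_on_def by blast
    then show ?thesis using openin_subset[OF o] by (simp add: inf.absorb1)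
  qed
  have sat: "smooth_fun_on A (cdom c) (\<lambda>q. arctan (f q))" if "smooth_fun_on A (cdom c) f" for f
    by (rule smooth_fun_on_compose[OF o that open_UNIV smooth_on_arctan]) simp
  have sln: "smooth_fun_on A (cdom c) (\<lambda>q. ln (f q))" if "smooth_fun_on A (cdom c) f" "\<And>q. q \<in> cdom c \<Longrightarrow> f q > 0" for f
    by (rule smooth_fun_on_compose[OF o that(1) open_greaterThan smooth_on_ln]) (use that(2) in simp)
  have sb: "smooth_fun_on A (cdom c) (\<lambda>q. ln (f q) - ln (1 + h q * h q) / 2)"
    if f: "smooth_fun_on A (cdom c) f" "\<And>q. q \<in> cdom c \<Longrightarrow> f q > 0" and h: "smooth_fun_on A (cdom c) h" for f h
  proof -
    have "1 + h q * h q > 0" for q using zero_le_square[of "h q"] by linarith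
    then have "smooth_fun_on A (cdom c) (\<lambda>q. ln (1 + h q * h q))"
      by (intro sln smooth_fun_on_add[OF o] smooth_fun_on_mult[OF o] smooth_fun_on_const h)
    from smooth_fun_on_add[OF o sln[OF f] smooth_fun_on_mult[OF o smooth_fun_on_const[of "cdom c" "-1/2"] this]]
    show ?thesis by simp
  qed
  have adm: "admissible_functions A c \<alpha> \<beta> \<gamma> \<delta>"
    unfolding admissible_functions_def \<alpha>_def \<beta>_def \<gamma>_def \<delta>_def
    using sat[OF sG] sb[OF sG b(3) sG] sb[OF sG b'(3) sG] arctan_lbound arctan_ubound by simp
  have sym: "?G i j q = ?G j i q" if "q \<in> cdom c" for i j q
    unfolding comp02_eq by (rule g_sym[OF c that cdom_topspace[OF c that]])
  have zero: "?G i j q = 0" if "q \<in> cdom c" "i = 1 \<or> i = 2" "j = 3 \<or> j = 4" for i j q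
    unfolding comp02_eq by (rule g_blocks[OF ad that(1)]) (use that(2,3) in \<open>auto simp: axis_def\<close>)
  have mf: "metric_formula A c g \<alpha> \<beta> \<gamma> \<delta>"
    unfolding metric_formula_def Let_def \<alpha>_def \<beta>_def \<gamma>_def \<delta>_def
  proof (rule ballI)
    fix q assume q: "q \<in> cdom c"
    note n = normal_form_values[OF b(1)[OF q] b(3)[OF q]] and n' = normal_form_values[OF b'(1)[OF q] b'(3)[OF q]]
    show "(\<forall>i j. ?G i j q = ?G j i q) \<and>
        ?G 1 1 q = exp (- (ln (?G 2 2 q) - ln (1 + ?G 1 2 q * ?G 1 2 q) / 2)) * sec (arctan (?G 1 2 q)) \<and>
        ?G 1 2 q = tan (arctan (?G 1 2 q)) \<and>
        ?G 2 2 q = exp (ln (?G 2 2 q) - ln (1 + ?G 1 2 q * ?G 1 2 q) / 2) * sec (arctan (?G 1 2 q)) \<and>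
        ?G 3 3 q = exp (- (ln (?G 4 4 q) - ln (1 + ?G 3 4 q * ?G 3 4 q) / 2)) * sec (arctan (?G 3 4 q)) \<and>
        ?G 3 4 q = tan (arctan (?G 3 4 q)) \<and>
        ?G 4 4 q = exp (ln (?G 4 4 q) - ln (1 + ?G 3 4 q * ?G 3 4 q) / 2) * sec (arctan (?G 3 4 q)) \<and>
        ?G 1 3 q = 0 \<and> ?G 1 4 q = 0 \<and> ?G 2 3 q = 0 \<and> ?G 2 4 q = 0"
      unfolding n n' using sym[OF q] zero[OF q] by simp
  qed
  have K: "comp11 A c J k j q = Jm c q (?E j) $ k" for k j q
    by (simp add: comp11_def Jm_def coord_field_eq)
  have csf: "complex_structure_formula A c g J"
    unfolding complex_structure_formula_def Let_def K
  proof (rule ballI)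
    fix q assume q: "q \<in> cdom c"
    note jb = b(4,5)[OF q] b'(4,5)[OF q]
    show "Jm c q (?E 1) $ 1 = - ?G 1 2 q \<and> Jm c q (?E 2) $ 1 = - ?G 2 2 q \<and> Jm c q (?E 1) $ 2 = ?G 1 1 q \<and>
        Jm c q (?E 2) $ 2 = ?G 1 2 q \<and> Jm c q (?E 3) $ 3 = - ?G 3 4 q \<and> Jm c q (?E 4) $ 3 = - ?G 4 4 q \<and>
        Jm c q (?E 3) $ 4 = ?G 3 3 q \<and> Jm c q (?E 4) $ 4 = ?G 3 4 q \<and>
        (\<forall>l\<in>{1, 2}. \<forall>r\<in>{3, 4}. Jm c q (?E l) $ r = 0 \<and> Jm c q (?E r) $ l = 0)"
      by (simp add: jb) (simp add: axis_def)
  qed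
  have H: "spanned_by_coord_fields A c 1 2 H"
    unfolding spanned_by_coord_fields_def
  proof
    fix q assume q: "q \<in> cdom c"
    show "H q = {lincomb a (coord_field A c 1 q) b (coord_field A c 2 q) | a b. True}"
      unfolding span_coord_fields[OF c q] span_12 adaptedD(2)[OF ad q] by blast
  qed
  have V: "spanned_by_coord_fields A c 3 4 V"
    unfolding spanned_by_coord_fields_def
  proof
    fix q assume q: "q \<in> cdom c"
    show "V q = {lincomb a (coord_field A c 3 q) b (coord_field A c 4 q) | a b. True}"
      unfolding span_coord_fields[OF c q] span_34 adaptedD(3)[OF ad q] by blast
  qed
  interpret nf: normal_form T A c g J \<alpha> \<beta> \<gamma> \<delta>
  proof unfold_locales
    show "tensor02_on A (cdom c) g"
      using riem openin_subset[OF o] unfolding riemannian_metric_on_def tensor02_on_def by blast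
    show "tensor11_on A (cdom c) J"
      using acs openin_subset[OF o] unfolding almost_complex_structure_on_def tensor11_on_def by blast
  qed (rule c adm mf csf)+
  \<comment> \<open>\<open>par\<close> does not involve the open set of the locale, so its
    vanishing, known on the whole manifold, can be used in the normal form over
    \<open>cdom c\<close>.\<close>
  have "pde_system c \<alpha> \<beta> \<gamma> \<delta>"
    by (rule nf.par_imp_pde) (rule par_zero[OF c])
  then show ?thesis using c pc adm mf csf H V by blast
qed

end

theorem theoremC:
  fixes T :: "'a topology" and A :: "('a, 4) chart set"
  assumes "smooth_manifold T A"
  shows
    "(\<forall>c\<in>A. \<forall>\<alpha> \<beta> \<gamma> \<delta> g J H V.
        admissible_functions A c \<alpha> \<beta> \<gamma> \<delta> \<and>
        tensor02_on A (cdom c) g \<and> metric_formula A c g \<alpha> \<beta> \<gamma> \<delta> \<and>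
        tensor11_on A (cdom c) J \<and> complex_structure_formula A c g J \<and>
        spanned_by_coord_fields A c 1 2 H \<and> spanned_by_coord_fields A c 3 4 V \<and>
        pde_system c \<alpha> \<beta> \<gamma> \<delta> \<longrightarrow>
        kaehler_on A (cdom c) g J \<and>
        integrable_complex_splitting_on T A (cdom c) g J H V)
     \<and>
     (\<forall>g J H V.
        kaehler_on A (topspace T) g J \<and>
        integrable_complex_splitting_on T A (topspace T) g J H V \<longrightarrow>
        (\<forall>p\<in>topspace T. \<exists>c\<in>A. p \<in> cdom c \<and>
           (\<exists>\<alpha> \<beta> \<gamma> \<delta>.
              admissible_functions A c \<alpha> \<beta> \<gamma> \<delta> \<and>
              metric_formula A c g \<alpha> \<beta> \<gamma> \<delta> \<and> complex_structure_formula A c g J \<and>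
              spanned_by_coord_fields A c 1 2 H \<and> spanned_by_coord_fields A c 3 4 V \<and>
              pde_system c \<alpha> \<beta> \<gamma> \<delta>)))"
proof (intro conjI ballI allI impI; elim conjE)
  fix c \<alpha> \<beta> \<gamma> \<delta> g J H V
  assume a: "c \<in> A" "admissible_functions A c \<alpha> \<beta> \<gamma> \<delta>" "tensor02_on A (cdom c) g" "metric_formula A c g \<alpha> \<beta> \<gamma> \<delta>"
    "tensor11_on A (cdom c) J" "complex_structure_formula A c g J"
    and s: "spanned_by_coord_fields A c 1 2 H" "spanned_by_coord_fields A c 3 4 V" and pde: "pde_system c \<alpha> \<beta> \<gamma> \<delta>"
  interpret normal_form T A c g J \<alpha> \<beta> \<gamma> \<delta>
    by unfold_locales (rule assms a)+
  show "kaehler_on A (cdom c) g J" "integrable_complex_splitting_on T A (cdom c) g J H V"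
    using kaehler_splitting[OF pde s] by blast+
next
  fix g J H V p
  assume k: "kaehler_on A (topspace T) g J" "integrable_complex_splitting_on T A (topspace T) g J H V"
    and p: "p \<in> topspace T"
  interpret kaehler_split T A g J H V
    by unfold_locales (rule assms k)+
  show "\<exists>c\<in>A. p \<in> cdom c \<and> (\<exists>\<alpha> \<beta> \<gamma> \<delta>.
      admissible_functions A c \<alpha> \<beta> \<gamma> \<delta> \<and>
      metric_formula A c g \<alpha> \<beta> \<gamma> \<delta> \<and> complex_structure_formula A c g J \<and>
      spanned_by_coord_fields A c 1 2 H \<and> spanned_by_coord_fields A c 3 4 V \<and>
      pde_system c \<alpha> \<beta> \<gamma> \<delta>)"
    by (rule normal_form_chart[OF p])
qed

end
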